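(* Let $(M,g_L)$ be a closed, connected, and oriented Lorentzian 3-manifold with a unit-length timelike Killing vector field $T$ (that is, $g_L(T,T)=-1$), Ricci tensor $\mathrm{Ric}_L$, and scalar curvature $\mathrm{scal}_L$. If $T$ is not parallel, and if $$\mathrm{scal}_L>3\,\mathrm{Ric}_L(T,T)+\big|d\ln(\mathrm{Ric}_L(T,T))\big|^2_{g_L},$$ then $b_1(M)=b_2(M)=0$. If the Lorentzian metric $g_L$ is replaced by a Riemannian metric $g$ (so that $(M,g)$ is a closed, connected, and oriented Riemannian 3-manifold with a unit-length Killing vector field $T$ that is not parallel, with Ricci tensor $\mathrm{Ric}$ and scalar curvature $\mathrm{scal}$), then the same conclusion $b_1(M)=b_2(M)=0$ holds with the inequality replaced by $$\mathrm{scal}>\mathrm{Ric}(T,T)+\big|d\ln(\mathrm{Ric}(T,T))\big|^2_{g}.$$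
   Context: "Closed" means compact without boundary; $b_i(M)$ is the $i$-th (real) Betti number. $|\alpha|^2_{g_L}$ denotes the $g_L$-squared norm of a 1-form $\alpha$ (and $|\alpha|^2_g$ the $g$-squared norm). The inequalities are required at every point of $M$, which includes the requirement that the logarithm be defined, i.e. that $\mathrm{Ric}_L(T,T)$ (respectively $\mathrm{Ric}(T,T)$) is positive. Curvature convention: $R(X,Y)Z=\nabla_X\nabla_YZ-\nabla_Y\nabla_XZ-\nabla_{[X,Y]}Z$ and $\mathrm{Rm}(X,Y,Z,W)=g(R(X,Y)Z,W)$; the Ricci tensor is normalized so that, for a local orthonormal frame $\{T,X,Y\}$, $\mathrm{Ric}(T,T)=\mathrm{Rm}(X,T,T,X)+\mathrm{Rm}(Y,T,T,Y)$ (so round spheres have positive Ricci curvature), and scalar curvature is the metric trace of Ricci; likewise for $g_L$. *)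

theory Defs
  imports
    "HOL-Analysis.Analysis"
    "HOL-Homology.Homology"
    "HOL-Library.Extended_Nat"
begin

section \<open>Smooth 3-manifolds\<close>

primrec Ck_on :: "nat \<Rightarrow> 'b::real_normed_vector set \<Rightarrow> ('b \<Rightarrow> 'c::real_normed_vector) \<Rightarrow> bool" where
  "Ck_on 0 S f \<longleftrightarrow> continuous_on S f"
| "Ck_on (Suc k) S f \<longleftrightarrow>
     (\<forall>x\<in>S. f differentiable (at x)) \<and> (\<forall>v. Ck_on k S (\<lambda>x. frechet_derivative f (at x) v))"

text \<open>Only used for open \<open>S\<close> in a Euclidean space, where directional derivatives suffice.\<close>

definition smooth_on :: "'b::real_normed_vector set \<Rightarrow> ('b \<Rightarrow> 'c::real_normed_vector) \<Rightarrow> bool" where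
  "smooth_on S f \<longleftrightarrow> (\<forall>k. Ck_on k S f)"

type_synonym 'a chart = "'a set \<times> ('a \<Rightarrow> real^3)"

definition chart_on :: "'a topology \<Rightarrow> 'a chart \<Rightarrow> bool" where
  "chart_on M c \<longleftrightarrow>
     openin M (fst c) \<and> open (snd c ` fst c) \<and>
     homeomorphic_map (subtopology M (fst c)) (top_of_set (snd c ` fst c)) (snd c)"

definition chart_inv :: "'a chart \<Rightarrow> real^3 \<Rightarrow> 'a" where
  "chart_inv c = inv_into (fst c) (snd c)"

definition transition :: "'a chart \<Rightarrow> 'a chart \<Rightarrow> real^3 \<Rightarrow> real^3" where
  "transition c d = snd d \<circ> chart_inv c"

definition overlap :: "'a chart \<Rightarrow> 'a chart \<Rightarrow> (real^3) set" where
  "overlap c d = snd c ` (fst c \<inter> fst d)"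

definition points :: "'a chart set \<Rightarrow> 'a set" where
  "points A = \<Union>(fst ` A)"

text \<open>The atlas is not required to be maximal. Charts are onto open subsets of \<open>\<real>\<^sup>3\<close>, so the
  manifold has no boundary.\<close>

definition smooth_3_manifold :: "'a topology \<Rightarrow> 'a chart set \<Rightarrow> bool" where
  "smooth_3_manifold M A \<longleftrightarrow>
     Hausdorff_space M \<and> second_countable M \<and>
     (\<forall>c\<in>A. chart_on M c) \<and> points A = topspace M \<and>
     (\<forall>c\<in>A. \<forall>d\<in>A. smooth_on (overlap c d) (transition c d))"

definition closed_3_manifold :: "'a topology \<Rightarrow> 'a chart set \<Rightarrow> bool" where
  "closed_3_manifold M A \<longleftrightarrow> smooth_3_manifold M A \<and> compact_space M"

text \<open>An orientation is encoded by the choice of an atlas of positively oriented charts.\<close>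

definition oriented_atlas :: "'a chart set \<Rightarrow> bool" where
  "oriented_atlas A \<longleftrightarrow>
     (\<forall>c\<in>A. \<forall>d\<in>A. \<forall>x\<in>overlap c d.
        det (matrix (frechet_derivative (transition c d) (at x))) > 0)"

section \<open>Tangent vectors and vector fields\<close>

text \<open>Functions on the manifold are total functions on the type; their values outside
  \<^term>\<open>points A\<close> are arbitrary. This is harmless: at a point of the manifold a derivation
  annihilates every smooth function that vanishes on the manifold (such an \<open>h\<close> equals \<open>h * u\<close>,
  where \<open>u\<close> is the indicator function of the complement).\<close>

definition smooth_fun :: "'a chart set \<Rightarrow> ('a \<Rightarrow> real) \<Rightarrow> bool" where
  "smooth_fun A f \<longleftrightarrow> (\<forall>c\<in>A. smooth_on (snd c ` fst c) (f \<circ> chart_inv c))"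

type_synonym 'a tvec = "('a \<Rightarrow> real) \<Rightarrow> real"
type_synonym 'a vfield = "'a \<Rightarrow> 'a tvec"

text \<open>Tangent vectors at \<open>p\<close> are the derivations at \<open>p\<close> of the algebra of smooth functions. They
  are set to \<open>0\<close> on non-smooth functions, so that equality of tangent vectors is equality in HOL.\<close>

definition tangent_space :: "'a chart set \<Rightarrow> 'a \<Rightarrow> 'a tvec set" where
  "tangent_space A p = {v.
     (\<forall>f. \<not> smooth_fun A f \<longrightarrow> v f = 0) \<and>
     (\<forall>f h a b. smooth_fun A f \<longrightarrow> smooth_fun A h \<longrightarrow>
        v (\<lambda>x. a * f x + b * h x) = a * v f + b * v h) \<and>
     (\<forall>f h. smooth_fun A f \<longrightarrow> smooth_fun A h \<longrightarrow>
        v (\<lambda>x. f x * h x) = v f * h p + f p * v h)}"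

definition tzero :: "'a tvec" where
  "tzero = (\<lambda>f. 0)"

definition tadd :: "'a tvec \<Rightarrow> 'a tvec \<Rightarrow> 'a tvec" where
  "tadd v w = (\<lambda>f. v f + w f)"

definition tscale :: "real \<Rightarrow> 'a tvec \<Rightarrow> 'a tvec" where
  "tscale a v = (\<lambda>f. a * v f)"

definition vector_field :: "'a chart set \<Rightarrow> 'a vfield \<Rightarrow> bool" where
  "vector_field A X \<longleftrightarrow>
     (\<forall>p\<in>points A. X p \<in> tangent_space A p) \<and>
     (\<forall>f. smooth_fun A f \<longrightarrow> smooth_fun A (\<lambda>p. X p f))"

definition lie_bracket :: "'a vfield \<Rightarrow> 'a vfield \<Rightarrow> 'a vfield" where
  "lie_bracket X Y = (\<lambda>p f. X p (\<lambda>q. Y q f) - Y p (\<lambda>q. X q f))"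

definition differential :: "('a \<Rightarrow> real) \<Rightarrow> 'a \<Rightarrow> 'a tvec \<Rightarrow> real" where
  "differential f p v = v f"

section \<open>Riemannian and Lorentzian metrics\<close>

type_synonym 'a metric = "'a \<Rightarrow> 'a tvec \<Rightarrow> 'a tvec \<Rightarrow> real"

definition symmetric_2_tensor :: "'a chart set \<Rightarrow> 'a metric \<Rightarrow> bool" where
  "symmetric_2_tensor A g \<longleftrightarrow>
     (\<forall>p\<in>points A. \<forall>u\<in>tangent_space A p. \<forall>v\<in>tangent_space A p. \<forall>w\<in>tangent_space A p. \<forall>a.
        g p v w = g p w v \<and>
        g p (tadd u v) w = g p u w + g p v w \<and>
        g p (tscale a v) w = a * g p v w) \<and>
     (\<forall>X Y. vector_field A X \<longrightarrow> vector_field A Y \<longrightarrow> smooth_fun A (\<lambda>p. g p (X p) (Y p)))"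

definition riemannian_metric :: "'a chart set \<Rightarrow> 'a metric \<Rightarrow> bool" where
  "riemannian_metric A g \<longleftrightarrow>
     symmetric_2_tensor A g \<and>
     (\<forall>p\<in>points A. \<forall>v\<in>tangent_space A p. v \<noteq> tzero \<longrightarrow> g p v v > 0)"

text \<open>Signature \<open>(-,+,+)\<close>: negative on a line, positive definite on its orthogonal complement.\<close>

definition lorentzian_metric :: "'a chart set \<Rightarrow> 'a metric \<Rightarrow> bool" where
  "lorentzian_metric A g \<longleftrightarrow>
     symmetric_2_tensor A g \<and>
     (\<forall>p\<in>points A. \<exists>t\<in>tangent_space A p. g p t t < 0 \<and>
        (\<forall>v\<in>tangent_space A p. v \<noteq> tzero \<longrightarrow> g p t v = 0 \<longrightarrow> g p v v > 0))"

section \<open>Levi-Civita connection\<close>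

definition affine_connection :: "'a chart set \<Rightarrow> ('a vfield \<Rightarrow> 'a vfield \<Rightarrow> 'a vfield) \<Rightarrow> bool" where
  "affine_connection A D \<longleftrightarrow>
     (\<forall>X Y. vector_field A X \<longrightarrow> vector_field A Y \<longrightarrow> vector_field A (D X Y)) \<and>
     (\<forall>X Y Z u. vector_field A X \<longrightarrow> vector_field A Y \<longrightarrow> vector_field A Z \<longrightarrow> smooth_fun A u \<longrightarrow>
       (\<forall>p\<in>points A.
          D (\<lambda>q. tadd (X q) (Y q)) Z p = tadd (D X Z p) (D Y Z p) \<and>
          D (\<lambda>q. tscale (u q) (X q)) Z p = tscale (u p) (D X Z p) \<and>
          D X (\<lambda>q. tadd (Y q) (Z q)) p = tadd (D X Y p) (D X Z p) \<and>
          D X (\<lambda>q. tscale (u q) (Y q)) p =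
            tadd (tscale (X p u) (Y p)) (tscale (u p) (D X Y p))))"

definition is_levi_civita ::
  "'a chart set \<Rightarrow> 'a metric \<Rightarrow> ('a vfield \<Rightarrow> 'a vfield \<Rightarrow> 'a vfield) \<Rightarrow> bool" where
  "is_levi_civita A g D \<longleftrightarrow>
     affine_connection A D \<and>
     (\<forall>X Y. vector_field A X \<longrightarrow> vector_field A Y \<longrightarrow>
       (\<forall>p\<in>points A. \<forall>f. D X Y p f - D Y X p f = lie_bracket X Y p f)) \<and>
     (\<forall>X Y Z. vector_field A X \<longrightarrow> vector_field A Y \<longrightarrow> vector_field A Z \<longrightarrow>
       (\<forall>p\<in>points A.
          X p (\<lambda>q. g q (Y q) (Z q)) = g p (D X Y p) (Z p) + g p (Y p) (D X Z p)))"

text \<open>On vector fields and at points of the manifold the choice is unique.\<close>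

definition levi_civita :: "'a chart set \<Rightarrow> 'a metric \<Rightarrow> 'a vfield \<Rightarrow> 'a vfield \<Rightarrow> 'a vfield" where
  "levi_civita A g = (SOME D. is_levi_civita A g D)"

definition killing_field :: "'a chart set \<Rightarrow> 'a metric \<Rightarrow> 'a vfield \<Rightarrow> bool" where
  "killing_field A g T \<longleftrightarrow>
     vector_field A T \<and>
     (\<forall>X Y. vector_field A X \<longrightarrow> vector_field A Y \<longrightarrow>
       (\<forall>p\<in>points A.
          T p (\<lambda>q. g q (X q) (Y q)) =
            g p (lie_bracket T X p) (Y p) + g p (X p) (lie_bracket T Y p)))"

definition parallel_field :: "'a chart set \<Rightarrow> 'a metric \<Rightarrow> 'a vfield \<Rightarrow> bool" where
  "parallel_field A g T \<longleftrightarrow>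
     (\<forall>X. vector_field A X \<longrightarrow> (\<forall>p\<in>points A. levi_civita A g X T p = tzero))"

section \<open>Curvature\<close>

definition curvature ::
  "'a chart set \<Rightarrow> 'a metric \<Rightarrow> 'a vfield \<Rightarrow> 'a vfield \<Rightarrow> 'a vfield \<Rightarrow> 'a vfield" where
  "curvature A g X Y Z = (let D = levi_civita A g in
     (\<lambda>p f. D X (D Y Z) p f - D Y (D X Z) p f - D (lie_bracket X Y) Z p f))"

definition Rm ::
  "'a chart set \<Rightarrow> 'a metric \<Rightarrow> 'a vfield \<Rightarrow> 'a vfield \<Rightarrow> 'a vfield \<Rightarrow> 'a vfield \<Rightarrow> 'a \<Rightarrow> real" where
  "Rm A g X Y Z W p = g p (curvature A g X Y Z p) (W p)"

text \<open>A frame at \<open>p\<close> consists of global vector fields that are only required to be orthonormal at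
  \<open>p\<close> itself; this is enough to evaluate tensors at \<open>p\<close>.\<close>

definition orthonormal_frame_at :: "'a chart set \<Rightarrow> 'a metric \<Rightarrow> 'a \<Rightarrow> (3 \<Rightarrow> 'a vfield) \<Rightarrow> bool" where
  "orthonormal_frame_at A g p e \<longleftrightarrow>
     (\<forall>i. vector_field A (e i)) \<and>
     (\<forall>i. \<bar>g p (e i p) (e i p)\<bar> = 1) \<and>
     (\<forall>i j. i \<noteq> j \<longrightarrow> g p (e i p) (e j p) = 0)"

text \<open>\<open>\<Sum>\<^sub>i \<epsilon>\<^sub>i B(e\<^sub>i, e\<^sub>i)\<close> with \<open>\<epsilon>\<^sub>i = g(e\<^sub>i, e\<^sub>i) = \<plusminus>1\<close>; applied below only to
  tensorial \<open>B\<close>, for which it does not depend on the chosen frame.\<close>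

definition metric_trace ::
  "'a chart set \<Rightarrow> 'a metric \<Rightarrow> 'a \<Rightarrow> ('a vfield \<Rightarrow> 'a vfield \<Rightarrow> real) \<Rightarrow> real" where
  "metric_trace A g p B = (let e = (SOME e. orthonormal_frame_at A g p e) in
     (\<Sum>i\<in>UNIV. g p (e i p) (e i p) * B (e i) (e i)))"

definition Ric :: "'a chart set \<Rightarrow> 'a metric \<Rightarrow> 'a vfield \<Rightarrow> 'a vfield \<Rightarrow> 'a \<Rightarrow> real" where
  "Ric A g V W p = metric_trace A g p (\<lambda>X Y. Rm A g X V W Y p)"

definition scal :: "'a chart set \<Rightarrow> 'a metric \<Rightarrow> 'a \<Rightarrow> real" where
  "scal A g p = metric_trace A g p (\<lambda>X Y. Ric A g X Y p)"

definition form_norm_sq ::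
  "'a chart set \<Rightarrow> 'a metric \<Rightarrow> ('a \<Rightarrow> 'a tvec \<Rightarrow> real) \<Rightarrow> 'a \<Rightarrow> real" where
  "form_norm_sq A g \<alpha> p = metric_trace A g p (\<lambda>X Y. \<alpha> p (X p) * \<alpha> p (Y p))"

section \<open>Real Betti numbers\<close>

text \<open>Singular chains with real coefficients, as finitely supported functions on singular
  simplices. The boundary extends the library's integral boundary of a single simplex linearly.\<close>

definition real_chains :: "nat \<Rightarrow> 'a topology \<Rightarrow> (((nat \<Rightarrow> real) \<Rightarrow> 'a) \<Rightarrow> real) set" where
  "real_chains p M = {c. finite {\<sigma>. c \<sigma> \<noteq> 0} \<and> {\<sigma>. c \<sigma> \<noteq> 0} \<subseteq> singular_simplex_set p M}"

definition real_boundary ::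
  "nat \<Rightarrow> (((nat \<Rightarrow> real) \<Rightarrow> 'a) \<Rightarrow> real) \<Rightarrow> ((nat \<Rightarrow> real) \<Rightarrow> 'a) \<Rightarrow> real" where
  "real_boundary p c = (\<lambda>\<tau>. \<Sum>\<sigma> | c \<sigma> \<noteq> 0.
     c \<sigma> * of_int (Poly_Mapping.lookup (chain_boundary p (frag_of \<sigma>)) \<tau>))"

definition real_cycles :: "nat \<Rightarrow> 'a topology \<Rightarrow> (((nat \<Rightarrow> real) \<Rightarrow> 'a) \<Rightarrow> real) set" where
  "real_cycles p M = {c \<in> real_chains p M. real_boundary p c = (\<lambda>\<tau>. 0)}"

definition real_boundaries :: "nat \<Rightarrow> 'a topology \<Rightarrow> (((nat \<Rightarrow> real) \<Rightarrow> 'a) \<Rightarrow> real) set" where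
  "real_boundaries p M = real_boundary (Suc p) ` real_chains (Suc p) M"

text \<open>The dimension of the quotient \<open>Z / B\<close> of real vector spaces of functions, possibly \<open>\<infinity>\<close>: the
  supremum of the sizes of finite subsets of \<open>Z\<close> that are linearly independent modulo \<open>B\<close>.\<close>

definition quotient_dim :: "('s \<Rightarrow> real) set \<Rightarrow> ('s \<Rightarrow> real) set \<Rightarrow> enat" where
  "quotient_dim Z B = (SUP S \<in> {S. finite S \<and> S \<subseteq> Z \<and>
       (\<forall>a. (\<lambda>x. \<Sum>c\<in>S. a c * c x) \<in> B \<longrightarrow> (\<forall>c\<in>S. a c = 0))}. enat (card S))"

definition betti :: "nat \<Rightarrow> 'a topology \<Rightarrow> enat" where
  "betti i M = quotient_dim (real_cycles i M) (real_boundaries i M)"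

end

theory Submission
 imports Defs "HOL-Real_Asymp.Real_Asymp" "HOL-Library.Function_Algebras"
begin

text \<open>Put \<open>\<epsilon> = g(T, T) = \<plusminus>1\<close>. In a frame \<open>E\<^sub>1, E\<^sub>2, T\<close> the Killing equation leaves the twist \<open>\<omega>\<close> and
 one more curvature function \<open>\<kappa>\<close>; \<open>Ric(T, T) = 2 \<omega>\<^sup>2\<close>, and in both signatures the hypothesis reads
 \<open>\<kappa> > 2 \<omega>\<^sup>2 + 2 |d\<omega>|\<^sup>2 / \<omega>\<^sup>2\<close>. This makes the Ricci tensor of the Riemannian metric
 \<open>h = g + (1 - \<epsilon>) g(T, \<cdot>)\<^sup>2\<close> positive definite.

 If \<open>Ric\<^sub>h > 0\<close>, a flat affine real line bundle with linear holonomy \<open>\<plusminus>1\<close> has a parallel section: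
 averaging a section along short approximate geodesics of length \<open>e\<close> shrinks its slope by a factor
 \<open>1 - k e\<^sup>2\<close>. For a 1-cycle that does not bound, a linear functional on chains killing boundaries
 but not the cycle defines such a bundle, and a parallel section contradicts its choice. For a 2-cycle
 \<open>z\<close> the local fillings are a torsor over \<open>H\<^sub>3(M, M - x) = \<int>\<close>; rounding a real parallel section \<open>u\<close> to
 \<open>\<lfloor>u\<rfloor> + \<lceil>u\<rceil>\<close>, which commutes with \<open>u \<mapsto> \<plusminus>u + n\<close> up to doubling \<open>n\<close>, gives compatible local
 fillings of \<open>2 z\<close>, and these glue.\<close>

text \<open>Betti numbers are singular while the hypothesis is differential; the bridge is a
  discrete heat flow in place of harmonic forms. The second derivative in \<open>e\<close> of the
  squared length of a variation field along a geodesic is a curvature term, and its mean over a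
  rotation invariant distribution of directions is a negative multiple of the Ricci curvature: this
  is the gain of order \<open>e^2\<close>. The obstacle is that averages are computed in charts and
  must be glued with a partition of unity. Approximate geodesics of two charts have the same 2-jet
  up to a rotation of the direction, so the charts disagree by order \<open>e^3\<close> only, and
  for small \<open>e\<close> the gain absorbs this loss. Rotation invariance is used a second time:
  when the average is differentiated, the turning of the frame against parallel transport drops out.
  In the curvature estimate the mixed terms of the Ricci form are derivatives of the twist, and
  completing the square in the \<open>T\<close> component is what calls for the logarithmic gradient
  term. Passing from \<open>z\<close> to \<open>2 z\<close> is harmless because the coefficients are
  real in the end.\<close>

abbreviation "fd f x \<equiv> frechet_derivative f (at x)"
abbreviation "smo \<equiv> smooth_on"
abbreviation "br \<equiv> lie_bracket"
abbreviation usum (binder "SU " 10) where "usum f \<equiv> sum f UNIV"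
abbreviation "cinv \<equiv> chart_inv"
abbreviation "img c \<equiv> snd c ` fst c"
abbreviation "cpart c X \<equiv> {q \<in> fst c. snd c q \<in> X}"
abbreviation "bdy \<equiv> chain_boundary"
abbreviation "sch \<equiv> singular_chain"
abbreviation "rhg \<equiv> relative_homology_group"
abbreviation "lkp \<equiv> Poly_Mapping.lookup"
abbreviation "kys \<equiv> Poly_Mapping.keys"
notation scaleR (infixr "*R" 75)

section \<open>Smooth functions on open sets\<close>

lemma Ck_on_cong: assumes "open S" "!!x. x : S ==> f x = g x" "Ck_on k S f" shows "Ck_on k S g" using assms(2,3)
proof (induction k arbitrary: f g)
 case 0
 thus ?case by simp
next
 case (Suc k)
 have *: "(g has_derivative fd f x) (at x)" if "x : S" for x
 proof (rule has_derivative_transform_within_open[OF _ \<open>open S\<close> that])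
  show "(f has_derivative fd f x) (at x)" using Suc.prems that by (simp add: frechet_derivative_works[symmetric])
 qed (use Suc.prems in auto)
 have "fd f x v = fd g x v" if "x : S" for x v by (rule fun_cong[OF frechet_derivative_at[OF *[OF that]]])
 hence "Ck_on k S (%x. fd g x v)" for v by (rule Suc.IH[where f = "%x. fd f x v"]) (use Suc.prems(2) in auto)
 moreover have "g differentiable at x" if "x : S" for x using *[OF that] by (rule differentiableI)
 ultimately show ?case by simp
qed

lemma Ck_on_SucI: assumes "!!x. x : S ==> (f has_derivative f' x) (at x)" and "!!v. Ck_on k S (%x. f' x v)" and "open S" shows "Ck_on (Suc k) S f"
proof -
 have "f' x v = fd f x v" if "x : S" for x v by (rule fun_cong[OF frechet_derivative_at[OF assms(1)[OF that]]])
 hence "Ck_on k S (%x. fd f x v)" for v by (rule Ck_on_cong[OF assms(3) _ assms(2)])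
 moreover have "f differentiable at x" if "x : S" for x using assms(1)[OF that] by (rule differentiableI)
 ultimately show ?thesis by simp
qed

lemma Ck_on_SucD: assumes "Ck_on (Suc k) S f" "x : S" shows "(f has_derivative fd f x) (at x)" using assms by (simp add: frechet_derivative_works[symmetric])

lemma Ck_on_cont: "Ck_on k S f ==> continuous_on S f" by (cases k) (auto simp: differentiable_imp_continuous_within continuous_at_imp_continuous_on)

lemma Ck_on_Suc_imp: "Ck_on (Suc k) S f ==> Ck_on k S f"
proof (induction k arbitrary: f)
 case 0
 thus ?case using Ck_on_cont[OF 0] by simp
qed auto

lemma Ck_on_sub: "Ck_on k S f ==> T <= S ==> Ck_on k T f" by (induction k arbitrary: f) (auto intro: continuous_on_subset)

lemma Ck_on_loc: assumes "!!x. x : S ==> EX U. open U & x : U & Ck_on k (S Int U) f" shows "Ck_on k S f" using assms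
proof (induction k arbitrary: f)
 case 0
 have "continuous (at x within S) f" if x: "x : S" for x
 proof -
  obtain U where U: "open U" "x : U" "continuous_on (S Int U) f" using 0[OF x] by auto
  hence "continuous (at x within S Int U) f" using x by (simp add: continuous_on_eq_continuous_within)
  moreover have "at x within S Int U = at x within S" by (rule at_within_nhd[of x U]) (use U in auto)
  ultimately show ?thesis by simp
 qed
 thus ?case by (simp add: continuous_on_eq_continuous_within)
next
 case (Suc k)
 show ?case
 proof (simp, intro conjI ballI allI)
  fix x assume "x : S" thus "f differentiable at x" using Suc.prems by fastforce
 next
  fix v show "Ck_on k S (%x. fd f x v)" by (rule Suc.IH) (use Suc.prems in fastforce)
 qed
qed

lemma Ck_on_c: "Ck_on k S (%x. c)" by (induction k arbitrary: c) (auto simp: frechet_derivative_const)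

lemma Ck_on_linear_comp: assumes "bounded_linear L" "open S" "Ck_on k S f" shows "Ck_on k S (%x. L (f x))" using assms(3)
proof (induction k arbitrary: f)
 case 0
 thus ?case using assms(1) by (auto intro: bounded_linear.continuous_on)
next
 case (Suc k)
 show ?case
 proof (rule Ck_on_SucI[OF _ _ assms(2)])
  show "((%x. L (f x)) has_derivative (%v. L (fd f x v))) (at x)" if "x : S" for x by (rule bounded_linear.has_derivative[OF assms(1) Ck_on_SucD[OF Suc.prems that]])
  show "Ck_on k S (%x. L (fd f x v))" for v by (rule Suc.IH) (use Suc.prems in simp)
 qed
qed

lemma Ck_on_id: "open S ==> Ck_on k S (%x. x)" by (cases k) (simp_all add: Ck_on_c)

lemma Ck_on_add: assumes "open S" "Ck_on k S f" "Ck_on k S g" shows "Ck_on k S (%x. f x+g x)" using assms(2,3)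
proof (induction k arbitrary: f g)
 case (Suc k)
 show ?case
 proof (rule Ck_on_SucI[OF _ _ assms(1)])
  show "((%x. f x+g x) has_derivative (%v. fd f x v+fd g x v)) (at x)" if "x : S" for x by (rule has_derivative_add[OF Ck_on_SucD[OF Suc.prems(1) that] Ck_on_SucD[OF Suc.prems(2) that]])
  show "Ck_on k S (%x. fd f x v+fd g x v)" for v by (rule Suc.IH) (use Suc.prems in simp_all)
 qed
qed (auto intro: continuous_intros)

lemma Ck_on_sum: assumes "open S" "!!i. i : I ==> Ck_on k S (f i)" shows "Ck_on k S (%x. SUM i:I. f i x)"
 using assms(2) by (induction I rule: infinite_finite_induct) (auto intro: Ck_on_c Ck_on_add assms(1))

lemma Ck_on_bilinear: assumes B: "bounded_bilinear B" and "open S" "Ck_on k S f" "Ck_on k S g" shows "Ck_on k S (%x. B (f x) (g x))" using assms(3,4)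
proof (induction k arbitrary: f g)
 case 0
 thus ?case using bounded_bilinear.continuous_on[OF B] by auto
next
 case (Suc k)
 have 1: "Ck_on k S f" "Ck_on k S g" using Suc.prems Ck_on_Suc_imp by blast+
 show ?case
 proof (rule Ck_on_SucI[OF _ _ assms(2)])
  show "((%x. B (f x) (g x)) has_derivative (%v. B (f x) (fd g x v)
      + B (fd f x v) (g x))) (at x)" if "x : S" for x by (rule bounded_bilinear.FDERIV[OF B Ck_on_SucD[OF Suc.prems(1) that] Ck_on_SucD[OF Suc.prems(2) that]])
  show "Ck_on k S (%x. B (f x) (fd g x v)+B (fd f x v) (g x))" for v by (rule Ck_on_add[OF assms(2)]; rule Suc.IH) (use Suc.prems 1 in simp_all)
 qed
qed

text \<open>In the chain rule the direction \<open>fd f x v\<close> varies with \<open>x\<close>, so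
  it is not one of the fixed directions that \<open>Ck_on\<close> speaks of. Expanding it in the
  basis leaves scalar functions times fixed directional derivatives of \<open>g\<close>, to which
  the induction hypothesis applies.\<close>

lemma Ck_on_comp:
 fixes f :: "'b::real_normed_vector => 'c::euclidean_space" and g :: "'c => 'd::real_normed_vector" assumes "open S" "open U" "f ` S <= U" "Ck_on k S f" "Ck_on k U g"
 shows "Ck_on k S (%x. g (f x))" using assms(4,5)
proof (induction k arbitrary: g)
 case 0
 thus ?case using assms(3) by (auto intro: continuous_on_compose2)
next
 case (Suc k)
 let ?D = "%x v. fd f x v"
 have 1: "Ck_on k S f" using Suc.prems(1) Ck_on_Suc_imp by blast
 have der: "((%x. g (f x)) has_derivative (%v. SUM b:Basis. (?D x v \<bullet> b)*Rfd g (f x) b)) (at x)" if x: "x : S" for x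
 proof -
  have g: "(g has_derivative fd g (f x)) (at (f x))" using Ck_on_SucD[OF Suc.prems(2)] x assms(3) by auto
  have rep: "fd g (f x) w = (SUM b:Basis. (w \<bullet> b)*Rfd g (f x) b)" for w
  proof -
   interpret bounded_linear "fd g (f x)" using g by (rule has_derivative_bounded_linear)
   show ?thesis by (subst (1) euclidean_representation[symmetric, of w]) (simp add: sum scale)
  qed
  show ?thesis by (rule has_derivative_eq_rhs[OF has_derivative_compose[OF Ck_on_SucD[OF Suc.prems(1) x] g]]) (rule ext, rule rep)
 qed
 show ?case
 proof (rule Ck_on_SucI[OF der _ assms(1)])
  fix v
  have a: "Ck_on k S (%x. fd g (f x) b)" for b by (rule Suc.IH) (use 1 Suc.prems in auto)
  have b: "Ck_on k S (%x. ?D x v \<bullet> b)" for b by (rule Ck_on_linear_comp[OF bounded_linear_inner_left assms(1)]) (use Suc.prems(1) in simp)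
  show "Ck_on k S (%x. SUM b:Basis. (?D x v \<bullet> b)*Rfd g (f x) b)" by (rule Ck_on_sum[OF assms(1) Ck_on_bilinear[OF bounded_bilinear_scaleR assms(1) b a]])
 qed
qed

lemmas Ck_on_mult = Ck_on_bilinear[OF bounded_bilinear_mult]
lemmas Ck_on_minus = Ck_on_linear_comp[OF bounded_linear_minus[OF bounded_linear_ident]]

lemma Ck_on_inverse:
 fixes f :: "'b::real_normed_vector => real" assumes "open S" "!!x. x : S ==> f x ~= 0" "Ck_on k S f" shows "Ck_on k S (%x. inverse (f x))" using assms(3)
proof (induction k)
 case 0
 thus ?case using assms(2) by (auto intro: continuous_on_inverse)
next
 case (Suc k)
 have IH: "Ck_on k S (%x. inverse (f x))" by (rule Suc.IH[OF Ck_on_Suc_imp[OF Suc.prems]])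
 show ?case
 proof (rule Ck_on_SucI[OF _ _ assms(1)])
  show "((%x. inverse (f x)) has_derivative (%v. - (inverse (f x)*fd f x v * inverse (f x)))) (at x)" if "x : S" for x
   by (rule Deriv.has_derivative_inverse[OF assms(2)[OF that] Ck_on_SucD[OF Suc.prems that]])
  have D: "Ck_on k S (%x. fd f x v)" for v using Suc.prems by simp
  show "Ck_on k S (%x. - (inverse (f x)*fd f x v * inverse (f x)))" for v by (rule Ck_on_minus[OF assms(1) Ck_on_mult[OF assms(1) Ck_on_mult[OF assms(1) IH D] IH]])
 qed
qed

lemma Ck_on_sqrt:
 fixes f :: "'b::real_normed_vector => real" assumes "open S" "!!x. x : S ==> f x>0" "Ck_on k S f" shows "Ck_on k S (%x. sqrt (f x))" using assms(3)
proof (induction k)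
 case 0
 thus ?case by (auto intro: continuous_on_real_sqrt)
next
 case (Suc k)
 have IH: "Ck_on k S (%x. sqrt (f x))" by (rule Suc.IH[OF Ck_on_Suc_imp[OF Suc.prems]])
 have pos: "sqrt (f x) ~= 0" if "x : S" for x using assms(2)[OF that] by simp
 show ?case
 proof (rule Ck_on_SucI[OF _ _ assms(1)])
  show "((%x. sqrt (f x)) has_derivative (%v. fd f x v * (inverse (sqrt (f x))/2))) (at x)" if "x : S" for x
   by (rule DERIV_compose_FDERIV[OF DERIV_real_sqrt[OF assms(2)[OF that]] Ck_on_SucD[OF Suc.prems that]])
  have D: "Ck_on k S (%x. fd f x v)" for v using Suc.prems by simp
  show "Ck_on k S (%x. fd f x v * (inverse (sqrt (f x))/2))" for v by (rule Ck_on_mult[OF assms(1) D Ck_on_linear_comp[OF bounded_linear_divide assms(1) Ck_on_inverse[OF assms(1) pos IH]]])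
 qed
qed

named_theorems smooth_intros

lemma smo_cong: "open S ==> (!!x. x : S ==> f x = g x) ==> smo S f ==> smo S g" unfolding smooth_on_def using Ck_on_cong by blast

lemma smo_sub: "smo S f ==> T <= S ==> smo T f" unfolding smooth_on_def using Ck_on_sub by blast

lemma smo_cont: "smo S f ==> continuous_on S f" unfolding smooth_on_def using Ck_on_cont by blast

lemma smo_loc: "(!!x. x : S ==> EX U. open U & x : U & smo (S Int U) f) ==> smo S f" unfolding smooth_on_def by (metis Ck_on_loc)

lemma smo_c [smooth_intros]: "smo S (%x. c)" unfolding smooth_on_def by (intro allI, rule Ck_on_c; auto)

lemma smo_id [smooth_intros]: "open S ==> smo S (%x. x)" unfolding smooth_on_def by (intro allI, rule Ck_on_id; auto)

lemma smo_linear_comp: "bounded_linear L ==> open S ==> smo S f ==> smo S (%x. L (f x))" unfolding smooth_on_def by (intro allI, rule Ck_on_linear_comp; auto)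

lemma smo_add [smooth_intros]: "open S ==> smo S f ==> smo S g ==> smo S (%x. f x+g x)" unfolding smooth_on_def by (intro allI, rule Ck_on_add; auto)

lemma smo_minus [smooth_intros]: "open S ==> smo S f ==> smo S (%x. - f x)" by (rule smo_linear_comp[OF bounded_linear_minus[OF bounded_linear_ident]])

lemma smo_diff [smooth_intros]: "open S ==> smo S f ==> smo S g ==> smo S (%x. f x-g x)" using smo_add[OF _ _ smo_minus] by force

lemma smo_sum [smooth_intros]: "open S ==> (!!i. i : I ==> smo S (f i)) ==> smo S (%x. SUM i:I. f i x)" unfolding smooth_on_def by (intro allI, rule Ck_on_sum; auto)

lemma smo_bilinear: "bounded_bilinear B ==> open S ==> smo S f ==> smo S g ==> smo S (%x. B (f x) (g x))" unfolding smooth_on_def by (intro allI, rule Ck_on_bilinear; auto)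

lemmas smo_mult [smooth_intros] = smo_bilinear[OF bounded_bilinear_mult]
lemmas smo_scR [smooth_intros] = smo_bilinear[OF bounded_bilinear_scaleR]
lemmas smo_inner [smooth_intros] = smo_bilinear[OF bounded_bilinear_inner]

lemma smo_comp:
 fixes f :: "'b::real_normed_vector => 'c::euclidean_space" and g :: "'c => 'd::real_normed_vector" shows "open S ==> open U ==> (!!x. x : S ==> f x : U) ==> smo S f ==> smo U g
  ==> smo S (%x. g (f x))" unfolding smooth_on_def by (intro allI, rule Ck_on_comp[of S U f]; auto)

lemma smo_inverse [smooth_intros]:
 fixes f :: "'b::real_normed_vector => real" shows "open S ==> smo S f ==> (!!x. x : S ==> f x ~= 0) ==> smo S (%x. inverse (f x))"
 unfolding smooth_on_def by (intro allI, rule Ck_on_inverse; auto)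

lemma smo_divide [smooth_intros]:
 fixes f g :: "'b::real_normed_vector => real" shows "open S ==> smo S f ==> smo S g ==> (!!x. x : S ==> g x ~= 0) ==> smo S (%x. f x/g x)"
 unfolding divide_inverse by (intro smo_mult smo_inverse)

lemma smo_sqrt [smooth_intros]:
 fixes f :: "'b::real_normed_vector => real" shows "open S ==> smo S f ==> (!!x. x : S ==> f x>0) ==> smo S (%x. sqrt (f x))" unfolding smooth_on_def by (intro allI, rule Ck_on_sqrt; auto)

lemma smooth_on_deriv: "smo S f ==> smo S (%x. fd f x v)" unfolding smooth_on_def by (metis Ck_on.simps(2))

lemma smooth_on_has_derivative: "smo S f ==> x : S ==> (f has_derivative fd f x) (at x)" unfolding smooth_on_def using Ck_on_SucD by blast

lemma smo_vec_nth [smooth_intros]: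
 fixes f :: "'b::real_normed_vector => real^'n" shows "open S ==> smo S f ==> smo S (%x. f x$i)" by (rule smo_linear_comp[OF bounded_linear_vec_nth])

lemma smo_vec_lambda [smooth_intros]:
 fixes f :: "'n::finite => 'b::real_normed_vector => real" assumes "open S" "!!i. smo S (f i)" shows "smo S (%x. \<chi> i. f i x)"
proof -
 have "(\<chi> i. f i x) = (SU i. f i x*Raxis i 1)" for x by (simp add: vec_eq_iff axis_def if_distrib cong: if_cong)
 thus ?thesis using assms by (auto intro!: smooth_intros)
qed

lemma smo_Pair [smooth_intros]:
 fixes f :: "'b::real_normed_vector => 'c::real_normed_vector" and g :: "'b => 'd::real_normed_vector" assumes "open S" "smo S f" "smo S g" shows "smo S (%x. (f x,g x))"
proof -
 have "smo S (%x. (f x,0::'d))" by (rule smo_linear_comp[OF bounded_linear_Pair[OF bounded_linear_ident bounded_linear_zero] assms(1,2)])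
 moreover have "smo S (%x. (0::'c,g x))" by (rule smo_linear_comp[OF bounded_linear_Pair[OF bounded_linear_zero bounded_linear_ident] assms(1,3)])
 ultimately have "smo S (%x. (f x,0)+(0,g x))" by (rule smo_add[OF assms(1)])
 thus ?thesis by simp
qed

lemma smo_fst: "open S ==> smo S f ==> smo S (%x. fst (f x))" by (rule smo_linear_comp[OF bounded_linear_fst])

lemma smo_snd: "open S ==> smo S f ==> smo S (%x. snd (f x))" by (rule smo_linear_comp[OF bounded_linear_snd])

lemmas [smooth_intros] = smo_fst smo_snd

text \<open>The factor \<open>x\<^sup>-\<^sup>n\<close> makes the family closed
 under differentiation.\<close>

definition flat :: "nat => real => real" where "flat n x = (if x <= 0 then 0 else inverse x^n*exp (- inverse x))"

lemma flat_deriv: "(flat n has_real_derivative-real n*flat (Suc n) x+flat (Suc (Suc n)) x) (at x)"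
proof -
 consider "x>0" | "x<0" | "x = 0" by linarith
 thus ?thesis
 proof cases
  case 1
  have "((%x. inverse x^n*exp (- inverse x)) has_real_derivative
    - real n*flat (Suc n) x+flat (Suc (Suc n)) x) (at x)"
  proof -
   have "real n*inverse x^(n-Suc 0)*(inverse x)^2 = real n*inverse x^Suc n" by (cases n) (auto simp: power2_eq_square algebra_simps)
   thus ?thesis using 1 by (auto intro!: derivative_eq_intros simp: flat_def power2_eq_square algebra_simps)
  qed
  thus ?thesis by (rule has_field_derivative_transform_within_open[where S = "{0<..}"]) (use 1 in "auto simp: flat_def")
 next
  case 2
  have "((%x. 0) has_real_derivative-real n*flat (Suc n) x+flat (Suc (Suc n)) x) (at x)" using 2 by (auto simp: flat_def)
  thus ?thesis by (rule has_field_derivative_transform_within_open[where S = "{..<0}"]) (use 2 in "auto simp: flat_def")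
 next
  case 3
  \<comment> \<open>The difference quotient of \<open>flat n\<close> at 0 is
    \<open>flat (Suc n)\<close>, so the derivative there is the limit of the latter, which is 0 from
    both sides.\<close>
  have "((%x::real. inverse x^Suc n*exp (- inverse x)) \<longlongrightarrow> 0) (at_right 0)" by real_asymp
  hence r: "(flat (Suc n) \<longlongrightarrow> 0) (at_right 0)" by (rule Lim_transform_eventually) (auto simp: flat_def eventually_at_filter)
  have l: "(flat (Suc n) \<longlongrightarrow> 0) (at_left 0)" by (rule Lim_transform_eventually[OF tendsto_const]) (auto simp: flat_def eventually_at_filter)
  from filterlim_split_at[OF l r] have "((%y. (flat n y-flat n 0)/(y-0)) \<longlongrightarrow> 0) (at 0)"
   by (rule Lim_transform_eventually) (auto simp: flat_def eventually_at_filter field_simps)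
  thus ?thesis using 3 by (simp add: has_field_derivative_iff flat_def)
 qed
qed

lemma smo_flat: "smo S (flat n)"
proof -
 have "Ck_on k UNIV (flat n)" for k n
 proof (induction k arbitrary: n)
  case 0
  show ?case using flat_deriv by (auto intro!: DERIV_continuous_on)
 next
  case (Suc k)
  show ?case
  proof (rule Ck_on_SucI)
   show "(flat n has_derivative (%v. v * (- real n*flat (Suc n) x+flat (Suc (Suc n)) x))) (at x)" for x using flat_deriv[of n x] unfolding has_field_derivative_def
    by (rule has_derivative_eq_rhs) (simp add: fun_eq_iff)
   show "Ck_on k UNIV (%x. v * (- real n*flat (Suc n) x+flat (Suc (Suc n)) x))" for v
    by (rule Ck_on_mult[OF open_UNIV Ck_on_c Ck_on_add[OF open_UNIV Ck_on_mult[OF open_UNIV Ck_on_c Suc.IH] Suc.IH]])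
  qed simp
 qed
 thus ?thesis unfolding smooth_on_def using Ck_on_sub by blast
qed

lemma flat_pos: "x>0 ==> flat n x>0" and flat_nonneg: "flat n x >= 0" and flat_zero: "x <= 0 ==> flat n x = 0" by (auto simp: flat_def)

lemma smo_flat_comp [smooth_intros]:
 fixes f :: "'b::real_normed_vector => real" shows "open S ==> smo S f ==> smo S (%x. flat n (f x))" by (rule smo_comp[OF _ open_UNIV _ _ smo_flat]) auto

text \<open>A function of \<open>norm x\<close> alone: the same bump serves as a cutoff in charts
  and as the rotation invariant density of the averages \<open>Ex\<close>.\<close>

definition plateau :: "real => real^3 => real" where "plateau r x = flat 0 (4*r^2-x \<bullet> x)/(flat 0 (4*r^2-x \<bullet> x)+flat 0 (x \<bullet> x-r^2))"

text \<open>The two arguments of \<open>flat 0\<close> add up to \<open>3*r^2\<close>, so at least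
  one of them is positive.\<close>

lemma plat_denom: "r>0 ==> flat 0 (4*r^2-x \<bullet> x)+flat 0 (x \<bullet> x-r^2)>0"
proof -
 assume "r>0"
 hence "4*r^2-x \<bullet> x>0 \<or> x \<bullet> x-r^2>0" using zero_less_power[of r 2] by linarith
 thus ?thesis by (metis flat_pos flat_nonneg add_pos_nonneg add_nonneg_pos)
qed

lemma plat_sm: "r>0 ==> smo UNIV (plateau r)" unfolding plateau_def by (intro smooth_intros open_UNIV less_imp_neq[OF plat_denom, symmetric])

lemma plat_one: "r>0 ==> norm x <= r ==> plateau r x = 1" using plat_denom[of r x] by (simp add: plateau_def flat_zero dot_square_norm power_mono)

lemma plat_zero: "r>0 ==> norm x >= 2*r ==> plateau r x = 0" using power_mono[of "2*r" "norm x" 2] by (simp add: plateau_def flat_zero dot_square_norm power_mult_distrib)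

lemma plat_range: "r>0 ==> 0 <= plateau r x & plateau r x <= 1" using plat_denom[of r x] by (simp add: plateau_def flat_nonneg divide_le_eq_1)

section \<open>Integrals with a parameter, Hadamard's lemma, symmetry of second derivatives\<close>

lemma integral_deriv_parameter:
 fixes F :: "'b::euclidean_space \<times> 'c::euclidean_space => real" assumes "open S" and W: "open W" "S \<times> cbox a b <= W" and F: "smo W F" and x: "x : S"
 shows "((%x. integral (cbox a b) (%t. F (x,t))) has_derivative (%v. integral (cbox a b) (%t. fd F (x,t) (v,0)))) (at x)"
proof -
 obtain r where r: "r>0" "ball x r <= S" using \<open>open S\<close> x openE by blast
 define fx where "fx y t = Blinfun (%v. fd F (y,t) (v,0))" for y t
 have D: "(F has_derivative fd F (y,t)) (at (y,t))" if "y : S" "t : cbox a b" for y t using W that by (intro smooth_on_has_derivative[OF F]) auto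
 have fx: "blinfun_apply (fx y t) = (%v. fd F (y,t) (v,0))" if "y : S" "t : cbox a b" for y t
 proof -
  have "bounded_linear (%v. fd F (y,t) (v,0))" by (rule bounded_linear_compose[OF has_derivative_bounded_linear[OF D[OF that]]
      bounded_linear_Pair[OF bounded_linear_ident bounded_linear_zero]])
  thus ?thesis by (simp add: fx_def bounded_linear_Blinfun_apply)
 qed
 have contF: "continuous_on W F" and contD: "continuous_on W (%z. fd F z v)" for v using F smo_cont smooth_on_deriv by blast+
 have cfx: "continuous_on (S \<times> cbox a b) (%z. fx (fst z) (snd z))"
 proof (rule continuous_on_blinfun_componentwise)
  fix i :: 'b
  have "continuous_on (S \<times> cbox a b) (%z. fd F z (i,0))" using contD W(2) continuous_on_subset by blast
  thus "continuous_on (S \<times> cbox a b) (%z. blinfun_apply (fx (fst z) (snd z)) i)" by (rule continuous_on_eq) (auto simp: fx)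
 qed
 have int: "(%t. fx y t) integrable_on cbox a b" if "y : S" for y using that by (intro integrable_continuous continuous_on_compose2[OF cfx, of _ "%t. (y,t)", simplified])
   (auto intro!: continuous_intros)
 have "((%x. integral (cbox a b) (%t. F (x,t))) has_derivative integral (cbox a b) (fx x)) (at x within ball x r)"
 proof (rule leibniz_rule)
  fix y t assume yt: "y : ball x r" "t : cbox a b"
  hence "y : S" using r by auto
  have "((%y. (y,t)) has_derivative (%v. (v,0))) (at y)" by (rule has_derivative_Pair) (auto intro: has_derivative_ident has_derivative_const)
  from has_derivative_compose[OF this D[OF \<open>y \<in> S\<close> yt(2)]]
  show "((%y. F (y,t)) has_derivative blinfun_apply (fx y t)) (at y within ball x r)" unfolding fx[OF \<open>y \<in> S\<close> yt(2)] by (rule has_derivative_at_withinI)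
 next
  fix y assume "y : ball x r"
  hence "{y} \<times> cbox a b <= W" using r W by auto
  thus "(%t. F (y,t)) integrable_on cbox a b" by (intro integrable_continuous continuous_on_compose2[OF contF]) (auto intro!: continuous_intros)
 next
  show "continuous_on (ball x r \<times> cbox a b) (%(x,t). fx x t)" unfolding case_prod_beta by (rule continuous_on_subset[OF cfx]) (use r in auto)
 qed (use r in auto)
 hence "((%x. integral (cbox a b) (%t. F (x,t))) has_derivative integral (cbox a b) (fx x)) (at x)" using r by (simp add: at_within_open[of x "ball x r"])
 moreover have "blinfun_apply (integral (cbox a b) (fx x)) = (%v. integral (cbox a b) (%t. fd F (x,t) (v,0)))"
 proof
  fix v
  have "blinfun_apply (integral (cbox a b) (fx x)) v = integral (cbox a b) (%t. blinfun_apply (fx x t) v)"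
   using integral_linear[OF int[OF x] bounded_linear_apply_blinfun[of v]] by (simp add: o_def)
  also have "... = integral (cbox a b) (%t. fd F (x,t) (v,0))" by (rule integral_cong) (simp add: fx x)
  finally show "blinfun_apply (integral (cbox a b) (fx x)) v = ..." .
 qed
 ultimately show ?thesis by simp
qed

lemma smo_integral:
 fixes F :: "'b::euclidean_space \<times> 'c::euclidean_space => real" assumes "open S" "open W" "S \<times> cbox a b <= W" "smo W F" shows "smo S (%x. integral (cbox a b) (%t. F (x,t)))"
proof -
 have "Ck_on k S (%x. integral (cbox a b) (%t. F (x,t)))" for k using assms(4)
 proof (induction k arbitrary: F)
  case 0
  show ?case unfolding Ck_on.simps(1) by (rule continuous_at_imp_continuous_on) (use integral_deriv_parameter[OF assms(1-3) 0] has_derivative_continuous in blast)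
 next
  case (Suc k)
  show ?case by (rule Ck_on_SucI[OF integral_deriv_parameter[OF assms(1-3) Suc.prems] _ assms(1)], assumption) (rule Suc.IH, rule smooth_on_deriv[OF Suc.prems])
 qed
 thus ?thesis by (simp add: smooth_on_def)
qed

text \<open>\<open>h i\<close> is the mean of the i-th partial derivative along the segment from
  \<open>a\<close> to \<open>x\<close>. The expansion yields both the symmetry of second derivatives
  and the fact that derivations are directional derivatives.\<close>

lemma hadamard:
 fixes f :: "real^3 => real" assumes f: "smo (ball a r) f" obtains h where "!!i. smo (ball a r) (h i)" "!!x. x : ball a r ==> f x = f a+(SU i. (x$i-a$i)*h i x)"
  "r>0 ==> (!!i. h i a = fd f a (axis i 1))"
proof
 let ?D = "%i x. fd f x (axis i 1)"
 define phi where "phi z = a+snd z*R(fst z-a)" for z :: "(real^3) \<times> real"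
 define W where "W = phi -` ball a r"
 define h where "h i x = integral (cbox 0 1) (%t. ?D i (phi (x,t)))" for i x
 have phi: "smo UNIV phi" unfolding phi_def by (intro smooth_intros) auto
 hence "open W" unfolding W_def by (metis continuous_on_open_vimage open_UNIV open_ball smo_cont Int_UNIV_right)
 have seg: "a+t*R(x-a) : ball a r" if "x : ball a r" "t : cbox 0 1" for x and t :: real
 proof -
  have "norm (t*R(x-a)) <= 1*norm (x-a)" using that unfolding norm_scaleR by (intro mult_right_mono) auto
  thus ?thesis using that by (simp add: dist_norm norm_minus_commute)
 qed
 have W: "ball a r \<times> cbox 0 1 <= W" using seg by (auto simp: W_def phi_def)
 show "smo (ball a r) (h i)" for i unfolding h_def
 proof (rule smo_integral[OF _ \<open>open W\<close> W])
  show "smo W (%z. ?D i (phi z))" by (rule smo_comp[OF \<open>open W\<close> open_ball _ smo_sub[OF phi] smooth_on_deriv[OF f]]) (auto simp: W_def)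
 qed simp
 show "h i a = ?D i a" if "r>0" for i by (simp add: h_def phi_def)
 fix x assume x: "x : ball a r"
 let ?g = "%t. f (a+t*R(x-a))"
 have rep: "fd f y v = (SU i. v$i*?D i y)" if "y : ball a r" for y v
 proof -
  interpret bounded_linear "fd f y" using smooth_on_has_derivative[OF f that] by (rule has_derivative_bounded_linear)
  have "v = (SU i. v$i*Raxis i 1)" by (simp add: vec_eq_iff axis_def if_distrib cong: if_cong)
  thus ?thesis by (metis (mono_tags, lifting) sum scaleR real_scaleR_def sum.cong)
 qed
 have cont: "continuous_on (cbox 0 1) (%t. ?D i (phi (x,t)))" for i using seg[OF x] by (intro continuous_on_compose2[OF smo_cont[OF smooth_on_deriv[OF f]]])
   (auto simp: phi_def intro!: continuous_intros)
 have "(?g has_vector_derivative (SU i. (x$i-a$i)*?D i (phi (x,t)))) (at t within cbox 0 1)" if t: "t : cbox 0 1" for t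
 proof -
  have "((%t. a+t*R(x-a)) has_derivative (%s. s*R(x-a))) (at t within cbox 0 1)" by (auto intro!: derivative_eq_intros)
  from has_derivative_compose[OF this smooth_on_has_derivative[OF f seg[OF x t]]]
  show ?thesis unfolding has_vector_derivative_def by (rule has_derivative_eq_rhs, intro ext, subst rep[OF seg[OF x t]]) (simp add: phi_def sum_distrib_left mult.assoc)
 qed
 hence "((%t. SU i. (x$i-a$i)*?D i (phi (x,t))) has_integral (?g 1-?g 0)) {0..1}" by (intro fundamental_theorem_of_calculus) (auto simp: cbox_interval)
 hence "f x-f a = integral (cbox 0 1) (%t. SU i. (x$i-a$i)*?D i (phi (x,t)))" by (simp add: integral_unique cbox_interval)
 also have "... = (SU i. (x$i-a$i)*h i x)"
 proof -
  have "(%t. (x$i-a$i)*?D i (phi (x,t))) integrable_on cbox 0 1" for i by (rule integrable_continuous, rule continuous_on_mult[OF continuous_on_const cont])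
  thus ?thesis unfolding h_def by (subst integral_sum) simp_all
 qed
 finally show "f x = f a+(SU i. (x$i-a$i)*h i x)" by simp
qed

lemma smo_fr_rep:
 fixes f :: "real^3 => real" assumes "smo S f" "x : S" shows "fd f x v = (SU i. v$i*fd f x (axis i 1))"
proof -
 interpret bounded_linear "fd f x" using smooth_on_has_derivative[OF assms] by (rule has_derivative_bounded_linear)
 have "v = (SU i. v$i*Raxis i 1)" by (simp add: vec_eq_iff axis_def if_distrib cong: if_cong)
 thus ?thesis by (metis (mono_tags, lifting) sum scaleR real_scaleR_def sum.cong)
qed

lemma sum_axis_mult: "(SU k. axis i (1::real)$k*f k) = f (i::'n::finite)"
proof -
 have "(SU k. axis i (1::real)$k*f k) = (SU k. if k = i then f k else 0)" by (rule sum.cong) (auto simp: axis_def)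
 thus ?thesis by simp
qed

lemma smo_differentiable: "smo S f ==> x : S ==> f differentiable (at x)" using smooth_on_has_derivative differentiableI by blast

lemma fr_deriv_cong: assumes "open S" "x : S" "!!y. y : S ==> f y = g y" "g differentiable (at x)" shows "fd f x = fd g x"
proof -
 have "(f has_derivative fd g x) (at x)" by (rule has_derivative_transform_within_open[OF _ assms(1,2)]) (use assms frechet_derivative_works in auto)
 thus ?thesis by (rule frechet_derivative_at[symmetric])
qed

text \<open>With Hadamard's representation both mixed derivatives at the centre are
 \<open>\<partial>\<^sub>i h\<^sub>j + \<partial>\<^sub>j h\<^sub>i\<close>.\<close>

lemma mixed_derivs_axis:
 fixes f :: "real^3 => real" assumes f: "smo (ball a r) f" and r: "r>0" shows "fd (%x. fd f x (axis i 1)) a (axis j 1) =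
   fd (%x. fd f x (axis j 1)) a (axis i 1)"
proof -
 obtain h where h: "!!i. smo (ball a r) (h i)" and fh: "!!x. x : ball a r ==> f x = f a+(SU i. (x$i-a$i)*h i x)" using hadamard[OF f] by metis
 let ?D = "%g x i. fd g x (axis i (1::real))"
 have D1: "?D f x i = h i x+(SU k. (x$k-a$k)*?D (h k) x i)" if x: "x : ball a r" for x i
 proof -
  have "((%x. f a+(SU k. (x$k-a$k)*h k x)) has_derivative (%v. SU k. (x$k-a$k)*fd (h k) x v+v$k*h k x)) (at x)" by (auto intro!: derivative_eq_intros smooth_on_has_derivative[OF h x]
     bounded_linear.has_derivative[OF bounded_linear_vec_nth])
  hence "(f has_derivative (%v. SU k. (x$k-a$k)*fd (h k) x v+v$k*h k x)) (at x)" by (rule has_derivative_transform_within_open[OF _ open_ball x]) (simp add: fh[symmetric])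
  from fun_cong[OF frechet_derivative_at[OF this], of "axis i 1"] show ?thesis by (simp add: sum.distrib sum_axis_mult)
 qed
 have D2: "?D (%x. ?D f x i) a j = ?D (h i) a j+?D (h j) a i" for i j
 proof -
  have "((%x. h i x+(SU k. (x$k-a$k)*?D (h k) x i)) has_derivative (%v. fd (h i) a v+(SU k. (a$k-a$k) *
      fd (%x. ?D (h k) x i) a v+v$k*?D (h k) a i))) (at a)" using r by (auto intro!: derivative_eq_intros smooth_on_has_derivative[OF h] smooth_on_has_derivative[OF smooth_on_deriv[OF h]]
     bounded_linear.has_derivative[OF bounded_linear_vec_nth])
  hence "((%x. ?D f x i) has_derivative (%v. fd (h i) a v+(SU k. (a$k-a$k) *
      fd (%x. ?D (h k) x i) a v+v$k*?D (h k) a i))) (at a)" by (rule has_derivative_transform_within_open[OF _ open_ball[of a r]]) (use r in "auto simp: D1")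
  from fun_cong[OF frechet_derivative_at[OF this], of "axis j 1"] show ?thesis by (simp add: sum_axis_mult)
 qed
 show ?thesis unfolding D2 by simp
qed

lemma mixed_derivs:
 fixes f :: "real^3 => real" assumes S: "open S" and f: "smo S f" and a: "a : S" shows "fd (%x. fd f x v) a w =
   fd (%x. fd f x w) a v"
proof -
 obtain r where r: "r>0" "ball a r <= S" using S a openE by blast
 let ?D = "%x i. fd f x (axis i (1::real))"
 have *: "fd (%x. fd f x v) a w = (SU i. SU j. v$i*w$j*fd (%x. ?D x i) a (axis j 1))" for v w
 proof -
  have "((%x. SU i. v$i*?D x i) has_derivative (%w. SU i. v$i*fd (%x. ?D x i) a w)) (at a)"
   by (intro has_derivative_sum has_derivative_mult_right smooth_on_has_derivative[OF smooth_on_deriv[OF f] a])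
  hence "((%x. fd f x v) has_derivative (%w. SU i. v$i*fd (%x. ?D x i) a w)) (at a)" by (rule has_derivative_transform_within_open[OF _ S a]) (simp add: smo_fr_rep[OF f, of _ v])
  hence "fd (%x. fd f x v) a w = (SU i. v$i*fd (%x. ?D x i) a w)" by (rule fun_cong[OF frechet_derivative_at[symmetric]])
  also have "... = (SU i. v$i*(SU j. w$j*fd (%x. ?D x i) a (axis j 1)))" by (subst smo_fr_rep[OF smooth_on_deriv[OF f] a]) simp
  finally show ?thesis by (simp add: sum_distrib_left mult.assoc)
 qed
 have fr: "smo (ball a r) f" by (rule smo_sub[OF f r(2)])
 let ?DD = "%i j. fd (%x. ?D x i) a (axis j 1)"
 have sym: "?DD i j = ?DD j i" for i j by (rule mixed_derivs_axis[OF fr r(1)])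
 have "(SU i. SU j. v$i*w$j*?DD i j) = (SU j. SU i. v$i*w$j*?DD i j)" by (rule sum.swap)
 also have "... = (SU j. SU i. w$j * v$i*?DD j i)" by (intro sum.cong refl) (simp only: sym mult.commute)
 finally show ?thesis using *[of v w] *[of w v] by (simp only:)
qed

section \<open>Local structure of a smooth manifold\<close>

locale closed_manifold =
 fixes M :: "'a topology" and A :: "'a chart set" assumes closed: "closed_3_manifold M A"
begin

abbreviation "vf \<equiv> vector_field A"
abbreviation "tsp \<equiv> tangent_space A"
abbreviation "sf \<equiv> smooth_fun A"
abbreviation "TM \<equiv> topspace M"
abbreviation "PA \<equiv> points A"

lemma haus: "Hausdorff_space M" and compact: "compact_space M" and charts: "c : A ==> chart_on M c" and pts: "PA = TM" and
 trans_smooth: "c : A ==> d : A ==> smo (overlap c d) (transition c d)" using closed by (auto simp: closed_3_manifold_def smooth_3_manifold_def)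

lemma chart_open: "c : A ==> openin M (fst c)" "c : A ==> open (img c)" and chart_homeo: "c : A ==> homeomorphic_map (subtopology M (fst c)) (top_of_set (img c)) (snd c)"
 using charts by (auto simp: chart_on_def)

lemma chart_sub: "c : A ==> fst c <= TM" using chart_open openin_subset by blast

lemma chart_inj: "c : A ==> inj_on (snd c) (fst c)" using homeomorphic_imp_injective_map[OF chart_homeo] chart_sub by (simp add: Int_absorb1)

lemma chart_inv_chart [simp]: "c : A ==> p : fst c ==> cinv c (snd c p) = p" using chart_inj by (simp add: chart_inv_def)

lemma chart_chart_inv [simp]: "y : img c ==> snd c (cinv c y) = y" and chart_inv_mem: "y : img c ==> cinv c y : fst c" by (simp_all add: chart_inv_def f_inv_into_f inv_into_into)

lemma open_chart_image: assumes "c : A" "openin M W" shows "open (snd c ` (W Int fst c))"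
proof -
 have "openin (subtopology M (fst c)) (W Int fst c)" using assms by (auto simp: openin_subtopology)
 hence "openin (top_of_set (img c)) (snd c ` (W Int fst c))" using homeomorphic_map_openness_eq[OF chart_homeo[OF assms(1)]] by blast
 thus ?thesis using chart_open(2)[OF assms(1)] openin_open_eq by blast
qed

lemma openin_chart_pre: assumes "c : A" "open V" shows "openin M (cpart c V)"
proof -
 have "openin (subtopology M (fst c)) {p : topspace (subtopology M (fst c)). snd c p : img c Int V}"
  by (rule openin_continuous_map_preimage[OF homeomorphic_imp_continuous_map[OF chart_homeo[OF assms(1)]]]) (use assms in "auto simp: openin_subtopology")
 moreover have "{p : topspace (subtopology M (fst c)). snd c p : img c Int V} = (cpart c V)" using chart_sub[OF assms(1)] by auto
 ultimately show ?thesis using openin_trans_full chart_open(1)[OF assms(1)] by metis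
qed

lemma compactin_chart_pre: assumes "c : A" "compact K" "K <= img c" shows "compactin M (cpart c K)"
proof -
 obtain g where g: "homeomorphic_maps (subtopology M (fst c)) (top_of_set (img c)) (snd c) g" using chart_homeo[OF assms(1)] homeomorphic_map_maps by blast
 have "compactin (top_of_set (img c)) K" using assms by (simp add: compactin_subtopology)
 hence "compactin (subtopology M (fst c)) (g ` K)" using g by (intro image_compactin) (auto simp: homeomorphic_maps_def)
 moreover have "g ` K = (cpart c K)" using g assms(3) chart_sub[OF assms(1)] unfolding homeomorphic_maps_def by (force simp: Int_absorb1)
 ultimately show ?thesis by (simp add: compactin_subtopology)
qed

lemma closedin_chart_pre: "c : A ==> compact K ==> K <= img c ==> closedin M (cpart c K)" using compactin_imp_closedin[OF haus compactin_chart_pre] .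

lemma chart_at: assumes "p : PA" obtains c where "c : A" "p : fst c" using assms by (auto simp: points_def)

lemma chart_ball: assumes "c : A" "p : fst c" "openin M W" "p : W" obtains r where "r>0" "cball (snd c p) (2*r) <= snd c ` (W Int fst c)"
proof -
 have "open (snd c ` (W Int fst c))" "snd c p : snd c ` (W Int fst c)" using open_chart_image assms by auto
 then obtain e where "e>0" "cball (snd c p) e <= snd c ` (W Int fst c)" using open_contains_cball by blast
 thus ?thesis using that[of "e/2"] by simp
qed

text \<open>Transition maps are smooth, so one chart around each point decides smoothness in all
  charts. The atlas need not contain restrictions of charts, hence the smaller set
  \<open>V\<close>.\<close>

lemma sm_fun_loc: assumes "!!p. p : PA ==> EX c:A. EX V. p : fst c & open V & snd c p : V & V <= img c
       & smo V (f \<circ> cinv c)" shows "sf f" unfolding smooth_fun_def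
proof (intro ballI smo_loc)
 fix d y assume d: "d : A" and y: "y : snd d ` fst d"
 then obtain p where p: "p : fst d" "y = snd d p" by auto
 hence "p : PA" using chart_sub[OF d] pts by auto
 from assms[OF this] obtain c V where c: "c : A" "p : fst c" and V: "open V" "snd c p : V" "V <= img c" "smo V (f \<circ> cinv c)" by auto
 define N where "N = snd d ` ((cpart c V) Int fst d)"
 have N: "open N" unfolding N_def by (rule open_chart_image[OF d openin_chart_pre[OF c(1) V(1)]])
 have yN: "y : N" using p c V by (auto simp: N_def)
 have sub: "N <= overlap d c" by (auto simp: N_def overlap_def)
 have "smo N (%x. (f \<circ> cinv c) (transition d c x))" by (rule smo_comp[OF N V(1) _ smo_sub[OF trans_smooth[OF d c(1)] sub] V(4)]) (auto simp: N_def transition_def d)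
 moreover have "(f \<circ> cinv c) (transition d c x) = (f \<circ> cinv d) x" if "x : N" for x using that d c by (auto simp: N_def transition_def)
 ultimately have "smo N (f \<circ> cinv d)" using smo_cong[OF N] by metis
 thus "EX U. open U & y : U & smo (snd d ` fst d Int U) (f \<circ> cinv d)" using N yN smo_sub[OF _ Int_lower2] by (intro exI[of _ N]) simp
qed

lemma sm_funD: "sf f ==> c : A ==> V <= img c ==> smo V (f \<circ> cinv c)" unfolding smooth_fun_def using smo_sub by blast

lemma sm_funI: assumes "!!p. p : PA ==> EX W h. openin M W & p : W & sf h & (ALL q:W. f q = h q)" shows "sf f"
proof (rule sm_fun_loc)
 fix p assume p: "p : PA"
 obtain W h where W: "openin M W" "p : W" "sf h" "ALL q:W. f q = h q" using assms[OF p] by blast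
 obtain c where c: "c : A" "p : fst c" using chart_at[OF p] .
 let ?V = "snd c ` (W Int fst c)"
 have o: "open ?V" by (rule open_chart_image[OF c(1) W(1)])
 have "smo ?V (h \<circ> cinv c)" by (rule sm_funD[OF W(3) c(1)]) auto
 hence "smo ?V (f \<circ> cinv c)" by (rule smo_cong[OF o, rotated]) (use W c in auto)
 thus "EX c:A. EX V. p : fst c & open V & snd c p : V & V <= img c & smo V (f \<circ> cinv c)" using c o W by (intro bexI[of _ c] exI[of _ ?V]) auto
qed

lemma sm_fun_cong: "sf h ==> (!!q. q : PA ==> f q = h q) ==> sf f" by (rule sm_funI, rule exI[of _ "TM"]) (auto simp: pts)

lemma sm_fun_c: "sf (%x. a)" by (simp add: smooth_fun_def o_def smo_c)

lemma sm_fun_add: "sf f ==> sf h ==> sf (%x. f x+h x)" and sm_fun_diff: "sf f ==> sf h ==> sf (%x. f x-h x)" and sm_fun_mult: "sf f ==> sf h ==> sf (%x. f x*h x)"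
 and sm_fun_minus: "sf f ==> sf (%x. - f x)" using chart_open(2) by (auto simp: smooth_fun_def o_def intro!: smo_add smo_diff smo_mult smo_minus)

lemma sm_fun_sum: "(!!i. i : I ==> sf (f i)) ==> sf (%x. SUM i:I. f i x)" using chart_open(2) by (auto simp: smooth_fun_def o_def intro!: smo_sum)

lemma chart_inv_pts: "c : A ==> y : img c ==> cinv c y : PA" using chart_inv_mem[of y c] chart_sub[of c] unfolding pts by (rule subsetD[rotated])

lemma sm_fun_inverse: "sf f ==> (!!p. p : PA ==> f p ~= 0) ==> sf (%x. inverse (f x))" by (auto simp: smo_inverse chart_open chart_inv_pts smooth_fun_def o_def)

lemma sm_fun_divide: "sf f ==> sf h ==> (!!p. p : PA ==> h p ~= 0) ==> sf (%x. f x/h x)" unfolding divide_inverse by (intro sm_fun_mult sm_fun_inverse)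

lemma sm_fun_sqrt: "sf f ==> (!!p. p : PA ==> f p>0) ==> sf (%x. sqrt (f x))" by (auto simp: smo_sqrt chart_open chart_inv_pts smooth_fun_def o_def)

lemmas sm_fun_intros = sm_fun_c sm_fun_add sm_fun_diff sm_fun_mult
 sm_fun_minus sm_fun_sum

text \<open>Tangent vectors act on global functions only, so a function known in coordinates is
  multiplied by a bump and continued by 0; on the coordinate ball of radius \<open>r\<close> it is
  unchanged.\<close>

definition extend :: "'a chart => real^3 => real => (real^3 => real) => 'a => real" where
 "extend c a r F q = (if q : fst c & snd c q : ball a (2*r) then plateau r (snd c q-a)*F (snd c q) else 0)"

lemma extend_sm: assumes c: "c : A" "cball a (2*r) <= V" and r: "r>0" and V: "open V" "V <= img c" and F: "smo V F" shows "sf (extend c a r F)"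
proof (rule sm_fun_loc)
 fix p assume p: "p : PA"
 show "EX c':A. EX V. p : fst c' & open V & snd c' p : V & V <= img c' & smo V (extend c a r F \<circ> cinv c')"
 proof (cases "p : fst c & snd c p : V")
  case True
  have "smo V (%y. plateau r (y-a)*F y)" by (rule smo_mult[OF V(1) smo_comp[OF V(1) open_UNIV _ _ plat_sm[OF r]] F]) (use V(1) in "auto intro!: smo_diff smo_id smo_c")
  hence "smo V (extend c a r F \<circ> cinv c)"
  proof (rule smo_cong[OF V(1), rotated])
   fix y assume y: "y : V"
   hence "cinv c y : fst c" "snd c (cinv c y) = y" using V(2) chart_inv_mem[of y c] chart_chart_inv[of y c] by (auto simp del: chart_chart_inv)
   thus "plateau r (y-a)*F y = (extend c a r F \<circ> cinv c) y" using plat_zero[OF r, of "y-a"] by (auto simp: extend_def dist_norm norm_minus_commute not_less)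
  qed
  thus ?thesis using c V True by blast
 next
  case False
  \<comment> \<open>The compact coordinate ball is closed because the space is Hausdorff; on its
    complement the extension is 0.\<close>
  define W where "W = TM-(cpart c (cball a (2*r)))"
  have W: "openin M W" "p : W" unfolding W_def using closedin_chart_pre[OF c(1), of "cball a (2*r)"] c V False p pts by (auto intro!: openin_diff)
  obtain d where d: "d : A" "p : fst d" using chart_at[OF p] .
  let ?V = "snd d ` (W Int fst d)"
  have "smo ?V (%x. 0::real)" by (rule smo_c)
  hence "smo ?V (extend c a r F \<circ> cinv d)" by (rule smo_cong[OF open_chart_image[OF d(1) W(1)], rotated]) (use d in "auto simp: W_def extend_def")
  thus ?thesis using d W open_chart_image[OF d(1) W(1)] by (intro bexI[of _ d] exI[of _ ?V]) auto
 qed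
qed

lemma extend_eq: "q : fst c ==> snd c q : cball a r ==> r>0 ==> extend c a r F q = F (snd c q)" by (auto simp: extend_def plat_one dist_norm norm_minus_commute)

lemma bump_exists: assumes "openin M W" "p : W" obtains b N where "sf b" "openin M N" "p : N" "N <= W" "!!q. q : N ==> b q = 1" "!!q. q ~: W ==> b q = 0" "!!q. 0 <= b q & b q <= 1"
proof -
 have "p : PA" using assms openin_subset[OF assms(1)] unfolding pts by auto
 then obtain c where c: "c : A" "p : fst c" using chart_at by blast
 obtain r where r: "r>0" "cball (snd c p) (2*r) <= snd c ` (W Int fst c)" using chart_ball[OF c assms] .
 let ?b = "extend c (snd c p) r (%_. 1)" and ?N = "(cpart c (ball (snd c p) r))"
 have W: "q : W" if "q : fst c" "snd c q : cball (snd c p) (2*r)" for q using that r chart_inj[OF c(1)] by (auto simp: inj_on_def image_iff subset_iff)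
 show ?thesis
 proof
  show "sf ?b" by (rule extend_sm[OF c(1) _ r(1) chart_open(2)[OF c(1)] order_refl smo_c]) (use r in auto)
  show "openin M ?N" by (rule openin_chart_pre[OF c(1) open_ball])
  show "?N <= W" using W r by force
  show "?b q = 1" if "q : ?N" for q using that r by (auto simp: extend_eq)
  show "?b q = 0" if "q ~: W" for q using that W by (auto simp: extend_def)
  show "0 <= ?b q & ?b q <= 1" for q using plat_range[OF r(1)] by (auto simp: extend_def)
 qed (use c r in auto)
qed

end

section \<open>Tangent vectors as derivations\<close>

context closed_manifold
begin

lemma tv_nsm: "v : tsp p ==> ~ sf f ==> v f = 0" and tv_lin: "v : tsp p ==> sf f ==> sf h ==>
   v (%x. a*f x+b*h x) = a * v f+b * v h" and tv_mult: "v : tsp p ==> sf f ==> sf h ==>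
   v (%x. f x*h x) = v f*h p+f p * v h" by (auto simp: tangent_space_def)

lemma tv_add: "v : tsp p ==> sf f ==> sf h ==> v (%x. f x+h x) = v f+v h" using tv_lin[of v p f h 1 1] by simp

lemma tv_diff: "v : tsp p ==> sf f ==> sf h ==> v (%x. f x-h x) = v f-v h" using tv_lin[of v p f h 1 "-1"] by simp

lemma tv_cmul: "v : tsp p ==> sf f ==> v (%x. a*f x) = a * v f" using tv_lin[of v p f f a 0] by simp

lemma tv_minus: "v : tsp p ==> sf f ==> v (%x. - f x) = - v f" using tv_cmul[of v p f "-1"] by simp

lemma tv_c: "v : tsp p ==> v (%x. a) = 0" using tv_mult[of v p "%x. 1" "%x. 1"] tv_cmul[of v p "%x. 1" a] sm_fun_c by simp

lemma tv_sum: "v : tsp p ==> (!!i. i : I ==> sf (f i)) ==>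
  v (%x. SUM i:I. f i x) = (SUM i:I. v (f i))"
proof (induction I rule: infinite_finite_induct)
 case (insert i I)
 thus ?case using tv_add[of v p "f i" "%x. SUM i:I. f i x"] sm_fun_sum[of I f] by simp
qed (simp_all add: tv_c)

text \<open>With a bump \<open>b\<close> that is 1 near \<open>p\<close> and 0 off \<open>W\<close>,
  the function \<open>f - h\<close> equals \<open>(f - h)*(1 - b)\<close>. Both factors vanish at
  \<open>p\<close>, so the product rule gives 0.\<close>

lemma tv_loc: assumes v: "v : tsp p" and W: "openin M W" "p : W" and f: "sf f" and h: "sf h" and eq: "!!q. q : W ==> f q = h q" shows "v f = v h"
proof -
 obtain b N where b: "sf b" "p : N" "!!q. q : N ==> b q = 1" "!!q. q ~: W ==> b q = 0" using bump_exists[OF W] by metis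
 have s: "sf (%q. f q-h q)" "sf (%q. 1-b q)" using sm_fun_diff[OF f h] sm_fun_diff[OF sm_fun_c b(1)] .
 have "(%q. f q-h q) = (%q. (f q-h q)*(1-b q))" by standard (use eq b in "auto")
 hence "v (%q. f q-h q) = v (%q. (f q-h q)*(1-b q))" by (rule arg_cong)
 also have "... = v (%q. f q-h q)*(1-b p)+(f p-h p) * v (%q. 1-b q)" by (rule tv_mult[OF v s])
 also have "... = 0" using eq[OF W(2)] b(3)[OF b(2)] by simp
 finally show ?thesis using tv_diff[OF v f h] by simp
qed

lemma tv_cong_pts: "v : tsp p ==> p : PA ==> sf f ==> (!!q. q : PA ==> f q = h q) ==> v f = v h" by (rule tv_loc[of v p "TM"]) (auto simp: pts intro: sm_fun_cong)

lemma tv_lincomb_in: assumes "!!i. i : I ==> v i : tsp p" shows "(%f. SUM i:I. a i * v i f) : tsp p" unfolding tangent_space_def mem_Collect_eq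
proof (intro conjI allI impI)
 fix f h b c assume f: "sf f" and h: "sf h"
 show "(SUM i:I. a i * v i (%x. b*f x + c*h x)) = b*(SUM i:I. a i * v i f) + c*(SUM i:I. a i * v i h)" by (simp add: sum_distrib_left sum.distrib[symmetric], intro sum.cong refl)
    (simp add: tv_lin[OF assms f h] algebra_simps)
next
 fix f h assume f: "sf f" and h: "sf h"
 show "(SUM i:I. a i * v i (%x. f x*h x)) = (SUM i:I. a i * v i f)*h p+f p*(SUM i:I. a i * v i h)"
  by (simp add: sum_distrib_left sum_distrib_right sum.distrib[symmetric], intro sum.cong refl) (simp add: tv_mult[OF assms f h] algebra_simps)
next
 fix f assume "~ sf f"
 thus "(SUM i:I. a i * v i f) = 0" using assms tv_nsm by (intro sum.neutral) auto
qed

lemma tadd_in: "v : tsp p ==> w : tsp p ==> tadd v w : tsp p" using tv_lincomb_in[of "UNIV::bool set" "%i. if i then v else w" p "%_. 1"] by (simp add: tadd_def UNIV_bool add.commute)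

lemma tscale_in: "v : tsp p ==> tscale a v : tsp p" using tv_lincomb_in[of "UNIV::unit set" "%i. v" p "%_. a"] by (simp add: tscale_def UNIV_unit)

lemma tzero_in: "tzero : tsp p" using tv_lincomb_in[of "{}"] by (simp add: tzero_def)

subsection \<open>Coordinates\<close>

definition dirv :: "'a chart => real^3 => 'a vfield" where "dirv c w p f = (if sf f then fd (f \<circ> cinv c) (snd c p) w else 0)"

lemma chart_fun_sm: "sf f ==> c : A ==> smo (img c) (f \<circ> cinv c)" using sm_funD[OF _ _ order_refl] .

lemma chart_fun_deriv: "sf f ==> c : A ==> p : fst c ==> (f \<circ> cinv c has_derivative (%w. dirv c w p f)) (at (snd c p))"
 using smooth_on_has_derivative[OF chart_fun_sm] by (simp add: dirv_def)

lemma dirv_tangent: assumes c: "c : A" "p : fst c" shows "dirv c w p : tsp p" unfolding tangent_space_def mem_Collect_eq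
proof (intro conjI allI impI)
 fix f h :: "'a => real" and a b assume f: "sf f" and h: "sf h"
 have s: "sf (%x. a*f x+b*h x)" "sf (%x. f x*h x)" by (rule sm_fun_add sm_fun_mult sm_fun_c f h)+
 note D = chart_fun_deriv[OF _ c]
 have "((%x. a*(f \<circ> cinv c) x+b*(h \<circ> cinv c) x) has_derivative (%w. a*dirv c w p f+b*dirv c w p h)) (at (snd c p))"
  by (rule has_derivative_add[OF has_derivative_mult_right[OF D[OF f]] has_derivative_mult_right[OF D[OF h]]])
 thus "dirv c w p (%x. a*f x+b*h x) = a*dirv c w p f+b*dirv c w p h" using has_derivative_unique[OF D[OF s(1)]] by (simp add: o_def fun_eq_iff)
 have "((%x. (f \<circ> cinv c) x*(h \<circ> cinv c) x) has_derivative (%w. (f \<circ> cinv c) (snd c p)*dirv c w p h+dirv c w p f*(h \<circ> cinv c) (snd c p))) (at (snd c p))"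
  by (rule has_derivative_mult[OF D[OF f] D[OF h]])
 thus "dirv c w p (%x. f x*h x) = dirv c w p f*h p+f p*dirv c w p h" using has_derivative_unique[OF D[OF s(2)]] c by (simp add: o_def fun_eq_iff)
qed (simp add: dirv_def)

lemma dirv_linear: assumes "c : A" "p : fst c" shows "dirv c (SUM i:I. a i*Rw i) p = (%f. SUM i:I. a i*dirv c (w i) p f)"
proof
 fix f show "dirv c (SUM i:I. a i*Rw i) p f = (SUM i:I. a i*dirv c (w i) p f)"
 proof (cases "sf f")
  case True
  interpret bounded_linear "%w. dirv c w p f" using chart_fun_deriv[OF True assms] by (rule has_derivative_bounded_linear)
  show ?thesis by (simp add: sum scaleR)
 qed (simp add: dirv_def)
qed

lemma dirv_rep: assumes "c : A" "p : fst c" shows "dirv c w p = (%f. SU i. w$i*dirv c (axis i 1) p f)"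
proof -
 have "w = (SU i. w$i*Raxis i 1)" by (simp add: vec_eq_iff axis_def if_distrib cong: if_cong)
 thus ?thesis using dirv_linear[OF assms, of "%i. w$i" "%i. axis i 1" UNIV] by simp
qed

lemma dirv_cong: assumes c: "c : A" "p : fst c" and V: "open V" "snd c p : V" "V <= img c" and F: "F differentiable (at (snd c p))"
  and f: "sf f" "!!q. q : fst c ==> snd c q : V ==> f q = F (snd c q)" shows "dirv c w p f = fd F (snd c p) w"
proof -
 have "(f \<circ> cinv c) y = F y" if "y : V" for y using that V f chart_inv_mem c chart_chart_inv by auto
 hence "fd (f \<circ> cinv c) (snd c p) = fd F (snd c p)" by (rule fr_deriv_cong[OF V(1,2) _ F])
 thus ?thesis using f(1) by (simp add: dirv_def)
qed

lemma chart_ball': assumes "c : A" "p : fst c" obtains r where "r>0" "cball (snd c p) (2*r) <= img c"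
 using chart_ball[OF assms chart_open(1)[OF assms(1)] assms(2)] by (simp add: Int_absorb) blast

text \<open>Apply the derivation to Hadamard's expansion around \<open>p\<close>: since
  \<open>x$i - a$i\<close> vanishes at \<open>p\<close>, only the terms in which the derivation hits
  a coordinate survive. So \<open>w\<close> consists of the values of \<open>v\<close> on the
  cut-off coordinates.\<close>

lemma tangent_eq_dirv: assumes c: "c : A" "p : fst c" and v: "v : tsp p" obtains w where "v = dirv c w p"
proof -
 define a where "a = snd c p"
 obtain r0 where r0: "r0>0" "cball a (2*r0) <= img c" unfolding a_def using chart_ball'[OF c] .
 \<comment> \<open>Halving makes the closed ball of radius \<open>2*r\<close> fit into the open ball
   on which the functions of Hadamard's lemma are smooth, so that these can be cut off too.\<close>
 define r where "r = r0/2"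
 have r: "r>0" "cball a (2*r) <= ball a (2*r0)" using r0 by (auto simp: r_def)
 have sub: "ball a (2*r0) <= img c" using r0(2) by force
 note ext = extend_sm[OF c(1) r(2) r(1) open_ball sub]
 define X where "X i = extend c a r (%y. y$i)" for i
 have X: "sf (X i)" for i unfolding X_def by (rule ext, rule smo_vec_nth, auto intro: smo_id)
 define w where "w = (\<chi> i. v (X i))"
 have "v f = dirv c w p f" if f: "sf f" for f
 proof -
  let ?F = "f \<circ> cinv c"
  have F: "smo (ball a (2*r0)) ?F" by (rule sm_funD[OF f c(1) sub])
  have "EX h. (ALL i. smo (ball a (2*r0)) (h i)) & (ALL x:ball a (2*r0). ?F x = ?F a+(SU i. (x$i-a$i)*h i x)) & (ALL i. h i a = fd ?F a (axis i 1))"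
  proof (rule hadamard[OF F])
   fix h :: "3 => real^3 => real"
   assume 1: "!!i. smo (ball a (2*r0)) (h i)" and 2: "!!x. x : ball a (2*r0) ==> ?F x = ?F a+(SU i. (x$i-a$i)*h i x)" and 3: "!!i. 2*r0>0 ==> h i a = fd ?F a (axis i 1)"
   have "2*r0>0" using r0 by simp
   thus ?thesis by (intro exI[of _ h] conjI allI ballI 1 2 3)
  qed
  then obtain h where h: "!!i. smo (ball a (2*r0)) (h i)" "!!x. x : ball a (2*r0) ==> ?F x = ?F a+(SU i. (x$i-a$i)*h i x)" "!!i. h i a = fd ?F a (axis i 1)" by blast
  define H where "H i = extend c a r (h i)" for i
  have H: "sf (H i)" for i unfolding H_def by (rule ext[OF h(1)])
  let ?G = "%q. f p+(SU i. (X i q-a$i)*H i q)"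
  have s: "sf (%q. X i q-a$i)" for i by (rule sm_fun_diff[OF X sm_fun_c])
  have G: "sf (%q. SU i. (X i q-a$i)*H i q)" by (rule sm_fun_sum, rule sm_fun_mult[OF s H])
  have "v f = v ?G"
  proof (rule tv_loc[OF v openin_chart_pre[OF c(1) open_ball[of a r]]])
   show "p : (cpart c (ball a r))" using c r by (simp add: a_def)
   show "sf ?G" by (rule sm_fun_add[OF sm_fun_c G])
   fix q assume q: "q : (cpart c (ball a r))"
   hence q': "snd c q : ball a (2*r0)" "snd c q : cball a r" using r0 by (auto simp: r_def)
   have "X i q = snd c q$i" "H i q = h i (snd c q)" for i using q by (simp_all add: X_def H_def extend_eq[OF _ q'(2) r(1)])
   thus "f q = ?G q" using h(2)[OF q'(1)] q c by (simp add: a_def)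
  qed (rule f)
  also have "... = (SU i. v (%q. (X i q-a$i)*H i q))" by (subst tv_add[OF v sm_fun_c G], subst tv_c[OF v]) (simp add: tv_sum[OF v sm_fun_mult[OF s H]])
  also have "... = (SU i. v (X i)*h i a)"
  proof (rule sum.cong[OF refl])
   fix i :: 3
   have "X i p = a$i" "H i p = h i a" using c r by (simp_all add: X_def H_def extend_eq a_def)
   moreover have "v (%q. X i q-a$i) = v (X i)" using tv_diff[OF v X sm_fun_c] tv_c[OF v] by simp
   ultimately show "v (%q. (X i q-a$i)*H i q) = v (X i)*h i a" using tv_mult[OF v s H] by simp
  qed
  also have "... = fd ?F a w" using smo_fr_rep[OF F, of a w] r0 h(3) by (simp add: w_def)
  finally show ?thesis using f by (simp add: dirv_def a_def)
 qed
 moreover have "v f = dirv c w p f" if "~ sf f" for f using tv_nsm[OF v that] that by (simp add: dirv_def)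
 ultimately show ?thesis using that by blast
qed

lemma dirv_coord: assumes c: "c : A" "p : fst c" and r: "r>0" "cball a (2*r) <= img c" "snd c p : ball a r" shows "dirv c w p (extend c a r (%y. y$i)) = w$i"
proof -
 have s: "sf (extend c a r (%y. y$i))" by (rule extend_sm[OF c(1) r(2,1) chart_open(2)[OF c(1)] order_refl smo_vec_nth]) (use chart_open(2)[OF c(1)] smo_id in auto)
 have d: "((%y::real^3. y$i) has_derivative (%w. w$i)) (at (snd c p))" by (rule bounded_linear_imp_has_derivative[OF bounded_linear_vec_nth])
 have "dirv c w p (extend c a r (%y. y$i)) = fd (%y. y$i) (snd c p) w" by (rule dirv_cong[OF c open_ball r(3) _ differentiableI[OF d] s]) (use r in "auto simp: extend_eq subset_iff")
 thus ?thesis using fun_cong[OF frechet_derivative_at[OF d], of w] by simp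
qed

lemma dirv_inj: assumes c: "c : A" "p : fst c" and eq: "dirv c w p = dirv c w' p" shows "w = w'"
proof -
 obtain r where r: "r>0" "cball (snd c p) (2*r) <= img c" using chart_ball'[OF c] .
 show ?thesis using dirv_coord[OF c r, of w] dirv_coord[OF c r, of w'] r eq by (simp add: vec_eq_iff)
qed

subsection \<open>Vector fields\<close>

lemma vtan: "vf X ==> p : PA ==> X p : tsp p" and vf_sm: "vf X ==> sf f ==> sf (%p. X p f)" by (auto simp: vector_field_def)

lemma vf_lincomb: assumes "!!i. i : I ==> vf (X i)" "!!i. i : I ==> sf (u i)" shows "vf (%q f. SUM i:I. u i q*X i q f)" unfolding vector_field_def
proof (intro conjI ballI allI impI)
 fix p assume "p : PA"
 thus "(%f. SUM i:I. u i p*X i p f) : tsp p" by (intro tv_lincomb_in vtan assms)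
next
 fix f assume "sf f"
 thus "sf (%p. SUM i:I. u i p*X i p f)" by (intro sm_fun_sum sm_fun_mult[OF assms(2) vf_sm[OF assms(1)]])
qed

lemma vf_add: "vf X ==> vf Y ==> vf (%q. tadd (X q) (Y q))" unfolding vector_field_def by (auto intro: tadd_in) (simp add: tadd_def sm_fun_add)

lemma vf_sc: "vf X ==> sf u ==> vf (%q. tscale (u q) (X q))" unfolding vector_field_def by (auto intro: tscale_in) (simp add: tscale_def sm_fun_mult)

definition coord_field :: "'a chart => real^3 => real => real^3 => 'a vfield" where "coord_field c a r w q = tscale (extend c a r (%_. 1) q) (dirv c w q)"

lemma coord_field_vf: assumes c: "c : A" and r: "r>0" "cball a (2*r) <= img c" shows "vf (coord_field c a r w)" unfolding vector_field_def
proof (intro conjI ballI allI impI)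
 fix q assume "q : PA"
 show "coord_field c a r w q : tsp q" using tscale_in dirv_tangent c tzero_in by (auto simp: coord_field_def extend_def tscale_def tzero_def)
next
 fix f assume f: "sf f"
 have "sf (extend c a r (%y. fd (f \<circ> cinv c) y w))" by (rule extend_sm[OF c r(2,1) chart_open(2)[OF c] order_refl smooth_on_deriv[OF chart_fun_sm[OF f c]]])
 thus "sf (%q. coord_field c a r w q f)" by (rule sm_fun_cong) (use f in "auto simp: coord_field_def extend_def tscale_def dirv_def")
qed

lemma coord_field_eq: "q : fst c ==> snd c q : cball a r ==> r>0 ==> coord_field c a r w q = dirv c w q" by (simp add: coord_field_def extend_eq tscale_def)

lemma tangent_field_exists: assumes p: "p : PA" and v: "v : tsp p" obtains X where "vf X" "X p = v"
proof -
 obtain c where c: "c : A" "p : fst c" using chart_at[OF p] .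
 obtain r where r: "r>0" "cball (snd c p) (2*r) <= img c" using chart_ball'[OF c] .
 obtain w where w: "v = dirv c w p" using tangent_eq_dirv[OF c v] .
 show ?thesis by (rule that[OF coord_field_vf[OF c(1) r]]) (use coord_field_eq[OF c(2)] r w in simp)
qed

lemma vf_loc: assumes X: "vf X" and Y: "vf Y" and Y': "vf Y'" and W: "openin M W" "p : W" "!!q. q : W ==> Y q = Y' q" and f: "sf f" shows "X p (%q. Y q f) = X p (%q. Y' q f)"
proof -
 have "p : PA" using W openin_subset[OF W(1)] unfolding pts by auto
 thus ?thesis by (intro tv_loc[OF vtan[OF X] W(1,2) vf_sm[OF Y f] vf_sm[OF Y' f]]) (simp_all add: W(3))
qed

text \<open>By convention \<open>Y q f\<close> is 0 for a non-smooth \<open>f\<close>, but only at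
  points \<open>q\<close> of the manifold; elsewhere its value is arbitrary, so the inner function
  is replaced by the constant 0 through \<open>tv_cong_pts\<close>.\<close>

lemma vf_nsm: assumes X: "vf X" and Y: "vf Y" and p: "p : PA" and f: "~ sf f" shows "X p (%q. Y q f) = 0"
proof -
 have "X p (%q. 0) = X p (%q. Y q f)" by (rule tv_cong_pts[OF vtan[OF X p] p sm_fun_c]) (use tv_nsm[OF vtan[OF Y] f] in simp)
 thus ?thesis using tv_c[OF vtan[OF X p]] by simp
qed

lemma br_vf: assumes X: "vf X" and Y: "vf Y" shows "vf (br X Y)" unfolding vector_field_def
proof (intro conjI ballI allI impI)
 fix p assume p: "p : PA"
 note Xp = vtan[OF X p] and Yp = vtan[OF Y p]
 note sX = vf_sm[OF X] and sY = vf_sm[OF Y]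
 show "br X Y p : tsp p" unfolding tangent_space_def mem_Collect_eq
 proof (intro conjI allI impI)
  fix f assume "~ sf f"
  thus "br X Y p f = 0" by (simp add: lie_bracket_def vf_nsm[OF X Y p] vf_nsm[OF Y X p])
 next
  fix f h :: "'a => real" and a b assume f: "sf f" and h: "sf h"
  have 1: "Z p (%q. V q (%x. a*f x+b*h x)) = a*Z p (%q. V q f)+b*Z p (%q. V q h)" if Z: "vf Z" and V: "vf V" for Z V
  proof -
   have s: "sf (%q. a*V q f+b*V q h)" by (rule sm_fun_add[OF sm_fun_mult[OF sm_fun_c vf_sm[OF V f]] sm_fun_mult[OF sm_fun_c vf_sm[OF V h]]])
   have "Z p (%q. a*V q f+b*V q h) = Z p (%q. V q (%x. a*f x+b*h x))" by (rule tv_cong_pts[OF vtan[OF Z p] p]) (use tv_lin[OF vtan[OF V] f h] s in simp_all)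
   thus ?thesis using tv_lin[OF vtan[OF Z p] vf_sm[OF V f] vf_sm[OF V h]] by simp
  qed
  show "br X Y p (%x. a*f x+b*h x) = a*br X Y p f+b*br X Y p h" by (simp add: lie_bracket_def 1[OF X Y] 1[OF Y X] algebra_simps)
 next
  fix f h :: "'a => real" assume f: "sf f" and h: "sf h"
  have 1: "Z p (%q. V q (%x. f x*h x)) =
    Z p (%q. V q f)*h p+V p f*Z p h+Z p f*V p h+f p*Z p (%q. V q h)" if Z: "vf Z" and V: "vf V" for Z V
  proof -
   have s: "sf (%q. V q f*h q)" "sf (%q. f q*V q h)" by (rule sm_fun_mult[OF vf_sm[OF V f] h], rule sm_fun_mult[OF f vf_sm[OF V h]])
   have "Z p (%q. V q f*h q+f q*V q h) = Z p (%q. V q (%x. f x*h x))" by (rule tv_cong_pts[OF vtan[OF Z p] p sm_fun_add[OF s]]) (use tv_mult[OF vtan[OF V] f h] in simp)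
   thus ?thesis using tv_add[OF vtan[OF Z p] s] tv_mult[OF vtan[OF Z p] vf_sm[OF V f] h] tv_mult[OF vtan[OF Z p] f vf_sm[OF V h]] by simp
  qed
  show "br X Y p (%x. f x*h x) = br X Y p f*h p+f p*br X Y p h" by (simp add: lie_bracket_def 1[OF X Y] 1[OF Y X] algebra_simps)
 qed
next
 fix f assume "sf f"
 note * = vf_sm[OF X vf_sm[OF Y this]] vf_sm[OF Y vf_sm[OF X this]]
 show "sf (%p. br X Y p f)" unfolding lie_bracket_def by (rule sm_fun_diff[OF *])
qed

end

abbreviation vadd :: "'a vfield => 'a vfield => 'a vfield" where "vadd X Y == (%q. tadd (X q) (Y q))"
abbreviation vscale :: "('a => real) => 'a vfield => 'a vfield" where "vscale u X == (%q. tscale (u q) (X q))"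
abbreviation vcomb :: "'i set => ('i => 'a => real) => ('i => 'a vfield) => 'a vfield" where "vcomb I u E == (%q f. SUM i:I. u i q*E i q f)"

lemma vcomb_insert: "finite I ==> i ~: I ==> vcomb (insert i I) u E = vadd (vscale (u i) (E i)) (vcomb I u E)" by (simp add: tadd_def tscale_def)

lemma vcomb_empty: "vcomb {} u E = vscale (%q. 0) X" by (simp add: tscale_def)

context closed_manifold
begin

lemma pts_open: "openin M W ==> p : W ==> p : PA" using openin_subset unfolding pts by blast

lemma lie_asym: "br X Y p f = - br Y X p f" by (simp add: lie_bracket_def)

lemma lie_loc: assumes X: "vf X" "vf X'" and Y: "vf Y" "vf Y'" and W: "openin M W" "p : W" "!!q. q : W ==> X q = X' q" "!!q. q : W ==> Y q = Y' q" shows "br X Y p = br X' Y' p"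
proof
 fix f
 note p = pts_open[OF W(1,2)]
 show "br X Y p f = br X' Y' p f"
 proof (cases "sf f")
  case True
  have "X p (%q. Y q f) = X' p (%q. Y' q f)" using vf_loc[OF X(1) Y W(1,2,4) True] W(3)[OF W(2)] by simp
  moreover have "Y p (%q. X q f) = Y' p (%q. X' q f)" using vf_loc[OF Y(1) X W(1,2,3) True] W(4)[OF W(2)] by simp
  ultimately show ?thesis by (simp add: lie_bracket_def)
 next
  case False
  thus ?thesis using tv_nsm vtan[OF br_vf p] X Y by metis
 qed
qed

lemma lie_add: assumes X: "vf X" "vf X'" and Y: "vf Y" and p: "p : PA" shows "br (vadd X X') Y p = tadd (br X Y p) (br X' Y p)"
proof
 fix f
 show "br (vadd X X') Y p f = tadd (br X Y p) (br X' Y p) f"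
 proof (cases "sf f")
  case True
  thus ?thesis using tv_add[OF vtan[OF Y p] vf_sm[OF X(1)] vf_sm[OF X(2)]] by (simp add: lie_bracket_def tadd_def)
 next
  case False
  note n = tv_nsm[OF vtan[OF br_vf p] False]
  show ?thesis using n[OF X(1) Y] n[OF X(2) Y] n[OF vf_add[OF X] Y] by (simp add: tadd_def)
 qed
qed

lemma lie_sc: assumes X: "vf X" and Y: "vf Y" and u: "sf u" and p: "p : PA" shows "br (vscale u X) Y p = (%f. u p*br X Y p f-Y p u*X p f)"
proof
 fix f
 show "br (vscale u X) Y p f = u p*br X Y p f-Y p u*X p f"
 proof (cases "sf f")
  case True
  thus ?thesis using tv_mult[OF vtan[OF Y p] u vf_sm[OF X]] by (simp add: lie_bracket_def tscale_def algebra_simps)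
 next
  case False
  note n = tv_nsm[OF vtan[OF br_vf p] False]
  show ?thesis using n[OF X Y] n[OF vf_sc[OF X u] Y] tv_nsm[OF vtan[OF X p] False] by simp
 qed
qed

lemma jacobi: assumes X: "vf X" and Y: "vf Y" and Z: "vf Z" and p: "p : PA" shows "br X (br Y Z) p f =
  br (br X Y) Z p f+br Y (br X Z) p f"
proof (cases "sf f")
 case True
 have 1: "U p (%q. br V W q f) = U p (%q. V q (%r. W r f))-U p (%q. W q (%r. V r f))" if "vf U" "vf V" "vf W" for U V W unfolding lie_bracket_def
  by (rule tv_diff[OF vtan[OF that(1) p] vf_sm[OF that(2) vf_sm[OF that(3) True]] vf_sm[OF that(3) vf_sm[OF that(2) True]]])
 show ?thesis unfolding lie_bracket_def[of _ "br _ _"] lie_bracket_def[of "br _ _"]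
   1[OF X Y Z] 1[OF Z X Y] 1[OF Y X Z] unfolding lie_bracket_def by simp
next
 case False
 note n = tv_nsm[OF vtan[OF br_vf p] False]
 show ?thesis using n[OF X br_vf[OF Y Z]] n[OF br_vf[OF X Y] Z] n[OF Y br_vf[OF X Z]] by simp
qed

end

section \<open>The Levi-Civita connection\<close>

locale tensor_manifold = closed_manifold +
 fixes g :: "'a metric" assumes tensor: "symmetric_2_tensor A g"
begin

lemma g_sym: "p : PA ==> v : tsp p ==> w : tsp p ==> g p v w = g p w v" using tensor unfolding symmetric_2_tensor_def by blast

lemma g_add: "p : PA ==> u : tsp p ==> v : tsp p ==> w : tsp p
  ==> g p (tadd u v) w = g p u w+g p v w" using tensor unfolding symmetric_2_tensor_def by blast

lemma g_sc: "p : PA ==> v : tsp p ==> w : tsp p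
  ==> g p (tscale a v) w = a*g p v w" using tensor unfolding symmetric_2_tensor_def by blast

lemma g_sm: "vf X ==> vf Y ==> sf (%p. g p (X p) (Y p))" using tensor unfolding symmetric_2_tensor_def by blast

lemma g_comb: assumes p: "p : PA" and v: "!!i. i : I ==> v i : tsp p" and w: "w : tsp p" shows "g p (%f. SUM i:I. a i * v i f) w = (SUM i:I. a i*g p (v i) w)" using v
proof (induction I rule: infinite_finite_induct)
 case (insert i I)
 have "(%f. SUM i:insert i I. a i * v i f) = tadd (tscale (a i) (v i)) (%f. SUM i:I. a i * v i f)" using insert by (simp add: tadd_def tscale_def)
 thus ?case using insert g_add[OF p tscale_in[of "v i"] tv_lincomb_in[of I v] w] g_sc[OF p _ w] by simp
qed (use g_sc[OF p tzero_in w, of 0] in "simp_all add: tscale_def")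

lemma g_comb_right: assumes p: "p : PA" and v: "!!i. i : I ==> v i : tsp p" and w: "w : tsp p" shows "g p w (%f. SUM i:I. a i * v i f) = (SUM i:I. a i*g p w (v i))"
 using g_comb[where I = I and v = v and a = a, OF p v w] g_sym[OF p w] tv_lincomb_in[of I v p a] v by (simp cong: sum.cong)

definition koszul :: "'a vfield => 'a vfield => 'a vfield => 'a => real" where "koszul X Y Z p = (X p (%q. g q (Y q) (Z q))+Y p (%q. g q (X q) (Z q))-Z p (%q. g q (X q) (Y q))
   + g p (br X Y p) (Z p)-g p (br X Z p) (Y p)-g p (br Y Z p) (X p))/2"

lemma ksz_sm: assumes "vf X" "vf Y" "vf Z" shows "sf (koszul X Y Z)"
proof -
 have "sf (%p. ((X p (%q. g q (Y q) (Z q))+Y p (%q. g q (X q) (Z q))-Z p (%q. g q (X q) (Y q))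
   + g p (br X Y p) (Z p)-g p (br X Z p) (Y p)-g p (br Y Z p) (X p)))*(1/2))" by (rule sm_fun_mult[OF _ sm_fun_c] sm_fun_add sm_fun_diff vf_sm[OF _ g_sm]
    g_sm br_vf assms)+
 thus ?thesis by (simp add: koszul_def[abs_def])
qed

lemma g_deriv_loc: assumes X: "vf X" and Y: "vf Y" "vf Y'" and Z: "vf Z" "vf Z'" and W: "openin M W" "p : W" "!!q. q : W ==> Y q = Y' q" "!!q. q : W ==> Z q = Z' q"
 shows "X p (%q. g q (Y q) (Z q)) = X p (%q. g q (Y' q) (Z' q))" by (rule tv_loc[OF vtan[OF X pts_open[OF W(1,2)]] W(1,2) g_sm[OF Y(1) Z(1)] g_sm[OF Y(2) Z(2)]]) (simp only: W(3,4))

lemma ksz_loc: assumes X: "vf X" "vf X'" and Y: "vf Y" "vf Y'" and Z: "vf Z" "vf Z'" and W: "openin M W" "p : W"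
  and eq: "!!q. q : W ==> X q = X' q" "!!q. q : W ==> Y q = Y' q" "!!q. q : W ==> Z q = Z' q" shows "koszul X Y Z p = koszul X' Y' Z' p" unfolding koszul_def
 by (simp only: g_deriv_loc[OF X(1) Y Z W eq(2,3)] g_deriv_loc[OF Y(1) X Z W eq(1,3)] g_deriv_loc[OF Z(1) X Y W eq(1,2)] lie_loc[OF X Y W eq(1,2)] lie_loc[OF X Z W eq(1,3)]
  lie_loc[OF Y Z W eq(2,3)]) (simp only: eq[OF W(2)])

lemma ksz_add3: assumes X: "vf X" and Y: "vf Y" and Z: "vf Z" "vf Z'" and p: "p : PA" shows "koszul X Y (vadd Z Z') p = koszul X Y Z p+koszul X Y Z' p"
proof -
 note t = vtan[OF _ p]
 have g: "U p (%q. g q (V q) (tadd (Z q) (Z' q))) = U p (%q. g q (V q) (Z q))+U p (%q. g q (V q) (Z' q))" if U: "vf U" and V: "vf V" for U V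
 proof -
  have "U p (%q. g q (V q) (Z q)+g q (V q) (Z' q)) = U p (%q. g q (V q) (tadd (Z q) (Z' q)))" by (rule tv_cong_pts[OF t[OF U] p sm_fun_add[OF g_sm[OF V Z(1)] g_sm[OF V Z(2)]]])
     (metis g_add g_sym vtan V Z tadd_in)
  thus ?thesis using tv_add[OF t[OF U] g_sm[OF V Z(1)] g_sm[OF V Z(2)]] by simp
 qed
 have l: "br V (vadd Z Z') p = tadd (br V Z p) (br V Z' p)" if V: "vf V" for V using lie_add[OF Z V p] by (auto simp: fun_eq_iff tadd_def lie_asym[of V])
 have gl: "g p (tadd (br V Z p) (br V Z' p)) (U p) = g p (br V Z p) (U p)+g p (br V Z' p) (U p)" if "vf V" "vf U" for U V by (rule g_add[OF p]) (intro t br_vf that Z)+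
 have gr: "g p (br X Y p) (tadd (Z p) (Z' p)) = g p (br X Y p) (Z p)+g p (br X Y p) (Z' p)" by (metis g_add g_sym p t X Y Z tadd_in br_vf)
 show ?thesis unfolding koszul_def l[OF X] l[OF Y] gl[OF X Y] gl[OF Y X] gr g[OF X Y] g[OF Y X] by (simp add: tadd_def add_divide_distrib diff_divide_distrib)
qed

lemma ksz_sc3: assumes X: "vf X" and Y: "vf Y" and Z: "vf Z" and u: "sf u" and p: "p : PA" shows "koszul X Y (vscale u Z) p = u p*koszul X Y Z p"
proof -
 note t = vtan[OF _ p]
 have g: "U p (%q. g q (V q) (tscale (u q) (Z q))) = U p u*g p (V p) (Z p)+u p*U p (%q. g q (V q) (Z q))" if U: "vf U" and V: "vf V" for U V
 proof -
  have "U p (%q. u q*g q (V q) (Z q)) = U p (%q. g q (V q) (tscale (u q) (Z q)))" by (rule tv_cong_pts[OF t[OF U] p sm_fun_mult[OF u g_sm[OF V Z]]]) (metis g_sc g_sym vtan V Z tscale_in)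
  thus ?thesis using tv_mult[OF t[OF U] u g_sm[OF V Z]] by simp
 qed
 have l: "br V (vscale u Z) p = tadd (tscale (u p) (br V Z p)) (tscale (V p u) (Z p))" if V: "vf V" for V using fun_cong[OF lie_sc[OF Z V u p]]
  by (auto simp: fun_eq_iff tadd_def tscale_def lie_asym[of V])
 have gl: "g p (tadd (tscale a (br V Z p)) (tscale b (Z p))) (U p) = a*g p (br V Z p) (U p)+b*g p (Z p) (U p)" if V: "vf V" and U: "vf U" for U V a b
  using g_add[OF p tscale_in tscale_in, OF t[OF br_vf[OF V Z]] t[OF Z] t[OF U]] g_sc[OF p t[OF br_vf[OF V Z]] t[OF U]] g_sc[OF p t[OF Z] t[OF U]] by simp
 have gr: "g p (br X Y p) (tscale (u p) (Z p)) = u p*g p (br X Y p) (Z p)" by (metis g_sc g_sym p t X Y Z tscale_in br_vf)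
 show ?thesis unfolding koszul_def l[OF X] l[OF Y] gl[OF X Y] gl[OF Y X] gr g[OF X Y] g[OF Y X]
  using g_sym[OF p t[OF Z] t[OF X]] g_sym[OF p t[OF Z] t[OF Y]] by (simp add: tscale_def algebra_simps)
qed

lemma ksz_comb3: assumes X: "vf X" and Y: "vf Y" and p: "p : PA" and fin: "finite I" and E: "!!i. vf (E i)" and u: "!!i. sf (u i)"
 shows "koszul X Y (vcomb I u E) p = (SUM i:I. u i p*koszul X Y (E i) p)" using fin
proof (induction I)
 case empty
 show ?case unfolding vcomb_empty[of u E X] ksz_sc3[OF X Y X sm_fun_c p] by simp
next
 case (insert i I)
 show ?case unfolding vcomb_insert[OF insert(1, 2)] ksz_add3[OF X Y vf_sc[OF E u] vf_lincomb[OF E u] p] ksz_sc3[OF X Y E u p] using insert by simp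
qed

lemma ksz_torsion: assumes X: "vf X" and Y: "vf Y" and Z: "vf Z" and p: "p : PA" shows "koszul X Y Z p-koszul Y X Z p = g p (br X Y p) (Z p)"
proof -
 note t = vtan[OF _ p]
 have "br Y X p = tscale (-1) (br X Y p)" by (auto simp: fun_eq_iff tscale_def lie_asym[of Y])
 hence "g p (br Y X p) (Z p) = - g p (br X Y p) (Z p)" using g_sc[OF p t[OF br_vf[OF X Y]] t[OF Z], of "-1"] by simp
 moreover have "Z p (%q. g q (X q) (Y q)) = Z p (%q. g q (Y q) (X q))" by (rule tv_cong_pts[OF t[OF Z] p g_sm[OF X Y]]) (intro g_sym vtan X Y)
 ultimately show ?thesis unfolding koszul_def by (simp add: field_simps)
qed

lemma ksz_metric: assumes X: "vf X" and Y: "vf Y" and Z: "vf Z" and p: "p : PA" shows "koszul X Y Z p+koszul X Z Y p = X p (%q. g q (Y q) (Z q))"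
proof -
 note t = vtan[OF _ p]
 have "br Z Y p = tscale (-1) (br Y Z p)" by (auto simp: fun_eq_iff tscale_def lie_asym[of Z])
 hence "g p (br Z Y p) (X p) = - g p (br Y Z p) (X p)" using g_sc[OF p t[OF br_vf[OF Y Z]] t[OF X], of "-1"] by simp
 moreover have "X p (%q. g q (Z q) (Y q)) = X p (%q. g q (Y q) (Z q))" by (rule tv_cong_pts[OF t[OF X] p g_sm[OF Z Y]]) (intro g_sym vtan Z Y)
 ultimately show ?thesis unfolding koszul_def by (simp add: field_simps)
qed

lemma ksz_swap12: "vf X ==> vf Y ==> vf Z ==> p : PA ==>
  koszul Y X Z p = koszul X Y Z p-g p (br X Y p) (Z p)" using ksz_torsion by fastforce

text \<open>Slots 2 and 1 follow from slot 3 through metric compatibility and torsion-freeness.\<close>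

lemma ksz_add2: assumes X: "vf X" and Y: "vf Y" "vf Y'" and Z: "vf Z" and p: "p : PA" shows "koszul X (vadd Y Y') Z p = koszul X Y Z p+koszul X Y' Z p"
proof -
 have "X p (%q. g q (Y q) (Z q)+g q (Y' q) (Z q)) = X p (%q. g q (tadd (Y q) (Y' q)) (Z q))" by (rule tv_cong_pts[OF vtan[OF X p] p sm_fun_add[OF g_sm[OF Y(1) Z] g_sm[OF Y(2) Z]]])
    (metis g_add vtan Y Z)
 thus ?thesis using ksz_metric[OF X vf_add[OF Y] Z p] ksz_metric[OF X Y(1) Z p] ksz_metric[OF X Y(2) Z p]
   ksz_add3[OF X Z Y p] tv_add[OF vtan[OF X p] g_sm[OF Y(1) Z] g_sm[OF Y(2) Z]] by simp
qed

lemma ksz_sc2: assumes X: "vf X" and Y: "vf Y" and Z: "vf Z" and u: "sf u" and p: "p : PA" shows "koszul X (vscale u Y) Z p = X p u*g p (Y p) (Z p)+u p*koszul X Y Z p"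
proof -
 have "X p (%q. u q*g q (Y q) (Z q)) = X p (%q. g q (tscale (u q) (Y q)) (Z q))" by (rule tv_cong_pts[OF vtan[OF X p] p sm_fun_mult[OF u g_sm[OF Y Z]]]) (metis g_sc vtan Y Z)
 moreover have "u p*koszul X Y Z p+u p*koszul X Z Y p = u p*X p (%q. g q (Y q) (Z q))" by (simp only: distrib_left[symmetric] ksz_metric[OF X Y Z p])
 ultimately show ?thesis using ksz_metric[OF X vf_sc[OF Y u] Z p]
   ksz_sc3[OF X Z Y u p] tv_mult[OF vtan[OF X p] u g_sm[OF Y Z]] by linarith
qed

lemma ksz_add1: assumes X: "vf X" "vf X'" and Y: "vf Y" and Z: "vf Z" and p: "p : PA" shows "koszul (vadd X X') Y Z p = koszul X Y Z p+koszul X' Y Z p"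
proof -
 note t = vtan[OF _ p]
 show ?thesis using ksz_swap12[OF vf_add[OF X] Y Z p] ksz_swap12[OF X(1) Y Z p] ksz_swap12[OF X(2) Y Z p]
   ksz_add2[OF Y X Z p] lie_add[OF X Y p] g_add[OF p t[OF br_vf[OF X(1) Y]] t[OF br_vf[OF X(2) Y]] t[OF Z]] by simp
qed

lemma ksz_sc1: assumes X: "vf X" and Y: "vf Y" and Z: "vf Z" and u: "sf u" and p: "p : PA" shows "koszul (vscale u X) Y Z p = u p*koszul X Y Z p"
proof -
 note t = vtan[OF _ p]
 have "br (vscale u X) Y p = tadd (tscale (u p) (br X Y p)) (tscale (- Y p u) (X p))" using lie_sc[OF X Y u p] by (simp add: tadd_def tscale_def)
 hence "g p (br (vscale u X) Y p) (Z p) = u p*g p (br X Y p) (Z p)-Y p u*g p (X p) (Z p)" using g_add[OF p tscale_in tscale_in, OF t[OF br_vf[OF X Y]] t[OF X] t[OF Z]]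
   g_sc[OF p t[OF br_vf[OF X Y]] t[OF Z]] g_sc[OF p t[OF X] t[OF Z]] by simp
 thus ?thesis using ksz_swap12[OF vf_sc[OF X u] Y Z p] ksz_swap12[OF X Y Z p] ksz_sc2[OF Y X Z u p] by (simp add: algebra_simps)
qed

text \<open>The fields are global and only their orthonormality is local, and the signs are
  constants; so the components of a field are smooth functions on the whole manifold.\<close>

definition frame :: "'a set => (3 => 'a vfield) => (3 => real) => bool" where "frame W E e \<longleftrightarrow> openin M W & (ALL i. vf (E i)) & (ALL i. e i*e i = 1) &
   (ALL q:W. ALL i j. g q (E i q) (E j q) = (if i = j then e i else 0))"

text \<open>Pairing with \<open>E j\<close> shows that the three vectors are independent, and the
  tangent space is 3-dimensional through \<open>dirv\<close>, so they span it. The coefficients are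
  then read off by pairing.\<close>

lemma orthonormal_rep: assumes p: "p : PA" and E: "!!i::3. E i : tsp p" and e: "!!i. e i*e i = (1::real)" and on: "!!i j. g p (E i) (E j) = (if i = j then e i else 0)" and v: "v : tsp p"
 shows "v = (%f. SU i. e i*g p v (E i)*E i f)"
proof -
 obtain c where c: "c : A" "p : fst c" using chart_at[OF p] .
 have "EX w. E i = dirv c w p" for i using tangent_eq_dirv[OF c E[of i]] by blast
 then obtain w where w: "!!i. E i = dirv c (w i) p" by metis
 define L where "L a = (SU i. a$i*Rw i)" for a :: "real^3"
 have lin: "linear L" by (rule linearI) (simp_all add: L_def scaleR_add_left sum.distrib scaleR_sum_right)
 have L: "dirv c (L a) p = (%f. SU i. a$i*E i f)" for a unfolding L_def w by (rule dirv_linear[OF c])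
 have gL: "g p (dirv c (L a) p) (E j) = a$j*e j" for a j unfolding L using g_comb[where I = UNIV and v = E and a = "%i. a$i", OF p E E[of j]] by (simp add: on if_distrib cong: if_cong)
 have "inj L" unfolding linear_injective_0[OF lin]
 proof (intro allI impI)
  fix a assume "L a = 0"
  hence "dirv c (L a) p = tzero" using dirv_linear[OF c, of "%_. 0" "%_. 0" "{}"] by (simp add: tzero_def)
  hence "a$j*e j = 0" for j using gL[of a j] g_sc[OF p tzero_in E, of 0 j] by (simp add: tscale_def tzero_def)
  hence "a$j = 0" for j using e[of j] by (metis mult_eq_0_iff zero_neq_one)
  thus "a = 0" by (simp add: vec_eq_iff)
 qed
 hence "surj L" using lin linear_injective_imp_surjective by blast
 obtain z where "v = dirv c z p" using tangent_eq_dirv[OF c v] .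
 then obtain a where a: "v = dirv c (L a) p" using \<open>surj L\<close> by (metis surjD)
 have aj: "a$j = e j*g p v (E j)" for j using gL[of a j] e[of j] unfolding a by (metis mult.assoc mult.commute mult_1)
 have "v = (%f. SU i. a$i*E i f)" by (rule trans[OF a L])
 also have "... = (%f. SU i. e i*g p v (E i)*E i f)" by (intro ext sum.cong refl arg_cong2[where f = "(*)"] aj)
 finally show ?thesis .
qed

end

section \<open>Existence and uniqueness of the Levi-Civita connection\<close>

locale framed_manifold = tensor_manifold + assumes frames: "!!p. p : PA ==> EX W E e. frame W E e & p : W"
begin

lemma frame_vf: "frame W E e ==> vf (E i)" and frame_open: "frame W E e ==> openin M W" and frame_sign: "frame W E e ==> e i*e i = 1"
 and frame_on: "frame W E e ==> q : W ==> g q (E i q) (E j q) = (if i = j then e i else 0)" by (auto simp: frame_def)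

lemma frame_rep: "frame W E e ==> q : W ==> v : tsp q ==>
  v = (%f. SU i. e i*g q v (E i q)*E i q f)" using orthonormal_rep[of q "%i. E i q" e v] pts_open[OF frame_open] vtan[OF frame_vf]
  frame_sign frame_on by blast

definition comp :: "(3 => 'a vfield) => (3 => real) => 'a vfield => 3 => 'a => real" where "comp E e X i q = e i*g q (X q) (E i q)"

lemma comp_sm: "frame W E e ==> vf X ==> sf (comp E e X i)" unfolding comp_def[abs_def] by (rule sm_fun_mult[OF sm_fun_c g_sm[OF _ frame_vf]])

lemma frame_field_rep: "frame W E e ==> vf X ==> q : W ==> X q = vcomb UNIV (comp E e X) E q" using frame_rep[of W E e q "X q"] vtan[of X q] pts_open[OF frame_open] by (simp add: comp_def)

lemma g_eqI: assumes p: "p : PA" and v: "v : tsp p" "v' : tsp p" and eq: "!!Z. vf Z ==> g p v (Z p) = g p v' (Z p)" shows "v = v'"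
proof -
 obtain W E e where f: "frame W E e" "p : W" using frames[OF p] by blast
 show ?thesis by (subst frame_rep[OF f v(1)], subst frame_rep[OF f v(2)]) (simp add: eq[OF frame_vf[OF f(1)]])
qed

text \<open>Tensoriality in the third slot makes Koszul's expression a linear functional of
  \<open>Z p\<close>; the frame writes down the vector that represents it, which becomes the value
  of the connection.\<close>

lemma ksz_frame: assumes f: "frame W E e" "p : W" and X: "vf X" and Y: "vf Y" and Z: "vf Z" shows "koszul X Y Z p = g p (%f. SU i. e i*koszul X Y (E i) p*E i p f) (Z p)"
proof -
 note p = pts_open[OF frame_open[OF f(1)] f(2)] and E = frame_vf[OF f(1)]
 have "koszul X Y Z p = koszul X Y (vcomb UNIV (comp E e Z) E) p" by (rule ksz_loc[OF X X Y Y Z vf_lincomb[OF E comp_sm[OF f(1) Z]] frame_open[OF f(1)] f(2)])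
    (use frame_field_rep[OF f(1) Z] in auto)
 also have "... = (SU i. comp E e Z i p*koszul X Y (E i) p)" by (rule ksz_comb3[OF X Y p _ E comp_sm[OF f(1) Z]]) simp
 also have "... = (SU i. (e i*koszul X Y (E i) p)*g p (E i p) (Z p))" using g_sym[OF p vtan[OF Z p] vtan[OF E p]] by (simp add: comp_def algebra_simps)
 also have "... = g p (%f. SU i. e i*koszul X Y (E i) p*E i p f) (Z p)" using g_comb[where I = UNIV and v = "%i. E i p" and a = "%i. e i*koszul X Y (E i) p",
    OF p vtan[OF E p] vtan[OF Z p]] by simp
 finally show ?thesis .
qed

definition lc :: "'a vfield => 'a vfield => 'a vfield" where "lc X Y p = (THE v. v : tsp p & (ALL Z. vf Z --> g p v (Z p) = koszul X Y Z p))"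

lemma lc_eqI: assumes p: "p : PA" and v: "v : tsp p" "!!Z. vf Z ==> g p v (Z p) = koszul X Y Z p" shows "lc X Y p = v" unfolding lc_def
proof (rule the_equality)
 show "v : tsp p & (ALL Z. vf Z --> g p v (Z p) = koszul X Y Z p)" using v by blast
next
 fix v' assume v': "v' : tsp p & (ALL Z. vf Z --> g p v' (Z p) = koszul X Y Z p)"
 show "v' = v" using g_eqI p v' by (auto simp: v)
qed

lemma lc_frame: assumes f: "frame W E e" "p : W" and X: "vf X" and Y: "vf Y" shows "lc X Y p = (%f. SU i. e i*koszul X Y (E i) p*E i p f)"
proof -
 note p = pts_open[OF frame_open[OF f(1)] f(2)]
 show ?thesis by (rule lc_eqI[OF p tv_lincomb_in[OF vtan[OF frame_vf[OF f(1)] p]]]) (rule ksz_frame[OF f X Y, symmetric])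
qed

lemma lc_tangent: assumes "vf X" "vf Y" "p : PA" shows "lc X Y p : tsp p"
proof -
 obtain W E e where f: "frame W E e" "p : W" using frames[OF assms(3)] by blast
 show ?thesis unfolding lc_frame[OF f assms(1,2)] by (rule tv_lincomb_in[OF vtan[OF frame_vf[OF f(1)] assms(3)]])
qed

lemma lc_ksz: assumes X: "vf X" and Y: "vf Y" and Z: "vf Z" and p: "p : PA" shows "g p (lc X Y p) (Z p) = koszul X Y Z p"
proof -
 obtain W E e where f: "frame W E e" "p : W" using frames[OF p] by blast
 show ?thesis unfolding lc_frame[OF f X Y] by (rule ksz_frame[OF f X Y Z, symmetric])
qed

lemma lc_vf: assumes X: "vf X" and Y: "vf Y" shows "vf (lc X Y)" unfolding vector_field_def
proof (intro conjI ballI allI impI lc_tangent[OF X Y])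
 fix h assume h: "sf h"
 show "sf (%p. lc X Y p h)"
 proof (rule sm_funI)
  fix p assume p: "p : PA"
  obtain W E e where f: "frame W E e" "p : W" using frames[OF p] by blast
  let ?h = "%q. SU i. e i*koszul X Y (E i) q*E i q h"
  have "sf ?h" by (intro sm_fun_sum sm_fun_mult[OF sm_fun_mult[OF sm_fun_c ksz_sm[OF X Y frame_vf[OF f(1)]]] vf_sm[OF frame_vf[OF f(1)] h]])
  thus "EX W h'. openin M W & p : W & sf h' & (ALL q:W. lc X Y q h = h' q)" using frame_open[OF f(1)] f(2) lc_frame[OF f(1) _ X Y] by (intro exI[of _ W] exI[of _ ?h]) simp
 qed
qed

lemma lc_is_levi_civita: "is_levi_civita A g lc" unfolding is_levi_civita_def affine_connection_def
proof (intro conjI allI impI ballI)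
 fix X Y assume X: "vf X" and Y: "vf Y"
 show "vf (lc X Y)" by (rule lc_vf[OF X Y])
 fix p f assume p: "p : PA"
 note t = vtan[OF _ p] and lct = lc_tangent[OF _ _ p]
 have "lc Y X p = tadd (lc X Y p) (tscale (-1) (br X Y p))"
 proof (rule lc_eqI[OF p tadd_in[OF lct[OF X Y] tscale_in[OF t[OF br_vf[OF X Y]]]]])
  fix Z assume Z: "vf Z"
  show "g p (tadd (lc X Y p) (tscale (- 1) (br X Y p))) (Z p) = koszul Y X Z p" using g_add[OF p lct[OF X Y] tscale_in[OF t[OF br_vf[OF X Y]]] t[OF Z], of "-1"]
    g_sc[OF p t[OF br_vf[OF X Y]] t[OF Z], of "-1"] lc_ksz[OF X Y Z p] ksz_torsion[OF X Y Z p] by simp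
 qed
 thus "lc X Y p f-lc Y X p f = br X Y p f" by (simp add: tadd_def tscale_def)
next
 fix X Y Z p assume X: "vf X" and Y: "vf Y" and Z: "vf Z" and p: "p : PA"
 show "X p (%q. g q (Y q) (Z q)) = g p (lc X Y p) (Z p)+g p (Y p) (lc X Z p)" using ksz_metric[OF X Y Z p] lc_ksz[OF X Y Z p] lc_ksz[OF X Z Y p]
   g_sym[OF p vtan[OF Y p] lc_tangent[OF X Z p]] by simp
next
 fix X Y Z u p assume X: "vf X" and Y: "vf Y" and Z: "vf Z" and u: "sf u" and p: "p : PA"
 note t = vtan[OF _ p] and lct = lc_tangent[OF _ _ p]
 have ga: "g p (tadd (tscale a v) (tscale b w)) (V p) = a*g p v (V p)+b*g p w (V p)" if "v : tsp p" "w : tsp p" "vf V" for a b v w V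
  using g_add[OF p tscale_in tscale_in, OF that(1,2) t[OF that(3)]] g_sc[OF p _ t[OF that(3)]] that by simp
 have one: "tscale 1 v = v" for v :: "'a tvec" by (simp add: tscale_def)
 show "lc (vadd X Y) Z p = tadd (lc X Z p) (lc Y Z p)" by (rule lc_eqI[OF p tadd_in[OF lct[OF X Z] lct[OF Y Z]]]) (simp add: g_add[OF p lct[OF X Z] lct[OF Y Z] t] lc_ksz X Y Z p ksz_add1)
 show "lc (vscale u X) Z p = tscale (u p) (lc X Z p)" by (rule lc_eqI[OF p tscale_in[OF lct[OF X Z]]]) (simp add: g_sc[OF p lct[OF X Z] t] lc_ksz X Y Z p ksz_sc1 u)
 show "lc X (vadd Y Z) p = tadd (lc X Y p) (lc X Z p)" by (rule lc_eqI[OF p tadd_in[OF lct[OF X Y] lct[OF X Z]]]) (simp add: g_add[OF p lct[OF X Y] lct[OF X Z] t] lc_ksz X Y Z p ksz_add2)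
 show "lc X (vscale u Y) p = tadd (tscale (X p u) (Y p)) (tscale (u p) (lc X Y p))" by (rule lc_eqI[OF p tadd_in[OF tscale_in[OF t[OF Y]] tscale_in[OF lct[OF X Y]]]])
    (simp add: ga[OF t[OF Y] lct[OF X Y]] lc_ksz X Y Z p ksz_sc2 u)
qed

abbreviation D :: "'a vfield => 'a vfield => 'a vfield" where "D == levi_civita A g"

lemma levi_civita: "is_levi_civita A g D" unfolding levi_civita_def by (rule someI[of _ lc]) (rule lc_is_levi_civita)

end

context framed_manifold
begin

lemma D_vf: "vf X ==> vf Y ==> vf (D X Y)" using levi_civita unfolding is_levi_civita_def affine_connection_def by blast

lemma D_tangent: "vf X ==> vf Y ==> p : PA ==> D X Y p : tsp p" using vtan[OF D_vf] .

lemma D_torsion: "vf X ==> vf Y ==> p : PA ==>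
  br X Y p f = D X Y p f-D Y X p f" using levi_civita unfolding is_levi_civita_def by simp

lemma D_metric: "vf X ==> vf Y ==> vf Z ==> p : PA ==>
  X p (%q. g q (Y q) (Z q)) = g p (D X Y p) (Z p)+g p (Y p) (D X Z p)" using levi_civita unfolding is_levi_civita_def by blast

lemma D_rules: assumes "vf X" "vf Y" "vf Z" "sf u" "p : PA" shows D_add1: "D (vadd X Y) Z p = tadd (D X Z p) (D Y Z p)" and D_sc1: "D (vscale u X) Z p = tscale (u p) (D X Z p)"
  and D_add2: "D X (vadd Y Z) p = tadd (D X Y p) (D X Z p)" and D_sc2: "D X (vscale u Y) p = tadd (tscale (X p u) (Y p)) (tscale (u p) (D X Y p))"
proof -
 have "affine_connection A D" using levi_civita unfolding is_levi_civita_def by (rule conjunct1)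
 note conjunct2[OF this[unfolded affine_connection_def], rule_format, OF assms(1-4) assms(5)]
 thus "D (vadd X Y) Z p = tadd (D X Z p) (D Y Z p)" "D (vscale u X) Z p = tscale (u p) (D X Z p)" "D X (vadd Y Z) p = tadd (D X Y p) (D X Z p)"
  "D X (vscale u Y) p = tadd (tscale (X p u) (Y p)) (tscale (u p) (D X Y p))" by simp_all
qed

lemma g_minus_left: "p : PA ==> v : tsp p ==> v' : tsp p ==> w : tsp p
  ==> u = (%f. v f-v' f) ==> g p u w = g p v w-g p v' w" using g_add[of p v "tscale (-1) v'" w] tscale_in[of v' p "-1"] g_sc[of p v' w "-1"] by (simp add: tadd_def tscale_def)

text \<open>\<open>D\<close> is obtained by choice, but metric compatibility and vanishing torsion
  force Koszul's formula. This pins \<open>D\<close> down at points of the manifold and makes its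
  locality a consequence of that of \<open>koszul\<close>.\<close>

lemma D_ksz: assumes X: "vf X" and Y: "vf Y" and Z: "vf Z" and p: "p : PA" shows "g p (D X Y p) (Z p) = koszul X Y Z p"
proof -
 note t = vtan[OF _ p] and Dt = D_tangent[OF _ _ p]
 have l: "g p (br U V p) (S p) = g p (D U V p) (S p)-g p (D V U p) (S p)" if U: "vf U" and V: "vf V" and S: "vf S" for U V S
  by (rule g_minus_left[OF p Dt[OF U V] Dt[OF V U] t[OF S]]) (simp add: fun_eq_iff D_torsion[OF U V p])
 show ?thesis unfolding koszul_def l[OF X Y Z] l[OF X Z Y] l[OF Y Z X] D_metric[OF X Y Z p] D_metric[OF Y X Z p] D_metric[OF Z X Y p]
  using g_sym[OF p t[OF Y] Dt[OF X Z]] g_sym[OF p t[OF X] Dt[OF Y Z]] g_sym[OF p t[OF X] Dt[OF Z Y]] by simp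
qed

lemma D_loc: assumes X: "vf X" "vf X'" and Y: "vf Y" "vf Y'" and W: "openin M W" "p : W" and eq: "!!q. q : W ==> X q = X' q" "!!q. q : W ==> Y q = Y' q" shows "D X Y p = D X' Y' p"
proof -
 note p = pts_open[OF W]
 show ?thesis by (rule g_eqI[OF p D_tangent[OF X(1) Y(1) p] D_tangent[OF X(2) Y(2) p]])(use g_eqI D_tangent ksz_loc W eq refl in "auto simp: p X Y D_ksz")
qed

lemma D_loc_pts: assumes X: "vf X" "vf X'" and Y: "vf Y" "vf Y'" and p: "p : PA" and eq: "!!q. q : PA ==> X q = X' q" "!!q. q : PA ==> Y q = Y' q" shows "D X Y p = D X' Y' p"
 by (rule D_loc[OF X Y, of "TM"]) (use p eq in "simp_all add: pts")

lemma D_comb1: assumes X: "!!i. vf (X i)" and u: "!!i. sf (u i)" and Z: "vf Z" and p: "p : PA" and fin: "finite I" shows "D (vcomb I u X) Z p f = (SUM i:I. u i p*D (X i) Z p f)" using fin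
proof (induction I)
 case empty
 show ?case unfolding vcomb_empty[of u X Z] D_sc1[OF Z Z Z sm_fun_c p] by (simp add: tscale_def)
next
 case (insert i I)
 show ?case unfolding vcomb_insert[OF insert(1,2)] D_add1[OF vf_sc[OF X u] vf_lincomb[OF X u] Z u p]
   D_sc1[OF X X Z u p] using insert by (simp add: tadd_def tscale_def)
qed

lemma D_comb2: assumes X: "vf X" and u: "!!i. sf (u i)" and Y: "!!i. vf (Y i)" and p: "p : PA" and fin: "finite I"
 shows "D X (vcomb I u Y) p f = (SUM i:I. X p (u i)*Y i p f+u i p*D X (Y i) p f)" using fin
proof (induction I)
 case empty
 show ?case unfolding vcomb_empty[of u Y X] D_sc2[OF X X X sm_fun_c p] by (simp add: tscale_def tadd_def tv_c[OF vtan[OF X p]])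
next
 case (insert i I)
 show ?case unfolding vcomb_insert[OF insert(1,2)] D_add2[OF X vf_sc[OF Y u] vf_lincomb[OF Y u] u p]
   D_sc2[OF X Y X u p] using insert by (simp add: tadd_def tscale_def)
qed

subsection \<open>Curvature\<close>

abbreviation R where "R == curvature A g"

lemma R_def: "R X Y Z p f = D X (D Y Z) p f-D Y (D X Z) p f-D (br X Y) Z p f" by (simp add: curvature_def Let_def)

lemma R_tangent: assumes X: "vf X" and Y: "vf Y" and Z: "vf Z" and p: "p : PA" shows "R X Y Z p : tsp p"
proof -
 have "R X Y Z p = tadd (D X (D Y Z) p) (tadd (tscale (-1) (D Y (D X Z) p)) (tscale (-1) (D (br X Y) Z p)))" by (simp add: fun_eq_iff R_def tadd_def tscale_def)
 thus ?thesis using X Y Z p by (simp add: tadd_in tscale_in D_tangent D_vf br_vf)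
qed

lemma R_asym: assumes X: "vf X" and Y: "vf Y" and Z: "vf Z" and p: "p : PA" shows "R Y X Z p f = - R X Y Z p f"
proof -
 have l: "br Y X = vscale (%q. -1) (br X Y)" by (simp add: fun_eq_iff tscale_def lie_asym[of Y])
 have "D (br Y X) Z p f = - D (br X Y) Z p f" unfolding l D_sc1[OF br_vf[OF X Y] X Z sm_fun_c p] by (simp add: tscale_def)
 thus ?thesis by (simp add: R_def)
qed

lemma R_loc: assumes X: "vf X" "vf X'" and Y: "vf Y" "vf Y'" and Z: "vf Z" "vf Z'" and W: "openin M W" "p : W"
  and eq: "!!q. q : W ==> X q = X' q" "!!q. q : W ==> Y q = Y' q" "!!q. q : W ==> Z q = Z' q" shows "R X Y Z p = R X' Y' Z' p"
proof -
 have "D X (D Y Z) p = D X' (D Y' Z') p" by (rule D_loc[OF X D_vf[OF Y(1) Z(1)] D_vf[OF Y(2) Z(2)] W eq(1) D_loc[OF Y Z W(1) _ eq(2,3)]])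
 moreover have "D Y (D X Z) p = D Y' (D X' Z') p" by (rule D_loc[OF Y D_vf[OF X(1) Z(1)] D_vf[OF X(2) Z(2)] W eq(2) D_loc[OF X Z W(1) _ eq(1,3)]])
 moreover have "D (br X Y) Z p = D (br X' Y') Z' p" by (rule D_loc[OF br_vf[OF X(1) Y(1)] br_vf[OF X(2) Y(2)] Z W lie_loc[OF X Y W(1) _ eq(1,2)] eq(3)])
 ultimately show ?thesis by (simp add: fun_eq_iff R_def)
qed

lemma R_add1: assumes X: "vf X" "vf X'" and Y: "vf Y" and Z: "vf Z" and p: "p : PA" shows "R (vadd X X') Y Z p f = R X Y Z p f+R X' Y Z p f"
proof -
 note u = sm_fun_c[of 0]
 have "D Y (D (vadd X X') Z) p = D Y (vadd (D X Z) (D X' Z)) p" by (rule D_loc_pts[OF Y Y D_vf[OF vf_add[OF X] Z] vf_add[OF D_vf[OF X(1) Z] D_vf[OF X(2) Z]] p refl D_add1[OF X Z u]])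
 moreover have "D (br (vadd X X') Y) Z p = D (vadd (br X Y) (br X' Y)) Z p" by (rule D_loc_pts[OF br_vf[OF vf_add[OF X] Y] vf_add[OF br_vf[OF X(1) Y] br_vf[OF X(2) Y]]
     Z Z p lie_add[OF X Y] refl])
 ultimately show ?thesis using D_add1[OF X D_vf[OF Y Z] u p] D_add2[OF Y D_vf[OF X(1) Z] D_vf[OF X(2) Z] u p]
   D_add1[OF br_vf[OF X(1) Y] br_vf[OF X(2) Y] Z u p] by (simp add: R_def tadd_def)
qed

lemma R_sc1: assumes X: "vf X" and Y: "vf Y" and Z: "vf Z" and u: "sf u" and p: "p : PA" shows "R (vscale u X) Y Z p f = u p * R X Y Z p f"
proof -
 have "D Y (D (vscale u X) Z) p = D Y (vscale u (D X Z)) p" by (rule D_loc_pts[OF Y Y D_vf[OF vf_sc[OF X u] Z] vf_sc[OF D_vf[OF X Z] u] p refl D_sc1[OF X X Z u]])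
 moreover have "D (br (vscale u X) Y) Z p = D (vadd (vscale u (br X Y)) (vscale (%q. - Y q u) X)) Z p"
 by (rule D_loc_pts[OF br_vf[OF vf_sc[OF X u] Y] vf_add[OF vf_sc[OF br_vf[OF X Y] u] vf_sc[OF X sm_fun_minus[OF vf_sm[OF Y u]]]] Z Z p _ refl])(use D_loc_pts br_vf vf_sc X u Y vf_add sm_fun_minus vf_sm Z p refl lie_sc in "auto simp: tadd_def tscale_def")
 ultimately show ?thesis using D_sc1[OF X X D_vf[OF Y Z] u p] D_sc2[OF Y D_vf[OF X Z] X u p]
   D_add1[OF vf_sc[OF br_vf[OF X Y] u] vf_sc[OF X sm_fun_minus[OF vf_sm[OF Y u]]] Z u p]
   D_sc1[OF br_vf[OF X Y] X Z u p] D_sc1[OF X X Z sm_fun_minus[OF vf_sm[OF Y u]] p] by (simp add: R_def tadd_def tscale_def algebra_simps)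
qed

lemma R_add3: assumes X: "vf X" and Y: "vf Y" and Z: "vf Z" "vf Z'" and p: "p : PA" shows "R X Y (vadd Z Z') p f = R X Y Z p f+R X Y Z' p f"
proof -
 note u = sm_fun_c[of 0]
 have *: "D U (D V (vadd Z Z')) p = tadd (D U (D V Z) p) (D U (D V Z') p)" if U: "vf U" and V: "vf V" for U V
 proof -
  have "D U (D V (vadd Z Z')) p = D U (vadd (D V Z) (D V Z')) p" by (rule D_loc_pts[OF U U D_vf[OF V vf_add[OF Z]] vf_add[OF D_vf[OF V Z(1)] D_vf[OF V Z(2)]] p refl D_add2[OF V Z u]])
  thus ?thesis using D_add2[OF U D_vf[OF V Z(1)] D_vf[OF V Z(2)] u p] by simp
 qed
 show ?thesis using *[OF X Y] *[OF Y X] D_add2[OF br_vf[OF X Y] Z u p] by (simp add: R_def tadd_def)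
qed

lemma R_sc3: assumes X: "vf X" and Y: "vf Y" and Z: "vf Z" and u: "sf u" and p: "p : PA" shows "R X Y (vscale u Z) p f = u p * R X Y Z p f"
proof -
 have *: "D U (D V (vscale u Z)) p f = U p (%q. V q u)*Z p f+V p u*D U Z p f+U p u*D V Z p f+u p*D U (D V Z) p f" if U: "vf U" and V: "vf V" for U V
 proof -
  note Vu = vf_sm[OF V u]
  have "D U (D V (vscale u Z)) p = D U (vadd (vscale (%q. V q u) Z) (vscale u (D V Z))) p"
   by (rule D_loc_pts[OF U U D_vf[OF V vf_sc[OF Z u]] vf_add[OF vf_sc[OF Z Vu] vf_sc[OF D_vf[OF V Z] u]]
      p refl D_sc2[OF V Z X u]])
  thus ?thesis using D_add2[OF U vf_sc[OF Z Vu] vf_sc[OF D_vf[OF V Z] u] u p] D_sc2[OF U Z X Vu p]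
    D_sc2[OF U D_vf[OF V Z] X u p] by (simp add: tadd_def tscale_def)
 qed
 show ?thesis using *[OF X Y] *[OF Y X] D_sc2[OF br_vf[OF X Y] Z X u p] by (simp add: R_def tadd_def tscale_def algebra_simps) (simp add: lie_bracket_def algebra_simps)
qed

text \<open>Only the values at \<open>p\<close> matter; expanding in a frame is all that is needed of tensoriality.\<close>

definition tens :: "'a => ('a vfield => real) => bool" where "tens p B \<longleftrightarrow> (ALL W E e X. frame W E e --> p : W --> vf X -->
   B X = (SU i. comp E e X i p*B (E i)))"

lemma tensD: "tens p B ==> frame W E e ==> p : W ==> vf X ==>
  B X = (SU i. comp E e X i p*B (E i))" unfolding tens_def by blast

lemma tensI: assumes loc: "!!W X X'. openin M W ==> p : W ==> vf X ==> vf X' ==> (!!q. q : W ==> X q = X' q) ==> B X = B X'" and add: "!!X X'. vf X ==> vf X' ==> B (vadd X X') = B X+B X'"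
  and sc: "!!u X. vf X ==> sf u ==> B (vscale u X) = u p*B X" shows "tens p B" unfolding tens_def
proof (intro allI impI)
 fix W E e X assume f: "frame W E e" "p : W" and X: "vf X"
 note E = frame_vf[OF f(1)] and u = comp_sm[OF f(1) X]
 have "B (vcomb I (comp E e X) E) = (SUM i:I. comp E e X i p*B (E i))" if "finite I" for I using that
 proof (induction I)
  case empty show ?case unfolding vcomb_empty[of "comp E e X" E X] sc[OF X sm_fun_c] by simp
 next
  case (insert i I)
  show ?case unfolding vcomb_insert[OF insert(1,2)] add[OF vf_sc[OF E u] vf_lincomb[OF E u]] sc[OF E u] insert.IH using insert by simp
 qed
 moreover have "B X = B (vcomb UNIV (comp E e X) E)" by (rule loc[OF frame_open[OF f(1)] f(2) X vf_lincomb[OF E u]]) (rule frame_field_rep[OF f(1) X])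
 ultimately show "B X = (SU i. comp E e X i p*B (E i))" by simp
qed

lemma Rm_tens1: assumes Y: "vf Y" and Z: "vf Z" and V: "vf V" and p: "p : PA" shows "tens p (%X. Rm A g X Y Z V p)"
proof (rule tensI)
 note t = R_tangent[OF _ Y Z p] and Vt = vtan[OF V p]
 show "Rm A g X Y Z V p = Rm A g X' Y Z V p" if "openin M W" "p : W" "vf X" "vf X'" "!!q. q : W ==> X q = X' q" for W X X'
  using R_loc[OF that(3,4) Y Y Z Z that(1,2,5) refl refl] by (simp only: Rm_def)
 show "Rm A g (vadd X X') Y Z V p = Rm A g X Y Z V p+Rm A g X' Y Z V p" if "vf X" "vf X'" for X X' unfolding Rm_def g_add[OF p t[OF that(1)] t[OF that(2)] Vt, symmetric]
  by (rule arg_cong[where f = "%v. g p v (V p)"], rule ext, subst R_add1[OF that Y Z p], simp only: tadd_def)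
 show "Rm A g (vscale u X) Y Z V p = u p * Rm A g X Y Z V p" if "vf X" "sf u" for X u unfolding Rm_def g_sc[OF p t[OF that(1)] Vt, symmetric]
  by (rule arg_cong[where f = "%v. g p v (V p)"], rule ext, subst R_sc1[OF that(1) Y Z that(2) p], simp only: tscale_def)
qed

lemma Rm_asym: assumes X: "vf X" and Y: "vf Y" and Z: "vf Z" and V: "vf V" and p: "p : PA" shows "Rm A g Y X Z V p = - Rm A g X Y Z V p"
proof -
 have "R Y X Z p = tscale (-1) (R X Y Z p)" by (simp add: fun_eq_iff tscale_def R_asym[OF X Y Z p])
 thus ?thesis using g_sc[OF p R_tangent[OF X Y Z p] vtan[OF V p], of "-1"] by (simp add: Rm_def)
qed

lemma Rm_tens2: assumes X: "vf X" and Z: "vf Z" and V: "vf V" and p: "p : PA" shows "tens p (%Y. Rm A g X Y Z V p)" unfolding tens_def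
proof (intro allI impI)
 fix W E e Y assume f: "frame W E e" "p : W" and Y: "vf Y"
 show "Rm A g X Y Z V p = (SU i. comp E e Y i p * Rm A g X (E i) Z V p)" unfolding Rm_asym[OF Y X Z V p] Rm_asym[OF frame_vf[OF f(1)] X Z V p] tensD[OF Rm_tens1[OF X Z V p] f Y]
  by (simp add: sum_negf)
qed

lemma Rm_tens3: assumes X: "vf X" and Y: "vf Y" and V: "vf V" and p: "p : PA" shows "tens p (%Z. Rm A g X Y Z V p)"
proof (rule tensI)
 note t = R_tangent[OF X Y _ p] and Vt = vtan[OF V p]
 show "Rm A g X Y Z V p = Rm A g X Y Z' V p" if "openin M W" "p : W" "vf Z" "vf Z'" "!!q. q : W ==> Z q = Z' q" for W Z Z'
  using R_loc[OF X X Y Y that(3,4) that(1,2) refl refl that(5)] by (simp only: Rm_def)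
 show "Rm A g X Y (vadd Z Z') V p = Rm A g X Y Z V p+Rm A g X Y Z' V p" if "vf Z" "vf Z'" for Z Z' unfolding Rm_def g_add[OF p t[OF that(1)] t[OF that(2)] Vt, symmetric]
  by (rule arg_cong[where f = "%v. g p v (V p)"], rule ext, subst R_add3[OF X Y that p], simp only: tadd_def)
 show "Rm A g X Y (vscale u Z) V p = u p * Rm A g X Y Z V p" if "vf Z" "sf u" for Z u unfolding Rm_def g_sc[OF p t[OF that(1)] Vt, symmetric]
  by (rule arg_cong[where f = "%v. g p v (V p)"], rule ext, subst R_sc3[OF X Y that p], simp only: tscale_def)
qed

lemma g_tens_right: assumes v: "v : tsp p" and p: "p : PA" shows "tens p (%V. g p v (V p))"
proof (rule tensI)
 note t = vtan[OF _ p]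
 show "g p v (tadd (X p) (X' p)) = g p v (X p)+g p v (X' p)" if "vf X" "vf X'" for X X' using g_add[OF p t[OF that(1)] t[OF that(2)] v] g_sym[OF p v] t that tadd_in by metis
 show "g p v (tscale (u p) (X p)) = u p*g p v (X p)" if "vf X" for X u using g_sc[OF p t[OF that] v] g_sym[OF p v] t that tscale_in by metis
qed simp

lemma Rm_tens4: assumes "vf X" "vf Y" "vf Z" "p : PA" shows "tens p (%V. Rm A g X Y Z V p)" unfolding Rm_def by (rule g_tens_right[OF R_tangent[OF assms] assms(4)])

lemma orthonormal_frame_at_frame: "frame W E e ==> p : W ==> orthonormal_frame_at A g p E"
proof -
 assume f: "frame W E e" "p : W"
 have "\<bar>e i\<bar> = 1" for i using frame_sign[OF f(1), of i] by (metis power2_eq_1_iff power2_eq_square abs_1 abs_minus_cancel)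
 thus ?thesis using f by (simp add: orthonormal_frame_at_def frame_vf[OF f(1)] frame_on[OF f])
qed

text \<open>Expanding one orthonormal basis in the other gives
 \<open>\<Sum>\<^sub>i \<epsilon>'\<^sub>i g(E\<^sub>a, E'\<^sub>i) g(E'\<^sub>i, E\<^sub>b) = g(E\<^sub>a, E\<^sub>b)\<close>, hence independence of the trace.\<close>

lemma metric_trace_frame: assumes f: "frame W E e" "p : W" and B1: "!!Y. vf Y ==> tens p (%X. B X Y)" and B2: "!!X. vf X ==> tens p (B X)"
 shows "metric_trace A g p B = (SU i. e i*B (E i) (E i))"
proof -
 note p = pts_open[OF frame_open[OF f(1)] f(2)]
 note t = vtan[OF _ p] and E = frame_vf[OF f(1)]
 define F where "F = (SOME F. orthonormal_frame_at A g p F)"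
 have F: "orthonormal_frame_at A g p F" unfolding F_def by (rule someI[of _ E]) (rule orthonormal_frame_at_frame[OF f])
 hence Fv: "vf (F i)" for i by (simp add: orthonormal_frame_at_def)
 define s where "s i = g p (F i p) (F i p)" for i
 have s1: "s i * s i = 1" for i using F unfolding orthonormal_frame_at_def s_def by (metis abs_mult_self_eq mult_1)
 have son: "g p (F i p) (F j p) = (if i = j then s i else 0)" for i j using F by (simp add: orthonormal_frame_at_def s_def)
 have key: "(SU i. s i*(comp E e (F i) a p * comp E e (F i) b p)) = (if a = b then e a else 0)" for a b
 proof -
  have "g p (E a p) (E b p) = g p (%f. SU i. s i*g p (E a p) (F i p)*F i p f) (E b p)" using orthonormal_rep[OF p t[OF Fv] s1 son t[OF E[of a]]] by simp
  also have "... = (SU i. s i*g p (E a p) (F i p)*g p (F i p) (E b p))" by (rule g_comb[OF p t[OF Fv] t[OF E]])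
  finally have 1: "(SU i. s i*g p (E a p) (F i p)*g p (F i p) (E b p)) = (if a = b then e a else 0)" by (simp add: frame_on[OF f])
  have "(SU i. s i*(comp E e (F i) a p * comp E e (F i) b p)) =
    e a*e b*(SU i. s i*g p (E a p) (F i p)*g p (F i p) (E b p))" unfolding comp_def sum_distrib_left by (rule sum.cong[OF refl]) (simp add: g_sym[OF p t[OF E[of a]] t[OF Fv]] algebra_simps)
  thus ?thesis using 1 frame_sign[OF f(1)] by simp
 qed
 have "metric_trace A g p B = (SU i. s i*B (F i) (F i))" by (simp add: metric_trace_def Let_def s_def flip: F_def)
 also have "... = (SU i. s i*(SU a. comp E e (F i) a p*(SU b. comp E e (F i) b p*B (E a) (E b))))" by (subst tensD[OF B1[OF Fv] f Fv], subst tensD[OF B2[OF E] f Fv]) (rule refl)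
 also have "... = (SU i. SU a. SU b. s i*(comp E e (F i) a p * comp E e (F i) b p)*B (E a) (E b))" by (simp add: sum_distrib_left mult.assoc)
 also have "... = (SU a. SU b. SU i. s i*(comp E e (F i) a p * comp E e (F i) b p)*B (E a) (E b))" by (subst sum.swap, rule sum.cong[OF refl], rule sum.swap)
 also have "... = (SU a. SU b. (if a = b then e a else 0)*B (E a) (E b))" by (simp only: sum_distrib_right[symmetric] key)
 also have "... = (SU a. e a*B (E a) (E a))" by (rule sum.cong[OF refl]) (simp add: if_distrib[of "%x. x*_"] cong: if_cong)
 finally show ?thesis .
qed

lemma Ric_frame: assumes f: "frame W E e" "p : W" and V: "vf V" and U: "vf U" shows "Ric A g V U p = (SU i. e i * Rm A g (E i) V U (E i) p)"
 unfolding Ric_def using pts_open[OF frame_open[OF f(1)] f(2)] by (intro metric_trace_frame[OF f] Rm_tens1 Rm_tens4 V U)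

lemma tens_sum: "(!!i. i : I ==> tens p (B i)) ==> tens p (%X. SUM i:I. k i*B i X)" unfolding tens_def
 by (simp add: sum_distrib_left sum.swap[of _ I] cong: sum.cong) (simp add: mult.left_commute)

lemma Ric_tens: assumes V: "vf V" and p: "p : PA" shows "tens p (%U. Ric A g U V p)" "tens p (%U. Ric A g V U p)"
proof -
 obtain W E e where f: "frame W E e" "p : W" using frames[OF p] by blast
 have 1: "tens p (%U. SU i. e i * Rm A g (E i) U V (E i) p)" by (intro tens_sum Rm_tens2 frame_vf[OF f(1)] V p)
 thus "tens p (%U. Ric A g U V p)" unfolding tens_def using Ric_frame[OF f _ V] frame_vf by (simp cong: sum.cong)
 have "tens p (%U. SU i. e i * Rm A g (E i) V U (E i) p)" by (intro tens_sum Rm_tens3 frame_vf[OF f(1)] V p)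
 thus "tens p (%U. Ric A g V U p)" unfolding tens_def using Ric_frame[OF f V] frame_vf by (simp cong: sum.cong)
qed

lemma scal_frame: assumes f: "frame W E e" "p : W" shows "scal A g p = (SU i. e i * Ric A g (E i) (E i) p)" unfolding scal_def using pts_open[OF frame_open[OF f(1)] f(2)]
 by (intro metric_trace_frame[OF f] Ric_tens)

lemma form_norm_frame: assumes f: "frame W E e" "p : W" shows "form_norm_sq A g (differential h) p = (SU i. e i*(E i p h)^2)"
proof -
 note p = pts_open[OF frame_open[OF f(1)] f(2)]
 have 1: "tens p (%X. k*X p h)" for k by (rule tensI) (simp_all add: tadd_def tscale_def algebra_simps)
 show ?thesis unfolding form_norm_sq_def differential_def by (subst metric_trace_frame[OF f]) (use 1 in "simp_all add: mult.commute power2_eq_square")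
qed

text \<open>Connection coefficients \<open>G\<close> and structure functions \<open>C\<close> enter
  through \<open>DE\<close> and \<open>LE\<close> only, and orthonormality is not assumed. So the
  formula serves orthonormal frames as well as coordinate fields, for which \<open>C\<close> is
  0.\<close>

lemma R_basis: assumes E: "!!i::3. vf (E i)" and W: "openin M W" "p : W" and G: "!!a b c. sf (G a b c)" and C: "!!a b c. sf (C a b c)"
  and DE: "!!q a b. q : W ==> D (E a) (E b) q = vcomb UNIV (G a b) E q" and LE: "!!q a b. q : W ==> br (E a) (E b) q = vcomb UNIV (C a b) E q"
 shows "R (E a) (E b) (E c) p = (%f. SU d. (E a p (G b c d)-E b p (G a c d) + (SU k. G b c k p*G a k d p-G a c k p*G b k d p-C a b k p*G k c d p))*E d p f)"
proof
 fix f
 note p = pts_open[OF W]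
 have DD: "D (E a) (D (E b) (E c)) p f = (SU d. (E a p (G b c d)+(SU k. G b c k p*G a k d p))*E d p f)" for a b
 proof -
  have "D (E a) (D (E b) (E c)) p f = D (E a) (vcomb UNIV (G b c) E) p f" using D_loc[OF E E D_vf[OF E E] vf_lincomb[OF E G] W refl DE] by simp
  also have "... = (SU k. E a p (G b c k)*E k p f+G b c k p*D (E a) (E k) p f)" by (rule D_comb2[OF E G E p]) simp
  also have "... = (SU k. E a p (G b c k)*E k p f)+(SU k. SU d. G b c k p*G a k d p*E d p f)" by (simp add: DE[OF W(2)] sum.distrib sum_distrib_left mult.assoc)
  also have "(SU k. SU d. G b c k p*G a k d p*E d p f) = (SU d. (SU k. G b c k p*G a k d p)*E d p f)" by (subst sum.swap) (simp add: sum_distrib_right)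
  finally show ?thesis by (simp add: sum.distrib distrib_right)
 qed
 have "D (br (E a) (E b)) (E c) p f = D (vcomb UNIV (C a b) E) (E c) p f" using D_loc[OF br_vf[OF E E] vf_lincomb[OF E C] E E W LE refl] by simp
 also have "... = (SU k. C a b k p*D (E k) (E c) p f)" by (rule D_comb1[OF E C E p]) simp
 also have "... = (SU k. SU d. C a b k p*G k c d p*E d p f)" by (simp add: DE[OF W(2)] sum_distrib_left mult.assoc)
 also have "... = (SU d. (SU k. C a b k p*G k c d p)*E d p f)" by (subst sum.swap) (simp add: sum_distrib_right)
 finally have L: "D (br (E a) (E b)) (E c) p f = (SU d. (SU k. C a b k p*G k c d p)*E d p f)" .
 show "R (E a) (E b) (E c) p f = (SU d. (E a p (G b c d)-E b p (G a c d) + (SU k. G b c k p*G a k d p-G a c k p*G b k d p-C a b k p*G k c d p))*E d p f)"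
  unfolding R_def DD L sum_subtractf[symmetric] left_diff_distrib[symmetric] by (rule sum.cong[OF refl]) (simp add: sum_subtractf)
qed

end

lemma span_card_2:
 fixes S :: "(real^3) set" assumes "finite S" "card S <= 2" shows "span S ~= UNIV"
proof
 assume "span S = UNIV"
 hence "dim S = 3" using dim_span[of S] by simp
 thus False using dim_le_card'[OF assms(1)] assms(2) by simp
qed

lemma Ck_on_ln:
 fixes f :: "'b::real_normed_vector => real" assumes "open S" "!!x. x : S ==> f x>0" "Ck_on k S f" shows "Ck_on k S (%x. ln (f x))"
proof (cases k)
 case 0
 have "ALL x:S. f x ~= 0" using assms(2) by fastforce
 thus ?thesis using 0 assms(3) by (auto intro: continuous_on_ln)
next
 case (Suc m)
 note f = assms(3)[unfolded Suc]
 have pos: "f x ~= 0" if "x : S" for x using assms(2)[OF that] by simp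
 show ?thesis unfolding Suc
 proof (rule Ck_on_SucI[OF _ _ assms(1)])
  show "((%x. ln (f x)) has_derivative (%v. fd f x v * inverse (f x))) (at x)" if "x : S" for x using DERIV_compose_FDERIV[OF DERIV_ln[OF assms(2)[OF that]] Ck_on_SucD[OF f that]] .
  have D: "Ck_on m S (%x. fd f x v)" for v using f by simp
  show "Ck_on m S (%x. fd f x v * inverse (f x))" for v by (rule Ck_on_mult[OF assms(1) D Ck_on_inverse[OF assms(1) pos Ck_on_Suc_imp[OF f]]])
 qed
qed

context closed_manifold
begin

lemma sm_fun_ln: "sf f ==> (!!p. p : PA ==> f p>0) ==> sf (%x. ln (f x))" by (auto simp: Ck_on_ln chart_open chart_inv_pts smooth_fun_def o_def smooth_on_def)

lemma tv_ln: assumes p: "p : PA" and v: "v : tsp p" and f: "sf f" "!!q. q : PA ==> f q>0" shows "v (%x. ln (f x)) = v f/f p"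
proof -
 obtain c where c: "c : A" "p : fst c" using chart_at[OF p] .
 obtain w where w: "v = dirv c w p" using tangent_eq_dirv[OF c v] .
 note l = sm_fun_ln[OF f]
 have "(f \<circ> cinv c) (snd c p)>0" using c f(2)[OF p] by simp
 from DERIV_compose_FDERIV[OF DERIV_ln[OF this] chart_fun_deriv[OF f(1) c]]
 have "((%x. ln (f x)) \<circ> cinv c has_derivative (%w. dirv c w p f*inverse (f p))) (at (snd c p))" using c by (simp add: o_def)
 from has_derivative_unique[OF this chart_fun_deriv[OF l c]] show ?thesis unfolding w by (simp add: fun_eq_iff divide_inverse)
qed

lemma openin_pos: assumes f: "sf f" shows "openin M {q : PA. f q>0}"
proof (subst openin_subopen, intro ballI)
 fix p assume "p : {q : PA. f q>0}"
 hence p: "p : PA" "f p>0" by auto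
 obtain c where c: "c : A" "p : fst c" using chart_at[OF p(1)] .
 have "open ((f \<circ> cinv c) -` {0<..} Int img c)" by (rule iffD1[OF continuous_on_open_vimage[OF chart_open(2)[OF c(1)]], rule_format,
     OF smo_cont[OF chart_fun_sm[OF f c(1)]] open_greaterThan])
 from openin_chart_pre[OF c(1) this]
 have "openin M {q : fst c. snd c q : (f \<circ> cinv c) -` {0<..} Int img c}" .
 moreover have "{q : fst c. snd c q : (f \<circ> cinv c) -` {0<..} Int img c} <= {q : PA. f q>0}"
 proof
  fix q assume q: "q : {q : fst c. snd c q : (f \<circ> cinv c) -` {0<..} Int img c}"
  hence "q : fst c" "(f \<circ> cinv c) (snd c q)>0" by simp_all
  thus "q : {q : PA. f q>0}" using c(1) chart_sub[OF c(1)] pts by auto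
 qed
 ultimately show "EX U. openin M U & p : U & U <= {q : PA. f q>0}" using c p by (intro exI[of _ "{q : fst c. snd c q : (f \<circ> cinv c) -` {0<..} Int img c}"]) auto
qed

lemma lie_comb: assumes X: "vf X" and u: "!!i. sf (u i)" and Y: "!!i. vf (Y i)" and p: "p : PA" and fin: "finite I"
 shows "br X (vcomb I u Y) p f = (SUM i:I. X p (u i)*Y i p f+u i p*br X (Y i) p f)" using fin
proof (induction I)
 case empty
 have "br X (vscale (%q. 0) X) p f = - br (vscale (%q. 0) X) X p f" by (rule lie_asym)
 thus ?case unfolding vcomb_empty[of u Y X] lie_sc[OF X X sm_fun_c p] by (simp add: tv_c[OF vtan[OF X p]])
next
 case (insert i I)
 show ?case unfolding vcomb_insert[OF insert(1,2)] lie_asym[of X "vadd _ _"] lie_add[OF vf_sc[OF Y u] vf_lincomb[OF Y u] X p] lie_sc[OF Y X u p]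
  using insert lie_asym[of "Y i" X p f] lie_asym[of "vcomb I u Y" X p f] by (simp add: tadd_def algebra_simps)
qed

end

section \<open>Orthonormal frames containing a given unit field\<close>

locale unit_field = tensor_manifold +
 fixes T :: "'a vfield" and eps :: real assumes T_vf: "vf T" and T_unit: "!!p. p : PA ==> g p (T p) (T p) = eps" and eps: "eps*eps = 1"
  and perp: "!!p v. p : PA ==> v : tsp p ==> g p (T p) v = 0 ==> v ~= tzero ==> g p v v>0"
begin

lemma normalize: assumes Z: "vf Z" and p: "p : PA" "g p (Z p) (Z p)>0" obtains u W where "sf u" "openin M W" "p : W" "!!q. q : W ==> u q>0 & u q*u q*g q (Z q) (Z q) = 1"
proof -
 define s where "s q = g q (Z q) (Z q)" for q
 have s: "sf s" unfolding s_def by (rule g_sm[OF Z Z])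
 obtain b N where b: "sf b" "openin M N" "p : N" "N <= {q : PA. s q>0}" "!!q. q : N ==> b q = 1" "!!q. q ~: {q : PA. s q>0} ==> b q = 0" "!!q. 0 <= b q & b q <= 1"
  using bump_exists[OF openin_pos[OF s], of p] p unfolding s_def by blast
 \<comment> \<open>\<open>t\<close> agrees with \<open>s\<close> near \<open>p\<close> and is
   positive on the whole manifold, so its square root is a globally smooth function.\<close>
 define t where "t q = b q * s q+(1-b q)" for q
 have t: "sf t" unfolding t_def by (rule sm_fun_add[OF sm_fun_mult[OF b(1) s] sm_fun_diff[OF sm_fun_c b(1)]])
 have tpos: "t q>0" if "q : PA" for q
 proof (cases "s q>0")
  case True
  thus ?thesis using b(7)[of q] by (cases "b q = 0") (auto simp: t_def intro!: add_pos_nonneg)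
 next
  case False thus ?thesis using b(6)[of q] by (simp add: t_def)
 qed
 have r: "sf (%q. sqrt (t q))" by (rule sm_fun_sqrt[OF t tpos])
 have "sqrt (t q) ~= 0" if "q : PA" for q using tpos[OF that] by simp
 note u = sm_fun_inverse[OF r this]
 show ?thesis
 proof (rule that[OF u b(2,3)])
  fix q assume q: "q : N"
  hence "t q = s q" "s q>0" using b by (auto simp: t_def)
  thus "inverse (sqrt (t q))>0 & inverse (sqrt (t q))*inverse (sqrt (t q))*g q (Z q) (Z q) = 1" by (simp add: s_def[symmetric] flip: inverse_mult_distrib)
 qed
qed

lemma g_axpy: assumes p: "p : PA" and v: "v : tsp p" "w : tsp p" "z : tsp p" shows "g p (tadd v (tscale a w)) z = g p v z+a*g p w z" "g p z (tadd v (tscale a w)) = g p z v+a*g p z w"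
using g_add p v tscale_in g_sc g_sym tadd_in by auto

text \<open>Gram--Schmidt, starting from \<open>T\<close> and two fields whose values complete
  \<open>T p\<close> to a basis. Positivity on the complement of \<open>T\<close> makes the
  normalizations possible in both signatures, and keeping \<open>T\<close> as third member leaves
  \<open>eps\<close> as the only sign in question.\<close>

lemma T_frame: assumes p: "p : PA" obtains W E where "frame W E (%i. if i = 3 then eps else 1)" "E 3 = T" "p : W"
proof -
 obtain c where c: "c : A" "p : fst c" using chart_at[OF p] .
 note t = vtan[OF _ p]
 obtain tt where tt: "T p = dirv c tt p" using tangent_eq_dirv[OF c t[OF T_vf]] .
 have "span {tt} ~= UNIV" by (rule span_card_2) auto
 then obtain w1 where w1: "w1 ~: span {tt}" by blast
 have "span {tt,w1} ~= UNIV" by (rule span_card_2) (auto simp: card_insert_if)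
 then obtain w2 where w2: "w2 ~: span {tt,w1}" by blast
 obtain Y1 where Y1: "vf Y1" "Y1 p = dirv c w1 p" using tangent_field_exists[OF p dirv_tangent[OF c]] .
 obtain Y2 where Y2: "vf Y2" "Y2 p = dirv c w2 p" using tangent_field_exists[OF p dirv_tangent[OF c]] .
 have comb: "tadd (dirv c v p) (tscale a (dirv c w p)) = dirv c (v+a*Rw) p" for v w a using dirv_linear[OF c, of "%i. if i then 1 else a" "%i. if i then v else w" "UNIV :: bool set"]
  by (simp add: UNIV_bool tadd_def tscale_def add.commute)
 have zero: "dirv c v p = tzero ==> v = 0" for v using dirv_inj[OF c, of v 0] dirv_linear[OF c, of "%_. 0" "%_. 0" "{}"] by (simp add: tzero_def)
 define a1 where "a1 q = - eps*g q (Y1 q) (T q)" for q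
 have a1: "sf a1" unfolding a1_def by (rule sm_fun_mult[OF sm_fun_c g_sm[OF Y1(1) T_vf]])
 define Z1 where "Z1 = vadd Y1 (vscale a1 T)"
 have Z1: "vf Z1" unfolding Z1_def by (rule vf_add[OF Y1(1) vf_sc[OF T_vf a1]])
 have Z1T: "g q (T q) (Z1 q) = 0" if "q : PA" for q using g_axpy(2)[OF that vtan[OF Y1(1) that] vtan[OF T_vf that] vtan[OF T_vf that]] T_unit[OF that]
   g_sym[OF that vtan[OF Y1(1) that] vtan[OF T_vf that]] eps by (simp add: Z1_def a1_def algebra_simps)
 have Z1p: "Z1 p = dirv c (w1+a1 p*Rtt) p" unfolding Z1_def Y1(2) tt comb ..
 have "Z1 p ~= tzero"
 proof
  assume "Z1 p = tzero"
  hence "w1 = (- a1 p)*Rtt" using zero Z1p by (simp add: eq_neg_iff_add_eq_0)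
  thus False using w1 by (metis span_base span_scale singletonI)
 qed
 hence "g p (Z1 p) (Z1 p)>0" using perp[OF p t[OF Z1] Z1T[OF p]] by blast
 then obtain u1 W1 where u1: "sf u1" "openin M W1" "p : W1" "!!q. q : W1 ==> u1 q>0 & u1 q*u1 q*g q (Z1 q) (Z1 q) = 1" using normalize[OF Z1 p] by metis
 define E1 where "E1 = vscale u1 Z1"
 have E1: "vf E1" unfolding E1_def by (rule vf_sc[OF Z1 u1(1)])
 have sc: "g q (tscale a (X q)) (Y q) = a*g q (X q) (Y q)" "g q (Y q) (tscale a (X q)) = a*g q (Y q) (X q)" if "q : PA" "vf X" "vf Y" for q a X Y using vtan that g_sc g_sym tscale_in by auto
 have E1T: "g q (T q) (E1 q) = 0" if "q : PA" for q using sc(2)[OF that Z1 T_vf] Z1T[OF that] by (simp add: E1_def)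
 have E11: "g q (E1 q) (E1 q) = 1" if "q : W1" for q by (metis pts_open u1 that sc Z1 E1 mult.assoc E1_def)
 define a2 where "a2 q = - eps*g q (Y2 q) (T q)" for q
 define b2 where "b2 q = - g q (Y2 q) (E1 q)" for q
 have a2: "sf a2" unfolding a2_def by (rule sm_fun_mult[OF sm_fun_c g_sm[OF Y2(1) T_vf]])
 have b2: "sf b2" unfolding b2_def by (rule sm_fun_minus[OF g_sm[OF Y2(1) E1]])
 define X2 where "X2 = vadd Y2 (vscale a2 T)"
 define Z2 where "Z2 = vadd X2 (vscale b2 E1)"
 have X2: "vf X2" unfolding X2_def by (rule vf_add[OF Y2(1) vf_sc[OF T_vf a2]])
 have Z2: "vf Z2" unfolding Z2_def by (rule vf_add[OF X2 vf_sc[OF E1 b2]])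
 have X2T: "g q (T q) (X2 q) = 0" if "q : PA" for q using g_axpy(2)[OF that vtan[OF Y2(1) that] vtan[OF T_vf that] vtan[OF T_vf that]] T_unit[OF that]
   g_sym[OF that vtan[OF Y2(1) that] vtan[OF T_vf that]] eps by (simp add: X2_def a2_def algebra_simps)
 have Z2T: "g q (T q) (Z2 q) = 0" if q: "q : PA" for q using g_axpy(2)[OF q vtan[OF X2 q] vtan[OF E1 q] vtan[OF T_vf q]] E1T[OF q] X2T[OF q] by (simp add: Z2_def)
 have Z21: "g q (E1 q) (Z2 q) = 0" if q1: "q : W1" for q
 proof -
  have q: "q : PA" by (rule pts_open[OF u1(2) q1])
  show ?thesis using g_axpy(2)[OF q vtan[OF Y2(1) q] vtan[OF T_vf q] vtan[OF E1 q]] E11[OF q1]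
   g_axpy(2)[OF q vtan[OF X2 q] vtan[OF E1 q] vtan[OF E1 q]] E1T[OF q] g_sym[OF q vtan[OF T_vf q] vtan[OF E1 q]]
   g_sym[OF q vtan[OF Y2(1) q] vtan[OF E1 q]] by (simp add: X2_def Z2_def b2_def)
 qed
 have E1p: "E1 p = dirv c (u1 p*R(w1+a1 p*Rtt)) p" using dirv_linear[OF c, of "%_. u1 p" "%_. w1+a1 p*Rtt" "UNIV :: unit set"] by (simp add: E1_def Z1p tscale_def UNIV_unit)
 have Z2p: "Z2 p = dirv c (w2+a2 p*Rtt+b2 p*R(u1 p*R(w1+a1 p*Rtt))) p" unfolding Z2_def X2_def Y2(2) tt E1p comb ..
 have "Z2 p ~= tzero"
 proof
  assume "Z2 p = tzero"
  hence "w2+a2 p*Rtt+b2 p*R(u1 p*R(w1+a1 p*Rtt)) = 0" using zero Z2p by simp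
  hence "w2 = - (a2 p*Rtt+b2 p*R(u1 p*R(w1+a1 p*Rtt)))" by (simp only: eq_neg_iff_add_eq_0 add.assoc)
  moreover have "- (a2 p*Rtt+b2 p*R(u1 p*R(w1+a1 p*Rtt))) : span {tt,w1}" by (intro span_neg span_add span_scale span_base) auto
  ultimately show False using w2 by simp
 qed
 hence "g p (Z2 p) (Z2 p)>0" using perp[OF p t[OF Z2] Z2T[OF p]] by blast
 then obtain u2 W2 where u2: "sf u2" "openin M W2" "p : W2" "!!q. q : W2 ==> u2 q>0 & u2 q*u2 q*g q (Z2 q) (Z2 q) = 1" using normalize[OF Z2 p] by metis
 define E2 where "E2 = vscale u2 Z2"
 have E2: "vf E2" unfolding E2_def by (rule vf_sc[OF Z2 u2(1)])
 have E2T: "g q (T q) (E2 q) = 0" if "q : PA" for q using sc(2)[OF that Z2 T_vf] Z2T[OF that] by (simp add: E2_def)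
 have E22: "g q (E2 q) (E2 q) = 1" if "q : W2" for q by (metis pts_open u2 that sc Z2 E2 mult.assoc E2_def)
 have E12: "g q (E1 q) (E2 q) = 0" if "q : W1" for q using sc(2)[OF pts_open[OF u1(2) that] Z2 E1] Z21[OF that] by (simp add: E2_def)
 define E where "E i = (if i = 1 then E1 else if i = 2 then E2 else T)" for i :: 3
 show ?thesis
 proof
  show "frame (W1 Int W2) E (%i. if i = 3 then eps else 1)" unfolding frame_def
  proof (intro conjI allI ballI)
   show "openin M (W1 Int W2)" using u1 u2 by blast
   show "vf (E i)" for i using E1 E2 T_vf by (simp add: E_def)
   show "(if i = 3 then eps else 1)*(if i = 3 then eps else 1) = 1" for i :: 3 using eps by simp
   fix q i j assume qq: "q : W1 Int W2"
   hence q: "q : PA" using pts_open[OF u1(2)] by blast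
   note tq = vtan[OF E1 q] vtan[OF E2 q] vtan[OF T_vf q]
   have "g q (E1 q) (T q) = 0" "g q (E2 q) (T q) = 0" "g q (E2 q) (E1 q) = 0" using E1T[OF q] E2T[OF q] E12[of q] qq g_sym[OF q tq(1,3)] g_sym[OF q tq(2,3)] g_sym[OF q tq(1,2)] by auto
   thus "g q (E i q) (E j q) = (if i = j then if i = 3 then eps else 1 else 0)" using E1T[OF q] E2T[OF q] E12[of q] E11[of q] E22[of q] qq T_unit[OF q] exhaust_3[of i] exhaust_3[of j]
    by (auto simp: E_def)
  qed
  show "E 3 = T" by (simp add: E_def)
  show "p : W1 Int W2" using u1 u2 by blast
 qed
qed

sublocale framed_manifold by unfold_locales (metis T_frame)

end

section \<open>Structure functions and curvature of a unit Killing field\<close>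

locale unit_killing = unit_field + assumes killing: "killing_field A g T"
begin

lemma eps_cases: "eps = 1 \<or> eps = -1" using eps by (simp add: square_eq_1_iff)

abbreviation sgns :: "3 => real" where "sgns == (%i. if i = 3 then eps else 1)"

text \<open>Structure functions with the last index lowered. They are skew in the first two indices,
  and the Killing equation makes \<open>S E 3 a b\<close> skew in \<open>a\<close> and
  \<open>b\<close>. What survives is \<open>S E 1 2 1\<close>, \<open>S E 1 2 2\<close>,
  \<open>S E 3 1 2\<close> and \<open>S E 1 2 3\<close>, the last being twice the twist up to
  sign.\<close>

definition S :: "(3 => 'a vfield) => 3 => 3 => 3 => 'a => real" where "S E a b c q = g q (br (E a) (E b) q) (E c q)"

text \<open>The inner products of the frame are constant on \<open>W\<close>, so only the bracket
  terms of Koszul's formula remain; \<open>sgns c\<close> raises the last index.\<close>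

definition Gam :: "(3 => 'a vfield) => 3 => 3 => 3 => 'a => real" where "Gam E a b c q = sgns c/2*(S E a b c q-S E a c b q-S E b c a q)"

definition Str :: "(3 => 'a vfield) => 3 => 3 => 3 => 'a => real" where "Str E a b c q = sgns c*S E a b c q"

context
 fixes W E assumes f: "frame W E sgns" and E3: "E 3 = T"
begin

lemma W_pts: "q : W ==> q : PA" by (rule pts_open[OF frame_open[OF f]])

lemma E_vf: "vf (E i)" by (rule frame_vf[OF f])

lemma E_tv: "q : W ==> E i q : tsp q" by (rule vtan[OF E_vf W_pts])

lemma S_sm: "sf (S E a b c)" unfolding S_def[abs_def] by (rule g_sm[OF br_vf[OF E_vf E_vf] E_vf])

lemma Gam_sm: "sf (Gam E a b c)" unfolding Gam_def[abs_def] by (rule sm_fun_mult[OF sm_fun_c sm_fun_diff[OF sm_fun_diff[OF S_sm S_sm] S_sm]])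

lemma Str_sm: "sf (Str E a b c)" unfolding Str_def[abs_def] by (rule sm_fun_mult[OF sm_fun_c S_sm])

lemma gE_c: assumes q: "q : W" and v: "v : tsp q" shows "v (%r. g r (E a r) (E b r)) = 0"
proof -
 have "v (%r. g r (E a r) (E b r)) = v (%r. if a = b then sgns a else 0)" by (rule tv_loc[OF v frame_open[OF f] q g_sm[OF E_vf E_vf] sm_fun_c]) (rule frame_on[OF f])
 thus ?thesis using tv_c[OF v] by simp
qed

lemma S_asym: "q : W ==> S E a b c q = - S E b a c q"
proof -
 assume q: "q : W"
 have "br (E a) (E b) q = tscale (-1) (br (E b) (E a) q)" by (simp add: fun_eq_iff tscale_def lie_asym[of "E a" "E b"])
 thus ?thesis using g_sc[OF W_pts[OF q] vtan[OF br_vf[OF E_vf E_vf] W_pts[OF q]] E_tv[OF q], of "-1"] by (simp add: S_def)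
qed

lemma S_killing: "q : W ==> S E 3 a b q = - S E 3 b a q"
proof -
 assume q: "q : W"
 note qp = W_pts[OF q]
 have "T q (%r. g r (E a r) (E b r)) = g q (br T (E a) q) (E b q)+g q (E a q) (br T (E b) q)" using killing E_vf qp unfolding killing_field_def by blast
 thus ?thesis using gE_c[OF q vtan[OF T_vf qp]] g_sym[OF qp E_tv[OF q] vtan[OF br_vf[OF T_vf E_vf] qp]] by (simp add: S_def E3)
qed

lemma D_E: "q : W ==> D (E a) (E b) q = vcomb UNIV (Gam E a b) E q"
proof -
 assume q: "q : W"
 note qp = W_pts[OF q]
 have "koszul (E a) (E b) (E c) q = (S E a b c q-S E a c b q-S E b c a q)/2" for c by (simp add: koszul_def gE_c[OF q E_tv[OF q]] S_def)
 hence *: "Gam E a b c q = sgns c*g q (D (E a) (E b) q) (E c q)" for c unfolding D_ksz[OF E_vf E_vf E_vf qp] by (simp add: Gam_def)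
 show ?thesis unfolding * by (rule frame_rep[OF f q D_tangent[OF E_vf E_vf qp]])
qed

lemma lie_E: "q : W ==> br (E a) (E b) q = vcomb UNIV (Str E a b) E q" unfolding Str_def S_def by (rule frame_rep[OF f _ vtan[OF br_vf[OF E_vf E_vf] W_pts]])

context
 fixes p assumes p: "p : W"
begin

lemma comb_zero: assumes "!!h. (SU d. k d*E d p h) = 0" shows "k d = 0"
proof -
 have "(%h. SU d. k d*E d p h) = tzero" using assms by (simp add: tzero_def)
 hence "g p tzero (E d p) = (SU i. k i*g p (E i p) (E d p))" using g_comb[where I = UNIV and a = k and v = "%i. E i p", OF W_pts[OF p] E_tv[OF p] E_tv[OF p]] by simp
 also have "... = k d * sgns d" by (simp add: frame_on[OF f p] if_distrib cong: if_cong)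
 finally have "k d * sgns d = 0" using g_sc[OF W_pts[OF p] tzero_in E_tv[OF p], of 0 d] by (simp add: tscale_def tzero_def)
 thus ?thesis using eps by (auto split: if_splits)
qed

lemma lie_lie: "br (E a) (br (E b) (E c)) p h = (SU d. (E a p (Str E b c d)+(SU i. Str E b c i p*Str E a i d p))*E d p h)"
proof -
 have "br (E a) (br (E b) (E c)) p h = br (E a) (vcomb UNIV (Str E b c) E) p h"
  using lie_loc[OF E_vf E_vf br_vf[OF E_vf E_vf] vf_lincomb[OF E_vf Str_sm] frame_open[OF f] p refl lie_E] by simp
 also have "... = (SU i. E a p (Str E b c i)*E i p h+Str E b c i p*br (E a) (E i) p h)" by (rule lie_comb[OF E_vf Str_sm E_vf W_pts[OF p]]) simp
 also have "... = (SU i. E a p (Str E b c i)*E i p h)+(SU i. SU d. Str E b c i p*Str E a i d p*E d p h)" by (simp add: lie_E[OF p] sum.distrib sum_distrib_left mult.assoc)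
 also have "(SU i. SU d. Str E b c i p*Str E a i d p*E d p h) = (SU d. (SU i. Str E b c i p*Str E a i d p)*E d p h)" by (subst sum.swap) (simp add: sum_distrib_right)
 finally show ?thesis by (simp add: sum.distrib distrib_right)
qed

lemma jacobi_str: "E a p (Str E b c d)+(SU i. Str E b c i p*Str E a i d p)
  + E c p (Str E a b d)+(SU i. Str E a b i p*Str E c i d p)
  - E b p (Str E a c d)-(SU i. Str E a c i p*Str E b i d p) = 0"
proof -
 let ?J = "%a b c d. E a p (Str E b c d)+(SU i. Str E b c i p*Str E a i d p)"
 have "(SU d. (?J a b c d+?J c a b d-?J b a c d)*E d p h) = 0" for h using jacobi[OF E_vf E_vf E_vf W_pts[OF p], of a b c h] lie_asym[of "br (E a) (E b)" "E c" p h]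
  unfolding lie_lie by (simp only: left_diff_distrib distrib_right sum.distrib sum_subtractf)
 from comb_zero[OF this, of d] show ?thesis by simp
qed

lemma dS_asym: "E x p (S E a b c) = - E x p (S E b a c)" and dS_killing: "E x p (S E 3 a b) = - E x p (S E 3 b a)"
proof -
 note l = tv_loc[OF E_tv[OF p] frame_open[OF f] p S_sm sm_fun_minus[OF S_sm]]
 have "E x p (S E a b c) = E x p (%q. - S E b a c q)" by (rule l) (rule S_asym)
 thus "E x p (S E a b c) = - E x p (S E b a c)" using tv_minus[OF E_tv[OF p] S_sm] by simp
 have "E x p (S E 3 a b) = E x p (%q. - S E 3 b a q)" by (rule l) (rule S_killing)
 thus "E x p (S E 3 a b) = - E x p (S E 3 b a)" using tv_minus[OF E_tv[OF p] S_sm] by simp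
qed

lemma dStr: "E x p (Str E a b c) = sgns c*E x p (S E a b c)" unfolding Str_def[abs_def] by (rule tv_cmul[OF E_tv[OF p] S_sm])

lemma dGam: "E x p (Gam E a b c) = sgns c/2*(E x p (S E a b c)-E x p (S E a c b)-E x p (S E b c a))"
 unfolding Gam_def[abs_def] tv_cmul[OF E_tv[OF p] sm_fun_diff[OF sm_fun_diff[OF S_sm S_sm] S_sm]] tv_diff[OF E_tv[OF p] sm_fun_diff[OF S_sm S_sm] S_sm] tv_diff[OF E_tv[OF p] S_sm S_sm] ..

lemma Rm_E: "Rm A g (E a) (E b) (E c) (E d) p = sgns d*(E a p (Gam E b c d)-E b p (Gam E a c d) +
   (SU k. Gam E b c k p*Gam E a k d p-Gam E a c k p*Gam E b k d p-Str E a b k p*Gam E k c d p))"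
proof -
 define k where "k d = E a p (Gam E b c d)-E b p (Gam E a c d) + (SU k. Gam E b c k p*Gam E a k d p-Gam E a c k p*Gam E b k d p-Str E a b k p*Gam E k c d p)" for d
 have "R (E a) (E b) (E c) p = (%h. SU d. k d*E d p h)" unfolding k_def by (rule R_basis[OF E_vf frame_open[OF f] p Gam_sm Str_sm D_E lie_E])
 hence "Rm A g (E a) (E b) (E c) (E d) p = (SU i. k i*g p (E i p) (E d p))" unfolding Rm_def
  using g_comb[where I = UNIV and a = k and v = "%i. E i p", OF W_pts[OF p] E_tv[OF p] E_tv[OF p]] by simp
 also have "... = sgns d*k d" by (simp add: frame_on[OF f p] if_distrib cong: if_cong)
 finally show ?thesis by (simp only: k_def)
qed

lemma S_table: "S E 1 1 c p = 0" "S E 2 2 c p = 0" "S E 3 3 c p = 0" "S E 2 1 c p = - S E 1 2 c p" "S E 1 3 c p = - S E 3 1 c p" "S E 2 3 c p = - S E 3 2 c p"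
 "S E 3 1 1 p = 0" "S E 3 2 2 p = 0" "S E 3 1 3 p = 0" "S E 3 2 3 p = 0" "S E 3 2 1 p = - S E 3 1 2 p" using S_asym[OF p, of 1 1 c] S_asym[OF p, of 2 2 c] S_asym[OF p, of 3 3]
  S_asym[OF p, of 2 1 c] S_asym[OF p, of 1 3 c] S_asym[OF p, of 2 3 c] S_killing[OF p, of 1 1] S_killing[OF p, of 2 2]
  S_killing[OF p, of 1 3] S_killing[OF p, of 2 3] S_killing[OF p, of 2 1] by (simp_all only: neg_equal_zero equal_neg_zero minus_zero)

lemma dS_table: "E x p (S E 1 1 c) = 0" "E x p (S E 2 2 c) = 0" "E x p (S E 3 3 c) = 0" "E x p (S E 2 1 c) = - E x p (S E 1 2 c)"
 "E x p (S E 1 3 c) = - E x p (S E 3 1 c)" "E x p (S E 2 3 c) = - E x p (S E 3 2 c)" "E x p (S E 3 1 1) = 0" "E x p (S E 3 2 2) = 0" "E x p (S E 3 1 3) = 0" "E x p (S E 3 2 3) = 0"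
 "E x p (S E 3 2 1) = - E x p (S E 3 1 2)" using dS_asym[of x 1 1 c] dS_asym[of x 2 2 c] dS_asym[of x 3 3]
  dS_asym[of x 2 1 c] dS_asym[of x 1 3 c] dS_asym[of x 2 3 c] dS_killing[of x 1 1] dS_killing[of x 2 2]
  dS_killing[of x 1 3] dS_killing[of x 2 3] dS_killing[of x 2 1] by (simp_all only: neg_equal_zero equal_neg_zero minus_zero)

text \<open>The three components of the Jacobi identity for \<open>E 3\<close>, \<open>E 1\<close>,
  \<open>E 2\<close>. The first says that the twist is constant along \<open>T\<close>; the other
  two eliminate the \<open>T\<close> derivatives of the remaining bracket coefficients from the
  Ricci tensor.\<close>

lemma jacobi_consequences: "E 3 p (S E 1 2 3) = 0" "E 3 p (S E 1 2 1) = S E 1 2 2 p*S E 3 1 2 p-E 1 p (S E 3 1 2)" "E 3 p (S E 1 2 2) = - S E 1 2 1 p*S E 3 1 2 p-E 2 p (S E 3 1 2)"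
proof -
 note simps = dStr Str_def sum_3 S_table dS_table
 show "E 3 p (S E 1 2 3) = 0" using jacobi_str[of 3 1 2 3] eps_cases by (auto simp: simps)
 show "E 3 p (S E 1 2 1) = S E 1 2 2 p*S E 3 1 2 p-E 1 p (S E 3 1 2)" using jacobi_str[of 3 1 2 1] by (simp add: simps)
 show "E 3 p (S E 1 2 2) = - S E 1 2 1 p*S E 3 1 2 p-E 2 p (S E 3 1 2)" using jacobi_str[of 3 1 2 2] by (simp add: simps)
qed

text \<open>The Gauss curvature of the local quotient by the flow of \<open>T\<close>. It depends on
  the metric of the complement of \<open>T\<close> only, which is why it does not change when
  \<open>g\<close> is replaced by \<open>h\<close>.\<close>

definition kap where "kap = E 1 p (S E 1 2 2)-E 2 p (S E 1 2 1)-(S E 1 2 1 p)^2-(S E 1 2 2 p)^2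
  + eps*S E 1 2 3 p*S E 3 1 2 p"

lemma Ric_values: "Ric A g (E 3) (E 3) p = (S E 1 2 3 p)^2/2" "Ric A g (E 1) (E 1) p = kap-eps*(S E 1 2 3 p)^2/2" "Ric A g (E 2) (E 2) p = kap-eps*(S E 1 2 3 p)^2/2"
 "Ric A g (E 1) (E 2) p = 0" "Ric A g (E 2) (E 1) p = 0" "Ric A g (E 3) (E 1) p = - E 2 p (S E 1 2 3)/2" "Ric A g (E 1) (E 3) p = - E 2 p (S E 1 2 3)/2"
 "Ric A g (E 3) (E 2) p = E 1 p (S E 1 2 3)/2" "Ric A g (E 2) (E 3) p = E 1 p (S E 1 2 3)/2" unfolding Ric_frame[OF f p E_vf E_vf] Rm_E dGam using eps_cases
 by (auto simp: Gam_def Str_def sum_3 S_table dS_table jacobi_consequences kap_def power2_eq_square field_simps)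

lemma scal_value: "scal A g p = 2*kap-eps*(S E 1 2 3 p)^2/2" unfolding scal_frame[OF f p] by (auto simp: sum_3 Ric_values)

end
end
end

section \<open>The curvature hypothesis and the Riemannian metric \<open>h\<close>\<close>

context unit_killing
begin

text \<open>With \<open>w = S E 1 2 3\<close> one has \<open>Ric(T,T) = w^2/2\<close>, hence
  \<open>d ln Ric(T,T) = 2 dw/w\<close>, and the scalar curvature is
  \<open>2*kap - eps*w^2/2\<close>. The coefficient \<open>2 - eps\<close>, which is 3 or 1, is
  exactly what makes the terms with \<open>eps\<close> cancel.\<close>

lemma pinching: assumes hyp: "!!q. q : PA ==> Ric A g T T q>0 &
   scal A g q>(2-eps) * Ric A g T T q+form_norm_sq A g (differential (%q. ln (Ric A g T T q))) q" and f: "frame W E sgns" "E 3 = T" "p : W" shows "S E 1 2 3 p ~= 0 &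
  kap E p>(S E 1 2 3 p)^2/2+2*((E 1 p (S E 1 2 3))^2+(E 2 p (S E 1 2 3))^2)/(S E 1 2 3 p)^2"
proof -
 note p = W_pts[OF f(1,2,3)]
 note t = vtan[OF E_vf[OF f(1,2)] p]
 define r where "r q = Ric A g T T q" for q
 have rW: "r q = (S E 1 2 3 q)^2/2" if "q : W" for q using Ric_values(1)[OF f(1,2) that] f(2) by (simp add: r_def)
 have sq: "sf (%q. S E' 1 2 3 q*S E' 1 2 3 q*(1/2))" if "frame W' E' sgns" "E' 3 = T" for W' E' by (rule sm_fun_mult[OF sm_fun_mult[OF S_sm[OF that] S_sm[OF that]] sm_fun_c])
 \<comment> \<open>A frame and its structure functions are local; \<open>r\<close> is smooth because
   near every point it is half the square of \<open>S E' 1 2 3\<close> for some frame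
   \<open>E'\<close> there.\<close>
 have rs: "sf r"
 proof (rule sm_funI)
  fix q assume "q : PA"
  then obtain W' E' where f': "frame W' E' sgns" "E' 3 = T" "q : W'" using T_frame by metis
  have "r x = S E' 1 2 3 x*S E' 1 2 3 x*(1/2)" if "x : W'" for x using Ric_values(1)[OF f'(1,2) that] f'(2) by (simp add: r_def power2_eq_square)
  thus "EX W h. openin M W & q : W & sf h & (ALL x:W. r x = h x)" using frame_open[OF f'(1)] f'(3) sq[OF f'(1,2)] by blast
 qed
 have rpos: "r q>0" if "q : PA" for q using hyp[OF that] by (simp add: r_def)
 define w where "w = S E 1 2 3 p"
 have w: "w ~= 0" using rpos[OF p] rW[OF f(3)] by (auto simp: w_def)
 define d where "d i = E i p (S E 1 2 3)" for i
 have "E i p r = w*d i" for i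
 proof -
  have "E i p r = E i p (%q. S E 1 2 3 q*S E 1 2 3 q*(1/2))" by (rule tv_loc[OF t frame_open[OF f(1)] f(3) rs sq[OF f(1,2)]]) (simp add: rW power2_eq_square)
  also have "... = w*d i" unfolding tv_mult[OF t sm_fun_mult[OF S_sm[OF f(1,2)] S_sm[OF f(1,2)]] sm_fun_c] tv_mult[OF t S_sm[OF f(1,2)] S_sm[OF f(1,2)]] tv_c[OF t] by (simp add: w_def d_def)
  finally show ?thesis .
 qed
 hence dl: "E i p (%q. ln (r q)) = 2*d i/w" for i using tv_ln[OF p t rs rpos] rW[OF f(3)] w by (simp add: w_def[symmetric] power2_eq_square field_simps)
 have d3: "d 3 = 0" using jacobi_consequences(1)[OF f] by (simp add: d_def)
 have "form_norm_sq A g (differential (%q. ln (r q))) p = (2*d 1/w)^2+(2*d 2/w)^2" using form_norm_frame[OF f(1,3)] by (simp add: sum_3 dl d3)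
 hence "2*kap E p-eps*w^2/2>(2-eps)*(w^2/2)+((2*d 1/w)^2+(2*d 2/w)^2)" using conjunct2[OF hyp[OF p]] unfolding scal_value[OF f] w_def rW[OF f(3), symmetric] r_def by simp
 moreover have "(2*d 1/w)^2+(2*d 2/w)^2 = 4*(((d 1)^2+(d 2)^2)/w^2)" by (simp add: power_divide power_mult_distrib add_divide_distrib)
 ultimately have "kap E p>w^2/2+2*(((d 1)^2+(d 2)^2)/w^2)" using left_diff_distrib[of 2 eps "w^2/2"] by linarith
 hence "kap E p>w^2/2+2*((d 1)^2+(d 2)^2)/w^2" by simp
 thus ?thesis using w by (simp add: w_def d_def)
qed

text \<open>The Ricci form has diagonal entries \<open>m\<close>, \<open>m\<close>,
  \<open>w^2/2\<close> and its mixed terms are derivatives of \<open>w\<close>. Completing the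
  square in the \<open>T\<close> component \<open>v 3\<close> leaves
  \<open>2*(m*w^2)*N - (v 2*a - v 1*b)^2\<close>. By Cauchy--Schwarz and
  \<open>m*w^2 > 2*(a^2+b^2)\<close> this is positive unless \<open>N = 0\<close>, and then
  \<open>v 3\<close> is not 0.\<close>

lemma Ric_positive: assumes e1: "eps = 1" and f: "frame W E sgns" "E 3 = T" "p : W" and w: "S E 1 2 3 p ~= 0"
  and k: "kap E p>(S E 1 2 3 p)^2/2+2*((E 1 p (S E 1 2 3))^2+(E 2 p (S E 1 2 3))^2)/(S E 1 2 3 p)^2" and V: "vf V" "V p ~= tzero" shows "Ric A g V V p>0"
proof -
 note p = W_pts[OF f]
 define w where "w = S E 1 2 3 p"
 define a where "a = E 1 p (S E 1 2 3)"
 define b where "b = E 2 p (S E 1 2 3)"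
 define v where "v i = comp E sgns V i p" for i
 define m where "m = kap E p-w^2/2"
 have w0: "w^2>0" using w by (simp add: w_def)
 have m: "m*w^2>2*(a^2+b^2)" using k w0 by (simp add: m_def w_def a_def b_def field_simps)
 have "Ric A g V V p = (SU i. v i*(SU j. v j * Ric A g (E i) (E j) p))" by (subst tensD[OF Ric_tens(1)[OF V(1) p] f(1,3) V(1)], subst tensD[OF Ric_tens(2)[OF E_vf[OF f(1,2)] p] f(1,3) V(1)])
    (simp add: v_def)
 also have "... = w^2/2*(v 3)^2+m*((v 1)^2+(v 2)^2)+v 3*(v 2*a-v 1*b)" unfolding sum_3 Ric_values[OF f] by (simp add: e1 w_def a_def b_def m_def power2_eq_square algebra_simps)
 finally have R: "Ric A g V V p = w^2/2*(v 3)^2+m*((v 1)^2+(v 2)^2)+v 3*(v 2*a-v 1*b)" .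
 have nz: "v 1 ~= 0 \<or> v 2 ~= 0 \<or> v 3 ~= 0"
 proof (rule ccontr)
  assume "~ ?thesis"
  hence "V p = tzero" using frame_field_rep[OF f(1) V(1) f(3)] by (simp add: v_def[symmetric] sum_3 tzero_def)
  thus False using V by simp
 qed
 have cs: "(v 2*a-v 1*b)^2 <= (a^2+b^2)*((v 1)^2+(v 2)^2)" using zero_le_power2[of "v 1*a+v 2*b"] by (simp add: power2_eq_square algebra_simps)
 define N where "N = (v 1)^2+(v 2)^2"
 have N: "N >= 0" by (simp add: N_def)
 have sq: "(w^2 * v 3+(v 2*a-v 1*b))^2 >= 0" by simp
 have "2*w^2 * Ric A g V V p = (w^2 * v 3+(v 2*a-v 1*b))^2+2*(m*w^2)*N-(v 2*a-v 1*b)^2" unfolding R N_def by (simp add: power2_eq_square algebra_simps)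
 moreover have "... > 0"
 proof (cases "N = 0")
  case True
  hence "v 1 = 0" "v 2 = 0" by (auto simp: N_def sum_power2_eq_zero_iff)
  thus ?thesis using nz w0 by (simp add: N_def zero_less_mult_iff)
 next
  case False
  hence "N>0" using N by simp
  hence "(m*w^2)*N>2*(a^2+b^2)*N" using m by simp
  moreover have "(a^2+b^2)*N >= 0" using N by simp
  ultimately show ?thesis using sq cs unfolding N_def[symmetric] by linarith
 qed
 ultimately have "2*w^2 * Ric A g V V p>0" by simp
 thus ?thesis using w0 by (simp add: zero_less_mult_iff)
qed

definition h :: "'a metric" where "h p v w = g p v w+(1-eps)*(g p (T p) v * g p (T p) w)"

lemma h_T: "p : PA ==> h p (T p) v = eps*g p (T p) v" using eps by (simp add: h_def T_unit algebra_simps)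

lemma g_right: assumes "p : PA" "u : tsp p" "v : tsp p" "w : tsp p" shows "g p w (tadd u v) = g p w u+g p w v" "g p w (tscale a v) = a*g p w v"
 using g_add[OF assms] g_sc[OF assms(1,3,4)] g_sym[OF assms(1,4)] assms tadd_in tscale_in by metis+

lemma h_tensor: "symmetric_2_tensor A h" unfolding symmetric_2_tensor_def
proof (intro conjI ballI allI impI)
 fix p u v w a assume p: "p : PA" and u: "u : tsp p" and v: "v : tsp p" and w: "w : tsp p"
 note Tp = vtan[OF T_vf p]
 show "h p v w = h p w v" using g_sym[OF p v w] by (simp add: h_def)
 show "h p (tadd u v) w = h p u w+h p v w" using g_add[OF p u v w] g_right(1)[OF p u v Tp] by (simp add: h_def algebra_simps)
 show "h p (tscale a v) w = a*h p v w" using g_sc[OF p v w] g_right(2)[OF p u v Tp] by (simp add: h_def algebra_simps)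
next
 fix X Y assume X: "vf X" and Y: "vf Y"
 show "sf (%p. h p (X p) (Y p))" unfolding h_def by (rule sm_fun_add[OF g_sm[OF X Y] sm_fun_mult[OF sm_fun_c sm_fun_mult[OF g_sm[OF T_vf X] g_sm[OF T_vf Y]]]])
qed

lemma h_unit_killing: "unit_killing M A h T 1"
proof unfold_locales
 show "symmetric_2_tensor A h" by (rule h_tensor)
 show "vf T" by (rule T_vf)
 show "h p (T p) (T p) = 1" if "p : PA" for p using h_T[OF that] T_unit[OF that] eps by simp
 show "h p v v>0" if "p : PA" "v : tsp p" "h p (T p) v = 0" "v ~= tzero" for p v
 proof -
  have "g p (T p) v = 0" using h_T[OF that(1)] that(3) eps by auto
  thus ?thesis using perp[OF that(1,2) _ that(4)] by (simp add: h_def)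
 qed
 show "killing_field A h T" unfolding killing_field_def
 proof (intro conjI allI impI ballI T_vf)
  fix X Y p assume X: "vf X" and Y: "vf Y" and p: "p : PA"
  note Tp = vtan[OF T_vf p]
  have k: "T p (%q. g q (U q) (V q)) = g p (br T U p) (V p)+g p (U p) (br T V p)" if "vf U" "vf V" for U V using killing that p unfolding killing_field_def by blast
  have "br T T p = tscale 0 (T p)" by (simp add: fun_eq_iff lie_bracket_def tscale_def)
  hence TT: "g p (br T T p) w = 0" if "w : tsp p" for w using g_sc[OF p Tp that, of 0] by simp
  have kT: "T p (%q. g q (T q) (U q)) = g p (T p) (br T U p)" if "vf U" for U using k[OF T_vf that] TT[OF vtan[OF that p]] by simp
  note sX = g_sm[OF T_vf X] and sY = g_sm[OF T_vf Y]
  have "T p (%q. h q (X q) (Y q)) = T p (%q. g q (X q) (Y q))+T p (%q. (1-eps)*(g q (T q) (X q)*g q (T q) (Y q)))"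
   unfolding h_def by (rule tv_add[OF Tp g_sm[OF X Y] sm_fun_mult[OF sm_fun_c sm_fun_mult[OF sX sY]]])
  also have "T p (%q. (1-eps)*(g q (T q) (X q)*g q (T q) (Y q))) = (1-eps)*(g p (T p) (br T X p)*g p (T p) (Y p)+g p (T p) (X p)*g p (T p) (br T Y p))"
   unfolding tv_cmul[OF Tp sm_fun_mult[OF sX sY]] tv_mult[OF Tp sX sY] kT[OF X] kT[OF Y] ..
  finally show "T p (%q. h q (X q) (Y q)) = h p (br T X p) (Y p)+h p (X p) (br T Y p)" unfolding k[OF X Y] h_def by (simp add: algebra_simps)
 qed
qed simp

text \<open>A frame adapted to \<open>g\<close> is orthonormal for \<open>h\<close>, now with
  positive signs only. Lowering the last index with \<open>h\<close> instead of \<open>g\<close>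
  multiplies the structure functions by \<open>k c\<close>, that is by \<open>eps\<close> for the
  \<open>T\<close> index and by 1 otherwise. Hence \<open>kap\<close> and the squares in the
  estimate are the same for both metrics, and the Riemannian case applies to
  \<open>h\<close>.\<close>

theorem h_Ric_positive: assumes hyp: "!!q. q : PA ==> Ric A g T T q>0 &
   scal A g q>(2-eps) * Ric A g T T q+form_norm_sq A g (differential (%q. ln (Ric A g T T q))) q" and p: "p : PA" and V: "vf V" "V p ~= tzero" shows "Ric A h V V p>0"
proof -
 interpret H: unit_killing M A h T 1 by (rule h_unit_killing)
 obtain W E where f: "frame W E sgns" "E 3 = T" "p : W" using T_frame[OF p] by metis
 note Ev = E_vf[OF f(1,2)] and Wp = W_pts[OF f(1,2)]
 have gT: "g q (T q) (E c q) = (if c = 3 then eps else 0)" if "q : W" for q c using frame_on[OF f(1) that, of 3 c] f(2) by auto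
 have fh: "H.frame W E (%i. if i = 3 then 1 else 1)" unfolding H.frame_def
 proof (intro conjI allI ballI frame_open[OF f(1)] Ev)
  fix q and i j :: 3 assume q: "q : W"
  show "h q (E i q) (E j q) = (if i = j then if i = 3 then 1 else 1 else 0)" using frame_on[OF f(1) q, of i j] gT[OF q] eps by (auto simp: h_def algebra_simps)
 qed simp
 define k where "k c = (if c = 3 then eps else 1)" for c :: 3
 have Sh: "H.S E a b c q = k c*S E a b c q" if q: "q : W" for a b c q
 proof -
  have "g q (T q) (br (E a) (E b) q) = S E a b 3 q" using g_sym[OF Wp[OF q] vtan[OF T_vf Wp[OF q]] vtan[OF br_vf[OF Ev Ev] Wp[OF q]]] by (simp add: S_def f(2))
  thus ?thesis using gT[OF q, of c] eps by (auto simp: H.S_def h_def k_def S_def algebra_simps)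
 qed
 have dSh: "E x p (H.S E a b c) = k c*E x p (S E a b c)" for x a b c
 proof -
  note t = vtan[OF Ev Wp[OF f(3)]]
  have "E x p (H.S E a b c) = E x p (%q. k c*S E a b c q)" by (rule tv_loc[OF t frame_open[OF f(1)] f(3) H.S_sm[OF fh f(2)] sm_fun_mult[OF sm_fun_c S_sm[OF f(1,2)]] Sh])
  thus ?thesis using tv_cmul[OF t S_sm[OF f(1,2)]] by simp
 qed
 have e2: "eps^2 = 1" using eps by (simp add: power2_eq_square)
 have kh: "H.kap E p = kap E p" unfolding H.kap_def[OF fh f(2,3)] kap_def[OF f] dSh Sh[OF f(3)] by (simp add: k_def)
 note pi = pinching[OF hyp f]
 show ?thesis
 proof (rule H.Ric_positive[OF refl fh f(2,3) _ _ V])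
  show "H.S E 1 2 3 p ~= 0" using pi eps by (auto simp: Sh[OF f(3)] k_def)
  show "(H.S E 1 2 3 p)^2/2+2*((E 1 p (H.S E 1 2 3))^2+(E 2 p (H.S E 1 2 3))^2)/(H.S E 1 2 3 p)^2<H.kap E p" unfolding kh dSh Sh[OF f(3)] using pi by (simp add: k_def power_mult_distrib e2)
 qed
qed

end

text \<open>The definition provides some timelike \<open>t\<close> with positive complement, which
  need not be \<open>T\<close>. The map \<open>u\<close> projects to that complement, where
  Cauchy--Schwarz gives \<open>R^2 <= P*Q\<close>. Since \<open>g(T,T) = -1\<close> and
  \<open>g(T,v) = 0\<close>, the left side is \<open>(P+1)*(b^2/ta)\<close>; so
  \<open>b^2/ta < Q\<close>, which says that \<open>g(v,v)\<close> is positive.\<close>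

lemma (in closed_manifold) lorentzian_perp_positive: assumes L: "lorentzian_metric A g" and p: "p : PA" and T: "T : tsp p" "g p T T = -1" and v: "v : tsp p" "g p T v = 0" "v ~= tzero"
 shows "g p v v>0"
proof -
 interpret tensor_manifold M A g using closed_manifold_axioms L by (simp add: tensor_manifold_def tensor_manifold_axioms_def lorentzian_metric_def)
 obtain t where t: "t : tsp p" "g p t t<0" and pos: "!!v. v : tsp p ==> v ~= tzero ==> g p t v = 0 ==> g p v v>0" using L p unfolding lorentzian_metric_def by blast
 have axpy: "g p (tadd x (tscale a y)) z = g p x z+a*g p y z" "g p z (tadd x (tscale a y)) = g p z x+a*g p z y" if "x : tsp p" "y : tsp p" "z : tsp p" for x y z a
 proof -
  show 1: "g p (tadd x (tscale a y)) z = g p x z+a*g p y z" using g_add[OF p that(1) tscale_in[OF that(2)] that(3)] g_sc[OF p that(2,3)] by simp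
  show "g p z (tadd x (tscale a y)) = g p z x+a*g p z y" using 1 g_sym[OF p that(3)] that tadd_in tscale_in by metis
 qed
 have z0: "g p tzero x = 0" if "x : tsp p" for x using g_sc[OF p tzero_in that, of 0] by (simp add: tscale_def tzero_def)
 define ta where "ta = - g p t t"
 have ta: "ta>0" using t by (simp add: ta_def)
 define u where "u x = tadd x (tscale (g p t x/ta) t)" for x
 have u: "u x : tsp p" if "x : tsp p" for x unfolding u_def by (intro tadd_in tscale_in that t)
 have tu: "g p t (u x) = 0" if "x : tsp p" for x using axpy(2)[OF that t(1) t(1)] ta by (simp add: u_def ta_def field_simps)
 have uu: "g p (u x) (u y) = g p x y+g p t x*g p t y/ta" if x: "x : tsp p" and y: "y : tsp p" for x y
 proof -
  have "g p (u x) (u y) = g p x (u y)+g p t x/ta*g p t (u y)" unfolding u_def[of x] by (rule axpy(1)[OF x t(1) u[OF y]])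
  also have "... = g p x (u y)" using tu[OF y] by simp
  also have "... = g p x y+g p t y/ta*g p x t" unfolding u_def by (rule axpy(2)[OF y t(1) x])
  finally show ?thesis using g_sym[OF p x t(1)] by simp
 qed
 have upos: "g p (u x) (u x) >= 0" and uz: "g p (u x) (u x) = 0 ==> u x = tzero" if "x : tsp p" for x using pos[OF u[OF that] _ tu[OF that]] z0[OF tzero_in] by (cases "u x = tzero"; force)+
 define a b where "a = g p t T" and "b = g p t v"
 define P Q R where "P = g p (u T) (u T)" and "Q = g p (u v) (u v)" and "R = g p (u T) (u v)"
 have PQR: "P = -1+a^2/ta" "Q = g p v v+b^2/ta" "R = a*b/ta"
  using uu[OF T(1) T(1)] uu[OF v(1) v(1)] uu[OF T(1) v(1)] T(2) v(2) by (simp_all add: P_def Q_def R_def a_def b_def power2_eq_square)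
 have cs: "R^2 <= P*Q"
 proof (cases "P = 0")
  case True
  hence "u T = tzero" using uz[OF T(1)] by (simp add: P_def)
  thus ?thesis using z0[OF u[OF v(1)]] True by (simp add: R_def)
 next
  case False
  hence P: "P>0" using upos[OF T(1)] by (simp add: P_def)
  \<comment> \<open>The component of \<open>u v\<close> orthogonal to \<open>u T\<close>; that its
    square is nonnegative is the Cauchy--Schwarz inequality.\<close>
  let ?x = "tadd (u v) (tscale (- R/P) (u T))"
  have x: "?x : tsp p" by (intro tadd_in tscale_in u v T)
  have tx: "g p t ?x = 0" using axpy(2)[OF u[OF v(1)] u[OF T(1)] t(1), of "- R/P"] tu v(1) T(1) by simp
  have "g p ?x ?x >= 0" using pos[OF x _ tx] z0[OF tzero_in] by (cases "?x = tzero") (simp, force)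
  moreover have "g p ?x ?x = Q-R^2/P" using axpy(1)[OF u[OF v(1)] u[OF T(1)] x, of "- R/P"] axpy(2)[OF u[OF v(1)] u[OF T(1)] u[OF v(1)], of "- R/P"]
    axpy(2)[OF u[OF v(1)] u[OF T(1)] u[OF T(1)], of "- R/P"] g_sym[OF p u[OF v(1)] u[OF T(1)]] P
   by (simp add: P_def[symmetric] Q_def[symmetric] R_def[symmetric] power2_eq_square field_simps)
  ultimately have "R^2/P <= Q" by linarith
  thus ?thesis using P by (simp add: pos_divide_le_eq mult.commute)
 qed
 have Q0: "Q >= 0" "P >= 0" using upos T(1) v(1) by (auto simp: P_def Q_def)
 have R2: "R^2 = (P+1)*(b^2/ta)" unfolding PQR using ta by (simp add: power2_eq_square field_simps)
 show ?thesis
 proof (cases "Q = 0")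
  case True
  hence "(P+1)*(b^2/ta) <= 0" using cs R2 by simp
  hence "b^2/ta <= 0" using Q0 zero_less_mult_iff[of "P+1" "b^2/ta"] by (metis add_nonneg_pos not_le zero_less_one)
  hence "b = 0" using ta by (simp add: divide_le_0_iff)
  moreover have "u v = tzero" using uz[OF v(1)] True by (simp add: Q_def)
  ultimately have "v = tzero" using ta by (simp add: u_def b_def[symmetric] tadd_def tscale_def)
  thus ?thesis using v by simp
 next
  case False
  hence Q: "Q>0" using Q0 by simp
  have "(P+1)*(b^2/ta)<(P+1)*Q" using cs R2 Q by (simp add: algebra_simps)
  hence "b^2/ta<Q" by (rule mult_left_less_imp_less) (use Q0 in simp)
  thus ?thesis using PQR by simp
 qed
qed

section \<open>Averages over a rotation invariant distribution\<close>

lemma Ck_on_sin_cos: "Ck_on k UNIV (sin :: real => real) & Ck_on k UNIV (cos :: real => real)"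
proof (induction k)
 case 0
 show ?case by (simp add: continuous_on_sin continuous_on_cos continuous_on_id)
next
 case (Suc k)
 have s: "(sin has_derivative (%v. v * cos x)) (at x)" for x :: real using DERIV_sin[of x] unfolding has_field_derivative_def by (rule has_derivative_eq_rhs) (simp add: fun_eq_iff)
 have c: "(cos has_derivative (%v. v * - sin x)) (at x)" for x :: real using DERIV_cos[of x] unfolding has_field_derivative_def by (rule has_derivative_eq_rhs) (simp add: fun_eq_iff)
 have "Ck_on (Suc k) UNIV (sin :: real => real)" by (rule Ck_on_SucI[OF s _ open_UNIV], rule Ck_on_mult[OF open_UNIV Ck_on_c]) (use Suc in blast)
 moreover have "Ck_on (Suc k) UNIV (cos :: real => real)" by (rule Ck_on_SucI[OF c _ open_UNIV], rule Ck_on_mult[OF open_UNIV Ck_on_c], rule Ck_on_minus[OF open_UNIV]) (use Suc in blast)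
 ultimately show ?case by blast
qed

lemma smo_sin_comp [smooth_intros]:
 fixes f :: "'b::real_normed_vector => real" shows "open S ==> smo S f ==> smo S (%x. sin (f x))" by (rule smo_comp[OF _ open_UNIV _ _ ]) (auto simp: smooth_on_def Ck_on_sin_cos)

lemma smo_cos_comp [smooth_intros]:
 fixes f :: "'b::real_normed_vector => real" shows "open S ==> smo S f ==> smo S (%x. cos (f x))" by (rule smo_comp[OF _ open_UNIV _ _ ]) (auto simp: smooth_on_def Ck_on_sin_cos)

text \<open>The box contains the support of \<open>plateau 1\<close>, the ball of radius 2, and is
  contained in the open ball of radius 4, on which the integrands are assumed smooth.\<close>

definition cube :: "(real^3) set" where "cube = cbox (\<chi> i. - 2) (\<chi> i. 2)"

lemma cube_norm: "x : cube ==> norm x<4"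
proof -
 assume "x : cube"
 hence "- 2 <= x$i & x$i <= 2" for i by (simp add: cube_def mem_box_cart)
 hence "\<bar>x$i\<bar> <= 2" for i by (simp add: abs_le_iff minus_le_iff)
 hence "(x$i)^2 <= 2^2" for i using power_mono[of "\<bar>x$i\<bar>" 2 2] by simp
 moreover have "(norm x)^2 = (x$1)^2+(x$2)^2+(x$3)^2" unfolding power2_norm_eq_inner inner_vec_def sum_3 by (simp add: power2_eq_square)
 ultimately have "(norm x)^2 <= 2^2+2^2+2^2" by (simp only: add_mono)
 hence "(norm x)^2<4^2" by simp
 thus ?thesis by (rule power2_less_imp_less) simp
qed

lemma cube_sub: "cube <= ball 0 4" using cube_norm by (auto simp: dist_norm)

lemma ball_cube: "norm x <= 2 ==> x : cube" unfolding cube_def mem_box_cart vec_lambda_beta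
proof (intro allI)
 fix i assume "norm x <= 2"
 thus "- 2 <= x$i & x$i <= 2" using component_le_norm_cart[of x i] by linarith
qed

lemma plat_cont: "continuous_on S (plateau 1)" using smo_cont[OF plat_sm[of 1]] continuous_on_subset by auto

definition mass :: real where "mass = integral cube (plateau 1)"

text \<open>Expectation for the probability density proportional to \<open>plateau 1\<close>. A
  smooth radial density of compact support, in place of the uniform measure on a sphere, keeps
  everything an integral over a box that depends smoothly on parameters.\<close>

definition Ex :: "(real^3 => real) => real" where "Ex F = integral cube (%x. plateau 1 x*F x)/mass"

lemma cube_box: "box (\<chi> i. - 2) (\<chi> i. 2) ~= ({} :: (real^3) set)" by (simp add: interval_ne_empty_cart)

lemma cube_positive: assumes F: "continuous_on cube F" "!!x. x : cube ==> F x >= 0" and x: "norm x <= 1" "F x>0" shows "integral cube (%x. plateau 1 x*F x)>0"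
proof -
 let ?G = "%x. plateau 1 x*F x"
 have c: "continuous_on cube ?G" by (rule continuous_on_mult[OF plat_cont F(1)])
 have nn: "?G x >= 0" if "x : cube" for x using plat_range[of 1 x] F(2)[OF that] by simp
 have xc: "x : cube" by (rule ball_cube) (use x in simp)
 have "?G x>0" using x plat_one[of 1 x] by simp
 hence "integral cube ?G ~= 0" using integral_cbox_eq_0_iff[OF c[unfolded cube_def] cube_box] nn xc unfolding cube_def by force
 moreover have "integral cube ?G >= 0" by (rule integral_nonneg) (use c nn in "auto simp: cube_def intro: integrable_continuous")
 ultimately show ?thesis by simp
qed

lemma mass_pos: "mass>0" using cube_positive[of "%_. 1" 0] by (simp add: mass_def)

lemma Ex_integrable: "continuous_on cube F ==> (%x. plateau 1 x*F x) integrable_on cube" unfolding cube_def by (rule integrable_continuous, rule continuous_on_mult[OF plat_cont])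

lemma Ex_cong: "(!!x. x : cube ==> F x = G x) ==> Ex F = Ex G" unfolding Ex_def by (rule arg_cong[where f = "%x. x/mass"], rule integral_cong) simp

lemma Ex_add: "continuous_on cube F ==> continuous_on cube G ==> Ex (%x. F x+G x) = Ex F+Ex G"
 using integral_add[OF Ex_integrable Ex_integrable, of F G] by (simp add: Ex_def distrib_left add_divide_distrib)

lemma Ex_cmul: "Ex (%x. c*F x) = c*Ex F"
proof -
 have "(%x. plateau 1 x*(c*F x)) = (%x. c*(plateau 1 x*F x))" by auto
 thus ?thesis by (simp add: Ex_def integral_mult_right)
qed

lemma Ex_c: "Ex (%x. c) = c" using mass_pos by (simp add: Ex_def mass_def)

lemma Ex_sum: "(!!i. i : I ==> continuous_on cube (F i)) ==> Ex (%x. SUM i:I. F i x) = (SUM i:I. Ex (F i))"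
proof (induction I rule: infinite_finite_induct)
 case (insert i I)
 thus ?case using Ex_add[of "F i" "%x. SUM i:I. F i x"] by (simp add: continuous_on_sum)
qed (use Ex_c[of 0] in auto)

lemma Ex_mono: "continuous_on cube F ==> continuous_on cube G ==> (!!x. x : cube ==> F x <= G x) ==> Ex F <= Ex G" unfolding Ex_def
 by (intro divide_right_mono integral_le Ex_integrable mult_left_mono) (use mass_pos plat_range[of 1] in auto)

lemma Ex_bound: "continuous_on cube F ==> (!!x. x : cube ==> \<bar>F x\<bar> <= b) ==> \<bar>Ex F\<bar> <= b"
proof -
 assume F: "continuous_on cube F" "!!x. x : cube ==> \<bar>F x\<bar> <= b"
 have "- b <= F x & F x <= b" if "x : cube" for x using F(2)[OF that] by linarith
 hence "Ex F <= b" "Ex (%x. - b) <= Ex F" using Ex_mono[OF F(1) continuous_on_const[of _ b]] Ex_mono[OF continuous_on_const[of _ "-b"] F(1)] by (auto simp: Ex_c)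
 thus ?thesis by (simp add: Ex_c)
qed

text \<open>The cube is not invariant, but the weight vanishes outside \<open>cball 0 2\<close>; so
  the integral may be taken over that ball, which \<open>f\<close> preserves together with the
  weight and the volume.\<close>

lemma Ex_rotate: assumes Or: "orthogonal_transformation (f :: real^3 => real^3)" and F: "continuous_on (ball 0 4) F" shows "Ex (%x. F (f x)) = Ex F"
proof -
 have lin: "linear f" and nf: "norm (f x) = norm x" for x using Or by (auto simp: orthogonal_transformation)
 have pl: "plateau 1 (f x) = plateau 1 x" for x using nf[of x] by (simp add: plateau_def dot_square_norm)
 have *: "integral cube (%x. plateau 1 x*G x) = integral (cball 0 2) (%x. plateau 1 x*G x)" for G
 proof -
  have "(if x : cube then plateau 1 x*G x else 0) = (if x : cball 0 2 then plateau 1 x*G x else 0)" for x using ball_cube[of x] plat_zero[of 1 x] by auto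
  thus ?thesis using integral_restrict_UNIV[of cube "%x. plateau 1 x*G x"] integral_restrict_UNIV[of "cball 0 2" "%x. plateau 1 x*G x"] by simp
 qed
 have im: "f ` cball 0 2 = cball 0 2" using image_orthogonal_transformation_cball[OF Or, of 0 2] lin by (simp add: linear_0)
 have det: "\<bar>det (matrix f)\<bar> = 1" using Or orthogonal_transformation_det by blast
 have cF: "continuous_on cube F" using F cube_sub continuous_on_subset by blast
 have "(%x. plateau 1 x*F x) absolutely_integrable_on cube" unfolding cube_def by (rule absolutely_integrable_continuous, rule continuous_on_mult[OF plat_cont])
    (use cF in "simp add: cube_def")
 hence "(%x. plateau 1 x*F x) absolutely_integrable_on cball 0 2" by (rule set_integrable_subset) (use ball_cube in auto)
 hence "integral (f ` cball 0 2) (%x. vec (plateau 1 x*F x) :: real^1) =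
   \<bar>det (matrix f)\<bar> *R integral (cball 0 2) ((%x. vec (plateau 1 x*F x)) \<circ> f)"
  by (intro integral_change_of_variables_linear lin) (simp add: im absolutely_integrable_on_1_iff)
 from arg_cong[OF this, of "%v. v$1"]
 have "integral (f ` cball 0 2) (%x. plateau 1 x*F x) =
   \<bar>det (matrix f)\<bar> *R integral (cball 0 2) ((%x. plateau 1 x*F x) \<circ> f)" by (simp add: integral_on_1_eq o_def)
 hence "integral (cball 0 2) (%x. plateau 1 x*F (f x)) = integral (cball 0 2) (%x. plateau 1 x*F x)" by (simp add: im det o_def pl)
 thus ?thesis unfolding Ex_def *[of "%x. F (f x)"] *[of F] by simp
qed

definition rot :: "3 => 3 => real => real^3 => real^3" where "rot i j t x = (\<chi> k. if k = i then cos t*x$i-sin t*x$j else if k = j then sin t*x$i + cos t*x$j else x$k)"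

definition skw :: "3 => 3 => real^3 => real^3" where "skw i j x = (\<chi> k. if k = i then-x$j else if k = j then x$i else 0)"

lemma rot_orthogonal: assumes "i ~= j" shows "orthogonal_transformation (rot i j t)"
proof -
 have lin: "linear (rot i j t)" by (rule linearI) (auto simp: rot_def vec_eq_iff algebra_simps)
 have "(rot i j t x) \<bullet> (rot i j t x) = x \<bullet> x" for x
 proof -
  have g: "(c*a-d*b)*(c*a-d*b)+(d*a + c*b)*(d*a + c*b) = (d*d + c * c)*(a*a+b*b)" for a b c d :: real by (simp add: algebra_simps)
  have e: "(cos t*a-sin t*b)*(cos t*a-sin t*b)+(sin t*a + cos t*b)*(sin t*a + cos t*b) = a*a+b*b" for a b
   using g[of "cos t" a "sin t" b] sin_cos_squared_add[of t] by (simp add: power2_eq_square)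
  show ?thesis using assms e[of "x$i" "x$j"] exhaust_3[of i] exhaust_3[of j] by (auto simp: rot_def inner_vec_def sum_3)
 qed
 thus ?thesis using lin by (simp add: orthogonal_transformation norm_eq_sqrt_inner)
qed

lemma rot_deriv: "((%t. rot i j t x) has_derivative (%h. h*Rskw i j x)) (at 0)"
proof -
 have "((%t. rot i j t x$k) has_derivative (%h. (h*Rskw i j x)$k)) (at 0)" for k by (cases "k = i"; cases "k = j") (auto simp: rot_def skw_def intro!: derivative_eq_intros)
 thus ?thesis by (subst has_derivative_componentwise_within) (auto simp: Basis_vec_def inner_axis)
qed

lemma rot_sm: "smo UNIV (%z. rot i j (fst z) (snd z))" unfolding rot_def
proof (rule smo_vec_lambda[OF open_UNIV])
 fix k
 have f: "smo UNIV (%z::real \<times> (real^3). fst z)" and s: "smo UNIV (%z::real \<times> (real^3). snd z)"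
  by (rule smo_fst[OF open_UNIV smo_id], simp, rule smo_snd[OF open_UNIV smo_id], simp)
 note n = smo_vec_nth[OF open_UNIV s] and sc = smo_sin_comp[OF open_UNIV f] smo_cos_comp[OF open_UNIV f]
 note m = smo_mult[OF open_UNIV]
 show "smo UNIV (%z::real \<times> (real^3). if k = i then cos (fst z) * snd z$i-sin (fst z) * snd z$j
   else if k = j then sin (fst z) * snd z$i + cos (fst z) * snd z$j else snd z$k)" using smo_diff[OF open_UNIV m[OF sc(2) n] m[OF sc(1) n], of i j]
   smo_add[OF open_UNIV m[OF sc(1) n] m[OF sc(2) n], of i j] n[of k] by (cases "k = i"; cases "k = j") simp_all
qed

text \<open>The mean of \<open>F\<close> composed with a rotation does not depend on the angle;
  differentiate at angle 0 under the integral.\<close>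

lemma Ex_rot_deriv: assumes ij: "i ~= j" and F: "smo (ball 0 4) F" shows "Ex (%x. fd F x (skw i j x)) = 0"
proof -
 let ?r = "%z. rot i j (fst z) (snd z)"
 define G where "G z = plateau 1 (snd z)*F (?r z)" for z :: "real \<times> (real^3)"
 define W where "W = (UNIV :: real set) \<times> ball (0 :: real^3) 4"
 have W: "open W" by (simp add: W_def open_Times)
 have nr: "norm (rot i j t x) = norm x" for t x using rot_orthogonal[OF ij] by (simp add: orthogonal_transformation)
 have Fr: "smo W (%z. F (?r z))" by (rule smo_comp[OF W open_ball _ smo_sub[OF rot_sm] F]) (auto simp: W_def nr)
 have pl: "smo W (%z. plateau 1 (snd z))" by (rule smo_comp[OF W open_UNIV _ smo_snd[OF W smo_id[OF W]] plat_sm]) auto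
 have G: "smo W G" unfolding G_def by (rule smo_mult[OF W pl Fr])
 have "integral cube (%x. G (t,x)) = mass*Ex F" for t using Ex_rotate[OF rot_orthogonal[OF ij] smo_cont[OF F], of t] mass_pos by (simp add: G_def Ex_def)
 hence c: "((%t. integral cube (%x. G (t,x))) has_derivative (%h. 0)) (at 0)" by simp
 have "((%t. integral cube (%x. G (t,x))) has_derivative (%h. integral cube (%x. fd G (0,x) (h,0)))) (at 0)" unfolding cube_def by (rule integral_deriv_parameter[OF open_UNIV W _ G])
    (use cube_sub in "auto simp: W_def cube_def")
 from fun_cong[OF has_derivative_unique[OF this c], of 1]
 have "integral cube (%x. fd G (0,x) (1,0)) = 0" .
 moreover have "fd G (0,x) (1,0) = plateau 1 x*fd F x (skw i j x)" if x: "x : cube" for x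
 proof -
  have x4: "x : ball 0 4" and xW: "(0,x) : W" using x cube_sub by (auto simp: W_def)
  have r0: "rot i j 0 x = x" by (auto simp: rot_def vec_eq_iff)
  have "((%t. (t,x)) has_derivative (%h. (h,0))) (at (0::real))" by (rule has_derivative_Pair[OF has_derivative_ident has_derivative_const])
  from has_derivative_compose[OF this smooth_on_has_derivative[OF G xW]]
  have 1: "((%t. G (t,x)) has_derivative (%h. fd G (0,x) (h,0))) (at 0)" .
  have "(F has_derivative fd F x) (at (rot i j 0 x))" unfolding r0 by (rule smooth_on_has_derivative[OF F x4])
  from has_derivative_mult_right[OF has_derivative_compose[OF rot_deriv this], of "plateau 1 x"]
  have 2: "((%t. G (t,x)) has_derivative (%h. plateau 1 x*fd F x (h*Rskw i j x))) (at 0)" by (simp add: G_def)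
  from fun_cong[OF has_derivative_unique[OF 1 2], of 1] show ?thesis by simp
 qed
 ultimately have "integral cube (%x. plateau 1 x*fd F x (skw i j x)) = 0" by (metis (mono_tags, lifting) integral_cong)
 thus ?thesis by (simp add: Ex_def)
qed

definition skew_apply :: "(3 => 3 => real) => real^3 => real^3" where "skew_apply B x = (\<chi> i. SU j. B i j*x$j)"

lemma cube_deriv_cont:
 fixes F :: "real^3 => real" assumes F: "smo (ball 0 4) F" and h: "continuous_on cube (h :: real^3 => real^3)" shows "continuous_on cube (%x. fd F x (h x))"
proof -
 have "continuous_on cube (%x. SU i. h x$i*fd F x (axis i 1))" by (intro continuous_on_sum continuous_on_mult continuous_on_component[OF h]
    continuous_on_subset[OF smo_cont[OF smooth_on_deriv[OF F]] cube_sub])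
 moreover have "(SU i. h x$i*fd F x (axis i 1)) = fd F x (h x)" if "x : cube" for x
 proof -
  interpret bounded_linear "fd F x" using smooth_on_has_derivative[OF F] cube_sub that has_derivative_bounded_linear by blast
  have "h x = (SU i. h x$i*Raxis i 1)" by (simp add: vec_eq_iff axis_def if_distrib cong: if_cong)
  thus ?thesis by (metis (mono_tags, lifting) sum scaleR real_scaleR_def sum.cong)
 qed
 ultimately show ?thesis by (rule continuous_on_eq)
qed

text \<open>A skew matrix is a combination of the three generators \<open>skw\<close>. This is what
  allows the direction to be turned at will while an average is differentiated.\<close>

lemma Ex_skew_deriv: assumes B: "!!i j. B i j = - B j i" and F: "smo (ball 0 4) F" shows "Ex (%x. fd F x (skew_apply B x)) = 0"
proof -
 have diag: "B i i = 0" for i using B[of i i] by simp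
 have sk: "skew_apply B x = - B 1 2*Rskw 1 2 x-B 1 3*Rskw 1 3 x-B 2 3*Rskw 2 3 x" for x unfolding vec_eq_iff forall_3 using B[of 2 1] B[of 3 1] B[of 3 2]
  by (simp add: skew_apply_def skw_def sum_3 diag)
 have cs: "continuous_on cube (skw i j)" for i j unfolding skw_def by (rule continuous_on_vec_lambda, rename_tac k) (case_tac "k = i"; case_tac "k = j"; auto intro!: continuous_intros)
 let ?D = "%i j x. fd F x (skw i j x)"
 note c = cube_deriv_cont[OF F cs]
 have "Ex (%x. fd F x (skew_apply B x)) =
   Ex (%x. (- B 1 2*?D 1 2 x + - B 1 3*?D 1 3 x) + - B 2 3*?D 2 3 x)"
 proof (rule Ex_cong)
  fix x assume "x : cube"
  then interpret bounded_linear "fd F x" using smooth_on_has_derivative[OF F] cube_sub has_derivative_bounded_linear by blast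
  show "fd F x (skew_apply B x) = (- B 1 2*?D 1 2 x + - B 1 3*?D 1 3 x) + - B 2 3*?D 2 3 x" unfolding sk by (simp add: diff scaleR linear_neg[OF linear])
 qed
 also have "... = (- B 1 2*Ex (?D 1 2) + - B 1 3*Ex (?D 1 3)) + - B 2 3*Ex (?D 2 3)" unfolding Ex_cmul[symmetric]
  by (subst Ex_add, rule continuous_on_add, (rule continuous_on_mult[OF continuous_on_const c])+, subst Ex_add) (rule continuous_on_mult[OF continuous_on_const c] refl)+
 finally show ?thesis using Ex_rot_deriv[OF _ F] by simp
qed

definition second_moment :: real where "second_moment = Ex (%x. x$1*x$1)"

lemma cont_coord: "continuous_on S (%x::real^3. x$i*x$j)" by (intro continuous_intros)

text \<open>A quarter turn reverses the sign of a mixed product and exchanges squares, so second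
  moments are isotropic. Averaging a quadratic form thus yields its trace, and this is how the Ricci
  tensor arises from the curvature tensor.\<close>

lemma Ex_coord: "Ex (%x. x$i*x$j) = (if i = j then second_moment else 0)"
proof -
 have r: "rot i j (pi/2) x$i = - x$j" "i ~= j ==> rot i j (pi/2) x$j = x$i" for x i j by (simp_all add: rot_def)
 have off: "Ex (%x. x$i*x$j) = 0" if "i ~= j" for i j
 proof -
  have "Ex (%x. rot i j (pi/2) x$i*rot i j (pi/2) x$j) = Ex (%x. x$i*x$j)" by (rule Ex_rotate[OF rot_orthogonal[OF that] cont_coord])
  hence "Ex (%x. (-1)*(x$i*x$j)) = Ex (%x. x$i*x$j)" using that by (simp add: r mult.commute)
  thus ?thesis unfolding Ex_cmul by simp
 qed
 have sq: "Ex (%x. x$i*x$i) = Ex (%x. x$j*x$j)" if "i ~= j" for i j using Ex_rotate[OF rot_orthogonal[OF that] cont_coord[of _ i i], of "pi/2"] by (simp add: r)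
 have "Ex (%x. x$i*x$i) = second_moment" for i unfolding second_moment_def using sq[of i 1] by (cases "i = 1") simp_all
 thus ?thesis using off by simp
qed

lemma mom2_pos: "second_moment>0"
proof -
 let ?x = "axis 1 1 :: real^3"
 have "integral cube (%x. plateau 1 x*(x$1*x$1))>0" by (rule cube_positive[where x = ?x, OF cont_coord]) (simp_all add: norm_axis_1)
 thus ?thesis using mass_pos by (simp add: second_moment_def Ex_def)
qed

lemma Ex_quadratic: "Ex (%x. SU i. SU j. x$i*x$j*q i j) = second_moment*(SU i. q i i)"
proof -
 have "Ex (%x. SU i. SU j. q i j*(x$i*x$j)) = (SU i. SU j. q i j*Ex (%x. x$i*x$j))" unfolding Ex_cmul[symmetric]
  by (subst Ex_sum, intro continuous_on_sum continuous_on_mult continuous_on_const cont_coord, subst Ex_sum,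
    rule continuous_on_mult[OF continuous_on_const cont_coord]) (rule refl)
 also have "... = (SU i. q i i * second_moment)" by (simp add: Ex_coord if_distrib cong: if_cong)
 finally show ?thesis by (simp add: mult.commute sum_distrib_left)
qed

lemma Ex_sm:
 fixes F :: "'b::euclidean_space \<times> (real^3) => real" assumes S: "open S" and F: "smo (S \<times> ball 0 4) F" shows "smo S (%y. Ex (%x. F (y,x)))"
  "y : S ==> fd (%y. Ex (%x. F (y,x))) y v = Ex (%x. fd F (y,x) (v,0))"
proof -
 let ?W = "S \<times> ball (0 :: real^3) 4"
 have W: "open ?W" using S by (simp add: open_Times)
 have WS: "S \<times> cbox (\<chi> i. - 2) (\<chi> i. 2) <= ?W" using cube_sub by (auto simp: cube_def)
 have pl: "smo ?W (%z. plateau 1 (snd z))" by (rule smo_comp[OF W open_UNIV _ smo_snd[OF W smo_id[OF W]] plat_sm]) auto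
 define G where "G z = plateau 1 (snd z)*F z" for z
 have G: "smo ?W G" unfolding G_def by (rule smo_mult[OF W pl F])
 have eq: "Ex (%x. F (y,x)) = integral (cbox (\<chi> i. - 2) (\<chi> i. 2)) (%x. G (y,x))*inverse mass" for y by (simp add: Ex_def G_def cube_def divide_inverse)
 show "smo S (%y. Ex (%x. F (y,x)))" unfolding eq by (rule smo_mult[OF S smo_integral[OF S W WS G] smo_c])
 assume y: "y : S"
 have "((%y. Ex (%x. F (y,x))) has_derivative (%v. integral (cbox (\<chi> i. - 2) (\<chi> i. 2)) (%x. fd G (y,x) (v,0))*inverse mass)) (at y)"
  unfolding eq by (rule has_derivative_mult_left[OF integral_deriv_parameter[OF S W WS G y]])
 from fun_cong[OF frechet_derivative_at[OF this], of v]
 have "fd (%y. Ex (%x. F (y,x))) y v =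
   integral cube (%x. fd G (y,x) (v,0))*inverse mass" by (simp add: cube_def)
 also have "integral cube (%x. fd G (y,x) (v,0)) =
   integral cube (%x. plateau 1 x*fd F (y,x) (v,0))"
 proof (rule integral_cong)
  fix x assume "x : cube"
  hence z: "(y,x) : ?W" using y cube_sub by auto
  have "((%y. (y,x)) has_derivative (%h. (h,0))) (at y)" by (rule has_derivative_Pair[OF has_derivative_ident has_derivative_const])
  note c = has_derivative_compose[OF this]
  from has_derivative_mult_right[OF c[OF smooth_on_has_derivative[OF F z]], of "plateau 1 x"]
  have "((%y. G (y,x)) has_derivative (%v. plateau 1 x*fd F (y,x) (v,0))) (at y)" by (simp add: G_def)
  from fun_cong[OF has_derivative_unique[OF c[OF smooth_on_has_derivative[OF G z]] this], of v]
  show "fd G (y,x) (v,0) = plateau 1 x*fd F (y,x) (v,0)" .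
 qed
 finally show "fd (%y. Ex (%x. F (y,x))) y v = Ex (%x. fd F (y,x) (v,0))" by (simp add: Ex_def divide_inverse)
qed

section \<open>Averages along approximate geodesics in a coordinate patch\<close>

definition bil :: "(3 => 3 => 'b::real_normed_vector) => real^3 => real^3 => 'b" where "bil B u v = (SU i. SU j. (u$i * v$j)*RB i j)"

lemma bil_add_left: "bil B (u+u') v = bil B u v+bil B u' v" and bil_add_right: "bil B u (v+v') = bil B u v+bil B u v'" and bil_sc_left: "bil B (c*Ru) v = c*Rbil B u v"
 and bil_sc_right: "bil B u (c*Rv) = c*Rbil B u v" by (simp_all add: bil_def sum_3 algebra_simps)

lemma bil_minus_left: "bil B (- u) v = - bil B u v" and bil_minus_right: "bil B u (- v) = - bil B u v" using bil_sc_left[of B "-1" u v] bil_sc_right[of B u "-1" v] by simp_all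

lemma bil_diff_left: "bil B (u-u') v = bil B u v-bil B u' v" and bil_diff_right: "bil B u (v-v') = bil B u v-bil B u v'"
 using bil_add_left[of B u "- u'" v] bil_add_right[of B u v "- v'"] by (simp_all add: bil_minus_left bil_minus_right)

lemma bil_sum_left: "finite I ==> bil B (SUM i:I. u i) v = (SUM i:I. bil B (u i) v)" and bil_sum_right: "finite I ==> bil B v (SUM i:I. u i) = (SUM i:I. bil B v (u i))"
 by (induction I rule: finite_induct; simp add: bil_add_left bil_add_right; simp add: bil_def)+

lemma bil_zero: "bil B 0 v = 0" "bil B u 0 = 0" by (simp_all add: bil_def)

lemmas bil_simps = bil_add_left bil_add_right bil_sc_left bil_sc_right bil_minus_left bil_minus_right
 bil_diff_left bil_diff_right bil_zero

lemma bil_axis: "bil B (axis i 1) (axis j 1) = B i j" using exhaust_3[of i] exhaust_3[of j] by (auto simp: bil_def sum_3 axis_def)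

lemma bil_sym: "(!!i j. B i j = B j i) ==> bil B u v = bil B v u" by (simp add: bil_def sum_3 algebra_simps)

lemma bil_deriv: assumes B: "!!i j. ((%x. B x i j) has_derivative B' i j) (at x)" and u: "(u has_derivative u') (at x)" and v: "(v has_derivative v') (at x)"
 shows "((%x. bil (B x) (u x) (v x)) has_derivative (%h. bil (%i j. B' i j h) (u x) (v x)+bil (B x) (u' h) (v x)+bil (B x) (u x) (v' h))) (at x)"
proof -
 have "((%x. u x$i * v x$j) has_derivative (%h. u x$i * v' h$j+u' h$i * v x$j)) (at x)" for i j
  by (rule has_derivative_mult[OF bounded_linear.has_derivative[OF bounded_linear_vec_nth u] bounded_linear.has_derivative[OF bounded_linear_vec_nth v]])
 from has_derivative_sum[OF has_derivative_sum[OF has_derivative_scaleR[OF this B]]]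
 show ?thesis unfolding bil_def by (rule has_derivative_eq_rhs) (simp add: sum_3 algebra_simps)
qed

lemma bil_sm [smooth_intros]: assumes S: "open S" and B: "!!i j. smo S (%x. B x i j)" and u: "smo S u" and v: "smo S v" shows "smo S (%x. bil (B x) (u x) (v x))" unfolding bil_def
 by (intro smo_sum smo_scR smo_mult smo_vec_nth S B u v)

lemma compact_tube:
 fixes phi :: "'b::euclidean_space \<times> 'c::euclidean_space => 'd::metric_space" assumes K: "compact K" and phi: "continuous_on UNIV phi" and V: "open V"
 shows "open {x. ALL t:K. phi (x,t) : V}"
proof -
 have o: "open (phi -` V)" using open_vimage[OF V phi] .
 have "EX T. open T & x : T & T <= {x. ALL t:K. phi (x,t) : V}" if "ALL t:K. phi (x,t) : V" for x
 proof -
  have "{x} \<times> K <= phi -` V" using that by auto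
  from Elementary_Topology.tube_lemma[OF K o this] obtain T where "open T" "x : T" "T \<times> K <= phi -` V" by auto
  thus ?thesis by auto
 qed
 thus ?thesis by (subst open_subopen) blast
qed

text \<open>Metric, Christoffel symbols and an orthonormal frame in coordinates. The data are smooth
  on the whole space, having been cut off, so that integrals and Taylor expansions need no care
  about domains; the geometric identities hold on \<open>U\<close> only.\<close>

locale patch =
 fixes gm :: "real^3 => 3 => 3 => real" and Gc :: "real^3 => 3 => 3 => real^3" and sg :: "3 => real^3 => real^3" and U :: "(real^3) set" assumes gm_smooth: "smo UNIV (%y. gm y i j)"
  and Gc_sm: "smo UNIV (%y. Gc y i j)" and sg_sm: "smo UNIV (sg i)" and U: "open U" and gm_sym: "y : U ==> gm y i j = gm y j i" and Gc_sym: "y : U ==> Gc y i j = Gc y j i"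
  and compat: "y : U ==> ((%y. bil (gm y) u v) has_derivative (%z. bil (gm y) (bil (Gc y) z u) v+bil (gm y) u (bil (Gc y) z v))) (at y)"
  and ortho: "y : U ==> bil (gm y) (sg i y) (sg j y) = (if i = j then 1 else 0)" and expand: "y : U ==> v = (SU i. bil (gm y) v (sg i y)*Rsg i y)"
begin

abbreviation "G y == bil (gm y)"
abbreviation "Ch y == bil (Gc y)"
definition "dCh y z = bil (%i j. fd (%y. Gc y i j) y z)"

definition "sgx x xi = (SU i. xi$i*Rsg i x)" for xi :: "real^3"

text \<open>Second order Taylor polynomial of the geodesic from \<open>x\<close> with initial
  velocity \<open>sgx x xi\<close>. Using it instead of the exponential map avoids solving
  differential equations.\<close>

definition "psi x xi e = x+e*Rsgx x xi-(e^2/2)*RCh x (sgx x xi) (sgx x xi)"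

text \<open>The variation of \<open>psi\<close> when \<open>x\<close> moves in direction
  \<open>v\<close> and the velocity \<open>sgx x xi\<close> is kept parallel, that is, changes by
  \<open>- Ch x v (sgx x xi)\<close>.\<close>

definition "Wf x v xi e = v-e*RCh x v (sgx x xi)
  - (e^2/2)*R(dCh x v (sgx x xi) (sgx x xi)-2*RCh x (Ch x v (sgx x xi)) (sgx x xi))"

definition "Rc x z u w = dCh x z u w-dCh x u z w+Ch x z (Ch x u w)-Ch x u (Ch x z w)"

lemma G_sym: "y : U ==> G y u v = G y v u" by (rule bil_sym[OF gm_sym])

lemma Ch_sym: "y : U ==> Ch y u v = Ch y v u" by (rule bil_sym[OF Gc_sym])

lemma G_pos: "y : U ==> G y v v = (SU i. (G y v (sg i y))^2)"
proof -
 assume y: "y : U"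
 have "G y v v = G y v (SU i. G y v (sg i y)*Rsg i y)" using expand[OF y, of v] by simp
 thus ?thesis by (simp add: bil_sum_right bil_sc_right power2_eq_square)
qed

lemma G_nonneg: "y : U ==> G y v v >= 0" by (simp add: G_pos sum_nonneg)

lemma deriv_sm_comp:
 fixes F :: "real^3 => 'b::real_normed_vector" assumes F: "smo UNIV F" and p: "(p has_derivative p') (at x)" shows "((%x. F (p x)) has_derivative (%h. fd F (p x) (p' h))) (at x)"
 by (rule has_derivative_compose[OF p smooth_on_has_derivative[OF F UNIV_I]])

lemma G_deriv: assumes px: "p x : U" and p: "(p has_derivative p') (at x)" and u: "(u has_derivative u') (at x)" and v: "(v has_derivative v') (at x)"
 shows "((%x. G (p x) (u x) (v x)) has_derivative (%h. G (p x) (u' h+Ch (p x) (p' h) (u x)) (v x)+G (p x) (u x) (v' h+Ch (p x) (p' h) (v x)))) (at x)"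
proof -
 let ?B = "%i j h. fd (%y. gm y i j) (p x) h"
 have "((%y. bil (gm y) (u x) (v x)) has_derivative (%h. bil (%i j. ?B i j h) (u x) (v x)+G (p x) 0 (v x)+G (p x) (u x) 0)) (at (p x))"
  by (rule bil_deriv[OF smooth_on_has_derivative[OF gm_smooth UNIV_I] has_derivative_const has_derivative_const])
 from has_derivative_unique[OF this compat[OF px]]
 have eq: "bil (%i j. ?B i j z) (u x) (v x) = G (p x) (Ch (p x) z (u x)) (v x)+G (p x) (u x) (Ch (p x) z (v x))" for z by (simp add: fun_eq_iff bil_zero)
 show ?thesis by (rule has_derivative_eq_rhs[OF bil_deriv[OF deriv_sm_comp[OF gm_smooth p] u v]]) (simp add: eq bil_add_left bil_add_right fun_eq_iff)
qed

lemma Ch_deriv: assumes p: "(p has_derivative p') (at x)" and u: "(u has_derivative u') (at x)" and v: "(v has_derivative v') (at x)" shows "((%x. Ch (p x) (u x) (v x)) has_derivative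
  (%h. dCh (p x) (p' h) (u x) (v x)+Ch (p x) (u' h) (v x)+Ch (p x) (u x) (v' h))) (at x)" unfolding dCh_def by (rule bil_deriv[OF deriv_sm_comp[OF Gc_sm p] u v])

lemma sgx_deriv: assumes p: "(p has_derivative p') (at x)" and u: "(u has_derivative u') (at x)" shows "((%x. sgx (p x) (u x)) has_derivative
   (%h. sgx (p x) (u' h)+(SU i. u x$i*Rfd (sg i) (p x) (p' h)))) (at x)" unfolding sgx_def
 by (rule has_derivative_eq_rhs[OF has_derivative_sum[OF has_derivative_scaleR[OF bounded_linear.has_derivative[OF bounded_linear_vec_nth u]
   deriv_sm_comp[OF sg_sm p]]]]) (simp add: sum.distrib add.commute)

lemma dCh_linear: "dCh y (a*Rz) u v = a*RdCh y z u v" "dCh y (- z) u v = - dCh y z u v"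
proof -
 have l: "linear (fd (%y. Gc y i j) y)" for i j using smooth_on_has_derivative[OF Gc_sm UNIV_I] has_derivative_linear by blast
 show "dCh y (a*Rz) u v = a*RdCh y z u v" "dCh y (- z) u v = - dCh y z u v" by (simp_all add: dCh_def bil_def sum_3 linear_cmul[OF l] linear_neg[OF l] algebra_simps)
qed

lemma dCh_sym: assumes x: "x : U" shows "dCh x z u v = dCh x z v u" unfolding dCh_def
proof (rule bil_sym)
 fix i j
 have "((%y. Gc y i j) has_derivative fd (%y. Gc y j i) x) (at x)" by (rule has_derivative_transform_within_open[OF smooth_on_has_derivative[OF Gc_sm UNIV_I] U x]) (rule Gc_sym)
 from has_derivative_unique[OF smooth_on_has_derivative[OF Gc_sm UNIV_I] this]
 show "fd (%y. Gc y i j) x z = fd (%y. Gc y j i) x z" by simp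
qed

lemma sgx_linear: "sgx x (u+v) = sgx x u+sgx x v" "sgx x (a*Ru) = a*Rsgx x u" by (simp_all add: sgx_def sum_3 algebra_simps)

lemma G_sgx: "x : U ==> G x (sgx x xi) (sg j x) = xi$j" by (simp add: sgx_def bil_sum_left bil_sc_left ortho if_distrib cong: if_cong)

lemma G_sgx_sgx: "x : U ==> G x (sgx x xi) (sgx x et) = xi \<bullet> et"
proof -
 assume x: "x : U"
 have "G x (sgx x xi) (sgx x et) = (SU j. et$j*G x (sgx x xi) (sg j x))" unfolding sgx_def[of x et] by (simp add: bil_sum_right bil_sc_right)
 thus ?thesis by (simp add: G_sgx[OF x] inner_vec_def mult.commute)
qed

lemma sgx_sm [smooth_intros]:
 fixes p :: "'b::real_normed_vector => real^3" assumes S: "open S" and p: "smo S p" and u: "smo S u" shows "smo S (%z. sgx (p z) (u z))" unfolding sgx_def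
 by (intro smo_sum smo_scR smo_vec_nth S u smo_comp[OF S open_UNIV UNIV_I p sg_sm])

lemma G_sm [smooth_intros]:
 fixes p :: "'b::real_normed_vector => real^3" assumes S: "open S" and p: "smo S p" and u: "smo S u" and v: "smo S v" shows "smo S (%z. G (p z) (u z) (v z))"
 by (rule bil_sm[OF S smo_comp[OF S open_UNIV UNIV_I p gm_smooth] u v])

lemma Ch_sm [smooth_intros]:
 fixes p :: "'b::real_normed_vector => real^3" assumes S: "open S" and p: "smo S p" and u: "smo S u" and v: "smo S v" shows "smo S (%z. Ch (p z) (u z) (v z))"
 by (rule bil_sm[OF S smo_comp[OF S open_UNIV UNIV_I p Gc_sm] u v])

lemma dCh_sm [smooth_intros]:
 fixes p :: "'b::real_normed_vector => real^3" assumes S: "open S" and p: "smo S p" and z: "smo S z" and u: "smo S u" and v: "smo S v" shows "smo S (%x. dCh (p x) (z x) (u x) (v x))"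
proof -
 have "fd (%y. Gc y i j) y w = (SU k. w$k*Rfd (%y. Gc y i j) y (axis k 1))" for i j y w
 proof -
  have l: "linear (fd (%y. Gc y i j) y)" using smooth_on_has_derivative[OF Gc_sm UNIV_I] has_derivative_linear by blast
  have "w = (SU k. w$k*Raxis k 1)" by (simp add: vec_eq_iff axis_def if_distrib cong: if_cong)
  from arg_cong[OF this, of "fd (%y. Gc y i j) y"] show ?thesis by (simp add: linear_sum[OF l] linear_cmul[OF l])
 qed
 note eq = this
 have "smo S (%x. SU k. z x$k*Rfd (%y. Gc y i j) (p x) (axis k 1))" for i j by (intro smo_sum smo_scR smo_vec_nth S z smo_comp[OF S open_UNIV UNIV_I p smooth_on_deriv[OF Gc_sm]])
 hence "smo S (%x. fd (%y. Gc y i j) (p x) (z x))" for i j by (simp only: eq[symmetric])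
 from bil_sm[OF S this u v] show ?thesis unfolding dCh_def .
qed

lemma psi_sm [smooth_intros]:
 fixes p :: "'b::real_normed_vector => real^3" assumes S: "open S" and p: "smo S p" and u: "smo S u" and e: "smo S e" shows "smo S (%z. psi (p z) (u z) (e z))"
 unfolding psi_def power2_eq_square by (intro smo_add smo_diff smo_scR smo_mult smo_divide smo_c Ch_sm sgx_sm assms) simp

lemma Wf_sm [smooth_intros]:
 fixes p :: "'b::real_normed_vector => real^3" assumes S: "open S" and p: "smo S p" and v: "smo S v" and u: "smo S u" and e: "smo S e" shows "smo S (%z. Wf (p z) (v z) (u z) (e z))"
 unfolding Wf_def power2_eq_square by (intro smo_add smo_diff smo_scR smo_mult smo_divide smo_c Ch_sm dCh_sm sgx_sm assms) simp

lemma psi_deriv: assumes x: "x : U" and s': "sgx x (u' v)+(SU i. xi$i*Rfd (sg i) x v) = - Ch x v (sgx x xi)" and der: "((%z. psi (fst z) (snd z) e) has_derivative D) (at (x,xi))"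
 shows "D (v,u' v) = Wf x v xi e"
proof -
 have f: "(fst has_derivative fst) (at (x,xi))" and s: "(snd has_derivative snd) (at (x,xi))"
  by (rule bounded_linear_imp_has_derivative[OF bounded_linear_fst], rule bounded_linear_imp_has_derivative[OF bounded_linear_snd])
 note sx = sgx_deriv[OF f s]
 note d = has_derivative_diff[OF has_derivative_add[OF f has_derivative_scaleR_right[OF sx, of e]]
  has_derivative_scaleR_right[OF Ch_deriv[OF f sx sx], of "e^2/2"]]
 note eq = fun_cong[OF has_derivative_unique[OF der[unfolded psi_def] d], of "(v,u' v)", unfolded fst_conv snd_conv s']
 have two: "(e^2/2)*R(2*y) = e^2*Ry" for y :: "real^3" by (simp add: vec_eq_iff)
 show ?thesis unfolding eq Wf_def using Ch_sym[OF x, of "sgx x xi"] by (simp add: bil_minus_left bil_minus_right two algebra_simps)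
qed

text \<open>Differentiating orthonormality shows that the frame turns against parallel transport by
  a skew matrix. Letting \<open>xi\<close> move by \<open>B\<close> undoes this turning, so that the
  velocity \<open>sgx x xi\<close> stays parallel to first order.\<close>

lemma frame_rotation: assumes x: "x : U" obtains B :: "3 => 3 => real" where "!!i j. B i j = - B j i" "!!xi. sgx x (skew_apply B xi)+(SU i. xi$i*Rfd (sg i) x v) = - Ch x v (sgx x xi)"
proof -
 let ?d = "%j. fd (sg j) x v"
 define z where "z j = - Ch x v (sg j x)-?d j" for j
 define B where "B i j = G x (z j) (sg i x)" for i j
 have "B i j = - B j i" for i j
 proof -
  have "((%y. G y (sg i y) (sg j y)) has_derivative (%h. 0)) (at x)"
  by (rule has_derivative_transform_within_open[OF _ U x])(use has_derivative_transform_within_open U has_derivative_const ortho in "auto")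
  note fun_cong[OF has_derivative_unique[OF G_deriv[OF x has_derivative_ident smooth_on_has_derivative[OF sg_sm UNIV_I] smooth_on_has_derivative[OF sg_sm UNIV_I]] this], of v]
  hence "G x (?d i+Ch x v (sg i x)) (sg j x)+G x (?d j+Ch x v (sg j x)) (sg i x) = 0" using G_sym[OF x, of "sg i x"] by simp
  thus ?thesis unfolding B_def z_def by (simp add: bil_simps)
 qed
 moreover have "sgx x (skew_apply B xi)+(SU i. xi$i*R?d i) = - Ch x v (sgx x xi)" for xi
 proof -
  have "sgx x (skew_apply B xi) = (SU j. xi$j*R(SU i. B i j*Rsg i x))" unfolding sgx_def skew_apply_def by (simp add: sum_3 algebra_simps)
  also have "... = (SU j. xi$j*Rz j)" unfolding B_def using expand[OF x] by simp
  also have "... = - Ch x v (sgx x xi)-(SU i. xi$i*R?d i)" unfolding z_def sgx_def by (simp add: sum_3 bil_add_right bil_sc_right algebra_simps)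
  finally show ?thesis by simp
 qed
 ultimately show thesis by (rule that)
qed

text \<open>Differentiation under the mean gives the variation with fixed \<open>xi\<close>, which
  depends on the turning of the frame. Adding the derivative in the direction
  \<open>skew_apply B xi\<close>, whose mean is 0, replaces it by the variation \<open>Wf\<close>
  with parallel velocity.\<close>

lemma average_deriv: assumes x: "x : U" and f: "smo U (f :: real^3 => real)" and K: "!!xi. xi : cball 0 4 ==> psi x xi e : U" shows "((%x. Ex (%xi. f (psi x xi e))) has_derivative
   (%v. Ex (%xi. fd f (psi x xi e) (Wf x v xi e)))) (at x)" "smo {x. ALL xi:cball 0 4. psi x xi e : U} (%x. Ex (%xi. f (psi x xi e)))" "open {x. ALL xi:cball 0 4. psi x xi e : U}"
proof -
 let ?S = "{x. ALL xi:cball 0 4. psi x xi e : U}"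
 let ?P = "%z. psi (fst z) (snd z) e"
 let ?F = "%z. f (?P z)"
 have P: "smo UNIV ?P" by (rule psi_sm[OF open_UNIV smo_fst[OF open_UNIV smo_id] smo_snd[OF open_UNIV smo_id] smo_c]) simp_all
 have S: "open ?S" using compact_tube[OF compact_cball smo_cont[OF P] U, of 0 4] by simp
 thus "open ?S" .
 have W: "open (?S \<times> ball 0 4)" using S by (simp add: open_Times)
 have F: "smo (?S \<times> ball 0 4) ?F" by (rule smo_comp[OF W U _ smo_sub[OF P] f]) auto
 from Ex_sm(1)[OF S F] show q: "smo ?S (%x. Ex (%xi. f (psi x xi e)))" by simp
 have xS: "x : ?S" using K by simp
 have "fd (%x. Ex (%xi. f (psi x xi e))) x v =
   Ex (%xi. fd f (psi x xi e) (Wf x v xi e))" for v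
 proof -
  obtain B where skew: "!!i j. B i j = - B j i" and B: "!!xi. sgx x (skew_apply B xi)+(SU i. xi$i*Rfd (sg i) x v) = - Ch x v (sgx x xi)" using frame_rotation[OF x] by blast
  have Fd: "(?F has_derivative fd ?F (x,xi)) (at (x,xi))" if "xi : ball 0 4" for xi using smooth_on_has_derivative[OF F, of "(x,xi)"] xS that by simp
  have pair: "((%xi. (x,xi)) has_derivative (%h. (0,h))) (at xi)" for xi :: "real^3" by (rule has_derivative_Pair[OF has_derivative_const has_derivative_ident])
  have Fx: "smo (ball 0 4) (%xi. ?F (x,xi))" by (rule smo_comp[OF open_ball W _ smo_Pair[OF open_ball smo_c smo_id[OF open_ball]] F]) (use xS in auto)
  have Fxd: "fd (%xi. ?F (x,xi)) xi w = fd ?F (x,xi) (0,w)" if "xi : ball 0 4" for xi w using fun_cong[OF frechet_derivative_at[OF has_derivative_compose[OF pair Fd[OF that]]], of w] by simp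
  have lin: "linear (skew_apply B)" by (rule linearI) (simp_all add: skew_apply_def vec_eq_iff sum_3 algebra_simps)
  have c1: "continuous_on cube (%xi. fd ?F (x,xi) (v,0))" by (rule continuous_on_compose2[OF smo_cont[OF smooth_on_deriv[OF F]] continuous_on_Pair[OF continuous_on_const continuous_on_id]])
     (use cube_sub xS in auto)
  have "continuous_on cube (%xi. fd (%xi. ?F (x,xi)) xi (skew_apply B xi))" by (rule cube_deriv_cont[OF Fx linear_continuous_on]) (use lin in "simp add: linear_conv_bounded_linear")
  hence c2: "continuous_on cube (%xi. fd ?F (x,xi) (0,skew_apply B xi))" by (rule continuous_on_eq) (use Fxd cube_sub in auto)
  have z: "Ex (%xi. fd ?F (x,xi) (0,skew_apply B xi)) = 0"
  proof (rule trans[OF Ex_cong Ex_skew_deriv[OF skew Fx]])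
   fix xi assume "xi : cube"
   thus "fd ?F (x,xi) (0,skew_apply B xi) = fd (%xi. ?F (x,xi)) xi (skew_apply B xi)" using Fxd cube_sub by auto
  qed
  have "fd (%x. Ex (%xi. f (psi x xi e))) x v = Ex (%xi. fd ?F (x,xi) (v,0))" using Ex_sm(2)[OF S F xS] by simp
  also have "... = Ex (%xi. fd ?F (x,xi) (v,0)+fd ?F (x,xi) (0,skew_apply B xi))" by (simp add: Ex_add[OF c1 c2] z)
  also have "... = Ex (%xi. fd f (psi x xi e) (Wf x v xi e))"
  proof (rule Ex_cong)
   fix xi assume "xi : cube"
   hence xi: "xi : ball 0 4" using cube_sub by auto
   have fd: "(f has_derivative fd f (?P (x,xi))) (at (?P (x,xi)))" using smooth_on_has_derivative[OF f] K xi by simp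
   have Pd: "(?P has_derivative fd ?P (x,xi)) (at (x,xi))" by (rule smooth_on_has_derivative[OF P UNIV_I])
   have "fd ?F (x,xi) (v,0)+fd ?F (x,xi) (0,skew_apply B xi)
     = fd ?F (x,xi) (v,skew_apply B xi)" using linear_add[OF has_derivative_linear[OF Fd[OF xi]], of "(v,0)" "(0,skew_apply B xi)"] by simp
   also have "... = fd f (?P (x,xi)) (fd ?P (x,xi) (v,skew_apply B xi))" using fun_cong[OF has_derivative_unique[OF Fd[OF xi] has_derivative_compose[OF Pd fd]]] by simp
   also have "fd ?P (x,xi) (v,skew_apply B xi) = Wf x v xi e" by (rule psi_deriv[where u' = "%_. skew_apply B xi", OF x B Pd])
   finally show "fd ?F (x,xi) (v,0)+fd ?F (x,xi) (0,skew_apply B xi)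
     = fd f (psi x xi e) (Wf x v xi e)" by simp
  qed
  finally show ?thesis .
 qed
 hence eq: "fd (%x. Ex (%xi. f (psi x xi e))) x = (%v. Ex (%xi. fd f (psi x xi e) (Wf x v xi e)))" by blast
 show "((%x. Ex (%xi. f (psi x xi e))) has_derivative (%v. Ex (%xi. fd f (psi x xi e) (Wf x v xi e)))) (at x)" using smooth_on_has_derivative[OF q xS] unfolding eq .
qed

text \<open>Here \<open>w'\<close> and \<open>p'\<close> are the derivatives of \<open>Wf\<close>
  and \<open>psi\<close> in \<open>e\<close>; so this is the covariant derivative of the variation
  field along the approximate geodesic.\<close>

definition "W1 x v xi e = (let s = sgx x xi; w' = - Ch x v s-e*R(dCh x v s s-2*RCh x (Ch x v s) s);
  p' = s-e*RCh x s s in w'+Ch (psi x xi e) p' (Wf x v xi e))"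

text \<open>At \<open>e = 0\<close> the curve satisfies the geodesic equation and the field has
  vanishing covariant derivative; so the second derivative of the squared length consists of the
  curvature term of the Jacobi equation alone.\<close>

lemma length_deriv: assumes p: "psi x xi e : U" shows "((%e. G (psi x xi e) (Wf x v xi e) (Wf x v xi e)) has_real_derivative
   2*G (psi x xi e) (W1 x v xi e) (Wf x v xi e)) (at e)" "x : U ==> W1 x v xi 0 = 0" "x : U ==> ((%e. 2*G (psi x xi e) (W1 x v xi e) (Wf x v xi e)) has_real_derivative
    2*G x (Rc x (sgx x xi) v (sgx x xi)) v) (at 0)"
proof -
 let ?s = "sgx x xi"
 let ?a = "dCh x v ?s ?s-2*RCh x (Ch x v ?s) ?s"
 have sq: "((%e. e^2/2) has_derivative (%h. h*e)) (at e)" for e :: real by (auto intro!: derivative_eq_intros)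
 note l = has_derivative_scaleR_left[OF has_derivative_ident] has_derivative_scaleR_left[OF sq]
 have pd: "((%e. psi x xi e) has_derivative (%h. h*R(?s-e*RCh x ?s ?s))) (at e)" for e
  unfolding psi_def by (rule has_derivative_eq_rhs[OF has_derivative_diff[OF has_derivative_add[OF has_derivative_const l(1)] l(2)]]) (simp add: fun_eq_iff algebra_simps)
 have wd: "((%e. Wf x v xi e) has_derivative (%h. h*R(- Ch x v ?s-e*R?a))) (at e)" for e
  unfolding Wf_def by (rule has_derivative_eq_rhs[OF has_derivative_diff[OF has_derivative_diff[OF has_derivative_const l(1)] l(2)]]) (simp add: fun_eq_iff algebra_simps)
 show "((%e. G (psi x xi e) (Wf x v xi e) (Wf x v xi e)) has_real_derivative
   2*G (psi x xi e) (W1 x v xi e) (Wf x v xi e)) (at e)" unfolding has_field_derivative_def by (rule has_derivative_eq_rhs[OF G_deriv[OF p pd wd wd]])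
    (simp add: W1_def Let_def fun_eq_iff bil_simps G_sym[OF p, of "Wf x v xi e"] algebra_simps)
 assume x: "x : U"
 have p0: "psi x xi 0 = x" and w0: "Wf x v xi 0 = v" by (simp_all add: psi_def Wf_def)
 show z: "W1 x v xi 0 = 0" using Ch_sym[OF x, of v] by (simp add: W1_def Let_def p0 w0)
 have e1: "((%e. e*Ry) has_derivative (%h. h*Ry)) (at e)" for e and y :: "real^3" by (rule l(1))
 have p'd: "((%e. ?s-e*RCh x ?s ?s) has_derivative (%h. h*R(- Ch x ?s ?s))) (at e)" for e by (rule has_derivative_eq_rhs[OF has_derivative_diff[OF has_derivative_const e1]]) simp
 have w'd: "((%e. - Ch x v ?s-e*R?a) has_derivative (%h. h*R(- ?a))) (at e)" for e
  by (rule has_derivative_eq_rhs[OF has_derivative_diff[OF has_derivative_const e1]]) (simp add: fun_eq_iff algebra_simps)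
 have W1d: "((%e. W1 x v xi e) has_derivative (%h. h*RRc x ?s v ?s)) (at 0)" unfolding W1_def Let_def
 proof (rule has_derivative_eq_rhs[OF has_derivative_add[OF w'd Ch_deriv[OF pd p'd wd]]], rule ext)
  fix h
  have eqs: "dCh x ?s ?s v = dCh x ?s v ?s" "Ch x (Ch x ?s ?s) v = Ch x v (Ch x ?s ?s)" "Ch x (Ch x v ?s) ?s = Ch x ?s (Ch x v ?s)"
   by (rule dCh_sym[OF x], rule Ch_sym[OF x], rule Ch_sym[OF x])
  show "h *R-?a+(dCh (psi x xi 0) (h*R(?s-0*RCh x ?s ?s)) (?s-0*RCh x ?s ?s) (Wf x v xi 0) +
    Ch (psi x xi 0) (h *R-Ch x ?s ?s) (Wf x v xi 0) +
    Ch (psi x xi 0) (?s-0*RCh x ?s ?s) (h*R(- Ch x v ?s-0*R?a))) = h*RRc x ?s v ?s"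
   unfolding p0 w0 Rc_def dCh_linear bil_sc_left bil_sc_right scale_zero_left diff_zero bil_minus_left bil_minus_right eqs
    scaleR_add_right[symmetric] by (rule arg_cong[where f = "scaleR h"]) (simp add: vec_eq_iff)
 qed
 have pU: "psi x xi 0 : U" using x p0 by simp
 have "((%e. G (psi x xi e) (W1 x v xi e) (Wf x v xi e)) has_derivative (%h. h*G x (Rc x ?s v ?s) v)) (at 0)" by (rule has_derivative_eq_rhs[OF G_deriv[OF pU pd W1d wd]])
    (simp add: fun_eq_iff p0 w0 z bil_simps)
 from has_derivative_mult_right[OF this, of 2]
 show "((%e. 2*G (psi x xi e) (W1 x v xi e) (Wf x v xi e)) has_real_derivative
    2*G x (Rc x ?s v ?s) v) (at 0)" unfolding has_field_derivative_def by (rule has_derivative_eq_rhs) (simp add: fun_eq_iff algebra_simps)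
qed

end

section \<open>Uniform Taylor estimates and the contraction of slopes\<close>

lemma param_deriv:
 fixes H :: "'b::euclidean_space \<times> real => real" assumes "smo UNIV H" shows "((%e. H (x,e)) has_real_derivative fd H (x,e) (0,1)) (at e)"
proof -
 have D: "(H has_derivative fd H (x,e)) (at (x,e))" by (rule smooth_on_has_derivative[OF assms UNIV_I])
 have "((%e. (x,e)) has_derivative (%h. (0,h))) (at e)" by (rule has_derivative_Pair[OF has_derivative_const has_derivative_ident])
 from has_derivative_compose[OF this D]
 show ?thesis unfolding has_field_derivative_def
 proof (rule has_derivative_eq_rhs, intro ext)
  fix h
  show "fd H (x,e) (0,h) = fd H (x,e) (0,1)*h" using linear_cmul[OF has_derivative_linear[OF D], of h "(0,1)"] by simp
 qed
qed

lemma taylor_two: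
 fixes F :: "'b::euclidean_space \<times> real => real" assumes F: "smo UNIV F" and K: "compact K" and F1: "F1 = (%z. fd F z (0,1))" and F2: "F2 = (%z. fd F1 z (0,1))"
  and z: "!!x. x : K ==> F1 (x,0) = 0" and neg: "!!x. x : K ==> F2 (x,0)<b" obtains d where "d>0" "!!x e. x : K ==> 0 <= e ==> e <= d ==> F (x,e) <= F (x,0)+b/2*e^2"
proof -
 have s1: "smo UNIV F1" and s2: "smo UNIV F2" unfolding F1 F2 using F by (auto intro: smooth_on_deriv)
 have o: "open {e. ALL x:K. (%z. F2 (snd z,fst z)) (e,x) : {..<b}}" by (rule compact_tube[OF K]) (auto intro!: continuous_intros continuous_on_compose2[OF smo_cont[OF s2]])
 have "0 : {e. ALL x:K. (%z. F2 (snd z,fst z)) (e,x) : {..<b}}" using neg by simp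
 with o obtain d where d: "d>0" "cball 0 d <= {e. ALL x:K. (%z. F2 (snd z,fst z)) (e,x) : {..<b}}" using open_contains_cball by blast
 note der = param_deriv
 have "F (x,e) <= F (x,0)+b/2*e^2" if x: "x : K" and e: "0 <= e" "e <= d" for x e
 proof -
  define df where "df m = (%e. (if m = 0 then F else if m = 1 then F1 else F2) (x,e))" for m :: nat
  have D: "ALL m t. m<2 & \<bar>t\<bar> <= \<bar>e\<bar> --> DERIV (df m) t :> df (Suc m) t" using der F s1 by (auto simp: F1 F2 df_def)
  have "df 0 = (%e. F (x,e))" by (simp add: df_def)
  from Maclaurin_bi_le[OF this D] obtain t where t: "\<bar>t\<bar> <= \<bar>e\<bar>" "F (x,e) = (\<Sum>m<2. df m 0/fact m*e^m)+df 2 t/fact 2*e^2" by blast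
  have "F2 (x,t) <= b" using d(2) t(1) e x by (force simp: subset_iff dist_real_def intro: less_imp_le)
  hence "F2 (x,t)/2*e^2 <= b/2*e^2" by (intro mult_right_mono divide_right_mono) auto
  thus ?thesis using t(2) z[OF x] by (simp add: df_def numeral_2_eq_2)
 qed
 with d(1) show thesis by (rule that)
qed

lemma taylor_three:
 fixes F :: "'b::euclidean_space \<times> real => real" assumes F: "smo UNIV F" and K: "compact K" and F1: "F1 = (%z. fd F z (0,1))" and F2: "F2 = (%z. fd F1 z (0,1))"
  and z: "!!x. x : K ==> F (x,0) = 0" "!!x. x : K ==> F1 (x,0) = 0" "!!x. x : K ==> F2 (x,0) = 0" obtains C where "C>0" "!!x e. x : K ==> 0 <= e ==> e <= 1 ==> \<bar>F (x,e)\<bar> <= C*e^3"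
proof -
 define F3 where "F3 = (%z. fd F2 z (0,1))"
 have s1: "smo UNIV F1" unfolding F1 by (rule smooth_on_deriv[OF F])
 have s2: "smo UNIV F2" unfolding F2 by (rule smooth_on_deriv[OF s1])
 have s3: "smo UNIV F3" unfolding F3_def by (rule smooth_on_deriv[OF s2])
 have "compact (F3 ` (K \<times> {-1..1}))" by (rule compact_continuous_image[OF continuous_on_subset[OF smo_cont[OF s3]] compact_Times[OF K compact_Icc]]) simp
 then obtain C where C: "C>0" "!!y. y : F3 ` (K \<times> {-1..1}) ==> norm y <= C" using compact_imp_bounded bounded_pos by metis
 have "\<bar>F (x,e)\<bar> <= C*e^3" if x: "x : K" and e: "0 <= e" "e <= 1" for x e
 proof -
  define df where "df m = (%e. (if m = 0 then F else if m = 1 then F1 else if m = 2 then F2 else F3) (x,e))" for m :: nat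
  have D: "ALL m t. m<3 & \<bar>t\<bar> <= \<bar>e\<bar> --> DERIV (df m) t :> df (Suc m) t" using param_deriv F s1 s2 F1 F2 by (auto simp: df_def F3_def)
  have "df 0 = (%e. F (x,e))" by (simp add: df_def)
  from Maclaurin_bi_le[OF this D] obtain t where t: "\<bar>t\<bar> <= \<bar>e\<bar>" "F (x,e) = (\<Sum>m<3. df m 0/fact m*e^m)+df 3 t/fact 3*e^3" by blast
  have "(x,t) : K \<times> {-1..1}" using t(1) e x by auto
  hence b: "\<bar>F3 (x,t)\<bar> <= C" using C(2)[of "F3 (x,t)"] by auto
  have "F (x,e) = F3 (x,t)/6*e^3" using t(2) z[OF x] by (simp add: df_def eval_nat_numeral lessThan_Suc)
  hence "\<bar>F (x,e)\<bar> = \<bar>F3 (x,t)/6*e^3\<bar>" by (rule arg_cong)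
  hence "\<bar>F (x,e)\<bar> = \<bar>F3 (x,t)\<bar> / 6*e^3" unfolding abs_mult using e by simp
  also have "... <= C*e^3" using b e by (intro mult_right_mono) auto
  finally show ?thesis .
 qed
 with C(1) show thesis by (rule that)
qed

text \<open>With this order of the arguments the sum over the frame is minus the Ricci curvature of
  \<open>v\<close>, hence the negative sign.\<close>

locale positive_patch = patch + assumes ric: "x : U ==> v ~= 0 ==> (SU i. G x (Rc x (sg i x) v (sg i x)) v)<0"
begin

lemma dCh_bil: "dCh x z (u+u') v = dCh x z u v+dCh x z u' v" "dCh x z u (v+v') = dCh x z u v+dCh x z u v'" "dCh x z (c*Ru) v = c*RdCh x z u v" "dCh x z u (c*Rv) = c*RdCh x z u v"
 "dCh x (z+z') u v = dCh x z u v+dCh x z' u v"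
proof -
 have l: "linear (fd (%y. Gc y i j) x)" for i j using smooth_on_has_derivative[OF Gc_sm UNIV_I] has_derivative_linear by blast
 show "dCh x (z+z') u v = dCh x z u v+dCh x z' u v" by (simp add: dCh_def bil_def sum_3 linear_add[OF l] algebra_simps)
qed (simp_all add: dCh_def bil_simps)

lemma Rc_quadratic: "G x (Rc x (sgx x xi) v (sgx x xi)) v = (SU i. SU j. xi$i*xi$j*G x (Rc x (sg i x) v (sg j x)) v)"
by (auto simp: bil_simps dCh_bil dCh_linear algebra_simps bil_sum_left bil_sc_left sgx_def sum_3 Rc_def)

text \<open>The mean squared length has derivative 0 at \<open>e = 0\<close>. Since second moments
  are isotropic, its second derivative is \<open>2*second_moment\<close> times minus the Ricci
  curvature, which is bounded away from 0 on the compact set of unit vectors over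
  \<open>K\<close>.\<close>

lemma mean_length: assumes K: "compact K" "K <= U" obtains c d where "c>0" "d>0" "!!x et e. x : K ==> norm et = 1 ==> 0 <= e ==> e <= d ==>
    Ex (%xi. G (psi x xi e) (Wf x (sgx x et) xi e) (Wf x (sgx x et) xi e)) <= 1-2 * c*e^2"
proof -
 define H where "H z = (let x = fst (fst (fst z)); et = snd (fst (fst z)); e = snd (fst z); xi = snd z
   in G (psi x xi e) (Wf x (sgx x et) xi e) (Wf x (sgx x et) xi e))" for z :: "(((real^3) \<times> (real^3)) \<times> real) \<times> (real^3)"
 define H1 where "H1 z = fd H z ((0,1),0)" for z
 define H2 where "H2 z = fd H1 z ((0,1),0)" for z
 define F where "F z = Ex (%xi. H (z,xi))" for z
 define F1 where "F1 = (%z. fd F z (0,1))"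
 define F2 where "F2 = (%z. fd F1 z (0,1))"
 have Hs: "smo UNIV H" unfolding H_def Let_def by (intro G_sm psi_sm Wf_sm sgx_sm smo_fst smo_snd smo_id open_UNIV)
 have H1s: "smo UNIV H1" unfolding H1_def by (rule smooth_on_deriv[OF Hs])
 have H2s: "smo UNIV H2" unfolding H2_def by (rule smooth_on_deriv[OF H1s])
 have Fs: "smo UNIV F" unfolding F_def by (rule Ex_sm(1)[OF open_UNIV smo_sub[OF Hs]]) simp
 have F1: "F1 = (%z. Ex (%xi. H1 (z,xi)))" unfolding F1_def F_def H1_def by (rule ext, rule Ex_sm(2)[OF open_UNIV smo_sub[OF Hs]]) simp_all
 have F2: "F2 = (%z. Ex (%xi. H2 (z,xi)))" unfolding F2_def F1 H2_def by (rule ext, rule Ex_sm(2)[OF open_UNIV smo_sub[OF H1s]]) simp_all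
 have F1s: "smo UNIV F1" unfolding F1_def by (rule smooth_on_deriv[OF Fs])
 have F2s: "smo UNIV F2" unfolding F2_def by (rule smooth_on_deriv[OF F1s])
 have der: "((%e. D ((x,e),xi)) has_real_derivative fd D ((x,e),xi) ((0,1),0)) (at e)"
  if "smo UNIV D" for D :: "(((real^3) \<times> (real^3)) \<times> real) \<times> (real^3) => real" and x e xi
 proof -
  have s: "smo UNIV (%y. D (y,xi))" by (rule smo_comp[OF open_UNIV open_UNIV UNIV_I smo_Pair[OF open_UNIV smo_id[OF open_UNIV] smo_c] that])
  have "((%y. (y,xi)) has_derivative (%h. (h,0))) (at (x,e))" by (rule has_derivative_Pair[OF has_derivative_ident has_derivative_const])
  from fun_cong[OF frechet_derivative_at[OF has_derivative_compose[OF this smooth_on_has_derivative[OF that UNIV_I]]], of "(0,1)"]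
  show ?thesis using param_deriv[OF s, of x e] by simp
 qed
 have H1e: "H1 (((x,et),e),xi) = 2*G (psi x xi e) (W1 x (sgx x et) xi e) (Wf x (sgx x et) xi e)" if "psi x xi e : U" for x et e xi
 proof -
  from length_deriv(1)[OF that, of "sgx x et"]
  have "((%e. H (((x,et),e),xi)) has_real_derivative 2*G (psi x xi e) (W1 x (sgx x et) xi e) (Wf x (sgx x et) xi e)) (at e)" by (simp add: H_def)
  from DERIV_unique[OF der[OF Hs, of "(x,et)" xi e] this] show ?thesis by (simp add: H1_def)
 qed
 have p0: "psi x xi 0 = x" for x xi by (simp add: psi_def)
 have w0: "Wf x v xi 0 = v" for x v xi by (simp add: Wf_def)
 have H10: "H1 (((x,et),0),xi) = 0" if x: "x : U" for x et xi using H1e[of x xi 0 et] length_deriv(2)[of x xi 0 "sgx x et"] x by (simp add: p0 bil_zero)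
 have H20: "H2 (((x,et),0),xi) = 2*G x (Rc x (sgx x xi) (sgx x et) (sgx x xi)) (sgx x et)" if x: "x : U" for x et xi
 proof -
  have pc: "continuous_on UNIV (%e. psi x xi e)" by (rule smo_cont[OF psi_sm[OF open_UNIV smo_c smo_c smo_id[OF open_UNIV]]])
  have o: "open {e. psi x xi e : U}" using open_vimage[OF U pc] by (simp add: vimage_def)
  have "psi x xi 0 : U" using x by (simp add: p0)
  from length_deriv(3)[OF this x, of "sgx x et"]
  have "((%e. H1 (((x,et),e),xi)) has_real_derivative 2*G x (Rc x (sgx x xi) (sgx x et) (sgx x xi)) (sgx x et)) (at 0)"
   by (rule has_field_derivative_transform_within_open[OF _ o]) (use x in "auto simp: p0 H1e")
  from DERIV_unique[OF der[OF H1s, of "(x,et)" xi 0] this] show ?thesis by (simp add: H2_def)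
 qed
 have K0: "F1 (z,0) = 0" if "z : K \<times> sphere 0 1" for z using that K H10 Ex_c[of 0] by (auto simp: F1 subset_iff)
 have F2neg: "F2 (z,0)<0" if "z : K \<times> sphere 0 1" for z
 proof -
  obtain x et where z: "z = (x,et)" by force
  have x: "x : U" and n: "norm et = 1" using that K z by auto
  let ?v = "sgx x et"
  have "?v ~= 0" using G_sgx_sgx[OF x, of et et] n by (auto simp: bil_zero norm_eq_1)
  from ric[OF x this] have r: "(SU i. G x (Rc x (sg i x) ?v (sg i x)) ?v)<0" .
  have "F2 (z,0) = Ex (%xi. 2*(SU i. SU j. xi$i*xi$j*G x (Rc x (sg i x) ?v (sg j x)) ?v))" by (simp add: F2 z H20[OF x] Rc_quadratic)
  also have "... = 2*(second_moment*(SU i. G x (Rc x (sg i x) ?v (sg i x)) ?v))" by (simp only: Ex_cmul Ex_quadratic)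
  also have "... < 0" using r mom2_pos by (simp add: mult_pos_neg)
  finally show ?thesis .
 qed
 have K': "compact (K \<times> sphere 0 (1::real) :: ((real^3) \<times> (real^3)) set)" by (rule compact_Times[OF K(1)]) simp
 obtain b where b: "b<0" "!!z. z : K \<times> sphere 0 1 ==> F2 (z,0)<b"
 proof (cases "K = {}")
  case True
  thus ?thesis using that[of "-1"] by simp
 next
  case False
  have "sphere 0 1 ~= ({} :: (real^3) set)" by simp
  hence ne: "K \<times> sphere 0 (1::real) ~= ({} :: ((real^3) \<times> (real^3)) set)" using False by auto
  have "continuous_on (K \<times> sphere 0 1) (%z. F2 (z,0))" by (rule continuous_on_compose2[OF smo_cont[OF F2s] continuous_on_Pair[OF continuous_on_id continuous_on_const]]) simp
  from continuous_attains_sup[OF K' ne this] obtain w where w: "w : K \<times> sphere 0 1" "!!z. z : K \<times> sphere 0 1 ==> F2 (z,0) <= F2 (w,0)" by blast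
  have n: "F2 (w,0)<0" by (rule F2neg[OF w(1)])
  \<comment> \<open>Half of a negative maximum is still negative and lies strictly above all
    values.\<close>
  show ?thesis by (rule that[of "F2 (w,0)/2"]) (use n w(2) in force)+
 qed
 obtain d where d: "d>0" "!!z e. z : K \<times> sphere 0 1 ==> 0 <= e ==> e <= d ==> F (z,e) <= F (z,0)+b/2*e^2" using taylor_two[OF Fs K' F1_def F2_def K0 b(2)] by blast
 show thesis
 \<comment> \<open>Taylor's formula gives \<open>1 + b/2*e^2\<close>. The bound is stated as
   \<open>1 - 2*c*e^2\<close> because passing from squared lengths to lengths will halve the
   gain.\<close>
 proof (rule that[of "- b/4" d])
  show "- b/4>0" "d>0" using b d by auto
  fix x et :: "real^3" and e :: real assume x: "x : K" and n: "norm et = 1" and e: "0 <= e" "e <= d"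
  have xU: "x : U" using x K by auto
  have "F ((x,et),0) = 1" unfolding F_def H_def Let_def fst_conv snd_conv p0 w0 G_sgx_sgx[OF xU] Ex_c using n by (simp add: norm_eq_1)
  thus "Ex (%xi. G (psi x xi e) (Wf x (sgx x et) xi e) (Wf x (sgx x et) xi e)) <= 1-2*(- b/4)*e^2" using d(2)[of "(x,et)" e] x n e by (simp add: F_def H_def)
 qed
qed

text \<open>The derivative of the average is at most \<open>L\<close> times the mean length of the
  variation field, and \<open>sqrt y <= (1 + y)/2\<close> reduces this to the mean squared length.
  Unit vectors suffice by linearity in \<open>v\<close>.\<close>

theorem contraction: assumes K: "compact K" "K <= U" obtains c d where "c>0" "d>0" "!!x xi e. x : K ==> 0 <= e ==> e <= d ==> xi : cball 0 4 ==> psi x xi e : U"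
  "!!x e f L v. x : K ==> 0 <= e ==> e <= d ==> smo U f ==> L >= 0 ==> (!!y w. y : U ==> \<bar>fd f y w\<bar> <= L * sqrt (G y w w)) ==>
   \<bar>fd (%x. Ex (%xi. f (psi x xi e))) x v\<bar> <= L*(1 - c*e^2) * sqrt (G x v v)"
proof -
 obtain c d where c: "c>0" "d>0" "!!x et e. x : K ==> norm et = 1 ==> 0 <= e ==> e <= d ==>
    Ex (%xi. G (psi x xi e) (Wf x (sgx x et) xi e) (Wf x (sgx x et) xi e)) <= 1-2 * c*e^2" using mean_length[OF K] by blast
 have pc: "continuous_on UNIV (%z :: real \<times> (real^3) \<times> (real^3). psi (fst (snd z)) (snd (snd z)) (fst z))"
  by (rule smo_cont[OF psi_sm]) (intro smo_fst smo_snd smo_id open_UNIV)+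
 have o: "open {e. ALL t:K \<times> cball 0 4. (%z. psi (fst (snd z)) (snd (snd z)) (fst z)) (e,t) : U}" by (rule compact_tube[OF compact_Times[OF K(1) compact_cball] pc U])
 have "0 : {e. ALL t:K \<times> cball 0 4. (%z. psi (fst (snd z)) (snd (snd z)) (fst z)) (e,t) : U}" using K(2) by (auto simp: psi_def)
 with o obtain d' where d': "d'>0" "cball 0 d' <= {e. ALL t:K \<times> cball 0 4. (%z. psi (fst (snd z)) (snd (snd z)) (fst z)) (e,t) : U}" using open_contains_cball by blast
 have pU: "psi x xi e : U" if "x : K" "0 <= e" "e <= min d d'" "xi : cball 0 4" for x xi e
 proof -
  have "e : cball 0 d'" using that by (simp add: dist_real_def)
  with d'(2) have "ALL t:K \<times> cball 0 4. (%z. psi (fst (snd z)) (snd (snd z)) (fst z)) (e,t) : U" by blast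
  from bspec[OF this, of "(x,xi)"] that show ?thesis by simp
 qed
 show thesis
 proof (rule that[of c "min d d'"])
  fix x e f L v
  assume x: "x : K" and e: "0 <= e" "e <= min d d'" and f: "smo U f" and L: "L >= 0" and bd: "!!y w. y : U ==> \<bar>fd f y w\<bar> <= L * sqrt (G y w w)"
  have xU: "x : U" using x K by auto
  define q where "q = (%v. Ex (%xi. fd f (psi x xi e) (Wf x v xi e)))"
  have D: "((%x. Ex (%xi. f (psi x xi e))) has_derivative q) (at x)" unfolding q_def by (rule average_deriv(1)[OF xU f pU[OF x e]])
  have qe: "fd (%x. Ex (%xi. f (psi x xi e))) x = q" by (rule frechet_derivative_at[OF D, symmetric])
  have sp: "smo UNIV (%xi. psi x xi e)" by (rule psi_sm[OF open_UNIV smo_c smo_id[OF open_UNIV] smo_c])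
  have sw: "smo UNIV (%xi. Wf x v xi e)" for v by (rule Wf_sm[OF open_UNIV smo_c smo_c smo_id[OF open_UNIV] smo_c])
  have cu: "psi x xi e : U" if "xi : cube" for xi using pU[OF x e] that cube_sub by force
  have cq: "continuous_on cube (%xi. fd f (psi x xi e) (Wf x v xi e))" for v
  proof -
   have "continuous_on cube (%xi. SU k. Wf x v xi e$k*fd f (psi x xi e) (axis k 1))"
    by (intro continuous_on_sum continuous_on_mult continuous_on_component continuous_on_subset[OF smo_cont[OF sw]] subset_UNIV
      continuous_on_compose2[OF smo_cont[OF smooth_on_deriv[OF f]] continuous_on_subset[OF smo_cont[OF sp]]]) (use cu in auto)
   thus ?thesis by (rule continuous_on_eq) (rule smo_fr_rep[OF f cu, symmetric])
  qed
  have unit: "\<bar>q (sgx x et)\<bar> <= L*(1 - c*e^2)" if n: "norm et = 1" for et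
  proof -
   let ?W = "%xi. Wf x (sgx x et) xi e" and ?p = "%xi. psi x xi e"
   let ?h = "%xi. G (?p xi) (?W xi) (?W xi)"
   have ch: "continuous_on cube ?h" by (rule continuous_on_subset[OF smo_cont[OF G_sm[OF open_UNIV sp sw sw]]]) simp
   have cb: "continuous_on cube (%xi. L/2+L/2*?h xi)" by (intro continuous_intros ch)
   have le: "\<bar>fd f (?p xi) (?W xi)\<bar> <= L/2+L/2*?h xi" if xi: "xi : cube" for xi
   proof -
    have h0: "?h xi >= 0" by (rule G_nonneg[OF cu[OF xi]])
    have "sqrt (?h xi) <= (1+?h xi)/2" using arith_geo_mean_sqrt[of 1 "?h xi"] h0 by simp
    hence "L * sqrt (?h xi) <= L*((1+?h xi)/2)" using L by (rule mult_left_mono)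
    with bd[OF cu[OF xi], of "?W xi"] show ?thesis by (simp add: field_simps)
   qed
   have "\<bar>q (sgx x et)\<bar> <= Ex (%xi. L/2+L/2*?h xi)"
   proof -
    have "q (sgx x et) <= Ex (%xi. L/2+L/2*?h xi)" unfolding q_def by (rule Ex_mono[OF cq cb]) (use le in force)
    moreover have "Ex (%xi. (-1)*(L/2+L/2*?h xi)) <= q (sgx x et)" unfolding q_def by (rule Ex_mono[OF continuous_on_mult[OF continuous_on_const cb] cq]) (use le in force)
    ultimately show ?thesis unfolding Ex_cmul by linarith
   qed
   also have "... = L/2+L/2*Ex ?h" by (subst Ex_add[OF continuous_on_const continuous_on_mult[OF continuous_on_const ch]]) (simp only: Ex_c Ex_cmul)
   also have "... <= L/2+L/2*(1-2 * c*e^2)" using c(3)[OF x n e(1)] e(2) L by (intro add_left_mono mult_left_mono) auto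
   finally show ?thesis by (simp add: field_simps)
  qed
  show "\<bar>fd (%x. Ex (%xi. f (psi x xi e))) x v\<bar> <= L*(1 - c*e^2) * sqrt (G x v v)"
  proof -
   define et where "et = (\<chi> i. G x v (sg i x))"
   have v: "v = sgx x et" unfolding sgx_def et_def using expand[OF xU, of v] by simp
   have n: "sqrt (G x v v) = norm et" unfolding v G_sgx_sgx[OF xU] by (simp add: norm_eq_sqrt_inner)
   have lq: "linear q" by (rule has_derivative_linear[OF D])
   show ?thesis
   proof (cases "et = 0")
    case True
    hence "v = 0" using v by (simp add: sgx_def)
    thus ?thesis using linear_0[OF lq] by (simp add: qe bil_zero)
   next
    case False
    hence "v = norm et*Rsgx x (et /\<^sub>R norm et)" unfolding sgx_linear(2) using v by simp
    hence "q v = norm et*q (sgx x (et /\<^sub>R norm et))" using linear_cmul[OF lq] by (metis real_scaleR_def)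
    hence "\<bar>q v\<bar> = norm et*\<bar>q (sgx x (et /\<^sub>R norm et))\<bar>" by (simp add: abs_mult)
    also have "... <= norm et*(L*(1 - c*e^2))" by (rule mult_left_mono[OF unit]) (use False in simp_all)
    finally show ?thesis unfolding qe n by (simp add: mult.commute)
   qed
  qed
 qed (use c d' pU in auto)
qed

end

section \<open>Coordinate patches of a manifold with positive Ricci curvature\<close>

context framed_manifold
begin

lemma tens_comb: assumes B: "tens p B" and p: "p : PA" and Y: "vf Y" and X: "!!i. i : I ==> vf (X i)" and eq: "Y p = (%f. SUM i:I. k i*X i p f)" and I: "finite I"
 shows "B Y = (SUM i:I. k i*B (X i))"
proof -
 obtain W E e where f: "frame W E e" "p : W" using frames[OF p] by blast
 note Ep = vtan[OF frame_vf[OF f(1)] p]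
 have "comp E e Y j p = (SUM i:I. k i * comp E e (X i) j p)" for j unfolding comp_def eq using g_comb[where I = I and v = "%i. X i p" and a = k, OF p vtan[OF X p] Ep]
  by (simp add: sum_distrib_left mult.left_commute)
 hence "B Y = (SU j. SUM i:I. k i * comp E e (X i) j p*B (E j))" unfolding tensD[OF B f Y] by (simp add: sum_distrib_right)
 also have "... = (SUM i:I. SU j. k i * comp E e (X i) j p*B (E j))" by (rule sum.swap)
 also have "... = (SUM i:I. k i*B (X i))" by (rule sum.cong[OF refl]) (simp add: tensD[OF B f X] sum_distrib_left mult.assoc)
 finally show ?thesis .
qed

text \<open>Apply the bracket of \<open>X\<close> and \<open>Y\<close> to the function
  \<open>g(Z,Z)\<close>, once by metric compatibility and once as a commutator. In the commutator
  the products of first derivatives of \<open>Z\<close> cancel by symmetry of the metric.\<close>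

lemma Rm_same: assumes X: "vf X" and Y: "vf Y" and Z: "vf Z" and p: "p : PA" shows "Rm A g X Y Z Z p = 0"
proof -
 let ?q = "%q. g q (Z q) (Z q)"
 note t = vtan[OF _ p] and Dv = D_vf[OF _ Z]
 have gs: "g p (Z p) (V p) = g p (V p) (Z p)" if "vf V" for V by (rule g_sym[OF p t[OF Z] t[OF that]])
 have 1: "V q ?q = 2*g q (D V Z q) (Z q)" if V: "vf V" and q: "q : PA" for V q using D_metric[OF V Z Z q] g_sym[OF q vtan[OF Z q] vtan[OF Dv[OF V] q]] by simp
 have 2: "U p (%q. V q ?q) = 2*(g p (D U (D V Z) p) (Z p)+g p (D V Z p) (D U Z p))" if U: "vf U" and V: "vf V" for U V
 proof -
  have "U p (%q. V q ?q) = U p (%q. 2*g q (D V Z q) (Z q))" by (rule tv_cong_pts[OF t[OF U] p vf_sm[OF V g_sm[OF Z Z]]]) (simp add: 1[OF V])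
  also have "... = 2*U p (%q. g q (D V Z q) (Z q))" by (rule tv_cmul[OF t[OF U] g_sm[OF Dv[OF V] Z]])
  finally show ?thesis unfolding D_metric[OF U Dv[OF V] Z p] .
 qed
 note L = br_vf[OF X Y]
 have "br X Y p ?q = 2*(g p (D X (D Y Z) p) (Z p)-g p (D Y (D X Z) p) (Z p))" unfolding lie_bracket_def 2[OF X Y] 2[OF Y X] using g_sym[OF p t[OF Dv[OF X]] t[OF Dv[OF Y]]] by simp
 hence "g p (D (br X Y) Z p) (Z p) = g p (D X (D Y Z) p) (Z p)-g p (D Y (D X Z) p) (Z p)" using 1[OF L p] by simp
 moreover have "Rm A g X Y Z Z p = g p (%f. D X (D Y Z) p f-D Y (D X Z) p f) (Z p)-g p (D (br X Y) Z p) (Z p)" unfolding Rm_def by (rule g_minus_left[OF p _ t[OF Dv[OF L]] t[OF Z]])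
    (use tv_lincomb_in[of "{0,1::nat}" "%i. if i = 0 then D X (D Y Z) p else D Y (D X Z) p" p "%i. if i = 0 then 1 else -1"]
     t[OF D_vf[OF X Dv[OF Y]]] t[OF D_vf[OF Y Dv[OF X]]] in "auto simp: R_def fun_eq_iff")
 moreover have "g p (%f. D X (D Y Z) p f-D Y (D X Z) p f) (Z p) = g p (D X (D Y Z) p) (Z p)-g p (D Y (D X Z) p) (Z p)"
  by (rule g_minus_left[OF p t[OF D_vf[OF X Dv[OF Y]]] t[OF D_vf[OF Y Dv[OF X]]] t[OF Z] refl])
 ultimately show ?thesis by simp
qed

lemma Rm_asym34: assumes X: "vf X" and Y: "vf Y" and Z: "vf Z" and V: "vf V" and p: "p : PA" shows "Rm A g X Y V Z p = - Rm A g X Y Z V p"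
proof -
 \<comment> \<open>Polarization: expand the vanishing expression for the sum of the two
   fields.\<close>
 let ?U = "vadd Z V"
 have U: "vf ?U" by (rule vf_add[OF Z V])
 have eq: "?U p = (%f. SUM i:{0,1::nat}. 1*(if i = 0 then Z else V) p f)" by (simp add: tadd_def)
 have *: "B ?U = B Z+B V" if "tens p B" for B using tens_comb[where X = "%i::nat. if i = 0 then Z else V" and k = "%_. 1", OF that p U _ eq] Z V by simp
 have "0 = Rm A g X Y ?U ?U p" by (rule Rm_same[OF X Y U p, symmetric])
 also have "... = Rm A g X Y Z Z p+Rm A g X Y Z V p+(Rm A g X Y V Z p+Rm A g X Y V V p)" unfolding *[OF Rm_tens3[OF X Y U p]] *[OF Rm_tens4[OF X Y Z p]] *[OF Rm_tens4[OF X Y V p]] by simp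
 finally show ?thesis using Rm_same[OF X Y Z p] Rm_same[OF X Y V p] by simp
qed

end

context closed_manifold
begin

text \<open>The counterpart of \<open>extend\<close>: a function on the manifold becomes one on the
  whole coordinate space, as \<open>patch\<close> asks for coefficients that are smooth
  everywhere.\<close>

definition cut :: "'a chart => real^3 => real => ('a => real) => real^3 => real" where "cut c a r h y = (if y : ball a (2*r) then plateau r (y-a)*h (cinv c y) else 0)"

lemma cut_sm: assumes c: "c : A" and r: "r>0" "cball a (2*r) <= img c" and h: "sf h" shows "smo UNIV (cut c a r h)"
proof (rule smo_loc)
 fix y :: "real^3"
 let ?V = "img c"
 note V = chart_open(2)[OF c]
 show "EX U. open U & y : U & smo (UNIV Int U) (cut c a r h)"
 proof (cases "y : ?V")
  case True
  have "smo ?V (%y. plateau r (y-a)*(h \<circ> cinv c) y)" by (rule smo_mult[OF V smo_comp[OF V open_UNIV UNIV_I smo_diff[OF V smo_id[OF V] smo_c] plat_sm[OF r(1)]] chart_fun_sm[OF h c]])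
  hence "smo ?V (cut c a r h)" by (rule smo_cong[OF V, rotated]) (use plat_zero[OF r(1)] in "auto simp: cut_def dist_norm norm_minus_commute not_less")
  thus ?thesis using True V by (intro exI[of _ ?V]) simp
 next
  case False
  let ?U = "- cball a (2*r)"
  have o: "open ?U" by (simp add: open_Compl)
  have "smo ?U (%y. 0 :: real)" by (rule smo_c)
  hence "smo ?U (cut c a r h)" by (rule smo_cong[OF o, rotated]) (simp add: cut_def)
  thus ?thesis using False r o by (intro exI[of _ ?U]) auto
 qed
qed

lemma cut_eq: "r>0 ==> y : cball a r ==> cut c a r h y = h (cinv c y)" by (auto simp: cut_def plat_one dist_norm norm_minus_commute)

end

section \<open>Metric, connection and curvature in a chart\<close>

locale positive_ricci = framed_manifold + assumes unit_frames: "!!p. p : PA ==> EX W E. frame W E (%_. 1) & p : W" and Ric_pos: "!!p V. p : PA ==> vf V ==> V p ~= tzero ==> Ric A g V V p>0"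

locale chart_patch = positive_ricci +
 fixes c :: "'a chart" and a :: "real^3" and r :: real and W :: "'a set" and E :: "3 => 'a vfield"
 assumes c: "c : A" and r: "r>0" and sub: "cball a (2*r) <= snd c ` (W Int fst c)" and f: "frame W E (%_. 1)"
begin

definition "X v = coord_field c a r v"
definition "crd k = extend c a r (%y. y$k)"
definition "N = (cpart c (ball a r))"
definition "gm y i j = cut c a r (%q. g q (X (axis i 1) q) (X (axis j 1) q)) y"
definition "Gc y i j = (\<chi> k. cut c a r (%q. D (X (axis i 1)) (X (axis j 1)) q (crd k)) y)"
definition "sg i y = (\<chi> k. cut c a r (%q. E i q (crd k)) y)"

lemma sub': "cball a (2*r) <= img c" using sub by blast

lemma X_vf: "vf (X v)" unfolding X_def by (rule coord_field_vf[OF c r sub'])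

lemma crd_sm: "sf (crd k)" unfolding crd_def by (rule extend_sm[OF c sub' r chart_open(2)[OF c] order_refl smo_vec_nth[OF chart_open(2)[OF c] smo_id[OF chart_open(2)[OF c]]]])

lemma N_open: "openin M N" unfolding N_def by (rule openin_chart_pre[OF c open_ball])

lemma N_pts: "q : N ==> q : PA" by (rule pts_open[OF N_open])

lemma N_chart: "q : N ==> q : fst c" and N_ball: "q : N ==> snd c q : ball a r" by (simp_all add: N_def)

lemma ball_in: "y : ball a r ==> y : img c" using sub' r by (auto simp: subset_iff)

lemma inv_N: assumes "y : ball a r" shows "cinv c y : N" "snd c (cinv c y) = y" using chart_inv_mem[OF ball_in[OF assms]] chart_chart_inv[OF ball_in[OF assms]] assms by (auto simp: N_def)

lemma N_W: "q : N ==> q : W"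
proof -
 assume q: "q : N"
 hence "snd c q : snd c ` (W Int fst c)" using sub r N_ball[OF q] by (auto simp: subset_iff)
 thus "q : W" using chart_inj[OF c] N_chart[OF q] by (auto simp: inj_on_def)
qed

lemma X_eq: "q : N ==> X v q = dirv c v q" unfolding X_def using coord_field_eq[of q c a r v] r by (auto simp: N_def)

lemma crd_dirv: "q : N ==> dirv c w q (crd k) = w$k" unfolding crd_def by (rule dirv_coord[OF c N_chart r sub' N_ball])

lemma coords: assumes q: "q : N" and v: "v : tsp q" shows "v = dirv c (\<chi> k. v (crd k)) q"
proof -
 obtain w where w: "v = dirv c w q" using tangent_eq_dirv[OF c N_chart[OF q] v] .
 thus ?thesis using crd_dirv[OF q, of w] by (metis vec_lambda_unique)
qed

lemma sg_eq: "y : ball a r ==> E i (cinv c y) = dirv c (sg i y) (cinv c y)" using coords[OF inv_N(1) vtan[OF frame_vf[OF f, of i] N_pts[OF inv_N(1)]], of y] cut_eq[OF r, of y a]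
 by (simp add: sg_def)

lemma dirv_comb: "q : N ==> dirv c v q = (%f. SU i. v$i*X (axis i 1) q f)" using dirv_rep[OF c N_chart, of q v] by (simp add: X_eq)

lemma gm_eq: "y : ball a r ==> bil (gm y) u v = g (cinv c y) (dirv c u (cinv c y)) (dirv c v (cinv c y))"
proof -
 assume y: "y : ball a r"
 note q = inv_N(1)[OF y]
 let ?q = "cinv c y"
 note t = vtan[OF X_vf N_pts[OF q]]
 have "g ?q (dirv c u ?q) (dirv c v ?q) = (SU i. u$i*g ?q (X (axis i 1) ?q) (dirv c v ?q))"
  unfolding dirv_comb[OF q, of u] by (rule g_comb[OF N_pts[OF q] t dirv_tangent[OF c N_chart[OF q]]])
 also have "... = (SU i. u$i*(SU j. v$j*g ?q (X (axis i 1) ?q) (X (axis j 1) ?q)))"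
  unfolding dirv_comb[OF q, of v] by (intro sum.cong refl arg_cong2[where f = "(*)"] g_comb_right[OF N_pts[OF q] t t])
 finally show ?thesis using cut_eq[OF r, of y a] y by (simp add: bil_def gm_def sum_distrib_left mult.assoc)
qed

text \<open>On \<open>N\<close> the cutoff is 1, so these are coordinate fields with constant
  coefficients; they commute by symmetry of second derivatives.\<close>

lemma lie_X: assumes q: "q : N" shows "br (X u) (X v) q = tzero"
proof
 fix h
 show "br (X u) (X v) q h = tzero h"
 proof (cases "sf h")
  case False
  thus ?thesis using tv_nsm[OF vtan[OF br_vf[OF X_vf X_vf] N_pts[OF q]]] by (simp add: tzero_def)
 next
  case h: True
  let ?F = "h \<circ> cinv c"
  have F: "smo (ball a r) ?F" by (rule sm_funD[OF h c]) (use ball_in in blast)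
  have 1: "X u q (%q. X v q h) = fd (%y. fd ?F y v) (snd c q) u" for u v
  proof -
   have e: "X v q' h = fd ?F (snd c q') v" if "q' : N" for q' using h by (simp add: X_eq[OF that] dirv_def)
   show ?thesis unfolding X_eq[OF q] by (rule dirv_cong[OF c N_chart[OF q] open_ball N_ball[OF q] _ smo_differentiable[OF smooth_on_deriv[OF F] N_ball[OF q]] vf_sm[OF X_vf h]])
      (use ball_in e in "auto simp: N_def")
  qed
  have "fd (%y. fd ?F y v) (snd c q) u = fd (%y. fd ?F y u) (snd c q) v" by (rule mixed_derivs[OF open_ball F N_ball[OF q]])
  thus ?thesis unfolding lie_bracket_def 1 by (simp add: tzero_def)
 qed
qed

lemma X_comb: "q : N ==> X v q = vcomb UNIV (%i q. v$i) (%i. X (axis i 1)) q" by (simp only: X_eq[of q v] dirv_comb)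

lemma Ch_axis: assumes y: "y : ball a r" shows "D (X (axis i 1)) (X (axis j 1)) (cinv c y) = dirv c (Gc y i j) (cinv c y)"
 using coords[OF inv_N(1)[OF y] D_tangent[OF X_vf X_vf N_pts[OF inv_N(1)[OF y]]], of "axis i 1" "axis j 1"] cut_eq[OF r, of y a] y by (simp add: Gc_def)

lemma Ch_eq: assumes y: "y : ball a r" shows "D (X u) (X v) (cinv c y) = dirv c (bil (Gc y) u v) (cinv c y)"
proof
 fix h
 note q = inv_N(1)[OF y]
 let ?q = "cinv c y" let ?e = "%i. X (axis i 1)"
 note cs = sm_fun_c and vc = vf_lincomb[of UNIV ?e, OF X_vf sm_fun_c]
 have "D (X u) (X v) ?q = D (vcomb UNIV (%i q. u$i) ?e) (vcomb UNIV (%i q. v$i) ?e) ?q" by (rule D_loc[OF X_vf vc X_vf vc N_open q X_comb X_comb])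
 hence "D (X u) (X v) ?q h = (SU i. u$i*D (?e i) (vcomb UNIV (%i q. v$i) ?e) ?q h)" using D_comb1[where I = UNIV and X = ?e and u = "%i q. u$i", OF X_vf cs vc N_pts[OF q]] by simp
 also have "... = (SU i. u$i*(SU j. v$j*D (?e i) (?e j) ?q h))" using D_comb2[where I = UNIV and Y = ?e and u = "%i q. v$i", OF X_vf cs X_vf N_pts[OF q]]
  by (simp add: tv_c[OF vtan[OF X_vf N_pts[OF q]]])
 also have "... = (SU i. SU j. (u$i * v$j)*dirv c (Gc y i j) ?q h)" by (simp add: Ch_axis[OF y] sum_distrib_left mult.assoc)
 also have "... = dirv c (bil (Gc y) u v) ?q h" unfolding bil_def sum.cartesian_product using dirv_linear[OF c N_chart[OF q], of "%(i,j). u$i * v$j" "%(i,j). Gc y i j" "UNIV \<times> UNIV"]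
  by (simp add: case_prod_beta' split_beta)
 finally show "D (X u) (X v) ?q h = dirv c (bil (Gc y) u v) ?q h" .
qed

lemma cut_deriv: assumes y: "y : ball a r" and h: "sf h" shows "(cut c a r h has_derivative (%z. X z (cinv c y) h)) (at y)"
proof -
 note q = inv_N[OF y]
 have "(h \<circ> cinv c has_derivative (%w. dirv c w (cinv c y) h)) (at y)" using chart_fun_deriv[OF h c N_chart[OF q(1)]] q(2) by simp
 thus ?thesis unfolding X_eq[OF q(1)] by (rule has_derivative_transform_within_open[OF _ open_ball y]) (use cut_eq[OF r] in auto)
qed

end

sublocale chart_patch \<subseteq> patch gm Gc sg "ball a r"
proof
 show "smo UNIV (%y. gm y i j)" for i j unfolding gm_def by (rule cut_sm[OF c r sub' g_sm[OF X_vf X_vf]])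
 show "smo UNIV (%y. Gc y i j)" for i j unfolding Gc_def by (rule smo_vec_lambda[OF open_UNIV cut_sm[OF c r sub' vf_sm[OF D_vf[OF X_vf X_vf] crd_sm]]])
 show "smo UNIV (sg i)" for i unfolding sg_def by (rule smo_vec_lambda[OF open_UNIV cut_sm[OF c r sub' vf_sm[OF frame_vf[OF f] crd_sm]]])
 fix y assume y: "y : ball a r"
 note q = inv_N(1)[OF y]
 let ?q = "cinv c y"
 note p = N_pts[OF q] and tX = vtan[OF X_vf N_pts[OF q]]
 show "gm y i j = gm y j i" for i j using cut_eq[OF r, of y a] y g_sym[OF p tX tX] by (simp add: gm_def)
 show "Gc y i j = Gc y j i" for i j
 proof -
  have "D (X (axis i 1)) (X (axis j 1)) ?q h = D (X (axis j 1)) (X (axis i 1)) ?q h" for h using D_torsion[OF X_vf X_vf p, of "axis i 1" "axis j 1" h] lie_X[OF q] by (simp add: tzero_def)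
  thus ?thesis using cut_eq[OF r, of y a] y by (simp add: Gc_def)
 qed
 show "((%y. bil (gm y) u v) has_derivative (%z. bil (gm y) (bil (Gc y) z u) v+bil (gm y) u (bil (Gc y) z v))) (at y)" for u v
 proof -
  let ?h = "%q. g q (X u q) (X v q)"
  have "(cut c a r ?h has_derivative (%z. X z ?q ?h)) (at y)" by (rule cut_deriv[OF y g_sm[OF X_vf X_vf]])
  hence "((%y. bil (gm y) u v) has_derivative (%z. X z ?q ?h)) (at y)"
  proof (rule has_derivative_transform_within_open[OF _ open_ball y])
   fix z assume z: "z : ball a r"
   thus "cut c a r ?h z = bil (gm z) u v" using cut_eq[OF r, of z a c ?h] gm_eq[OF z] X_eq[OF inv_N(1)[OF z]] by simp
  qed
  moreover have "X z ?q ?h = bil (gm y) (bil (Gc y) z u) v+bil (gm y) u (bil (Gc y) z v)" for z unfolding D_metric[OF X_vf X_vf X_vf p] unfolding Ch_eq[OF y] gm_eq[OF y] X_eq[OF q] ..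
  ultimately show ?thesis by simp
 qed
 have G: "g ?q (dirv c v ?q) (E i ?q) = bil (gm y) v (sg i y)" for v i unfolding gm_eq[OF y] sg_eq[OF y] ..
 show "bil (gm y) (sg i y) (sg j y) = (if i = j then 1 else 0)" for i j using frame_on[OF f N_W[OF q], of i j] by (simp add: gm_eq[OF y] sg_eq[OF y])
 show "v = (SU i. bil (gm y) v (sg i y)*Rsg i y)" for v
 proof (rule dirv_inj[OF c N_chart[OF q]])
  have "dirv c v ?q = (%h. SU i. 1*g ?q (dirv c v ?q) (E i ?q)*E i ?q h)" by (rule frame_rep[OF f N_W[OF q] dirv_tangent[OF c N_chart[OF q]]])
  also have "... = dirv c (SU i. bil (gm y) v (sg i y)*Rsg i y) ?q" unfolding G dirv_linear[OF c N_chart[OF q]] by (simp add: sg_eq[OF y])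
  finally show "dirv c v ?q = dirv c (SU i. bil (gm y) v (sg i y)*Rsg i y) ?q" .
 qed
qed simp

context chart_patch
begin

text \<open>Coordinate fields commute, so \<open>R_basis\<close> applies with vanishing structure
  functions; the derivatives of the Christoffel symbols account for \<open>dCh\<close> in
  \<open>Rc\<close>.\<close>

lemma R_eq: assumes y: "y : ball a r" shows "R (X (axis i 1)) (X (axis j 1)) (X (axis k 1)) (cinv c y) = dirv c (Rc y (axis i 1) (axis j 1) (axis k 1)) (cinv c y)"
proof -
 note q = inv_N(1)[OF y]
 let ?q = "cinv c y" let ?e = "%i. X (axis i 1)"
 define Gm where "Gm i j k q = D (?e i) (?e j) q (crd k)" for i j k q
 have Gs: "sf (Gm i j k)" for i j k unfolding Gm_def[abs_def] by (rule vf_sm[OF D_vf[OF X_vf X_vf] crd_sm])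
 have DE: "D (?e i) (?e j) q = vcomb UNIV (Gm i j) ?e q" if "q : N" for q i j
 proof -
  have "D (?e i) (?e j) q = dirv c (\<chi> k. Gm i j k q) q" unfolding Gm_def by (rule coords[OF that D_tangent[OF X_vf X_vf N_pts[OF that]]])
  thus ?thesis unfolding dirv_comb[OF that] by simp
 qed
 have "R (?e i) (?e j) (?e k) ?q = (%f. SU d. (?e i ?q (Gm j k d)-?e j ?q (Gm i k d) + (SU l. Gm j k l ?q*Gm i l d ?q-Gm i k l ?q*Gm j l d ?q-0*Gm l k d ?q))*?e d ?q f)"
  by (rule R_basis[where C = "%_ _ _ _. 0", OF X_vf N_open q Gs sm_fun_c DE]) (simp_all add: lie_X tzero_def)
 moreover have "Rc y (axis i 1) (axis j 1) (axis k 1)$d = ?e i ?q (Gm j k d)-?e j ?q (Gm i k d) + (SU l. Gm j k l ?q*Gm i l d ?q-Gm i k l ?q*Gm j l d ?q-0*Gm l k d ?q)" for d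
 proof -
  have dG: "fd (%y. Gc y j k) y z$d = X z ?q (Gm j k d)" for j k z
  proof -
   have "((%y. Gc y j k$d) has_derivative (%z. fd (%y. Gc y j k) y z$d)) (at y)" by (rule bounded_linear.has_derivative[OF bounded_linear_vec_nth smooth_on_has_derivative[OF Gc_sm UNIV_I]])
   moreover have "((%y. Gc y j k$d) has_derivative (%z. X z ?q (Gm j k d))) (at y)" using cut_deriv[OF y Gs, of j k d] by (simp add: Gc_def Gm_def[abs_def])
   ultimately show ?thesis using has_derivative_unique by metis
  qed
  have G: "Gc y i j$k = Gm i j k ?q" for i j k using cut_eq[OF r, of y a] y by (simp add: Gc_def Gm_def)
  have b: "bil B u (axis j 1) = (SU l. u$l*RB l j)" "bil B (axis j 1) u = (SU l. u$l*RB j l)" for B :: "3 => 3 => real^3" and u j using exhaust_3[of j] by (auto simp: bil_def sum_3 axis_def)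
  show ?thesis unfolding Rc_def dCh_def bil_axis b by (simp add: dG G sum_subtractf sum_axis_mult)
 qed
 ultimately show ?thesis unfolding dirv_comb[OF q] by simp
qed

lemma dCh_simps: "dCh x z (u+u') v = dCh x z u v+dCh x z u' v" "dCh x z u (v+v') = dCh x z u v+dCh x z u v'" "dCh x z (k*Ru) v = k*RdCh x z u v" "dCh x z u (k*Rv) = k*RdCh x z u v"
 "dCh x (z+z') u v = dCh x z u v+dCh x z' u v" "dCh x (k*Rz) u v = k*RdCh x z u v"
proof -
 have l: "linear (fd (%y. Gc y i j) x)" for i j using smooth_on_has_derivative[OF Gc_sm UNIV_I] has_derivative_linear by blast
 show "dCh x (z+z') u v = dCh x z u v+dCh x z' u v" by (simp add: dCh_def bil_def sum_3 linear_add[OF l] algebra_simps)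
qed (simp_all add: dCh_linear, simp_all add: dCh_def bil_simps)

lemma Rc_lin: "linear (%z. Rc x z u w)" "linear (%u. Rc x z u w)" "linear (%w. Rc x z u w)" by (rule linearI; simp add: Rc_def bil_simps dCh_simps algebra_simps)+

lemma axis_rep: "v = (SU i. v$i*Raxis i (1::real))" for v :: "real^3" by (simp add: vec_eq_iff axis_def if_distrib cong: if_cong)

lemma Rc_Rm: assumes y: "y : ball a r" and Z: "vf Z" "Z (cinv c y) = dirv c z (cinv c y)" shows "Rm A g Z (X v) Z (X v) (cinv c y) = bil (gm y) (Rc y z v z) v"
proof -
 note q = inv_N(1)[OF y]
 let ?q = "cinv c y" let ?e = "%i. X (axis i 1)"
 note p = N_pts[OF q] and Xv = X_vf
 have Zq: "Z ?q = (%h. SU i. z$i*?e i ?q h)" using Z(2) dirv_comb[OF q] by simp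
 have Xq: "X v ?q = (%h. SU i. v$i*?e i ?q h)" by (rule X_comb[OF q])
 have eX: "X v ?q = dirv c v ?q" by (rule X_eq[OF q])
 have s1: "Rm A g Z (X v) Z (X v) ?q = (SU i. z$i * Rm A g (?e i) (X v) Z (X v) ?q)" by (rule tens_comb[OF Rm_tens1[OF Xv Z(1) Xv p] p Z(1) Xv Zq finite])
 have s2: "Rm A g (?e i) (X v) Z (X v) ?q = (SU j. v$j * Rm A g (?e i) (?e j) Z (X v) ?q)" for i by (rule tens_comb[OF Rm_tens2[OF Xv Z(1) Xv p] p Xv Xv Xq finite])
 have s3: "Rm A g (?e i) (?e j) Z (X v) ?q = (SU k. z$k * Rm A g (?e i) (?e j) (?e k) (X v) ?q)" for i j by (rule tens_comb[OF Rm_tens3[OF Xv Xv Xv p] p Z(1) Xv Zq finite])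
 have "Rm A g Z (X v) Z (X v) ?q = (SU i. z$i*(SU j. v$j*(SU k. z$k * Rm A g (?e i) (?e j) (?e k) (X v) ?q)))" unfolding s1 s2 s3 ..
 also have "... = (SU i. z$i*(SU j. v$j*(SU k. z$k*bil (gm y) (Rc y (axis i 1) (axis j 1) (axis k 1)) v)))" unfolding Rm_def R_eq[OF y] eX gm_eq[OF y] ..
 also have "... = bil (gm y) (SU i. z$i*R(SU j. v$j*R(SU k. z$k*RRc y (axis i 1) (axis j 1) (axis k 1)))) v" by (simp add: bil_sum_left bil_sc_left)
 also have "(SU i. z$i*R(SU j. v$j*R(SU k. z$k*RRc y (axis i 1) (axis j 1) (axis k 1)))) = Rc y z v z"
 proof -
  have "(SU k. z$k*RRc y u w (axis k 1)) = Rc y u w z" for u w using axis_rep[of z] linear_sum[OF Rc_lin(3)] linear_cmul[OF Rc_lin(3)] by (metis (no_types, lifting) sum.cong)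
  moreover have "(SU j. v$j*RRc y u (axis j 1) z) = Rc y u v z" for u using axis_rep[of v] linear_sum[OF Rc_lin(2)] linear_cmul[OF Rc_lin(2)] by (metis (no_types, lifting) sum.cong)
  moreover have "(SU i. z$i*RRc y (axis i 1) v z) = Rc y z v z" using axis_rep[of z] linear_sum[OF Rc_lin(1)] linear_cmul[OF Rc_lin(1)] by (metis (no_types, lifting) sum.cong)
  ultimately show ?thesis by simp
 qed
 finally show ?thesis .
qed

end

sublocale chart_patch \<subseteq> positive_patch gm Gc sg "ball a r"
proof
 fix y v :: "real^3" assume y: "y : ball a r" and v: "v ~= 0"
 note q = inv_N(1)[OF y]
 let ?q = "cinv c y"
 note p = N_pts[OF q]
 have "dirv c v ?q ~= dirv c 0 ?q" using dirv_inj[OF c N_chart[OF q]] v by blast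
 moreover have "dirv c 0 ?q = tzero" using dirv_linear[OF c N_chart[OF q], of "%_. 0" "%_. 0" "{}"] by (simp add: tzero_def)
 ultimately have "X v ?q ~= tzero" using X_eq[OF q] by simp
 from Ric_pos[OF p X_vf this] have "0<(SU i. 1 * Rm A g (E i) (X v) (X v) (E i) ?q)" unfolding Ric_frame[OF f N_W[OF q] X_vf X_vf] .
 \<comment> \<open>Exchanging the last two arguments brings the Ricci sum to the form used in
   \<open>positive_patch\<close>, at the price of a sign.\<close>
 hence "0<(SU i. - Rm A g (E i) (X v) (E i) (X v) ?q)" unfolding Rm_asym34[OF frame_vf[OF f] X_vf frame_vf[OF f] X_vf p] by simp
 thus "(SU i. bil (gm y) (Rc y (sg i y) v (sg i y)) v)<0" unfolding Rc_Rm[OF y frame_vf[OF f] sg_eq[OF y]] by (simp add: sum_negf)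
qed

context chart_patch
begin

text \<open>The covariant acceleration of a field in the coordinates of this patch. It will be
  applied to a coordinate field of another patch, in order to compare approximate geodesics of the
  two.\<close>

lemma hessian: assumes V: "vf V" and q: "q : N" shows "D V V q (crd k) = V q (%q. V q (crd k))+bil (Gc (snd c q)) (\<chi> j. V q (crd j)) (\<chi> j. V q (crd j))$k"
proof -
 let ?e = "%i. X (axis i 1)" and ?v = "%j q. V q (crd j)" and ?y = "snd c q"
 note p = N_pts[OF q] and tV = vtan[OF V N_pts]
 have y: "?y : ball a r" by (rule N_ball[OF q])
 have qy: "cinv c ?y = q" using c N_chart[OF q] by simp
 have vs: "sf (?v j)" for j by (rule vf_sm[OF V crd_sm])
 have comb: "vf (vcomb UNIV ?v ?e)" by (rule vf_lincomb[OF X_vf vs])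
 have Vc: "V q = vcomb UNIV ?v ?e q" if "q : N" for q using coords[OF that tV[OF that]] dirv_comb[OF that, of "\<chi> k. V q (crd k)"] by simp
 have xk: "?e j q (crd k) = (if j = k then 1 else 0)" for j using crd_dirv[OF q, of "axis j 1" k] X_eq[OF q] by (simp add: axis_def)
 have "D V V q (crd k) = D V (vcomb UNIV ?v ?e) q (crd k)" using D_loc[OF V V V comb N_open q refl Vc] by simp
 also have "... = (SU j. V q (?v j)*?e j q (crd k)+?v j q*D V (?e j) q (crd k))" by (rule D_comb2[OF V vs X_vf p finite])
 also have "... = V q (?v k)+(SU j. ?v j q*D V (?e j) q (crd k))" unfolding sum.distrib xk by (simp add: if_distrib cong: if_cong)
 also have "(SU j. ?v j q*D V (?e j) q (crd k)) = (SU j. ?v j q*(SU i. ?v i q*(Gc ?y i j$k)))"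
 proof (intro sum.cong refl arg_cong2[where f = "(*)"])
  fix j
  have "D V (?e j) q (crd k) = D (vcomb UNIV ?v ?e) (?e j) q (crd k)" using D_loc[OF V comb X_vf X_vf N_open q Vc refl] by simp
  also have "... = (SU i. ?v i q*D (?e i) (?e j) q (crd k))" by (rule D_comb1[OF X_vf vs X_vf p finite])
  also have "... = (SU i. ?v i q*(Gc ?y i j$k))" using Ch_axis[OF y] crd_dirv[OF q] unfolding qy by simp
  finally show "D V (?e j) q (crd k) = (SU i. ?v i q*(Gc ?y i j$k))" .
 qed
 also have "... = bil (Gc ?y) (\<chi> j. ?v j q) (\<chi> j. ?v j q)$k" by (simp add: bil_def sum_3 algebra_simps)
 finally show ?thesis .
qed

lemma G_bound: obtains B where "B>0" "!!y w. y : ball a r ==> sqrt (bil (gm y) w w) <= B*norm w"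
proof -
 have "EX b. ALL y:cball a r. \<bar>gm y i j\<bar> <= b" for i j
 proof -
  have "compact ((%y. gm y i j) ` cball a r)" by (rule compact_continuous_image[OF continuous_on_subset[OF smo_cont[OF gm_smooth]] compact_cball]) simp
  hence "bounded ((%y. gm y i j) ` cball a r)" by (rule compact_imp_bounded)
  thus ?thesis unfolding bounded_iff by auto
 qed
 then obtain b where b: "!!i j y. y : cball a r ==> \<bar>gm y i j\<bar> <= b i j" by metis
 define B where "B = 1+(SU i. SU j. \<bar>b i j\<bar>)"
 have B: "B >= 1" unfolding B_def by (simp add: sum_nonneg)
 show thesis
 proof (rule that[of B])
  fix y w assume "y : ball a r"
  hence y: "y : cball a r" by simp
  have "bil (gm y) w w <= (SU i. SU j. norm w*norm w*\<bar>b i j\<bar>)" unfolding bil_def real_scaleR_def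
  proof (intro sum_mono)
   fix i j
   have "w$i*w$j*gm y i j <= \<bar>w$i\<bar> * \<bar>w$j\<bar> * \<bar>gm y i j\<bar>" by (metis abs_ge_self abs_mult)
   also have "... <= norm w*norm w*\<bar>b i j\<bar>" by (intro mult_mono component_le_norm_cart mult_nonneg_nonneg) (use b[OF y, of i j] in auto)
   finally show "w$i*w$j*gm y i j <= norm w*norm w*\<bar>b i j\<bar>" .
  qed
  also have "... <= (norm w)^2*B" unfolding B_def by (simp add: sum_distrib_left[symmetric] power2_eq_square distrib_left)
  also have "... <= (norm w)^2*(B*B)" using B by (intro mult_left_mono) auto
  finally have "sqrt (bil (gm y) w w) <= sqrt ((B*norm w)^2)" by (intro real_sqrt_le_mono) (simp add: power2_eq_square mult_ac)
  thus "sqrt (bil (gm y) w w) <= B*norm w" using B by simp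
 qed (use B in simp)
qed

lemma lipschitz: assumes B: "!!y w. y : ball a r ==> sqrt (bil (gm y) w w) <= B*norm w" and F: "smo (ball a r) F" and L: "L >= 0"
  and sl: "!!y w. y : ball a r ==> \<bar>fd F y w\<bar> <= L * sqrt (bil (gm y) w w)" and z: "z : ball a r" "z' : ball a r" shows "\<bar>F z-F z'\<bar> <= L*B*norm (z-z')"
proof -
 have "norm (F z-F z') <= (L*B)*norm (z-z')"
 proof (rule differentiable_bound[OF convex_ball _ _ z])
  fix y assume y: "y : ball a r"
  show d: "(F has_derivative fd F y) (at y within ball a r)" by (rule has_derivative_at_withinI[OF smooth_on_has_derivative[OF F y]])
  show "onorm (fd F y) <= L*B"
  proof (rule onorm_le)
   fix w
   have "\<bar>fd F y w\<bar> <= L * sqrt (bil (gm y) w w)" by (rule sl[OF y])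
   also have "... <= L*(B*norm w)" by (rule mult_left_mono[OF B[OF y] L])
   finally show "norm (fd F y w) <= L*B*norm w" by (simp add: mult.assoc)
  qed
 qed
 thus ?thesis by simp
qed

lemma sgx_eq: "y : ball a r ==> dirv c (sgx y xi) (cinv c y) = (%h. SU i. xi$i*E i (cinv c y) h)" unfolding sgx_def by (simp add: dirv_linear[OF c N_chart[OF inv_N(1)]] sg_eq)

end

context positive_ricci
begin

text \<open>Once the initial velocities are matched by the orthogonal change of frame, both curves
  carry the 2-jet of the same geodesic. So their difference in the coordinates of the second patch
  vanishes to second order at \<open>e = 0\<close> and is of order \<open>e^3\<close>, uniformly by
  compactness.\<close>

lemma compare: assumes 1: "chart_patch M A g c1 a1 r1 W1 E1" and 2: "chart_patch M A g c2 a2 r2 W2 E2"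
  and K: "compact K" "K <= ball a1 r1" "!!y. y : K ==> cinv c1 y : fst c2 & snd c2 (cinv c1 y) : ball a2 r2"
 defines "psi1 == patch.psi (chart_patch.Gc A g c1 a1 r1) (chart_patch.sg c1 a1 r1 E1)" and "psi2 == patch.psi (chart_patch.Gc A g c2 a2 r2) (chart_patch.sg c2 a2 r2 E2)"
 obtains C d where "C>0" "d>0" "!!y e. y : K ==> 0 <= e ==> e <= d ==> EX f. orthogonal_transformation f & (ALL xi:cball 0 4.
    psi1 y xi e : ball a1 r1 & cinv c1 (psi1 y xi e) : fst c2 & snd c2 (cinv c1 (psi1 y xi e)) : ball a2 r2 &
    psi2 (snd c2 (cinv c1 y)) (f xi) e : ball a2 r2 &
    norm (snd c2 (cinv c1 (psi1 y xi e))-psi2 (snd c2 (cinv c1 y)) (f xi) e) <= C*e^3)"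
proof -
 interpret p1: chart_patch M A g c1 a1 r1 W1 E1 by (rule 1)
 interpret p2: chart_patch M A g c2 a2 r2 W2 E2 by (rule 2)
 have psi1: "psi1 = p1.psi" and psi2: "psi2 = p2.psi" by (simp_all add: psi1_def psi2_def)
 \<comment> \<open>\<open>ph\<close> is the change of coordinates and \<open>om\<close> the matrix
   of one frame in terms of the other, both cut off to be smooth everywhere; \<open>rt\<close> acts
   on directions by the transpose of \<open>om\<close>.\<close>
 define ph where "ph y = (\<chi> k. cut c1 a1 r1 (p2.crd k) y)" for y
 define om where "om y i j = cut c1 a1 r1 (%q. g q (E1 i q) (E2 j q)) y" for y i j
 define rt where "rt y xi = (\<chi> j. SU i. xi$i * om y i j)" for y and xi :: "real^3"
 define F where "F k z = ph (p1.psi (fst (fst z)) (snd (fst z)) (snd z))$k-p2.psi (ph (fst (fst z))) (rt (fst (fst z)) (snd (fst z))) (snd z)$k"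
  for k and z :: "((real^3) \<times> (real^3)) \<times> real"
 define F1 where "F1 k = (%z. fd (F k) z (0,1))" for k
 define F2 where "F2 k = (%z. fd (F1 k) z (0,1))" for k
 have ps: "smo UNIV ph" unfolding ph_def by (rule smo_vec_lambda[OF open_UNIV cut_sm[OF p1.c p1.r p1.sub' p2.crd_sm]])
 have os: "smo UNIV (%y. om y i j)" for i j unfolding om_def by (rule cut_sm[OF p1.c p1.r p1.sub' g_sm[OF frame_vf[OF p1.f] frame_vf[OF p2.f]]])
 note zs = smo_fst[OF open_UNIV smo_fst[OF open_UNIV smo_id[OF open_UNIV]]] smo_snd[OF open_UNIV smo_fst[OF open_UNIV smo_id[OF open_UNIV]]] smo_snd[OF open_UNIV smo_id[OF open_UNIV]]
 have rs: "smo UNIV (%z :: ((real^3) \<times> (real^3)) \<times> real. rt (fst (fst z)) (snd (fst z)))" unfolding rt_def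
  by (intro smo_vec_lambda smo_sum smo_mult smo_vec_nth zs open_UNIV smo_comp[OF open_UNIV open_UNIV UNIV_I zs(1) os])
 have Fs: "smo UNIV (F k)" for k unfolding F_def by (intro smo_diff smo_vec_nth open_UNIV smo_comp[OF open_UNIV open_UNIV UNIV_I _ ps] p1.psi_sm p2.psi_sm
    smo_comp[OF open_UNIV open_UNIV UNIV_I zs(1) ps] rs zs)
 have F1s: "smo UNIV (F1 k)" for k unfolding F1_def by (rule smooth_on_deriv[OF Fs])
 have eqs: "ph y = snd c2 (cinv c1 y)" if "y : ball a1 r1" "cinv c1 y : p2.N" for y
  using cut_eq[OF p1.r, of y a1 c1] that p2.crd_dirv extend_eq[OF p2.N_chart[OF that(2)], of a2 r2] p2.N_ball[OF that(2)] p2.r by (simp add: ph_def p2.crd_def vec_eq_iff)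
 have KN: "cinv c1 y : p2.N" if "y : K" for y using K(3)[OF that] by (simp add: p2.N_def)
 have KU: "y : ball a1 r1" if "y : K" for y using that K(2) by blast
 have E12: "E1 i q = (%h. SU j. g q (E1 i q) (E2 j q)*E2 j q h)" if "q : p1.N" "q : p2.N" for q i
  using frame_rep[OF p2.f p2.N_W[OF that(2)] vtan[OF frame_vf[OF p1.f] p1.N_pts[OF that(1)]]] by simp
 have jet: "F k ((y,xi),0) = 0 & F1 k ((y,xi),0) = 0 & F2 k ((y,xi),0) = 0" if y: "y : K" for k y xi
 proof -
  note yU = KU[OF y] and q2 = KN[OF y] and q1 = p1.inv_N(1)[OF KU[OF y]]
  let ?q = "cinv c1 y" and ?s1 = "p1.sgx y xi" let ?s2 = "p2.sgx (ph y) (rt y xi)"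
  let ?ph = "cut c1 a1 r1 (p2.crd k)" and ?V = "p1.X ?s1"
  let ?d = "%y z. fd ?ph y z"
  have phy: "ph y = snd c2 ?q" "ph y : ball a2 r2" "cinv c2 (ph y) = ?q" using eqs[OF yU q2] p2.N_ball[OF q2] p2.N_chart[OF q2] p2.c by simp_all
  have s: "smo UNIV ?ph" by (rule cut_sm[OF p1.c p1.r p1.sub' p2.crd_sm])
  have oy: "om y i j = g ?q (E1 i ?q) (E2 j ?q)" for i j using cut_eq[OF p1.r, of y a1 c1] yU by (simp add: om_def)
  have "dirv c1 ?s1 ?q = dirv c2 ?s2 ?q"
  proof
   fix h
   have "dirv c1 ?s1 ?q h = (SU i. xi$i*(SU j. g ?q (E1 i ?q) (E2 j ?q)*E2 j ?q h))" unfolding p1.sgx_eq[OF yU] by (intro sum.cong refl arg_cong2[where f = "(*)"] fun_cong[OF E12[OF q1 q2]])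
   also have "... = dirv c2 ?s2 ?q h" using p2.sgx_eq[OF phy(2), of "rt y xi"] unfolding phy(3) by (simp add: rt_def oy sum_3 algebra_simps)
   finally show "dirv c1 ?s1 ?q h = dirv c2 ?s2 ?q h" .
  qed
  hence V: "?V ?q = dirv c2 ?s2 ?q" using p1.X_eq[OF q1] by simp
  hence Vk: "?V ?q (p2.crd k) = ?s2$k" for k using p2.crd_dirv[OF q2] by simp
  have D1: "((?ph) has_derivative (%z. p1.X z (cinv c1 y') (p2.crd k))) (at y')" if "y' : ball a1 r1" for y' by (rule p1.cut_deriv[OF that p2.crd_sm])
  have d1: "?d y z = p1.X z ?q (p2.crd k)" for z using fun_cong[OF frechet_derivative_at[OF D1[OF yU]], of z] by simp
  have "fd (%y. ?d y ?s1) y ?s1 = ?V ?q (%q. ?V q (p2.crd k))"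
  proof -
   have "(cut c1 a1 r1 (%q. ?V q (p2.crd k)) has_derivative (%z. p1.X z ?q (%q. ?V q (p2.crd k)))) (at y)" by (rule p1.cut_deriv[OF yU vf_sm[OF p1.X_vf p2.crd_sm]])
   hence "((%y. ?d y ?s1) has_derivative (%z. p1.X z ?q (%q. ?V q (p2.crd k)))) (at y)"
   proof (rule has_derivative_transform_within_open[OF _ open_ball yU])
    fix y' assume y': "y' : ball a1 r1"
    show "cut c1 a1 r1 (%q. ?V q (p2.crd k)) y' = ?d y' ?s1" using fun_cong[OF frechet_derivative_at[OF D1[OF y']], of ?s1] cut_eq[OF p1.r, of y' a1 c1] y' by simp
   qed
   from fun_cong[OF frechet_derivative_at[OF this], of ?s1] show ?thesis by simp
  qed
  note VV = this
  \<comment> \<open>The transformation law of Christoffel symbols, obtained by computing the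
    derivative of the field along itself in both patches.\<close>
  have h2: "fd (%y. ?d y ?s1) y ?s1-?d y (bil (p1.Gc y) ?s1 ?s1) = - bil (p2.Gc (ph y)) ?s2 ?s2$k"
  proof -
   have "p1.X (bil (p1.Gc y) ?s1 ?s1) ?q = D ?V ?V ?q" unfolding p1.X_eq[OF q1] p1.Ch_eq[OF yU] ..
   moreover have "D ?V ?V ?q (p2.crd k) = ?V ?q (%q. ?V q (p2.crd k))+bil (p2.Gc (ph y)) ?s2 ?s2$k" unfolding p2.hessian[OF p1.X_vf q2] Vk phy(1) vec_lambda_eta ..
   ultimately show ?thesis using VV unfolding d1 by simp
  qed
  let ?p1 = "%e. p1.psi y xi e" and ?G1 = "bil (p1.Gc y) ?s1 ?s1" and ?G2 = "bil (p2.Gc (ph y)) ?s2 ?s2"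
  have sq: "((%e. e^2/2) has_derivative (%h. h*e)) (at e)" for e :: real by (auto intro!: derivative_eq_intros)
  note l = has_derivative_scaleR_left[OF has_derivative_ident] has_derivative_scaleR_left[OF sq]
  have pd1: "(?p1 has_derivative (%h. h*R(?s1-e*R?G1))) (at e)" for e
   unfolding p1.psi_def by (rule has_derivative_eq_rhs[OF has_derivative_diff[OF has_derivative_add[OF has_derivative_const l(1)] l(2)]]) (simp add: fun_eq_iff algebra_simps)
  have pd2: "((%e. p2.psi (ph y) (rt y xi) e$k) has_derivative (%h. h*(?s2$k-e*?G2$k))) (at e)" for e
  proof -
   have "((%e. p2.psi (ph y) (rt y xi) e) has_derivative (%h. h*R(?s2-e*R?G2))) (at e)"
    unfolding p2.psi_def by (rule has_derivative_eq_rhs[OF has_derivative_diff[OF has_derivative_add[OF has_derivative_const l(1)] l(2)]]) (simp add: fun_eq_iff algebra_simps)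
   from bounded_linear.has_derivative[OF bounded_linear_vec_nth this, of k] show ?thesis by simp
  qed
  define f1 where "f1 e = ?d (?p1 e) (?s1-e*R?G1)-(?s2$k-e*?G2$k)" for e
  have lin: "linear (fd ?ph y')" for y' by (rule has_derivative_linear[OF smooth_on_has_derivative[OF s UNIV_I]])
  have Fd: "((%e. F k ((y,xi),e)) has_real_derivative f1 e) (at e)" for e
  proof -
   have "((%e. ?ph (?p1 e)-p2.psi (ph y) (rt y xi) e$k) has_derivative (%h. ?d (?p1 e) (h*R(?s1-e*R?G1))-h*(?s2$k-e*?G2$k))) (at e)"
    by (rule has_derivative_diff[OF has_derivative_compose[OF pd1 smooth_on_has_derivative[OF s UNIV_I]] pd2])
   moreover have "(%h. ?d (?p1 e) (h*R(?s1-e*R?G1))-h*(?s2$k-e*?G2$k)) = (*) (f1 e)" unfolding linear_cmul[OF lin] f1_def by (simp add: fun_eq_iff algebra_simps)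
   moreover have "(%e. F k ((y,xi),e)) = (%e. ?ph (?p1 e)-p2.psi (ph y) (rt y xi) e$k)" by (simp add: F_def ph_def)
   ultimately show ?thesis unfolding has_field_derivative_def by simp
  qed
  have F1e: "F1 k ((y,xi),e) = f1 e" for e using DERIV_unique[OF param_deriv[OF Fs, of k "(y,xi)" e] Fd] by (simp add: F1_def)
  have p0: "?p1 0 = y" by (simp add: p1.psi_def)
  have "((%e. ?d (?p1 e) ?s1-e*?d (?p1 e) ?G1-(?s2$k-e*?G2$k)) has_real_derivative
    fd (%y. ?d y ?s1) y ?s1-?d y ?G1+?G2$k) (at 0)"
  proof -
   have A: "((%e. ?d (?p1 e) z) has_derivative (%h. fd (%y. ?d y z) y (h*R?s1))) (at 0)" for z
    using has_derivative_compose[OF pd1 smooth_on_has_derivative[OF smooth_on_deriv[OF s, of z] UNIV_I], of 0] by (simp add: p0)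
   have lin2: "linear (fd (%y. ?d y z) y)" for z by (rule has_derivative_linear[OF smooth_on_has_derivative[OF smooth_on_deriv[OF s] UNIV_I]])
   have B: "((%e. ?s2$k-e*?G2$k) has_derivative (%h. - h*?G2$k)) (at 0)" by (auto intro!: derivative_eq_intros)
   show ?thesis unfolding has_field_derivative_def by (rule has_derivative_eq_rhs[OF has_derivative_diff[OF has_derivative_diff[OF A has_derivative_mult[OF has_derivative_ident A]] B]])
      (simp add: fun_eq_iff p0 linear_cmul[OF lin2] algebra_simps)
  qed
  moreover have "f1 = (%e. ?d (?p1 e) ?s1-e*?d (?p1 e) ?G1-(?s2$k-e*?G2$k))" by (rule ext) (simp add: f1_def linear_diff[OF lin] linear_cmul[OF lin])
  ultimately have "((%e. F1 k ((y,xi),e)) has_real_derivative 0) (at 0)" using h2 by (simp add: F1e)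
  from DERIV_unique[OF param_deriv[OF F1s, of k "(y,xi)" 0] this] have "F2 k ((y,xi),0) = 0" by (simp add: F2_def)
  moreover have "F1 k ((y,xi),0) = 0" using Vk d1 by (simp add: F1e f1_def p0)
  moreover have "F k ((y,xi),0) = 0" by (simp add: F_def p0 p2.psi_def)
  ultimately show ?thesis by blast
 qed
 have K4: "compact (K \<times> cball (0 :: real^3) 4)" by (rule compact_Times[OF K(1) compact_cball])
 have "EX C>0. ALL x e. x : K \<times> cball 0 4 --> 0 <= e --> e <= 1 --> \<bar>F k (x,e)\<bar> <= C*e^3" for k
 proof -
  have z: "F k (x,0) = 0" "F1 k (x,0) = 0" "F2 k (x,0) = 0" if "x : K \<times> cball 0 4" for x using that jet[of "fst x" k "snd x"] by auto
  obtain C where "C>0" "!!x e. x : K \<times> cball 0 4 ==> 0 <= e ==> e <= 1 ==> \<bar>F k (x,e)\<bar> <= C*e^3" using taylor_three[OF Fs K4 F1_def F2_def z] by blast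
  thus ?thesis by blast
 qed
 then obtain C where C: "!!k. C k>0" "!!k y xi e. y : K ==> xi : cball 0 4 ==> 0 <= e ==> e <= 1 ==> \<bar>F k ((y,xi),e)\<bar> <= C k*e^3" by (metis mem_Times_iff fst_conv snd_conv)
 have orth: "orthogonal_transformation (rt y)" if y: "y : K" for y
 proof -
  note yU = KU[OF y] and q2 = KN[OF y] and q1 = p1.inv_N(1)[OF KU[OF y]]
  let ?q = "cinv c1 y"
  have oy: "om y i j = g ?q (E1 i ?q) (E2 j ?q)" for i j using cut_eq[OF p1.r, of y a1 c1] yU by (simp add: om_def)
  have on: "(SU j. om y i j * om y k j) = (if i = k then 1 else 0)" for i k
  proof -
   have "g ?q (E1 i ?q) (E1 k ?q) = (SU j. om y i j*g ?q (E2 j ?q) (E1 k ?q))"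
    unfolding oy by (subst E12[OF q1 q2, of i], rule g_comb[OF p1.N_pts[OF q1] vtan[OF frame_vf[OF p2.f] p1.N_pts[OF q1]] vtan[OF frame_vf[OF p1.f] p1.N_pts[OF q1]]])
   thus ?thesis using frame_on[OF p1.f p1.N_W[OF q1], of i k] g_sym[OF p1.N_pts[OF q1] vtan[OF frame_vf[OF p2.f] p1.N_pts[OF q1]] vtan[OF frame_vf[OF p1.f] p1.N_pts[OF q1]]]
    by (simp add: oy)
  qed
  have lin: "linear (rt y)" by (rule linearI) (simp_all add: rt_def vec_eq_iff sum_3 algebra_simps)
  have "rt y xi \<bullet> rt y xi = xi \<bullet> xi" for xi
  proof -
   have "rt y xi \<bullet> rt y xi = (SU i. SU k. xi$i*xi$k*(SU j. om y i j * om y k j))" by (simp add: rt_def inner_vec_def sum_3 algebra_simps)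
   thus ?thesis by (simp add: on inner_vec_def if_distrib cong: if_cong)
  qed
  thus ?thesis using lin by (simp add: orthogonal_transformation norm_eq_sqrt_inner)
 qed
 \<comment> \<open>Membership in an open set holds at \<open>e = 0\<close>, hence by compactness for
   all small \<open>e\<close> with one bound for all points and directions.\<close>
 have tube: "EX d>0. ALL y:K. ALL xi:cball 0 4. ALL e. 0 <= e --> e <= d --> h (e,y,xi) : V"
  if h: "continuous_on UNIV h" and V: "open V" and 0: "!!y xi. y : K ==> h (0,y,xi) : V" for h :: "real \<times> (real^3) \<times> (real^3) => real^3" and V
 proof -
  have "open {e. ALL t:K \<times> cball 0 4. h (e,t) : V}" by (rule compact_tube[OF K4 h V])
  moreover have "0 : {e. ALL t:K \<times> cball 0 4. h (e,t) : V}" using 0 by auto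
  ultimately obtain d where d: "d>0" "cball 0 d <= {e. ALL t:K \<times> cball 0 4. h (e,t) : V}" using open_contains_cball by blast
  have "ALL y:K. ALL xi:cball 0 4. ALL e. 0 <= e --> e <= d --> h (e,y,xi) : V"
  proof (intro ballI allI impI)
   fix y xi e assume "y : K" "xi : cball (0 :: real^3) 4" "0 <= e" "e <= d"
   hence "e : cball 0 d" "(y,xi) : K \<times> cball 0 4" by (simp_all add: dist_real_def)
   thus "h (e,y,xi) : V" using d(2) by blast
  qed
  thus ?thesis using d(1) by blast
 qed
 let ?V1 = "{y : ball a1 r1. cinv c1 y : p2.N}"
 have V1: "open ?V1"
 proof -
  have "?V1 = snd c1 ` (p2.N Int fst c1) Int ball a1 r1"
  proof (intro equalityI subsetI)
   fix y assume "y : ?V1"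
   thus "y : snd c1 ` (p2.N Int fst c1) Int ball a1 r1" using p1.inv_N[of y] p1.N_chart[of "cinv c1 y"] by (auto intro!: image_eqI[of y _ "cinv c1 y"])
  next
   fix y assume "y : snd c1 ` (p2.N Int fst c1) Int ball a1 r1"
   thus "y : ?V1" using p1.c by auto
  qed
  thus ?thesis using open_chart_image[OF p1.c p2.N_open] by (simp add: open_Int)
 qed
 note es = smo_fst[OF open_UNIV smo_id[OF open_UNIV]] smo_fst[OF open_UNIV smo_snd[OF open_UNIV smo_id[OF open_UNIV]]] smo_snd[OF open_UNIV smo_snd[OF open_UNIV smo_id[OF open_UNIV]]]
 have "continuous_on UNIV (%z :: real \<times> (real^3) \<times> (real^3). p1.psi (fst (snd z)) (snd (snd z)) (fst z))" by (rule smo_cont[OF p1.psi_sm[OF open_UNIV es(2,3,1)]])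
 from tube[OF this V1] obtain d1 where d1: "d1>0" "!!y xi e. y : K ==> xi : cball 0 4 ==> 0 <= e ==> e <= d1 ==> p1.psi y xi e : ?V1" using KU KN by (auto simp: p1.psi_def)
 have "continuous_on UNIV (%z :: real \<times> (real^3) \<times> (real^3). p2.psi (ph (fst (snd z))) (rt (fst (snd z)) (snd (snd z))) (fst z))" unfolding rt_def
  by (intro smo_cont[OF p2.psi_sm] open_UNIV smo_comp[OF open_UNIV open_UNIV UNIV_I es(2) ps]
    smo_vec_lambda smo_sum smo_mult smo_vec_nth smo_comp[OF open_UNIV open_UNIV UNIV_I es(2) os] es)
 from tube[OF this open_ball, of a2 r2] obtain d2 where d2: "d2>0" "!!y xi e. y : K ==> xi : cball 0 4 ==> 0 <= e ==> e <= d2 ==> p2.psi (ph y) (rt y xi) e : ball a2 r2"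
  using eqs[OF KU KN] K(3) by (auto simp: p2.psi_def)
 show thesis
 proof (rule that[of "SU k. C k" "min 1 (min d1 d2)"])
  show "(SU k. C k)>0" using C(1) by (intro sum_pos) auto
  show "min 1 (min d1 d2)>0" using d1 d2 by simp
  fix y e assume y: "y : K" and e: "0 <= e" "e <= min 1 (min d1 d2)"
  show "EX f. orthogonal_transformation f & (ALL xi:cball 0 4.
    psi1 y xi e : ball a1 r1 & cinv c1 (psi1 y xi e) : fst c2 & snd c2 (cinv c1 (psi1 y xi e)) : ball a2 r2 &
    psi2 (snd c2 (cinv c1 y)) (f xi) e : ball a2 r2 &
    norm (snd c2 (cinv c1 (psi1 y xi e))-psi2 (snd c2 (cinv c1 y)) (f xi) e) <= (SU k. C k)*e^3)"
  proof (rule exI[of _ "rt y"], intro conjI orth[OF y] ballI)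
   fix xi :: "real^3" assume xi: "xi : cball 0 4"
   have P1: "p1.psi y xi e : ?V1" using d1(2)[OF y xi] e by simp
   thus "psi1 y xi e : ball a1 r1" "cinv c1 (psi1 y xi e) : fst c2" "snd c2 (cinv c1 (psi1 y xi e)) : ball a2 r2" using p2.N_chart p2.N_ball by (auto simp: psi1)
   show "psi2 (snd c2 (cinv c1 y)) (rt y xi) e : ball a2 r2" using d2(2)[OF y xi] e eqs[OF KU KN, OF y y] by (simp add: psi2)
   have "norm (ph (p1.psi y xi e)-p2.psi (ph y) (rt y xi) e) <= (SU k. \<bar>F k ((y,xi),e)\<bar>)"
    using norm_le_l1_cart[of "ph (p1.psi y xi e)-p2.psi (ph y) (rt y xi) e"] by (simp add: F_def)
   also have "... <= (SU k. C k*e^3)" by (intro sum_mono C(2) y xi) (use e in auto)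
   finally show "norm (snd c2 (cinv c1 (psi1 y xi e))-psi2 (snd c2 (cinv c1 y)) (rt y xi) e) <= (SU k. C k)*e^3"
    using eqs[of "p1.psi y xi e"] P1 eqs[OF KU KN, OF y y] by (simp add: psi1 psi2 sum_distrib_right)
  qed
 qed
qed

end

section \<open>Parallel sections of flat affine line bundles\<close>

context closed_manifold
begin

lemma finite_cover: assumes "!!p. p : TM ==> openin M (B p) & p : B p" obtains F where "finite F" "F <= TM" "TM <= (UN p:F. B p)"
proof -
 have c: "compactin M TM" using compact by (simp add: compact_space_def)
 have "EX FF. finite FF & FF <= B ` TM & TM <= \<Union>FF" by (rule compactinD[OF c]) (use assms in auto)
 then obtain FF where FF: "finite FF" "FF <= B ` TM" "TM <= \<Union>FF" by blast
 from finite_subset_image[OF FF(1,2)] obtain F where "F <= TM" "finite F" "FF = B ` F" by blast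
 thus ?thesis using that[of F] FF(3) by auto
qed

lemma closed_ball_neighbourhood: assumes "openin M V" "p : V" obtains B K where "openin M B" "p : B" "B <= K" "closedin M K" "K <= V"
proof -
 have "p : PA" by (rule pts_open[OF assms])
 then obtain c where c: "c : A" "p : fst c" using chart_at by blast
 obtain r where r: "r>0" "cball (snd c p) (2*r) <= snd c ` (V Int fst c)" using chart_ball[OF c assms] .
 let ?B = "(cpart c (ball (snd c p) r))" and ?K = "(cpart c (cball (snd c p) r))"
 have s: "cball (snd c p) r <= snd c ` (V Int fst c)" using r by (force simp: subset_iff)
 show ?thesis
 proof (rule that[of ?B ?K])
  show "openin M ?B" by (rule openin_chart_pre[OF c(1) open_ball])
  show "closedin M ?K" by (rule closedin_chart_pre[OF c(1) compact_cball]) (use s in auto)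
  show "?K <= V" using s chart_inj c unfolding inj_on_def by blast
 qed (use c r in auto)
qed

text \<open>\<open>Q x\<close> lies in the ball of its index \<open>z x\<close> and, for every index
  \<open>p\<close> of the finite cover, either inside \<open>V p\<close> or off \<open>K p\<close>.
  If \<open>Q x\<close> and \<open>Q y\<close> meet, then \<open>y\<close> cannot be outside
  \<open>K (z x)\<close>, as \<open>Q y\<close> would miss that set; so both lie in
  \<open>V (z x)\<close>.\<close>

lemma star_refinement: assumes cov: "!!p. p : TM ==> EX V:VV. openin M V & p : V" obtains Q where "!!x. x : TM ==> openin M (Q x) & x : Q x"
  "!!x y. x : TM ==> y : TM ==> Q x Int Q y ~= {} ==> EX V:VV. openin M V & Q x Un Q y <= V"
proof -
 have "EX B K V. V : VV & openin M V & openin M B & p : B & B <= K & closedin M K & K <= V" if p: "p : TM" for p by (metis cov p closed_ball_neighbourhood)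
 then obtain B K V where BKV: "!!p. p : TM ==> V p : VV & openin M (V p) & openin M (B p) & p : B p & B p <= K p & closedin M (K p) & K p <= V p" by metis
 obtain F where F: "finite F" "F <= TM" "TM <= (UN p:F. B p)" using finite_cover[of B] BKV by blast
 hence "!!x. x : TM ==> EX p:F. x : B p" by blast
 then obtain z where z: "!!x. x : TM ==> z x : F & x : B (z x)" by metis
 define Q where "Q x = \<Inter>(insert (B (z x)) ((%p. if x : K p then V p else TM-K p) ` F))" for x
 show thesis
 proof (rule that[of Q])
  fix x assume x: "x : TM"
  show "openin M (Q x) & x : Q x"
  proof
   show "openin M (Q x)" unfolding Q_def by (rule openin_Inter) (use F BKV z[OF x] in "auto intro!: openin_diff")
   show "x : Q x" using z[OF x] x F BKV by (auto simp: Q_def)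
  qed
 next
  fix x y assume x: "x : TM" and y: "y : TM" and ne: "Q x Int Q y ~= {}"
  then obtain w where w: "w : Q x" "w : Q y" by blast
  have zF: "z x : F" and zt: "z x : TM" using z[OF x] F by auto
  have Qx: "Q x <= K (z x)" using BKV[OF zt] by (auto simp: Q_def)
  have "y : K (z x)"
  proof (rule ccontr)
   assume "y ~: K (z x)"
   hence "Q y <= TM-K (z x)" using zF by (auto simp: Q_def)
   thus False using w Qx by blast
  qed
  hence "Q y <= V (z x)" using zF by (auto simp: Q_def)
  thus "EX V:VV. openin M V & Q x Un Q y <= V" using BKV[OF zt] Qx by blast
 qed
qed

lemma sm_fun_bounded: assumes h: "sf h" obtains b where "!!q. q : PA ==> \<bar>h q\<bar> <= b"
proof -
 have "EX B b. openin M B & p : B & (ALL q:B. \<bar>h q\<bar> <= b)" if p: "p : TM" for p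
 proof -
  obtain c where c: "c : A" "p : fst c" using chart_at p pts by metis
  obtain r where r: "r>0" "cball (snd c p) (2*r) <= img c" using chart_ball'[OF c] .
  have sub: "cball (snd c p) r <= img c" using r by (force simp: subset_iff)
  have "compact ((h \<circ> cinv c) ` cball (snd c p) r)" by (rule compact_continuous_image[OF continuous_on_subset[OF smo_cont[OF chart_fun_sm[OF h c(1)]] sub] compact_cball])
  hence "bounded ((h \<circ> cinv c) ` cball (snd c p) r)" by (rule compact_imp_bounded)
  then obtain b where "ALL z:(h \<circ> cinv c) ` cball (snd c p) r. norm z <= b" unfolding bounded_iff by blast
  hence b: "!!y. y : cball (snd c p) r ==> \<bar>(h \<circ> cinv c) y\<bar> <= b" by auto
  have hq: "\<bar>h q\<bar> <= b" if "q : fst c" "snd c q : ball (snd c p) r" for q using b[of "snd c q"] that c by auto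
  show ?thesis by (rule exI[of _ "(cpart c (ball (snd c p) r))"], rule exI[of _ b]) (use openin_chart_pre[OF c(1) open_ball, of "snd c p" r] c r hq in auto)
 qed
 then obtain B b where B: "!!p. p : TM ==> openin M (B p) & p : B p & (ALL q:B p. \<bar>h q\<bar> <= b p)" by metis
 obtain F where F: "finite F" "F <= TM" "TM <= (UN p:F. B p)" using finite_cover[of B] B by blast
 show thesis
 proof (rule that[of "SUM p:F. \<bar>b p\<bar>"])
  fix q assume "q : PA"
  then obtain p where p: "p : F" "q : B p" using F pts by blast
  hence "\<bar>h q\<bar> <= \<bar>b p\<bar>" using B F by force
  also have "... <= (SUM p:F. \<bar>b p\<bar>)" by (rule member_le_sum[OF p(1)]) (use F in auto)
  finally show "\<bar>h q\<bar> <= (SUM p:F. \<bar>b p\<bar>)" .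
 qed
qed

end

context positive_ricci
begin

lemma gradient_bound: assumes h: "sf h" obtains b where "b >= 0" "!!q v. q : PA ==> v : tsp q ==> \<bar>v h\<bar> <= b * sqrt (g q v v)"
proof -
 have "EX B b. openin M B & p : B & (ALL q:B. ALL v:tsp q. \<bar>v h\<bar> <= b * sqrt (g q v v))" if p: "p : TM" for p
 proof -
  obtain W E where f: "frame W E (%_. 1)" "p : W" using unit_frames p pts by metis
  have "EX b. ALL q:PA. \<bar>E i q h\<bar> <= b" for i by (rule sm_fun_bounded[OF vf_sm[OF frame_vf[OF f(1)] h], of i]) (rule exI, rule ballI)
  then obtain b where b: "!!i q. q : PA ==> \<bar>E i q h\<bar> <= b i" by metis
  have "\<bar>v h\<bar> <= (SU i. b i) * sqrt (g q v v)" if q: "q : W" and v: "v : tsp q" for q v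
  proof -
   note qp = pts_open[OF frame_open[OF f(1)] q]
   have rep: "v = (%f. SU i. g q v (E i q)*E i q f)" using frame_rep[OF f(1) q v] by simp
   have "g q v v = g q (%f. SU i. g q v (E i q)*E i q f) v" using rep by simp
   also have "... = (SU i. g q v (E i q)*g q (E i q) v)" by (rule g_comb[OF qp vtan[OF frame_vf[OF f(1)] qp] v])
   finally have gv: "g q v v = (SU i. (g q v (E i q))^2)" using g_sym[OF qp v vtan[OF frame_vf[OF f(1)] qp]] by (simp add: power2_eq_square)
   have le: "\<bar>g q v (E i q)\<bar> <= sqrt (g q v v)" for i unfolding gv by (rule real_le_rsqrt) (simp add: member_le_sum[of i UNIV "%i. (g q v (E i q))^2"])
   have "\<bar>v h\<bar> = \<bar>SU i. g q v (E i q)*E i q h\<bar>" using fun_cong[OF rep, of h] by simp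
   also have "... <= (SU i. \<bar>g q v (E i q)*E i q h\<bar>)" by (rule sum_abs)
   also have "... <= (SU i. sqrt (g q v v)*b i)" unfolding abs_mult by (intro sum_mono mult_mono le b qp) (use gv in "auto intro: sum_nonneg")
   finally show ?thesis by (simp add: sum_distrib_right mult.commute)
  qed
  thus ?thesis using frame_open[OF f(1)] f(2) by blast
 qed
 then obtain B b where B: "!!p. p : TM ==> openin M (B p) & p : B p & (ALL q:B p. ALL v:tsp q. \<bar>v h\<bar> <= b p * sqrt (g q v v))" by metis
 obtain F where F: "finite F" "F <= TM" "TM <= (UN p:F. B p)" using finite_cover[of B] B by blast
 have nn: "g q v v >= 0" if q: "q : PA" and v: "v : tsp q" for q v
 proof -
  obtain W E where f: "frame W E (%_. 1)" "q : W" using unit_frames[OF q] by blast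
  have rep: "v = (%f. SU i. g q v (E i q)*E i q f)" using frame_rep[OF f v] by simp
  have "g q v v = g q (%f. SU i. g q v (E i q)*E i q f) v" using rep by simp
  also have "... = (SU i. g q v (E i q)*g q (E i q) v)" by (rule g_comb[OF q vtan[OF frame_vf[OF f(1)] q] v])
  also have "... >= 0" using g_sym[OF q v vtan[OF frame_vf[OF f(1)] q]] by (intro sum_nonneg) simp
  finally show ?thesis .
 qed
 show thesis
 proof (rule that[of "SUM p:F. \<bar>b p\<bar>"])
  fix q v assume q: "q : PA" and v: "v : tsp q"
  then obtain p where p: "p : F" "q : B p" using F pts by blast
  hence "\<bar>v h\<bar> <= b p * sqrt (g q v v)" using B F v by blast
  also have "... <= (SUM p:F. \<bar>b p\<bar>) * sqrt (g q v v)"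
  proof (rule mult_right_mono)
   have "\<bar>b p\<bar> <= (SUM p:F. \<bar>b p\<bar>)" by (rule member_le_sum[OF p(1)]) (use F in auto)
   thus "b p <= (SUM p:F. \<bar>b p\<bar>)" by simp
  qed (use nn[OF q v] in simp)
  finally show "\<bar>v h\<bar> <= (SUM p:F. \<bar>b p\<bar>) * sqrt (g q v v)" .
 qed (simp add: sum_nonneg)
qed

text \<open>The local expression \<open>k\<close> may be arbitrary away from \<open>x\<close>,
  whereas tangent vectors act on globally smooth functions; \<open>h\<close> represents
  \<open>k\<close> near \<open>x\<close>.\<close>

definition germ :: "('a => real) => ('a => real) => 'a => bool" where "germ h k x \<longleftrightarrow> sf h & (EX V. openin M V & x : V & (ALL q:V. h q = k q))"

lemma germ_eq: "germ h k x ==> germ h' k x ==> v : tsp x ==> v h = v h'"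
proof -
 assume 1: "germ h k x" and 2: "germ h' k x" and v: "v : tsp x"
 obtain V V' where V: "openin M V" "x : V" "ALL q:V. h q = k q" "openin M V'" "x : V'" "ALL q:V'. h' q = k q" using 1 2 unfolding germ_def by blast
 show "v h = v h'" by (rule tv_loc[OF v openin_Int[OF V(1,4)]]) (use V 1 2 in "auto simp: germ_def")
qed

end

text \<open>A flat affine line bundle without a total space: every fibre is the real line, the map
  with slope \<open>sgm x y\<close> and offset \<open>tau x y\<close> carries the fibre at
  \<open>y\<close> to the fibre at \<open>x\<close>, and a section is a plain function. The cocycle
  law is required on unions of two overlapping patches, which is where transports get
  composed.\<close>

locale glued = positive_ricci +
 fixes P :: "'i set" and c :: "'i => 'a chart" and a :: "'i => real^3" and r :: "'i => real" and W :: "'i => 'a set" and E :: "'i => 3 => 'a vfield" and rho :: "'i => 'a => real"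
  and sgm tau :: "'a => 'a => real" assumes finP: "finite P" and patch: "!!i. i : P ==> chart_patch M A g (c i) (a i) (r i) (W i) (E i)"
  and rho_sm: "!!i. i : P ==> sf (rho i)" and rho_nonneg: "!!i q. i : P ==> rho i q >= 0" and rho_sum: "!!q. q : PA ==> (SUM i:P. rho i q) = 1"
  and rho_supp: "!!i q. i : P ==> rho i q ~= 0 ==> q : fst (c i) & snd (c i) q : cball (a i) (r i/2)"
  and sgm: "!!i j x y. i : P ==> j : P ==> chart_patch.N (c i) (a i) (r i) Int chart_patch.N (c j) (a j) (r j) ~= {} ==>
    x : chart_patch.N (c i) (a i) (r i) Un chart_patch.N (c j) (a j) (r j) ==>
    y : chart_patch.N (c i) (a i) (r i) Un chart_patch.N (c j) (a j) (r j) ==> sgm x y = 1 \<or> sgm x y = -1"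
  and cocycle: "!!i j x y z. i : P ==> j : P ==> chart_patch.N (c i) (a i) (r i) Int chart_patch.N (c j) (a j) (r j) ~= {} ==>
    x : chart_patch.N (c i) (a i) (r i) Un chart_patch.N (c j) (a j) (r j) ==>
    y : chart_patch.N (c i) (a i) (r i) Un chart_patch.N (c j) (a j) (r j) ==>
    z : chart_patch.N (c i) (a i) (r i) Un chart_patch.N (c j) (a j) (r j) ==>
    sgm x z = sgm x y * sgm y z & tau x z = sgm x y*tau y z+tau x y"
begin

abbreviation "N i == chart_patch.N (c i) (a i) (r i)"
abbreviation "psi i == patch.psi (chart_patch.Gc A g (c i) (a i) (r i)) (chart_patch.sg (c i) (a i) (r i) (E i))"
abbreviation "gmi i == chart_patch.gm A g (c i) (a i) (r i)"

definition "ctr i = cinv (c i) (a i)"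
definition "T x y u = sgm x y*u+tau x y"
text \<open>A section may jump from point to point along with the identifications of the fibres;
  only its values carried to the centre of a patch can be smooth. So smoothness and slope are stated
  for \<open>loc i u\<close>.\<close>

definition "loc i u q = T (ctr i) q (u q)"
definition "avg e u i y = Ex (%xi. loc i u (cinv (c i) (psi i y xi e)))"
definition "supp i = {q : fst (c i). snd (c i) q : cball (a i) (r i/2)}"
text \<open>One step of the discrete heat flow: each patch averages at its centre fibre, the results
  are carried back to \<open>x\<close> and mixed by the partition of unity.\<close>

definition "step e u x = (SUM i:P. rho i x*T x (ctr i) (avg e u i (snd (c i) x)))"
definition "smooth_sec u \<longleftrightarrow> (ALL i:P. ALL x:N i. EX h. germ h (loc i u) x)"
definition "slope u L \<longleftrightarrow> (ALL i:P. ALL x:N i. ALL h. germ h (loc i u) x --> (ALL v:tsp x. \<bar>v h\<bar> <= L * sqrt (g x v v)))"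

context
 fixes i j assumes i: "i : P" and j: "j : P" and ne: "N i Int N j ~= {}"
begin

lemma T_self: "x : N i Un N j ==> T x x u = u" using sgm[OF i j ne, of x x] cocycle[OF i j ne, of x x x] by (auto simp: T_def)

lemma T_trans: "x : N i Un N j ==> y : N i Un N j ==> z : N i Un N j ==> T x z u = T x y (T y z u)" using cocycle[OF i j ne, of x y z] by (simp add: T_def algebra_simps)

lemma T_dist: "x : N i Un N j ==> y : N i Un N j ==> \<bar>T x y u-T x y w\<bar> = \<bar>u-w\<bar>" using sgm[OF i j ne, of x y] by (auto simp: T_def)

end

lemma ctr_N: "i : P ==> ctr i : N i"
proof -
 assume i: "i : P"
 interpret p: chart_patch M A g "c i" "a i" "r i" "W i" "E i" by (rule patch[OF i])
 show ?thesis unfolding ctr_def by (rule p.inv_N) (use p.r in simp)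
qed

lemma supp_N: "i : P ==> supp i <= N i"
proof -
 assume i: "i : P"
 interpret p: chart_patch M A g "c i" "a i" "r i" "W i" "E i" by (rule patch[OF i])
 show ?thesis using p.r by (auto simp: supp_def p.N_def)
qed

lemma N_open: "i : P ==> openin M (N i)" using chart_patch.N_open[OF patch] .

lemma supp_closed: "i : P ==> closedin M (supp i)"
proof -
 assume i: "i : P"
 interpret p: chart_patch M A g "c i" "a i" "r i" "W i" "E i" by (rule patch[OF i])
 show ?thesis unfolding supp_def by (rule closedin_chart_pre[OF p.c compact_cball]) (use p.sub' p.r in "force simp: subset_iff")
qed

lemma rho_supp': "i : P ==> q ~: supp i ==> rho i q = 0" using rho_supp by (auto simp: supp_def)

lemma loc_change: assumes i: "i : P" and j: "j : P" and q: "q : N i" "q : N j" shows "loc j u q = T (ctr j) (ctr i) (loc i u q)"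
 unfolding loc_def using T_trans[OF i j, of "ctr j" "ctr i" q] q ctr_N[OF i] ctr_N[OF j] by blast

lemma chart_form: assumes s: "smooth_sec u" and i: "i : P" shows "smo (ball (a i) (r i)) (%y. loc i u (cinv (c i) y))"
  "slope u L ==> y : ball (a i) (r i) ==> \<bar>fd (%y. loc i u (cinv (c i) y)) y w\<bar> <= L * sqrt (bil (gmi i y) w w)"
proof -
 interpret p: chart_patch M A g "c i" "a i" "r i" "W i" "E i" by (rule patch[OF i])
 let ?F = "%y. loc i u (cinv (c i) y)"
 have nb: "EX h V. germ h (loc i u) (cinv (c i) y) & open V & y : V & V <= ball (a i) (r i) & (ALL z:V. h (cinv (c i) z) = ?F z)" if y: "y : ball (a i) (r i)" for y
 proof -
  obtain h where h: "germ h (loc i u) (cinv (c i) y)" using s i p.inv_N(1)[OF y] unfolding smooth_sec_def by blast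
  then obtain O' where O': "openin M O'" "cinv (c i) y : O'" "ALL q:O'. h q = loc i u q" unfolding germ_def by blast
  let ?V = "snd (c i) ` (O' Int fst (c i)) Int ball (a i) (r i)"
  have "open ?V" using open_chart_image[OF p.c O'(1)] by (simp add: open_Int)
  moreover have "y : ?V" using O'(2) p.inv_N[OF y] p.N_chart y by (auto intro!: image_eqI[of y _ "cinv (c i) y"])
  moreover have "ALL z:?V. h (cinv (c i) z) = ?F z" using O'(3) p.c by auto
  ultimately show ?thesis using h by (intro exI[of _ h] exI[of _ ?V]) auto
 qed
 show "smo (ball (a i) (r i)) ?F"
 proof (rule smo_loc)
  fix y assume "y : ball (a i) (r i)"
  from nb[OF this] obtain h V where h: "germ h (loc i u) (cinv (c i) y)" and V: "open V" "y : V" "V <= ball (a i) (r i)" "ALL z:V. h (cinv (c i) z) = ?F z" by blast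
  have "smo V (h \<circ> cinv (c i))" by (rule sm_funD[OF _ p.c]) (use h V(3) p.ball_in in "auto simp: germ_def")
  hence "smo V ?F" by (rule smo_cong[OF V(1), rotated]) (use V(4) in simp)
  thus "EX U. open U & y : U & smo (ball (a i) (r i) Int U) ?F" using V smo_sub[OF _ Int_lower2] by blast
 qed
 assume sl: "slope u L" and y: "y : ball (a i) (r i)"
 from nb[OF y] obtain h V where h: "germ h (loc i u) (cinv (c i) y)" and V: "open V" "y : V" "V <= ball (a i) (r i)" "ALL z:V. h (cinv (c i) z) = ?F z" by blast
 note q = p.inv_N[OF y]
 have hs: "sf h" using h by (simp add: germ_def)
 have "(h \<circ> cinv (c i) has_derivative (%w. dirv (c i) w (cinv (c i) y) h)) (at y)" using chart_fun_deriv[OF hs p.c p.N_chart[OF q(1)]] q(2) by simp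
 hence "(?F has_derivative (%w. dirv (c i) w (cinv (c i) y) h)) (at y)" by (rule has_derivative_transform_within_open[OF _ V(1,2)]) (use V(4) in simp)
 from fun_cong[OF frechet_derivative_at[OF this], of w]
 have "fd ?F y w = dirv (c i) w (cinv (c i) y) h" by simp
 moreover have "\<bar>dirv (c i) w (cinv (c i) y) h\<bar> <= L * sqrt (g (cinv (c i) y) (dirv (c i) w (cinv (c i) y)) (dirv (c i) w (cinv (c i) y)))"
  using sl i q(1) h dirv_tangent[OF p.c p.N_chart[OF q(1)]] unfolding slope_def by blast
 ultimately show "\<bar>fd ?F y w\<bar> <= L * sqrt (bil (gmi i y) w w)" unfolding p.gm_eq[OF y] by simp
qed

lemma slope_nonneg_bound: obtains B where "B>0" "!!i y w. i : P ==> y : ball (a i) (r i) ==> sqrt (bil (gmi i y) w w) <= B*norm w"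
proof -
 have "EX B>0. ALL y w. y : ball (a i) (r i) --> sqrt (bil (gmi i y) w w) <= B*norm w" if "i : P" for i using chart_patch.G_bound[OF patch[OF that]] by metis
 then obtain B where B: "!!i. i : P ==> B i>0 & (ALL y w. y : ball (a i) (r i) --> sqrt (bil (gmi i y) w w) <= B i*norm w)" by metis
 show thesis
 proof (rule that[of "1+(SUM i:P. B i)"])
  show "1+(SUM i:P. B i)>0" using B by (intro add_pos_nonneg sum_nonneg) (auto intro: less_imp_le)
  fix i y and w :: "real^3" assume i: "i : P" and y: "y : ball (a i) (r i)"
  have "B i <= (SUM i:P. B i)" by (rule member_le_sum[OF i]) (use B finP in "auto intro: less_imp_le")
  hence "B i*norm w <= (1+(SUM i:P. B i))*norm w" by (intro mult_right_mono) auto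
  thus "sqrt (bil (gmi i y) w w) <= (1+(SUM i:P. B i))*norm w" using B[OF i] y by (meson order_trans)
 qed
qed

lemma finite_uniform:
 fixes Q :: "'j => real => bool" assumes "finite S" "!!i. i : S ==> EX d>0. ALL e. 0 <= e --> e <= d --> Q i e" shows "EX d>0. ALL i:S. ALL e. 0 <= e --> e <= d --> Q i e" using assms
proof (induction S)
 case empty
 thus ?case by (intro exI[of _ 1]) simp
next
 case (insert i S)
 then obtain d where d: "d>0" "!!j e. j : S ==> 0 <= e ==> e <= d ==> Q j e" by auto
 obtain d' where d': "d'>0" "!!e. 0 <= e ==> e <= d' ==> Q i e" using insert.prems by blast
 show ?case by (rule exI[of _ "min d d'"]) (use d d' in auto)
qed

text \<open>Starting points in the half ball suffice since \<open>rho i\<close> is supported there;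
  end points must remain where the patch data are valid.\<close>

definition "stays i e \<longleftrightarrow> (ALL y:cball (a i) (r i/2). ALL xi:cball 0 4. psi i y xi e : ball (a i) (r i))"

lemma staysD: "stays i e ==> y : cball (a i) (r i/2) ==> xi : cball 0 4 ==> psi i y xi e : ball (a i) (r i)" unfolding stays_def by blast

definition "contracts k i e \<longleftrightarrow> (ALL y:cball (a i) (r i/2). ALL F L v. smo (ball (a i) (r i)) F --> L >= 0 -->
   (ALL y w. y : ball (a i) (r i) --> \<bar>fd F y w\<bar> <= L * sqrt (bil (gmi i y) w w)) -->
   \<bar>fd (%x. Ex (%xi. F (psi i x xi e))) y v\<bar> <= L*(1-k*e^2) * sqrt (bil (gmi i y) v v))"

lemma contracts_antimono: "contracts k i e ==> k' <= k ==> i : P ==> contracts k' i e" unfolding contracts_def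
proof (intro ballI allI impI)
 fix y and F :: "real^3 => real" and L v
 assume h: "ALL y:cball (a i) (r i/2). ALL F L v. smo (ball (a i) (r i)) F --> L >= 0 --> (ALL y w. y : ball (a i) (r i) --> \<bar>fd F y w\<bar> <= L * sqrt (bil (gmi i y) w w)) -->
   \<bar>fd (%x. Ex (%xi. F (psi i x xi e))) y v\<bar> <= L*(1-k*e^2) * sqrt (bil (gmi i y) v v)"
  and k: "k' <= k" and i: "i : P" and y: "y : cball (a i) (r i/2)" and F: "smo (ball (a i) (r i)) F" and L: "L >= 0"
  and sl: "ALL y w. y : ball (a i) (r i) --> \<bar>fd F y w\<bar> <= L * sqrt (bil (gmi i y) w w)"
 interpret p: chart_patch M A g "c i" "a i" "r i" "W i" "E i" by (rule patch[OF i])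
 have nn: "bil (gmi i y) v v >= 0" using p.G_nonneg[of y v] y p.r by auto
 have "\<bar>fd (%x. Ex (%xi. F (psi i x xi e))) y v\<bar> <= L*(1-k*e^2) * sqrt (bil (gmi i y) v v)" using h y F L sl by blast
 also have "... <= L*(1-k'*e^2) * sqrt (bil (gmi i y) v v)" using k L nn by (intro mult_right_mono mult_left_mono diff_left_mono) auto
 finally show "\<bar>fd (%x. Ex (%xi. F (psi i x xi e))) y v\<bar> <= L*(1-k'*e^2) * sqrt (bil (gmi i y) v v)" .
qed

lemma uniform_contraction: obtains k d where "k>0" "d>0" "!!i e. i : P ==> 0 <= e ==> e <= d ==> stays i e & contracts k i e"
proof -
 have "EX k>0. EX d>0. ALL e. 0 <= e --> e <= d --> stays i e & contracts k i e" if i: "i : P" for i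
 proof -
  interpret p: chart_patch M A g "c i" "a i" "r i" "W i" "E i" by (rule patch[OF i])
  have K: "compact (cball (a i) (r i/2))" "cball (a i) (r i/2) <= ball (a i) (r i)" using p.r by auto
  show ?thesis
  proof (rule p.contraction[OF K], goal_cases)
   case (1 k d)
   note h = this
   have "stays i e & contracts k i e" if "0 <= e" "e <= d" for e unfolding stays_def contracts_def using h(3)[OF _ that] h(4)[OF _ that] by blast
   thus ?case using h(1,2) by blast
  qed
 qed
 then obtain k where k: "!!i. i : P ==> k i>0 & (EX d>0. ALL e. 0 <= e --> e <= d --> stays i e & contracts (k i) i e)" by metis
 obtain d where d: "d>0" "ALL i:P. ALL e. 0 <= e --> e <= d --> stays i e & contracts (k i) i e" using finite_uniform[OF finP, of "%i e. stays i e & contracts (k i) i e"] k by blast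
 define k0 where "k0 = Min (insert 1 (k ` P))"
 have k0: "k0>0" "!!i. i : P ==> k0 <= k i" using finP k by (auto simp: k0_def)
 show thesis by (rule that[OF k0(1) d(1)]) (use d(2) contracts_antimono[OF _ k0(2)] in blast)
qed

lemma Ex_affine: "continuous_on cube F ==> Ex (%x. s*F x+t) = s*Ex F+t" by (subst Ex_add[OF continuous_on_mult[OF continuous_on_const] continuous_on_const]) (simp_all only: Ex_cmul Ex_c)

text \<open>By \<open>compare\<close>, the end points in two patches differ by order
  \<open>e^3\<close> after a rotation of the direction, which does not affect the mean. The slope
  bound turns this into a difference of values, and \<open>T\<close> commutes with means because it
  is affine.\<close>

lemma uniform_comparison: obtains C d where "C>0" "d>0" "!!i j x e u L. i : P ==> j : P ==> x : supp i ==> x : supp j ==> 0 <= e ==> e <= d ==> smooth_sec u ==> L >= 0 ==> slope u L ==>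
   \<bar>T (ctr j) (ctr i) (avg e u i (snd (c i) x))-avg e u j (snd (c j) x)\<bar> <= L*C*e^3"
proof -
 obtain B where B: "B>0" "!!i y w. i : P ==> y : ball (a i) (r i) ==> sqrt (bil (gmi i y) w w) <= B*norm w" using slope_nonneg_bound by blast
 obtain k d0 where d0': "k>0" "d0>0" "!!i e. i : P ==> 0 <= e ==> e <= d0 ==> stays i e & contracts k i e" by (rule uniform_contraction, rule that, assumption+)
 have d0: "d0>0" "!!i y xi e. i : P ==> y : cball (a i) (r i/2) ==> 0 <= e ==> e <= d0 ==> xi : cball 0 4 ==> psi i y xi e : ball (a i) (r i)"
  by (rule d0'(2), rule staysD[OF conjunct1[OF d0'(3)]])
 let ?Q = "%C ij e. ALL x u L. x : supp (fst ij) --> x : supp (snd ij) --> smooth_sec u --> L >= 0 --> slope u L -->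
   \<bar>T (ctr (snd ij)) (ctr (fst ij)) (avg e u (fst ij) (snd (c (fst ij)) x))-avg e u (snd ij) (snd (c (snd ij)) x)\<bar> <= L*C*e^3"
 have "EX C>0. EX d>0. ALL e. 0 <= e --> e <= d --> ?Q C (i,j) e" if i: "i : P" and j: "j : P" for i j
 proof -
  interpret p: chart_patch M A g "c i" "a i" "r i" "W i" "E i" by (rule patch[OF i])
  interpret q: chart_patch M A g "c j" "a j" "r j" "W j" "E j" by (rule patch[OF j])
  \<comment> \<open>The coordinates in patch \<open>i\<close> of the common part of the two
    supports, written as a compact ball minus an open set.\<close>
  define K where "K = cball (a i) (r i/2)-snd (c i) ` ((TM-supp j) Int fst (c i))"
  have K1: "compact K" unfolding K_def by (rule compact_diff[OF compact_cball open_chart_image[OF p.c openin_diff[OF openin_topspace supp_closed[OF j]]]])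
  have K2: "K <= ball (a i) (r i)" using p.r by (auto simp: K_def)
  have K3: "cinv (c i) y : supp j" if "y : K" for y
  proof (rule ccontr)
   assume n: "cinv (c i) y ~: supp j"
   have y: "y : ball (a i) (r i)" using that K2 by blast
   have "cinv (c i) y : (TM-supp j) Int fst (c i)" using n p.inv_N(1)[OF y] p.N_chart p.N_pts pts by auto
   hence "y : snd (c i) ` ((TM-supp j) Int fst (c i))" using p.inv_N(2)[OF y] by (metis image_eqI)
   thus False using that by (simp add: K_def)
  qed
  have K3': "cinv (c i) y : fst (c j) & snd (c j) (cinv (c i) y) : ball (a j) (r j)" if "y : K" for y using K3[OF that] supp_N[OF j] q.N_chart q.N_ball by blast
  have Kx: "snd (c i) x : K & cinv (c i) (snd (c i) x) = x" if x: "x : supp i" "x : supp j" for x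
  proof -
   have xc: "x : fst (c i)" "snd (c i) x : cball (a i) (r i/2)" using x by (auto simp: supp_def)
   have "snd (c i) x ~: snd (c i) ` ((TM-supp j) Int fst (c i))" using chart_inj[OF p.c] xc x(2) by (auto simp: inj_on_def)
   thus ?thesis using xc p.c by (simp add: K_def)
  qed
  obtain C d where C: "C>0" "d>0" "!!y e. y : K ==> 0 <= e ==> e <= d ==> EX f. orthogonal_transformation f & (ALL xi:cball 0 4.
    psi i y xi e : ball (a i) (r i) & cinv (c i) (psi i y xi e) : fst (c j) & snd (c j) (cinv (c i) (psi i y xi e)) : ball (a j) (r j) &
    psi j (snd (c j) (cinv (c i) y)) (f xi) e : ball (a j) (r j) &
    norm (snd (c j) (cinv (c i) (psi i y xi e))-psi j (snd (c j) (cinv (c i) y)) (f xi) e) <= C*e^3)" using compare[OF patch[OF i] patch[OF j] K1 K2 K3'] by metis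
  have "?Q (B*C) (i,j) e" if e: "0 <= e" "e <= min d d0" for e
  proof (intro allI impI)
   fix x u L assume xi: "x : supp (fst (i,j))" and xj: "x : supp (snd (i,j))" and u: "smooth_sec u" and L: "L >= 0" and sl: "slope u L"
   let ?y = "snd (c i) x" and ?z = "snd (c j) x"
   have x: "x : supp i" "x : supp j" using xi xj by simp_all
   note y = Kx[OF x, THEN conjunct1] and yx = Kx[OF x, THEN conjunct2]
   have zc: "?z : cball (a j) (r j/2)" and yc: "?y : cball (a i) (r i/2)" using x by (auto simp: supp_def)
   obtain f where f: "orthogonal_transformation f" "!!xi. xi : cball 0 4 ==>
     psi i ?y xi e : ball (a i) (r i) & cinv (c i) (psi i ?y xi e) : fst (c j) & snd (c j) (cinv (c i) (psi i ?y xi e)) : ball (a j) (r j) &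
     psi j ?z (f xi) e : ball (a j) (r j) & norm (snd (c j) (cinv (c i) (psi i ?y xi e))-psi j ?z (f xi) e) <= C*e^3" using C(3)[OF y e(1)] e(2) unfolding yx by auto
   let ?F = "%y. loc i u (cinv (c i) y)" and ?G = "%y. loc j u (cinv (c j) y)"
   have cub: "xi : cball 0 4" if "xi : cube" for xi using that cube_sub by force
   have psc: "continuous_on X (%xi. psi i ?y xi e)" "continuous_on X (%xi. psi j ?z xi e)" for X
    using continuous_on_subset[OF smo_cont[OF p.psi_sm[OF open_UNIV smo_c smo_id[OF open_UNIV] smo_c]] subset_UNIV]
     continuous_on_subset[OF smo_cont[OF q.psi_sm[OF open_UNIV smo_c smo_id[OF open_UNIV] smo_c]] subset_UNIV] by blast+
   have cF: "continuous_on cube (%xi. ?F (psi i ?y xi e))" by (rule continuous_on_compose2[OF smo_cont[OF chart_form(1)[OF u i]] psc(1)]) (use f(2) cub in auto)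
   have cG: "continuous_on (ball 0 4) (%xi. ?G (psi j ?z xi e))" by (rule continuous_on_compose2[OF smo_cont[OF chart_form(1)[OF u j]] psc(2)]) (use d0(2)[OF j zc] e in auto)
   have nf: "norm (f xi) = norm xi" for xi using f(1) by (simp add: orthogonal_transformation)
   have cGf: "continuous_on cube (%xi. ?G (psi j ?z (f xi) e))"
    by (rule continuous_on_compose2[OF cG linear_continuous_on]) (use f(1) nf cube_sub in "auto simp: orthogonal_transformation_def linear_conv_bounded_linear")
   have tr: "T (ctr j) (ctr i) (?F (psi i ?y xi e)) = ?G (snd (c j) (cinv (c i) (psi i ?y xi e)))" if xi: "xi : cube" for xi
   proof -
    let ?m = "cinv (c i) (psi i ?y xi e)"
    have m: "?m : N i" "?m : N j" "cinv (c j) (snd (c j) ?m) = ?m" using f(2)[OF cub[OF xi]] p.inv_N(1) q.c by (auto simp: q.N_def)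
    show ?thesis using loc_change[OF i j m(1,2)] m(3) by simp
   qed
   have e1: "T (ctr j) (ctr i) (avg e u i ?y) = Ex (%xi. T (ctr j) (ctr i) (?F (psi i ?y xi e)))" unfolding T_def avg_def by (rule Ex_affine[OF cF, symmetric])
   have e2: "avg e u j ?z = Ex (%xi. ?G (psi j ?z (f xi) e))" unfolding avg_def by (rule Ex_rotate[OF f(1) cG, symmetric])
   have e3: "Ex (%xi. T (ctr j) (ctr i) (?F (psi i ?y xi e))+(-1)*?G (psi j ?z (f xi) e)) =
     T (ctr j) (ctr i) (avg e u i ?y)-avg e u j ?z" unfolding e1 e2 by (subst Ex_add) (auto simp: T_def Ex_cmul[of "-1", simplified] intro!: continuous_intros cF cGf)
   have "\<bar>Ex (%xi. T (ctr j) (ctr i) (?F (psi i ?y xi e))+(-1)*?G (psi j ?z (f xi) e))\<bar> <= L*B*(C*e^3)"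
   proof (rule Ex_bound)
    show "continuous_on cube (%xi. T (ctr j) (ctr i) (?F (psi i ?y xi e))+(-1)*?G (psi j ?z (f xi) e))" by (auto simp: T_def intro!: continuous_intros cF cGf)
    fix xi assume xi: "xi : cube"
    note fx = f(2)[OF cub[OF xi]]
    have l1: "\<bar>?G (snd (c j) (cinv (c i) (psi i ?y xi e)))-?G (psi j ?z (f xi) e)\<bar>
      <= L*B*norm (snd (c j) (cinv (c i) (psi i ?y xi e))-psi j ?z (f xi) e)" by (rule q.lipschitz[OF B(2)[OF j] chart_form(1)[OF u j] L chart_form(2)[OF u j sl]]) (use fx in auto)
    have "L*B*norm (snd (c j) (cinv (c i) (psi i ?y xi e))-psi j ?z (f xi) e) <= L*B*(C*e^3)" using fx L B(1) by (intro mult_left_mono) auto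
    with l1 show "\<bar>T (ctr j) (ctr i) (?F (psi i ?y xi e))+(-1)*?G (psi j ?z (f xi) e)\<bar> <= L*B*(C*e^3)" unfolding tr[OF xi] by simp
   qed
   thus "\<bar>T (ctr (snd (i,j))) (ctr (fst (i,j))) (avg e u (fst (i,j)) (snd (c (fst (i,j))) x))-avg e u (snd (i,j)) (snd (c (snd (i,j))) x)\<bar> <= L*(B*C)*e^3"
    unfolding e3 fst_conv snd_conv by (simp only: mult.assoc)
  qed
  thus ?thesis using B(1) C(1,2) d0(1) by (intro exI[of _ "B*C"] conjI exI[of _ "min d d0"]) auto
 qed
 hence "ALL ij:P \<times> P. EX C>0. EX d>0. ALL e. 0 <= e --> e <= d --> ?Q C ij e" by auto
 then obtain C where C: "!!ij. ij : P \<times> P ==> C ij>0 & (EX d>0. ALL e. 0 <= e --> e <= d --> ?Q (C ij) ij e)" by metis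
 have finPP: "finite (P \<times> P)" using finP by simp
 obtain d where d: "d>0" "ALL ij:P \<times> P. ALL e. 0 <= e --> e <= d --> ?Q (C ij) ij e" using finite_uniform[OF finPP, of "%ij e. ?Q (C ij) ij e"] C by blast
 define C0 where "C0 = 1+(SUM ij:P \<times> P. C ij)"
 have "(SUM ij:P \<times> P. C ij) >= 0" by (rule sum_nonneg) (use C in "blast intro: less_imp_le")
 hence C0: "C0>0" by (simp add: C0_def)
 have Cle: "C ij <= C0" if "ij : P \<times> P" for ij
 proof -
  have "C ij <= (SUM ij:P \<times> P. C ij)" by (rule member_le_sum[OF that]) (use C finPP in "auto intro: less_imp_le")
  thus ?thesis by (simp add: C0_def)
 qed
 show thesis
 proof (rule that[OF C0 d(1)])
  fix i j x e u L assume i: "i : P" and j: "j : P" and x: "x : supp i" "x : supp j" and e: "0 <= e" "e <= d" and u: "smooth_sec u" and L: "L >= 0" and sl: "slope u L"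
  have ij: "(i,j) : P \<times> P" using i j by simp
  have "\<bar>T (ctr j) (ctr i) (avg e u i (snd (c i) x))-avg e u j (snd (c j) x)\<bar> <= L*C (i,j)*e^3" using d(2)[rule_format, OF ij e, of x u L] x u L sl by simp
  also have "... <= L*C0*e^3" using Cle[OF ij] L e by (intro mult_right_mono mult_left_mono) auto
  finally show "\<bar>T (ctr j) (ctr i) (avg e u i (snd (c i) x))-avg e u j (snd (c j) x)\<bar> <= L*C0*e^3" .
 qed
qed

lemma avg_germ: assumes i: "i : P" and x: "x : supp i" and u: "smooth_sec u" and st: "stays i e" obtains k where "germ k (%q. avg e u i (snd (c i) q)) x"
  "!!L v. slope u L ==> L >= 0 ==> contracts kk i e ==> v : tsp x ==> \<bar>v k\<bar> <= L*(1-kk*e^2) * sqrt (g x v v)"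
proof -
 interpret p: chart_patch M A g "c i" "a i" "r i" "W i" "E i" by (rule patch[OF i])
 let ?F = "%y. loc i u (cinv (c i) y)" and ?y = "snd (c i) x"
 let ?q = "%y. Ex (%xi. ?F (psi i y xi e))"
 have xc: "x : fst (c i)" "?y : cball (a i) (r i/2)" using x by (auto simp: supp_def)
 have yU: "?y : ball (a i) (r i)" using xc p.r by auto
 have xN: "x : N i" using xc yU by (simp add: p.N_def)
 have Fs: "smo (ball (a i) (r i)) ?F" by (rule chart_form(1)[OF u i])
 have in1: "!!xi. xi : cball 0 4 ==> psi i ?y xi e : ball (a i) (r i)" using st xc unfolding stays_def by blast
 let ?S = "{y. ALL xi:cball 0 4. psi i y xi e : ball (a i) (r i)}"
 note av = p.average_deriv[OF yU Fs in1]
 have So: "open (?S Int ball (a i) (r i))" using av(3) by (simp add: open_Int)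
 have "?y : ?S Int ball (a i) (r i)" using in1 yU by blast
 then obtain s0 where s0: "s0>0" "cball ?y s0 <= ?S Int ball (a i) (r i)" using So open_contains_cball by blast
 define s where "s = s0/2"
 have s: "s>0" "cball ?y (2 * s) <= ?S Int ball (a i) (r i)" using s0 by (simp_all add: s_def)
 define k where "k = extend (c i) ?y s ?q"
 have qs: "smo (?S Int ball (a i) (r i)) ?q" by (rule smo_sub[OF av(2) Int_lower1])
 have ks: "sf k" unfolding k_def by (rule extend_sm[OF p.c s(2,1) So _ qs]) (use p.ball_in in blast)
 let ?V = "{q : fst (c i). snd (c i) q : ball ?y s}"
 have V: "openin M ?V" "x : ?V" using openin_chart_pre[OF p.c open_ball] xc s by auto
 have keq: "k q = ?q (snd (c i) q)" if "q : ?V" for q unfolding k_def by (rule extend_eq) (use that s in auto)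
 have "germ k (%q. avg e u i (snd (c i) q)) x" unfolding germ_def avg_def using ks V keq by (intro conjI exI[of _ ?V]) auto
 moreover have "\<bar>v k\<bar> <= L*(1-kk*e^2) * sqrt (g x v v)" if sl: "slope u L" and L: "L >= 0" and ct: "contracts kk i e" and v: "v : tsp x" for L v
 proof -
  obtain w where w: "v = dirv (c i) w x" using tangent_eq_dirv[OF p.c xc(1) v] .
  have "v k = fd ?q ?y w" unfolding w
  proof (rule dirv_cong[OF p.c xc(1) open_ball])
   show "?y : ball ?y s" using s by simp
   show "ball ?y s <= img (c i)" using s p.ball_in by (auto simp: subset_iff)
   show "?q differentiable (at ?y)" using av(1) differentiableI by blast
  qed (use ks keq in auto)
  moreover have "\<bar>fd ?q ?y w\<bar> <= L*(1-kk*e^2) * sqrt (bil (gmi i ?y) w w)" using ct xc(2) Fs L chart_form(2)[OF u i sl] unfolding contracts_def by blast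
  moreover have "bil (gmi i ?y) w w = g x v v" using p.gm_eq[OF yU, of w w] xc p.c by (simp add: w)
  ultimately show ?thesis by simp
 qed
 ultimately show thesis by (rule that)
qed

lemma near: assumes x: "x : N j" and j: "j : P" obtains V where "openin M V" "x : V" "V <= N j" "!!i q. i : P ==> x : supp i ==> q : V ==> q : N i"
  "!!i q. i : P ==> x ~: supp i ==> q : V ==> rho i q = 0"
proof -
 define V where "V = \<Inter>(insert (N j) ((%i. if x : supp i then N i else TM-supp i) ` P))"
 have xt: "x : TM" using x openin_subset[OF N_open[OF j]] by blast
 show thesis
 proof (rule that[of V])
  show "openin M V" unfolding V_def by (rule openin_Inter) (use finP N_open j supp_closed in "auto intro!: openin_diff")
  show "x : V" unfolding V_def using x xt supp_N by auto
  show "V <= N j" by (auto simp: V_def)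
  have mem: "q : (if x : supp i then N i else TM-supp i)" if "i : P" "q : V" for i q using that unfolding V_def by blast
  show "q : N i" if "i : P" "x : supp i" "q : V" for i q using mem[OF that(1,3)] that(2) by simp
  show "rho i q = 0" if "i : P" "x ~: supp i" "q : V" for i q using mem[OF that(1,3)] that(2) rho_supp'[OF that(1)] by simp
 qed
qed

text \<open>The weights add up to 1 and \<open>T\<close> is affine, so carrying the mixture to the
  centre of patch \<open>j\<close> amounts to mixing the transported averages.\<close>

lemma weighted_germ: assumes j: "j : P" and x: "x : N j" and k: "!!i. i : P ==> x : supp i ==> germ (k i) (z i) x"
 shows "germ (%q. SUM i:{i:P. x : supp i}. rho i q*T (ctr j) (ctr i) (k i q)) (loc j (%q. SUM i:P. rho i q*T q (ctr i) (z i q))) x"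
proof -
 let ?I = "{i:P. x : supp i}"
 obtain V where V: "openin M V" "x : V" "V <= N j" "!!i q. i : P ==> x : supp i ==> q : V ==> q : N i" "!!i q. i : P ==> x ~: supp i ==> q : V ==> rho i q = 0" using near[OF x j] by blast
 obtain Y where Y: "!!i. i : ?I ==> openin M (Y i) & x : Y i & (ALL q:Y i. k i q = z i q)" using k unfolding germ_def by (simp, metis)
 have fin: "finite ?I" using finP by simp
 define O' where "O' = \<Inter>(insert V (Y ` ?I))"
 have "openin M O'" unfolding O'_def by (rule openin_Inter) (use V(1) Y fin in auto)
 moreover have "x : O'" unfolding O'_def using V(2) Y by blast
 ultimately have O': "openin M O'" "x : O'" by blast+
 have sm: "sf (%q. SUM i:?I. rho i q*T (ctr j) (ctr i) (k i q))" unfolding T_def using k rho_sm by (intro sm_fun_sum sm_fun_mult sm_fun_add sm_fun_c) (auto simp: germ_def)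
 have "(SUM i:?I. rho i q*T (ctr j) (ctr i) (k i q)) = loc j (%q. SUM i:P. rho i q*T q (ctr i) (z i q)) q" if q: "q : O'" for q
 proof -
  have qV: "q : V" using q by (simp add: O'_def)
  have qp: "q : PA" by (rule pts_open[OF V(1) qV])
  have red: "(SUM i:P. rho i q*f i) = (SUM i:?I. rho i q*f i)" for f by (rule sum.mono_neutral_right) (use finP V(5) qV in auto)
  have one: "(SUM i:?I. rho i q) = 1" using red[of "%_. 1"] rho_sum[OF qp] by simp
  have "loc j (%q. SUM i:P. rho i q*T q (ctr i) (z i q)) q = T (ctr j) q (SUM i:?I. rho i q*T q (ctr i) (z i q))" by (simp add: loc_def red)
  also have "... = (SUM i:?I. rho i q*(sgm (ctr j) q*T q (ctr i) (z i q)+tau (ctr j) q))"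
   using one by (simp add: T_def[of "ctr j" q] sum_distrib_left distrib_left sum.distrib mult.left_commute flip: sum_distrib_right)
  also have "... = (SUM i:?I. rho i q*T (ctr j) (ctr i) (z i q))"
  proof (rule sum.cong[OF refl])
   fix i assume i: "i : ?I"
   have qi: "q : N i" and qj: "q : N j" using V(3,4) qV i by auto
   have "T (ctr j) (ctr i) (z i q) = T (ctr j) q (T q (ctr i) (z i q))" by (rule T_trans[of i j]) (use i j qi qj ctr_N in auto)
   thus "rho i q*(sgm (ctr j) q*T q (ctr i) (z i q)+tau (ctr j) q) = rho i q*T (ctr j) (ctr i) (z i q)" by (simp add: T_def[of "ctr j" q])
  qed
  also have "... = (SUM i:?I. rho i q*T (ctr j) (ctr i) (k i q))" by (rule sum.cong[OF refl]) (use Y q in "auto simp: O'_def")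
  finally show ?thesis by simp
 qed
 thus ?thesis unfolding germ_def using sm O' by blast
qed

text \<open>The derivatives of the weights add up to 0, so any constant may be subtracted: they then
  multiply differences between patch averages, which are small, rather than the averages
  themselves.\<close>

lemma weighted_deriv: assumes j: "j : P" and x: "x : N j" and k: "!!i. i : P ==> x : supp i ==> sf (k i)" and v: "v : tsp x"
 shows "v (%q. SUM i:{i:P. x : supp i}. rho i q*T (ctr j) (ctr i) (k i q)) = (SUM i:{i:P. x : supp i}. v (rho i)*(T (ctr j) (ctr i) (k i x)-Z)+rho i x*(sgm (ctr j) (ctr i) * v (k i)))"
proof -
 let ?I = "{i:P. x : supp i}"
 obtain V where V: "openin M V" "x : V" "!!i q. i : P ==> x ~: supp i ==> q : V ==> rho i q = 0" using near[OF x j] by metis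
 have s1: "sf (%q. T (ctr j) (ctr i) (k i q))" if "i : ?I" for i unfolding T_def using k that by (intro sm_fun_add sm_fun_mult sm_fun_c) auto
 have "v (%q. SUM i:?I. rho i q) = v (%q. 1)"
 proof (rule tv_loc[OF v V(1,2)])
  show "sf (%q. SUM i:?I. rho i q)" using rho_sm by (intro sm_fun_sum) auto
  show "sf (%q. 1)" by (rule sm_fun_c)
  fix q assume q: "q : V"
  have "(SUM i:P. rho i q) = (SUM i:?I. rho i q)" by (rule sum.mono_neutral_right) (use finP V(3) q in auto)
  thus "(SUM i:?I. rho i q) = 1" using rho_sum[OF pts_open[OF V(1) q]] by simp
 qed
 moreover have "v (%q. SUM i:?I. rho i q) = (SUM i:?I. v (rho i))" by (rule tv_sum[OF v]) (use rho_sm in auto)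
 ultimately have z: "(SUM i:?I. v (rho i)) = 0" using tv_c[OF v] by simp
 have "v (%q. SUM i:?I. rho i q*T (ctr j) (ctr i) (k i q)) = (SUM i:?I. v (%q. rho i q*T (ctr j) (ctr i) (k i q)))" by (rule tv_sum[OF v], rule sm_fun_mult[OF _ s1]) (use rho_sm in auto)
 also have "... = (SUM i:?I. v (rho i)*T (ctr j) (ctr i) (k i x)+rho i x*(sgm (ctr j) (ctr i) * v (k i)))"
 proof (rule sum.cong[OF refl])
  fix i assume i: "i : ?I"
  have ki: "sf (k i)" using k i by simp
  have "v (%q. T (ctr j) (ctr i) (k i q)) = sgm (ctr j) (ctr i) * v (k i)" unfolding T_def using tv_add[OF v sm_fun_mult[OF sm_fun_c ki] sm_fun_c] tv_cmul[OF v ki] tv_c[OF v] by simp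
  thus "v (%q. rho i q*T (ctr j) (ctr i) (k i q)) = v (rho i)*T (ctr j) (ctr i) (k i x)+rho i x*(sgm (ctr j) (ctr i) * v (k i))" using tv_mult[OF v rho_sm s1[OF i]] i by simp
 qed
 also have "... = (SUM i:?I. v (rho i)*(T (ctr j) (ctr i) (k i x)-Z)+rho i x*(sgm (ctr j) (ctr i) * v (k i)))+(SUM i:?I. v (rho i))*Z"
  by (simp add: sum_distrib_right right_diff_distrib sum.distrib sum_subtractf)
 finally show ?thesis by (simp add: z)
qed

lemma g_nonneg: assumes x: "x : PA" and v: "v : tsp x" shows "g x v v >= 0"
proof -
 obtain i where i: "i : P" "rho i x ~= 0" using rho_sum[OF x] by (metis sum.neutral zero_neq_one)
 interpret p: chart_patch M A g "c i" "a i" "r i" "W i" "E i" by (rule patch[OF i(1)])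
 have xN: "x : N i" using rho_supp'[OF i(1)] i(2) supp_N[OF i(1)] by blast
 obtain w where w: "v = dirv (c i) w x" using tangent_eq_dirv[OF p.c p.N_chart[OF xN] v] .
 show ?thesis using p.G_nonneg[OF p.N_ball[OF xN], of w] p.gm_eq[OF p.N_ball[OF xN], of w w] p.c p.N_chart[OF xN] by (simp add: w)
qed

lemma rho_gradient: obtains b where "b >= 0" "!!i q v. i : P ==> q : PA ==> v : tsp q ==> \<bar>v (rho i)\<bar> <= b * sqrt (g q v v)"
proof -
 have "EX b>=0. ALL q v. q : PA --> v : tsp q --> \<bar>v (rho i)\<bar> <= b * sqrt (g q v v)" if "i : P" for i using gradient_bound[OF rho_sm[OF that]] by metis
 then obtain b where b: "!!i. i : P ==> b i >= 0 & (ALL q v. q : PA --> v : tsp q --> \<bar>v (rho i)\<bar> <= b i * sqrt (g q v v))" by metis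
 show thesis
 proof (rule that[of "SUM i:P. b i"])
  show "(SUM i:P. b i) >= 0" using b by (intro sum_nonneg) auto
  fix i q v assume i: "i : P" and q: "q : PA" and v: "v : tsp q"
  have "b i <= (SUM i:P. b i)" by (rule member_le_sum[OF i]) (use b finP in auto)
  hence "b i * sqrt (g q v v) <= (SUM i:P. b i) * sqrt (g q v v)" using g_nonneg[OF q v] by (intro mult_right_mono) auto
  thus "\<bar>v (rho i)\<bar> <= (SUM i:P. b i) * sqrt (g q v v)" using b[OF i] q v by (meson order_trans)
 qed
qed

text \<open>The mixture costs at most \<open>n*b*C*e^3*L\<close>, gradients of the weights times
  disagreement of the patches, against a gain of \<open>kk*e^2*L\<close> from averaging. As soon as
  \<open>n*b*C*e <= kk/2\<close>, half of the gain remains, whence the factor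
  \<open>1 - kk/2*e^2\<close>.\<close>

lemma step_contracts: obtains e k where "e>0" "0 <= k" "k<1" "!!i. i : P ==> stays i e"
  "!!u. smooth_sec u ==> smooth_sec (step e u)" "!!u L. smooth_sec u ==> L >= 0 ==> slope u L ==> slope (step e u) (k*L)"
proof -
 obtain kk d1 where d1: "kk>0" "d1>0" "!!i e. i : P ==> 0 <= e ==> e <= d1 ==> stays i e & contracts kk i e" using uniform_contraction by blast
 obtain C d2 where C: "C>0" "d2>0" "!!i j x e u L. i : P ==> j : P ==> x : supp i ==> x : supp j ==> 0 <= e ==> e <= d2 ==> smooth_sec u ==> L >= 0 ==> slope u L ==>
   \<bar>T (ctr j) (ctr i) (avg e u i (snd (c i) x))-avg e u j (snd (c j) x)\<bar> <= L*C*e^3" using uniform_comparison by metis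
 obtain b where b: "b >= 0" "!!i q v. i : P ==> q : PA ==> v : tsp q ==> \<bar>v (rho i)\<bar> <= b * sqrt (g q v v)" using rho_gradient by blast
 define n where "n = real (card P)"
 \<comment> \<open>The bound \<open>1/(1+kk)\<close> ensures \<open>kk*e^2 <= 1\<close>, so that the
   contraction factor is not negative.\<close>
 define e where "e = min (min d1 d2) (min (1/(1+kk)) (kk/2/(1+n*b*C)))"
 have n0: "n >= 0" by (simp add: n_def)
 have den: "1+n*b*C>0" using n0 b(1) C(1) by (simp add: add_pos_nonneg)
 have e: "e>0" "e <= d1" "e <= d2" "e <= 1/(1+kk)" "e <= kk/2/(1+n*b*C)" using d1(1,2) C(2) den by (auto simp: e_def)
 have "e*(1+kk) <= 1" using e(4) d1(1) by (simp add: pos_le_divide_eq)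
 hence "e+e*kk <= 1" by (simp add: algebra_simps)
 moreover have "e*kk >= 0" using e(1) d1(1) by simp
 ultimately have ek: "e <= 1" "e*kk <= 1" using e(1) by linarith+
 have e5: "n*b*C*e <= kk/2"
 proof -
  have "e*(1+n*b*C) <= kk/2" using e(5) unfolding pos_le_divide_eq[OF den] .
  thus ?thesis using e(1) by (simp add: algebra_simps)
 qed
 define k where "k = 1-kk/2*e^2"
 have "kk*e^2 <= 1" using mult_mono[OF ek(2, 1)] e(1) by (simp add: power2_eq_square mult_ac)
 hence k: "0 <= k" "k<1" using e(1) d1(1) by (auto simp: k_def)
 have st: "stays i e" and ct: "contracts kk i e" if "i : P" for i using d1(3)[OF that] e by auto
 have main: "EX h. germ h (loc j (step e u)) x & (ALL L. L >= 0 --> slope u L --> (ALL v:tsp x. \<bar>v h\<bar> <= k*L * sqrt (g x v v)))"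
  if u: "smooth_sec u" and j: "j : P" and x: "x : N j" for u j x
 proof -
  let ?I = "{i:P. x : supp i}"
  have xp: "x : PA" using chart_patch.N_pts[OF patch[OF j] x] .
  have "EX h. germ h (%q. avg e u i (snd (c i) q)) x & (ALL L v. slope u L --> L >= 0 --> v : tsp x --> \<bar>v h\<bar> <= L*(1-kk*e^2) * sqrt (g x v v))" if "i : ?I" for i
  proof -
   have i: "i : P" "x : supp i" using that by auto
   show ?thesis by (metis avg_germ i u st ct)
  qed
  hence "ALL i:?I. EX h. germ h (%q. avg e u i (snd (c i) q)) x & (ALL L v. slope u L --> L >= 0 --> v : tsp x --> \<bar>v h\<bar> <= L*(1-kk*e^2) * sqrt (g x v v))" by (rule ballI)
  from bchoice[OF this] obtain h where hh: "ALL i:?I. germ (h i) (%q. avg e u i (snd (c i) q)) x & (ALL L v. slope u L --> L >= 0 --> v : tsp x --> \<bar>v (h i)\<bar> <= L*(1-kk*e^2) * sqrt (g x v v))" ..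
  have h: "!!i. i : ?I ==> germ (h i) (%q. avg e u i (snd (c i) q)) x" "!!i L v. i : ?I ==> slope u L ==> L >= 0 ==> v : tsp x ==> \<bar>v (h i)\<bar> <= L*(1-kk*e^2) * sqrt (g x v v)"
   using hh by simp_all
  have hs: "sf (h i)" and hx: "h i x = avg e u i (snd (c i) x)" if "i : ?I" for i using h(1)[OF that] unfolding germ_def by auto
  let ?h = "%q. SUM i:?I. rho i q*T (ctr j) (ctr i) (h i q)"
  have "germ ?h (loc j (%q. SUM i:P. rho i q*T q (ctr i) (avg e u i (snd (c i) q)))) x" by (rule weighted_germ[OF j x]) (use h(1) in auto)
  hence gh: "germ ?h (loc j (step e u)) x" by (simp add: step_def[abs_def])
  have "\<bar>v ?h\<bar> <= k*L * sqrt (g x v v)" if L: "L >= 0" and sl: "slope u L" and v: "v : tsp x" for L v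
  proof -
   let ?s = "sqrt (g x v v)"
   have s0: "?s >= 0" using g_nonneg[OF xp v] by simp
   have rI: "(SUM i:?I. rho i x) = 1"
   proof -
    have "(SUM i:P. rho i x) = (SUM i:?I. rho i x)" by (rule sum.mono_neutral_right) (use finP rho_supp' in auto)
    thus ?thesis using rho_sum[OF xp] by simp
   qed
   then obtain i0 where i0: "i0 : ?I" by (metis (no_types, lifting) sum.neutral zero_neq_one)
   \<comment> \<open>The average in one reference patch \<open>i0\<close>, carried to the centre of
     \<open>j\<close>; the averages of all other patches are compared with it.\<close>
   define Z where "Z = T (ctr j) (ctr i0) (h i0 x)"
   have dv: "v ?h = (SUM i:?I. v (rho i)*(T (ctr j) (ctr i) (h i x)-Z)+rho i x*(sgm (ctr j) (ctr i) * v (h i)))" by (rule weighted_deriv[OF j x _ v]) (use hs in auto)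
   have t1: "\<bar>v (rho i)*(T (ctr j) (ctr i) (h i x)-Z)\<bar> <= b*?s*(L*C*e^3)" if i: "i : ?I" for i
   proof -
    have iP: "i : P" "x : supp i" "i0 : P" "x : supp i0" using i i0 by auto
    have xN: "x : N i" "x : N i0" using supp_N iP by auto
    have "T (ctr j) (ctr i) z = T (ctr j) (ctr i0) (T (ctr i0) (ctr i) z)" for z
    proof -
     have "T (ctr j) (ctr i) z = T (ctr j) x (T x (ctr i) z)" by (rule T_trans[of i j]) (use iP xN x j ctr_N in auto)
     also have "T x (ctr i) z = T x (ctr i0) (T (ctr i0) (ctr i) z)" by (rule T_trans[of i i0]) (use iP xN ctr_N in auto)
     also have "T (ctr j) x (T x (ctr i0) (T (ctr i0) (ctr i) z)) = T (ctr j) (ctr i0) (T (ctr i0) (ctr i) z)" by (rule T_trans[of i0 j, symmetric]) (use iP xN x j ctr_N in auto)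
     finally show ?thesis .
    qed
    hence "\<bar>T (ctr j) (ctr i) (h i x)-Z\<bar> = \<bar>T (ctr i0) (ctr i) (h i x)-h i0 x\<bar>" unfolding Z_def using T_dist[of i0 j "ctr j" "ctr i0"] iP xN x j ctr_N by auto
    also have "... <= L*C*e^3" unfolding hx[OF i] hx[OF i0] by (rule C(3)[OF iP(1,3,2,4) _ e(3) u L sl]) (use e in simp)
    finally have "\<bar>T (ctr j) (ctr i) (h i x)-Z\<bar> <= L*C*e^3" .
    thus ?thesis unfolding abs_mult by (intro mult_mono b(2)[OF iP(1) xp v]) (use b(1) s0 in auto)
   qed
   have t2: "\<bar>rho i x*(sgm (ctr j) (ctr i) * v (h i))\<bar> <= rho i x*(L*(1-kk*e^2)*?s)" if i: "i : ?I" for i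
   proof -
    have iP: "i : P" "x : N i" using i supp_N by auto
    have ne: "N i Int N j ~= {}" using iP(2) x by blast
    have "\<bar>sgm (ctr j) (ctr i)\<bar> = 1" using sgm[OF iP(1) j ne UnI2[OF ctr_N[OF j]] UnI1[OF ctr_N[OF iP(1)]]] by auto
    thus ?thesis using h(2)[OF i sl L v] rho_nonneg[OF iP(1), of x] by (simp add: abs_mult mult_left_mono)
   qed
   have "\<bar>v ?h\<bar> <= (SUM i:?I. \<bar>v (rho i)*(T (ctr j) (ctr i) (h i x)-Z)+rho i x*(sgm (ctr j) (ctr i) * v (h i))\<bar>)" unfolding dv by (rule sum_abs)
   also have "... <= (SUM i:?I. b*?s*(L*C*e^3)+rho i x*(L*(1-kk*e^2)*?s))" by (intro sum_mono order_trans[OF abs_triangle_ineq] add_mono t1 t2)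
   also have "... = real (card ?I)*(b*?s*(L*C*e^3))+L*(1-kk*e^2)*?s" unfolding sum.distrib using rI by (simp flip: sum_distrib_right)
   also have "... <= n*(b*?s*(L*C*e^3))+L*(1-kk*e^2)*?s" unfolding n_def using finP b(1) s0 L C(1) e(1) by (intro add_right_mono mult_right_mono) (auto intro: card_mono)
   also have "... = L*?s*(n*b*C*e*e^2+(1-kk*e^2))" by (simp add: algebra_simps power2_eq_square power3_eq_cube)
   also have "... <= L*?s*(kk/2*e^2+(1-kk*e^2))" using e5 L s0 by (intro mult_left_mono add_right_mono mult_right_mono) auto
   also have "... = k*L*?s" by (simp add: k_def algebra_simps)
   finally show ?thesis .
  qed
  thus ?thesis using gh by blast
 qed
 show thesis
 proof (rule that[OF e(1) k st])
  fix u assume u: "smooth_sec u"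
  show "smooth_sec (step e u)" unfolding smooth_sec_def[of "step e u"] using main[OF u] by blast
  fix L assume L: "L >= 0" and sl: "slope u L"
  show "slope (step e u) (k*L)" unfolding slope_def[of "step e u"]
  proof (intro ballI allI impI)
   fix j x h v assume j: "j : P" and x: "x : N j" and h: "germ h (loc j (step e u)) x" and v: "v : tsp x"
   obtain h' where h': "germ h' (loc j (step e u)) x" "\<bar>v h'\<bar> <= k*L * sqrt (g x v v)" using main[OF u j x] L sl v by blast
   show "\<bar>v h\<bar> <= k*L * sqrt (g x v v)" using germ_eq[OF h h'(1) v] h'(2) by simp
  qed
 qed
qed

end

context glued
begin

text \<open>Mix the zero sections of the patches; the slope then comes only from the gradients of
  the weights multiplied by the translations \<open>tau\<close>.\<close>

lemma initial_section: obtains u L where "smooth_sec u" "L >= 0" "slope u L"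
proof -
 obtain b where b: "b >= 0" "!!i q v. i : P ==> q : PA ==> v : tsp q ==> \<bar>v (rho i)\<bar> <= b * sqrt (g q v v)" using rho_gradient by blast
 define u where "u q = (SUM i:P. rho i q*T q (ctr i) 0)" for q
 define L where "L = b*(SUM j:P. SUM i:P. \<bar>tau (ctr j) (ctr i)\<bar>)"
 have L: "L >= 0" unfolding L_def using b(1) by (intro mult_nonneg_nonneg sum_nonneg) auto
 have main: "EX h. germ h (loc j u) x & (ALL v:tsp x. \<bar>v h\<bar> <= L * sqrt (g x v v))" if j: "j : P" and x: "x : N j" for j x
 proof -
  let ?I = "{i:P. x : supp i}"
  let ?h = "%q. SUM i:?I. rho i q*T (ctr j) (ctr i) 0"
  have xp: "x : PA" using chart_patch.N_pts[OF patch[OF j] x] .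
  have z: "germ (%_. 0) (%_. 0) x" unfolding germ_def using sm_fun_c pts xp by blast
  have gh: "germ ?h (loc j u) x" using weighted_germ[OF j x, of "%_ _. 0" "%_ _. 0"] z by (simp add: u_def[abs_def])
  have "\<bar>v ?h\<bar> <= L * sqrt (g x v v)" if v: "v : tsp x" for v
  proof -
   have "v ?h = (SUM i:?I. v (rho i)*tau (ctr j) (ctr i))" using weighted_deriv[OF j x _ v, of "%_ _. 0" 0] sm_fun_c[of 0] tv_c[OF v, of 0] by (simp add: T_def)
   hence "\<bar>v ?h\<bar> <= (SUM i:?I. \<bar>v (rho i)*tau (ctr j) (ctr i)\<bar>)" by simp
   also have "... <= (SUM i:?I. b * sqrt (g x v v)*\<bar>tau (ctr j) (ctr i)\<bar>)" unfolding abs_mult using b(2)[OF _ xp v] by (intro sum_mono mult_right_mono) auto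
   also have "... = b * sqrt (g x v v)*(SUM i:?I. \<bar>tau (ctr j) (ctr i)\<bar>)" by (simp add: sum_distrib_left)
   also have "... <= b * sqrt (g x v v)*(SUM j:P. SUM i:P. \<bar>tau (ctr j) (ctr i)\<bar>)"
   proof (rule mult_left_mono)
    have "(SUM i:?I. \<bar>tau (ctr j) (ctr i)\<bar>) <= (SUM i:P. \<bar>tau (ctr j) (ctr i)\<bar>)" by (rule sum_mono2) (use finP in auto)
    also have "... <= (SUM j:P. SUM i:P. \<bar>tau (ctr j) (ctr i)\<bar>)"
     by (rule member_le_sum[OF j, of "%j. SUM i:P. \<bar>tau (ctr j) (ctr i)\<bar>"]) (use finP in "auto intro: sum_nonneg")
    finally show "(SUM i:?I. \<bar>tau (ctr j) (ctr i)\<bar>) <= (SUM j:P. SUM i:P. \<bar>tau (ctr j) (ctr i)\<bar>)" .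
   qed (use b(1) g_nonneg[OF xp v] in simp)
   finally show ?thesis unfolding L_def by (simp only: mult_ac)
  qed
  thus ?thesis using gh by blast
 qed
 show thesis
 proof (rule that[OF _ L])
  show "smooth_sec u" unfolding smooth_sec_def using main by blast
  show "slope u L" unfolding slope_def
  proof (intro ballI allI impI)
   fix j x h v assume j: "j : P" and x: "x : N j" and h: "germ h (loc j u) x" and v: "v : tsp x"
   obtain h' where h': "germ h' (loc j u) x" "\<bar>v h'\<bar> <= L * sqrt (g x v v)" using main[OF j x] v by blast
   show "\<bar>v h\<bar> <= L * sqrt (g x v v)" using germ_eq[OF h h'(1) v] h'(2) by simp
  qed
 qed
qed

lemma oscillation: obtains B where "B >= 0" "!!i u L y z. i : P ==> smooth_sec u ==> L >= 0 ==> slope u L ==> y : ball (a i) (r i) ==> z : ball (a i) (r i) ==>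
   \<bar>loc i u (cinv (c i) y)-loc i u (cinv (c i) z)\<bar> <= L*B"
proof -
 obtain B where B: "B>0" "!!i y w. i : P ==> y : ball (a i) (r i) ==> sqrt (bil (gmi i y) w w) <= B*norm w" using slope_nonneg_bound by blast
 have r0: "r i>0" if "i : P" for i using chart_patch.r[OF patch[OF that]] .
 define R where "R = (SUM i:P. r i)"
 have R: "r i <= R" if "i : P" for i unfolding R_def by (rule member_le_sum[OF that]) (use finP r0 in "auto intro: less_imp_le")
 have R0: "R >= 0" unfolding R_def by (rule sum_nonneg) (use r0 in "blast intro: less_imp_le")
 show thesis
 proof (rule that[of "B*(2 * R)"])
  show "B*(2 * R) >= 0" using B(1) R0 by simp
  fix i u L y z assume i: "i : P" and u: "smooth_sec u" and L: "L >= 0" and sl: "slope u L" and y: "y : ball (a i) (r i)" and z: "z : ball (a i) (r i)"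
  interpret p: chart_patch M A g "c i" "a i" "r i" "W i" "E i" by (rule patch[OF i])
  have "norm (y-z) <= dist (a i) y+dist (a i) z" using dist_triangle2[of y z "a i"] by (simp add: dist_norm norm_minus_commute)
  hence nz: "norm (y-z) <= 2 * R" using y z R[OF i] by simp
  have "\<bar>loc i u (cinv (c i) y)-loc i u (cinv (c i) z)\<bar> <= L*B*norm (y-z)" by (rule p.lipschitz[OF B(2)[OF i] chart_form(1)[OF u i] L chart_form(2)[OF u i sl] y z])
  also have "... <= L*B*(2 * R)" using nz L B(1) by (intro mult_left_mono) auto
  finally show "\<bar>loc i u (cinv (c i) y)-loc i u (cinv (c i) z)\<bar> <= L*(B*(2 * R))" by (simp add: mult.assoc)
 qed
qed

lemma T_back: assumes i: "i : P" and x: "x : N i" shows "T x (ctr i) (loc i u x) = u x"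
proof -
 have ne: "N i Int N i ~= {}" using x by blast
 have m: "x : N i Un N i" "ctr i : N i Un N i" using x ctr_N[OF i] by auto
 show ?thesis unfolding loc_def using T_trans[OF i i ne m(1,2,1), of "u x"] T_self[OF i i ne m(1)] by simp
qed

text \<open>A patch average is a mean of values of the section on the same patch, so it differs from
  the value at \<open>x\<close> by at most the oscillation there, which the slope controls.\<close>

lemma step_close: assumes st: "!!i. i : P ==> stays i e" obtains B where "B >= 0" "!!u L x. smooth_sec u ==> L >= 0 ==> slope u L ==> x : PA ==> \<bar>step e u x-u x\<bar> <= L*B"
proof -
 obtain B where B: "B >= 0" "!!i u L y z. i : P ==> smooth_sec u ==> L >= 0 ==> slope u L ==> y : ball (a i) (r i) ==> z : ball (a i) (r i) ==>
   \<bar>loc i u (cinv (c i) y)-loc i u (cinv (c i) z)\<bar> <= L*B" using oscillation by blast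
 show thesis
 proof (rule that[OF B(1)])
  fix u L x assume u: "smooth_sec u" and L: "L >= 0" and sl: "slope u L" and x: "x : PA"
  have t: "\<bar>rho i x*(T x (ctr i) (avg e u i (snd (c i) x))-u x)\<bar> <= rho i x*(L*B)" if i: "i : P" for i
  proof (cases "x : supp i")
   case False
   thus ?thesis using rho_supp'[OF i] by simp
  next
   case True
   interpret p: chart_patch M A g "c i" "a i" "r i" "W i" "E i" by (rule patch[OF i])
   let ?y = "snd (c i) x" and ?F = "%y. loc i u (cinv (c i) y)"
   have xN: "x : N i" using supp_N[OF i] True by blast
   have xc: "x : fst (c i)" "?y : cball (a i) (r i/2)" "?y : ball (a i) (r i)" using True p.N_ball[OF xN] by (auto simp: supp_def)
   have pin: "psi i ?y xi e : ball (a i) (r i)" if "xi : cube" for xi by (rule staysD[OF st[OF i] xc(2)]) (use that cube_sub in force)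
   have psc: "continuous_on cube (%xi. psi i ?y xi e)" by (rule continuous_on_subset[OF smo_cont[OF p.psi_sm[OF open_UNIV smo_c smo_id[OF open_UNIV] smo_c]] subset_UNIV])
   have cF: "continuous_on cube (%xi. ?F (psi i ?y xi e))" by (rule continuous_on_compose2[OF smo_cont[OF chart_form(1)[OF u i]] psc]) (use pin in auto)
   have "avg e u i ?y-loc i u x = Ex (%xi. 1*?F (psi i ?y xi e) + - loc i u x)" unfolding avg_def Ex_affine[OF cF] by simp
   moreover have "\<bar>Ex (%xi. 1*?F (psi i ?y xi e) + - loc i u x)\<bar> <= L*B"
   proof (rule Ex_bound)
    show "continuous_on cube (%xi. 1*?F (psi i ?y xi e) + - loc i u x)" by (intro continuous_intros cF)
    show "\<bar>1*?F (psi i ?y xi e) + - loc i u x\<bar> <= L*B" if "xi : cube" for xi using B(2)[OF i u L sl pin[OF that] xc(3)] xc(1) p.c by simp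
   qed
   ultimately have d: "\<bar>avg e u i ?y-loc i u x\<bar> <= L*B" by simp
   have ne: "N i Int N i ~= {}" using xN by blast
   have "\<bar>T x (ctr i) (avg e u i ?y)-T x (ctr i) (loc i u x)\<bar> = \<bar>avg e u i ?y-loc i u x\<bar>" by (rule T_dist[OF i i ne]) (use xN ctr_N[OF i] in auto)
   thus ?thesis unfolding T_back[OF i xN] using d rho_nonneg[OF i, of x] by (simp add: abs_mult mult_left_mono)
  qed
  have "step e u x-u x = (SUM i:P. rho i x*T x (ctr i) (avg e u i (snd (c i) x)))-(SUM i:P. rho i x)*u x" by (simp add: step_def rho_sum[OF x])
  also have "... = (SUM i:P. rho i x*(T x (ctr i) (avg e u i (snd (c i) x))-u x))" by (simp add: sum_distrib_right right_diff_distrib sum_subtractf)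
  finally have s: "step e u x-u x = (SUM i:P. rho i x*(T x (ctr i) (avg e u i (snd (c i) x))-u x))" .
  have "\<bar>step e u x-u x\<bar> <= (SUM i:P. rho i x*(L*B))" unfolding s by (rule order_trans[OF sum_abs sum_mono[OF t]])
  thus "\<bar>step e u x-u x\<bar> <= L*B" using rho_sum[OF x] by (simp flip: sum_distrib_right)
 qed
qed

text \<open>The slopes of the iterates decrease geometrically, so successive differences are
  summable and the iterates converge pointwise. The oscillation on each patch tends to 0, so in the
  limit \<open>loc i u\<close> is constant there, that is, the section is parallel.\<close>

theorem parallel_glued: obtains u where "!!i x y. i : P ==> x : N i ==> y : N i ==> u x = T x y (u y)"
proof -
 obtain e k where e: "e>0" "0 <= k" "k<1" "!!i. i : P ==> stays i e" "!!u. smooth_sec u ==> smooth_sec (step e u)" "!!u L. smooth_sec u ==> L >= 0 ==> slope u L ==> slope (step e u) (k*L)"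
  using step_contracts by metis
 obtain u0 L where u0: "smooth_sec u0" "L >= 0" "slope u0 L" using initial_section by blast
 obtain B where B: "B >= 0" "!!u L x. smooth_sec u ==> L >= 0 ==> slope u L ==> x : PA ==> \<bar>step e u x-u x\<bar> <= L*B" using step_close[OF e(4)] by metis
 obtain B' where B': "B' >= 0" "!!i u L y z. i : P ==> smooth_sec u ==> L >= 0 ==> slope u L ==> y : ball (a i) (r i) ==> z : ball (a i) (r i) ==>
   \<bar>loc i u (cinv (c i) y)-loc i u (cinv (c i) z)\<bar> <= L*B'" using oscillation by blast
 define un where "un n = (step e ^^ n) u0" for n
 have kn: "k^n*L >= 0" for n using e(2) u0(2) by simp
 have un: "smooth_sec (un n) & slope (un n) (k^n*L)" for n
 proof (induction n)
  case 0 thus ?case using u0 by (simp add: un_def)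
 next
  case (Suc n)
  thus ?case using e(5)[of "un n"] e(6)[of "un n" "k^n*L"] kn[of n] by (simp add: un_def mult.assoc)
 qed
 have conv: "EX l. (%n. un n x) \<longlonglongrightarrow> l" if x: "x : PA" for x
 proof -
  have s: "summable (%n. k^n*(L*B))" using e(2,3) by (intro summable_mult2 summable_geometric) simp
  have "summable (%n. un (Suc n) x-un n x)"
  proof (rule summable_comparison_test'[OF s])
   fix n
   show "norm (un (Suc n) x-un n x) <= k^n*(L*B)" using B(2)[of "un n" "k^n*L" x] un[of n] kn x by (simp add: un_def mult.assoc)
  qed
  hence "(%n. un n x-un 0 x) \<longlonglongrightarrow> suminf (%n. un (Suc n) x-un n x)"
   using summable_LIMSEQ[of "%n. un (Suc n) x-un n x"] by (simp only: sum_lessThan_telescope[of "%n. un n x"])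
  from tendsto_add[OF this tendsto_const[of "un 0 x"]] show ?thesis by (intro exI) simp
 qed
 then obtain u where u: "!!x. x : PA ==> (%n. un n x) \<longlonglongrightarrow> u x" by metis
 show thesis
 proof (rule that)
  fix i x y assume i: "i : P" and x: "x : N i" and y: "y : N i"
  interpret p: chart_patch M A g "c i" "a i" "r i" "W i" "E i" by (rule patch[OF i])
  have lim: "(%n. loc i (un n) z) \<longlonglongrightarrow> loc i u z" if "z : N i" for z unfolding loc_def T_def by (intro tendsto_intros u p.N_pts that)
  have "(%n. loc i (un n) x-loc i (un n) y) \<longlonglongrightarrow> 0"
  proof (rule Lim_null_comparison)
   have "norm (loc i (un n) x-loc i (un n) y) <= k^n*L*B'" for n
    using B'(2)[OF i conjunct1[OF un[of n]] kn conjunct2[OF un[of n]] p.N_ball[OF x] p.N_ball[OF y]] p.c p.N_chart[OF x] p.N_chart[OF y] by simp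
   thus "\<forall>\<^sub>F n in sequentially. norm (loc i (un n) x-loc i (un n) y) <= k^n*L*B'" by simp
   have "(%n. k^n) \<longlonglongrightarrow> 0" using e(2,3) by (intro LIMSEQ_realpow_zero)
   from tendsto_mult_left_zero[OF tendsto_mult_left_zero[OF this, of L], of B']
   show "(%n. k^n*L*B') \<longlonglongrightarrow> 0" .
  qed
  from LIMSEQ_unique[OF this tendsto_diff[OF lim[OF x] lim[OF y]]] have eq: "loc i u x = loc i u y" by simp
  have ne: "N i Int N i ~= {}" using x by blast
  have "u x = T x (ctr i) (T (ctr i) y (u y))" using T_back[OF i x, of u] eq by (simp add: loc_def)
  also have "... = T x y (u y)" by (rule T_trans[OF i i ne, symmetric]) (use x y ctr_N[OF i] in auto)
  finally show "u x = T x y (u y)" .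
 qed
qed

end

section \<open>Global parallel sections\<close>

context positive_ricci
begin

text \<open>The cocycle law is known near each point only. A star refinement yields patches so small
  that the union of two overlapping ones still lies in a set where it holds.\<close>

theorem parallel_section: assumes cov: "!!p. p : TM ==> EX V. openin M V & p : V & (ALL x:V. ALL y:V. s x y = 1 \<or> s x y = (-1::real)) &
   (ALL x:V. ALL y:V. ALL z:V. s x z = s x y * s y z & t x z = s x y*t y z+t x y)" obtains u where "!!p. p : TM ==> EX V. openin M V & p : V & (ALL x:V. ALL y:V. u x = s x y*u y+t x y)"
proof -
 define VV where "VV = {V. (ALL x:V. ALL y:V. s x y = 1 \<or> s x y = (-1::real)) & (ALL x:V. ALL y:V. ALL z:V. s x z = s x y * s y z & t x z = s x y*t y z+t x y)}"
 have "EX V:VV. openin M V & p : V" if "p : TM" for p using cov[OF that] unfolding VV_def by blast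
 from star_refinement[of VV, OF this]
 obtain Q where Q: "!!x. x : TM ==> openin M (Q x) & x : Q x" "!!x y. x : TM ==> y : TM ==> Q x Int Q y ~= {} ==> EX V:VV. openin M V & Q x Un Q y <= V" by metis
 have "EX c r W E. chart_patch M A g c (snd c x) r W E & x : fst c & W <= Q x" if x: "x : TM" for x
 proof -
  obtain W E where f: "frame W E (%_. 1)" "x : W" using unit_frames x pts by metis
  obtain c where c: "c : A" "x : fst c" using chart_at x pts by metis
  have o: "openin M (W Int Q x)" "x : W Int Q x" using Q(1)[OF x] frame_open[OF f(1)] f(2) by auto
  obtain r where r: "r>0" "cball (snd c x) (2*r) <= snd c ` ((W Int Q x) Int fst c)" using chart_ball[OF c o] .
  have "frame (W Int Q x) E (%_. 1)" using f(1) o(1) by (auto simp: frame_def)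
  hence "chart_patch M A g c (snd c x) r (W Int Q x) E" using c r by unfold_locales
  thus ?thesis using c(2) by blast
 qed
 then obtain c r W E where cp: "!!x. x : TM ==> chart_patch M A g (c x) (snd (c x) x) (r x) (W x) (E x) & x : fst (c x) & W x <= Q x" by metis
 define a where "a x = snd (c x) x" for x
 define N where "N x = {q : fst (c x). snd (c x) q : ball (a x) (r x)}" for x
 \<comment> \<open>Balls of radius \<open>r x/4\<close> cover the manifold; the bumps
   \<open>be\<close> are 1 on them and vanish beyond \<open>r x/2\<close>, as the support condition
   of \<open>glued\<close> demands.\<close>
 define B where "B x = {q : fst (c x). snd (c x) q : ball (a x) (r x/4)}" for x
 have cA: "c x : A" and r0: "r x>0" and sub: "cball (a x) (2*r x) <= img (c x)" if "x : TM" for x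
  using chart_patch.c[OF conjunct1[OF cp[OF that]]] chart_patch.r[OF conjunct1[OF cp[OF that]]] chart_patch.sub'[OF conjunct1[OF cp[OF that]]] by (auto simp: a_def)
 have "openin M (B x) & x : B x" if "x : TM" for x unfolding B_def using openin_chart_pre[OF cA[OF that] open_ball, of "a x" "r x/4"] cp[OF that] r0[OF that] by (auto simp: a_def)
 then obtain F where F: "finite F" "F <= TM" "TM <= (UN p:F. B p)" using finite_cover[of B] by blast
 define be where "be x = extend (c x) (a x) (r x/4) (%_. 1)" for x
 have bes: "sf (be x)" if "x : F" for x
 proof -
  have x: "x : TM" using that F by blast
  have "cball (a x) (2*(r x/4)) <= img (c x)" using sub[OF x] r0[OF x] by (auto simp: subset_iff)
  thus ?thesis unfolding be_def using extend_sm[OF cA[OF x] _ _ chart_open(2)[OF cA[OF x]] order_refl smo_c] r0[OF x] by simp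
 qed
 have be0: "be x q >= 0" if "x : F" for x q using plat_range[of "r x/4"] r0[of x] that F by (auto simp: be_def extend_def)
 have be1: "be x q = 1" if "x : F" "q : B x" for x q unfolding be_def using that F r0[of x] by (subst extend_eq) (auto simp: B_def)
 have pos: "(SUM x:F. be x q)>0" if "q : PA" for q
 proof -
  have "q : (UN p:F. B p)" using F(3) that unfolding pts by (rule subsetD)
  then obtain x where x: "x : F" "q : B x" by (rule UN_E)
  show ?thesis by (rule sum_pos2[OF F(1) x(1)]) (use be1[OF x] be0 in auto)
 qed
 define rho where "rho x q = be x q/(SUM x:F. be x q)" for x q
 have N_eq: "chart_patch.N (c x) (a x) (r x) = N x" if "x : F" for x using chart_patch.N_def[OF conjunct1[OF cp]] that F by (auto simp: N_def a_def)
 have NQ: "N x <= Q x" if "x : F" for x using chart_patch.N_W[OF conjunct1[OF cp]] N_eq[OF that] cp that F unfolding a_def by blast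
 have key: "EX V:VV. N i Un N j <= V" if ij: "i : F" "j : F" "N i Int N j ~= {}" for i j
 proof -
  have "Q i Int Q j ~= {}" using NQ ij by blast
  then obtain V where "V : VV" "Q i Un Q j <= V" using Q(2)[of i j] ij F(2) by blast
  thus ?thesis using Un_mono[OF NQ[OF ij(1)] NQ[OF ij(2)]] by blast
 qed
 interpret G: glued M A g F c a r W E rho s t
 proof (intro glued.intro positive_ricci_axioms glued_axioms.intro)
  show "finite F" by (rule F(1))
  show "chart_patch M A g (c i) (a i) (r i) (W i) (E i)" if "i : F" for i using cp[of i] that F by (auto simp: a_def)
  show "sf (rho i)" if "i : F" for i unfolding rho_def by (intro sm_fun_divide sm_fun_sum bes that) (assumption, rule less_imp_neq[OF pos, symmetric])
  show "rho i q >= 0" if "i : F" for i q unfolding rho_def using be0 that by (intro divide_nonneg_nonneg sum_nonneg) auto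
  show "(SUM i:F. rho i q) = 1" if "q : PA" for q unfolding rho_def sum_divide_distrib[symmetric] using pos[OF that] by simp
  show "q : fst (c i) & snd (c i) q : cball (a i) (r i/2)" if "i : F" "rho i q ~= 0" for i q using that(2) by (auto simp: rho_def be_def extend_def split: if_splits)
  fix i j x y assume ij: "i : F" "j : F" and ne: "chart_patch.N (c i) (a i) (r i) Int chart_patch.N (c j) (a j) (r j) ~= {}"
   and x: "x : chart_patch.N (c i) (a i) (r i) Un chart_patch.N (c j) (a j) (r j)" and y: "y : chart_patch.N (c i) (a i) (r i) Un chart_patch.N (c j) (a j) (r j)"
  obtain V where V: "V : VV" "N i Un N j <= V" using key[OF ij] ne N_eq ij by blast
  have xV: "x : V" "y : V" using x y V(2) unfolding N_eq[OF ij(1)] N_eq[OF ij(2)] by blast+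
  thus "s x y = 1 \<or> s x y = -1" using V(1) unfolding VV_def by blast
  fix z assume "z : chart_patch.N (c i) (a i) (r i) Un chart_patch.N (c j) (a j) (r j)"
  hence "z : V" using V(2) unfolding N_eq[OF ij(1)] N_eq[OF ij(2)] by blast
  thus "s x z = s x y * s y z & t x z = s x y*t y z+t x y" using V(1) xV unfolding VV_def by blast
 qed
 obtain u where u: "!!i x y. i : F ==> x : G.N i ==> y : G.N i ==> u x = G.T x y (u y)" using G.parallel_glued by blast
 show thesis
 proof (rule that)
  fix p assume p: "p : TM"
  then obtain i where i: "i : F" "p : B i" using F(3) by blast
  have "p : N i" using i r0[of i] F by (force simp: B_def N_def)
  thus "EX V. openin M V & p : V & (ALL x:V. ALL y:V. u x = s x y*u y+t x y)" using G.N_open[OF i(1)] u[OF i(1)] N_eq[OF i(1)] by (auto simp: G.T_def)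
 qed
qed

end

section \<open>Local homology\<close>

lemma relhomology_trivialD: assumes "trivial_group (rhg (int p) X S)" "singular_relcycle p X S c" shows "singular_relboundary p X S c"
proof -
 have "homologous_rel_set p X S c : carrier (rhg (int p) X S)" using assms(2) by (simp add: carrier_relative_homology_group)
 hence "homologous_rel_set p X S c = singular_relboundary_set p X S" using assms(1) by (simp add: trivial_group_def)
 thus ?thesis by (simp add: homologous_rel_set_eq_relboundary)
qed

text \<open>An isomorphism from the relative homology group to the integers, described on chains, so
  that later arguments need not handle homology classes.\<close>

definition degree_map :: "nat => 'a topology => 'a set => ('a chain => int) => bool" where "degree_map p X S d \<longleftrightarrow>
   (ALL a b. singular_relcycle p X S a --> singular_relcycle p X S b --> d (a+b) = d a+d b) &
   (ALL a. singular_relcycle p X S a --> (d a = 0 \<longleftrightarrow> singular_relboundary p X S a)) & (EX a. singular_relcycle p X S a & d a = 1)"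

lemma degree_map_exists: assumes "rhg (int p) X S \<cong> integer_group" obtains d where "degree_map p X S d"
proof -
 let ?G = "rhg (int p) X S"
 obtain f where f: "f : iso ?G integer_group" using assms by (auto simp: is_iso_def)
 have hom: "f : hom ?G integer_group" and bij: "bij_betw f (carrier ?G) UNIV" using f by (auto simp: iso_def)
 define d where "d a = f (homologous_rel_set p X S a)" for a
 have cl: "homologous_rel_set p X S a : carrier ?G" if "singular_relcycle p X S a" for a using that by (simp add: carrier_relative_homology_group)
 have "degree_map p X S d" unfolding degree_map_def
 proof (intro conjI allI impI)
  fix a b assume a: "singular_relcycle p X S a" and b: "singular_relcycle p X S b"
  have "homologous_rel_set p X S (a+b) = homologous_rel_set p X S a \<otimes>\<^bsub>?G\<^esub> homologous_rel_set p X S b"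
  proof -
   have "homologous_rel_set p X S (a+b) = (UN r:homologous_rel_set p X S a. UN s:homologous_rel_set p X S b. {r+s})"
   proof (intro equalityI subsetI)
    fix c assume "c : homologous_rel_set p X S (a+b)"
    hence "homologous_rel p X S (a+b) c" by simp
    hence "homologous_rel p X S b (c-a)" using homologous_rel_diff[OF _ homologous_rel_refl[of p X S a], of "a+b" c] by simp
    thus "c : (UN r:homologous_rel_set p X S a. UN s:homologous_rel_set p X S b. {r+s})" by (intro UN_I[of a] UN_I[of "c-a"]) auto
   qed (auto intro: homologous_rel_add)
   thus ?thesis by (simp add: mult_relative_homology_group)
  qed
  thus "d (a+b) = d a+d b" unfolding d_def using hom_mult[OF hom cl[OF a] cl[OF b]] by simp
 next
  fix a assume a: "singular_relcycle p X S a"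
  have one: "f \<one>\<^bsub>?G\<^esub> = 0" using hom_one[OF hom] by simp
  have "d a = 0 \<longleftrightarrow> homologous_rel_set p X S a = \<one>\<^bsub>?G\<^esub>"
   unfolding d_def using bij_betw_imp_inj_on[OF bij] cl[OF a] one group.is_monoid[OF group_relative_homology_group, THEN monoid.one_closed] by (metis inj_onD)
  thus "d a = 0 \<longleftrightarrow> singular_relboundary p X S a" by (simp add: homologous_rel_set_eq_relboundary)
 next
  have "1 : f ` carrier ?G" using bij by (simp add: bij_betw_def)
  thus "EX a. singular_relcycle p X S a & d a = 1" by (auto simp: carrier_relative_homology_group d_def)
 qed
 thus thesis by (rule that)
qed

text \<open>The punctured ball is homotopy equivalent to a sphere and the ball is contractible, so
  the long exact sequence shifts the reduced homology of the sphere by one degree.\<close>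

lemma punctured_ball_homology: assumes r: "r>0" shows "reduced_homology_group p (nsphere 2) \<cong> rhg (p+1) (top_of_set (ball (a :: real^3) r)) (ball a r-{a})"
proof -
 let ?B = "ball a r" and ?s = "r/2"
 have s: "?s>0" using r by simp
 obtain f g where fg: "homeomorphic_maps (nsphere (3-1)) (top_of_set (sphere 0 1 Int span (Basis :: (real^3) set))) f g"
  by (rule homeomorphic_maps_nsphere_euclidean_sphere[of "Basis :: (real^3) set" 3]) (simp_all add: independent_Basis orthogonal_Basis)
 hence 1: "nsphere 2 homeomorphic_space top_of_set (sphere (0 :: real^3) 1)" unfolding homeomorphic_space_def by (auto simp: numeral_2_eq_2)
 have 2: "(sphere (0 :: real^3) 1) homotopy_eqv sphere a ?s" by (rule homeomorphic_imp_homotopy_eqv) (use s in "simp add: homeomorphic_spheres")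
 have "rel_frontier (cball a ?s) homotopy_eqv (?B-{a})"
 proof (rule homotopy_eqv_rel_frontier_punctured_convex)
  show "a : rel_interior (cball a ?s)" using s by (simp add: rel_interior_nonempty_interior)
  show "rel_frontier (cball a ?s) <= ?B" using r by (auto simp: rel_frontier_cball)
  show "?B <= affine hull cball a ?s" using s by (simp add: affine_hull_nonempty_interior)
 qed auto
 hence 3: "sphere a ?s homotopy_eqv (?B-{a})" using s by (simp add: rel_frontier_cball)
 have "reduced_homology_group p (nsphere 2) \<cong> reduced_homology_group p (top_of_set (sphere (0 :: real^3) 1))" by (rule homeomorphic_space_imp_isomorphic_reduced_homology_groups[OF 1])
 also have "... \<cong> reduced_homology_group p (top_of_set (sphere a ?s))" by (rule homotopy_equivalent_space_imp_isomorphic_reduced_homology_groups[OF 2])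
 also have "... \<cong> reduced_homology_group p (top_of_set (?B-{a}))" by (rule homotopy_equivalent_space_imp_isomorphic_reduced_homology_groups[OF 3])
 also have "top_of_set (?B-{a}) = subtopology (top_of_set ?B) (?B-{a})" by (simp add: subtopology_subtopology Int_absorb1)
 also have "reduced_homology_group p (subtopology (top_of_set ?B) (?B-{a})) \<cong> rhg (p+1) (top_of_set ?B) (?B-{a})"
 proof (rule isomorphic_group_reduced_homology_of_contractible)
  show "contractible_space (top_of_set ?B)" using convex_imp_contractible[OF convex_ball] by (simp add: contractible_space_top_of_set)
  have "a+?s*Raxis 1 1 : ?B-{a}" using r by (simp add: dist_norm norm_axis_1 axis_eq_0_iff)
  thus "topspace (top_of_set ?B) Int (?B-{a}) ~= {}" by auto
 qed
 finally show ?thesis .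
qed

context closed_manifold
begin

text \<open>Excise everything outside a coordinate ball around \<open>x\<close> and carry the rest
  to \<real>^3 by the chart.\<close>

lemma local_homology: assumes x: "x : TM" shows "reduced_homology_group p (nsphere 2) \<cong> rhg (p+1) M (TM-{x})"
proof -
 obtain c where c: "c : A" "x : fst c" using chart_at x pts by metis
 obtain r where r: "r>0" "cball (snd c x) (2*r) <= img c" using chart_ball'[OF c] .
 let ?a = "snd c x" let ?B = "ball ?a r" and ?O = "(cpart c (ball ?a r))"
 have sub: "?B <= img c" using r by (auto simp: subset_iff)
 have Oo: "openin M ?O" by (rule openin_chart_pre[OF c(1) open_ball])
 have Ot: "?O <= TM" by (rule openin_subset[OF Oo])
 have img: "snd c ` ?O = ?B" using sub by auto
 have hm: "homeomorphic_map (subtopology M ?O) (top_of_set ?B) (snd c)"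
 proof -
  have "homeomorphic_map (subtopology (subtopology M (fst c)) ?O) (subtopology (top_of_set (img c)) ?B) (snd c)"
   by (rule homeomorphic_map_subtopologies[OF chart_homeo[OF c(1)]]) (use sub chart_sub[OF c(1)] in auto)
  moreover have "fst c Int ?O = ?O" "img c Int ?B = ?B" using sub by auto
  ultimately show ?thesis by (simp only: subtopology_subtopology)
 qed
 have "hom_induced (p+1) (subtopology M ?O) (?O-{x}) (top_of_set ?B) (?B-{?a}) (snd c)
   : iso (rhg (p+1) (subtopology M ?O) (?O-{x})) (rhg (p+1) (top_of_set ?B) (?B-{?a}))"
 proof (rule homeomorphic_map_relative_homology_iso[OF hm])
  show "?O-{x} <= topspace (subtopology M ?O)" using Ot by auto
  show "snd c ` (?O-{x}) = ?B-{?a}" using img chart_inj[OF c(1)] c(2) by (auto simp: inj_on_def)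
 qed
 hence 1: "rhg (p+1) (subtopology M ?O) (?O-{x}) \<cong> rhg (p+1) (top_of_set ?B) (?B-{?a})" by (rule is_isoI)
 have xc: "closedin M {x}" using closedin_Hausdorff_singleton[OF haus x] .
 have xO: "x : ?O" using c r by simp
 have "hom_induced (p+1) (subtopology M (TM-(TM-?O))) ((TM-{x})-(TM-?O)) (subtopology M TM) (TM-{x}) id
   : iso (rhg (p+1) (subtopology M (TM-(TM-?O))) ((TM-{x})-(TM-?O))) (rhg (p+1) (subtopology M TM) (TM-{x}))"
 proof (rule homology_excision_axiom)
  have "M closure_of (TM-?O) = TM-?O" using Oo by (simp add: closure_of_closedin closedin_diff)
  moreover have "M interior_of (TM-{x}) = TM-{x}" using xc by (simp add: interior_of_openin openin_diff)
  ultimately show "M closure_of (TM-?O) <= M interior_of (TM-{x})" using xO by auto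
 qed auto
 moreover have "TM-(TM-?O) = ?O" "(TM-{x})-(TM-?O) = ?O-{x}" using Ot by auto
 ultimately have 2: "rhg (p+1) (subtopology M ?O) (?O-{x}) \<cong> rhg (p+1) M (TM-{x})" by (auto intro: is_isoI)
 have "reduced_homology_group p (nsphere 2) \<cong> rhg (p+1) (top_of_set ?B) (?B-{?a})" by (rule punctured_ball_homology[OF r(1)])
 also have "... \<cong> rhg (p+1) (subtopology M ?O) (?O-{x})" using group.iso_sym[OF group_relative_homology_group 1] .
 also note 2
 finally show ?thesis .
qed

lemma local_homology_trivial: assumes x: "x : TM" and i: "i ~= 3" and c: "singular_relcycle i M (TM-{x}) c" shows "singular_relboundary i M (TM-{x}) c"
proof (rule relhomology_trivialD[OF _ c])
 have "trivial_group (reduced_homology_group (int i-1) (nsphere 2))" by (rule reduced_homology_group_nsphere(2)) (use i in auto)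
 thus "trivial_group (rhg (int i) M (TM-{x}))" using isomorphic_group_triviality[OF local_homology[OF x, of "int i-1"]] by simp
qed

lemma local_degree: assumes x: "x : TM" obtains d where "degree_map 3 M (TM-{x}) d"
proof (rule degree_map_exists)
 have "rhg 3 M (TM-{x}) \<cong> reduced_homology_group 2 (nsphere 2)" using group.iso_sym[OF group_reduced_homology_group local_homology[OF x, of 2]] by simp
 also have "... \<cong> integer_group" using reduced_homology_group_nsphere(1)[of 2] by simp
 finally show "rhg (int 3) M (TM-{x}) \<cong> integer_group" by simp
qed (rule that)

subsection \<open>Radial pushes\<close>

text \<open>At time 1 the shell between the radii \<open>dl\<close> and \<open>R\<close> is pushed
  onto the sphere of radius \<open>R\<close>, while points beyond \<open>R\<close> never move. The
  maximum with \<open>dl\<close> in the denominator keeps the map continuous at the centre.\<close>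

definition radial :: "real^3 => real => real => real => real^3 => real^3" where "radial a R dl t y = a+(1+t*(max 1 (R/max dl (dist a y))-1))*R(y-a)"

lemma radial_cont: "dl>0 ==> continuous_on UNIV (%z. radial a R dl (fst z) (snd z))" unfolding radial_def by (intro continuous_intros) auto

lemma radial_dist: assumes "0<dl" "dl<R" "0 <= t" "t <= 1" shows "dist a (radial a R dl t y) = (1+t*(max 1 (R/max dl (dist a y))-1))*dist a y"
proof -
 have "1+t*(max 1 (R/max dl (dist a y))-1) >= 0" using assms by simp
 thus ?thesis by (simp add: radial_def dist_norm norm_minus_commute)
qed

lemma radial_id: assumes "0<dl" "dl<R" "R <= dist a y" shows "radial a R dl t y = y"
proof -
 have "max dl (dist a y) = dist a y" "R/dist a y <= 1" using assms by (simp_all add: divide_le_eq)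
 thus ?thesis by (simp add: radial_def max_absorb1)
qed

lemma radial_factor: assumes "0<dl" "dl <= dist a y" "dist a y <= R" shows "max 1 (R/max dl (dist a y)) = R/dist a y"
proof -
 have "dist a y>0" using assms by linarith
 hence "max dl (dist a y) = dist a y" "1 <= R/dist a y" using assms by (simp_all add: le_divide_eq del: zero_less_dist_iff)
 thus ?thesis by simp
qed

lemma radial_inside: assumes "0<dl" "dl<R" "0 <= t" "t <= 1" "dist a y <= R" shows "dist a (radial a R dl t y) <= R"
proof -
 let ?m = "max 1 (R/max dl (dist a y))"
 have "1+t*(?m-1) <= ?m" using mult_right_mono[of t 1 "?m-1"] assms by simp
 hence "(1+t*(?m-1))*dist a y <= ?m*dist a y" by (rule mult_right_mono) simp
 also have "... <= R"
 proof (cases "dist a y <= dl")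
  case True
  have "?m = R/dl" using True assms by (simp add: max_def)
  moreover have "R/dl*dist a y <= R/dl*dl" using True assms by (intro mult_left_mono) auto
  ultimately show ?thesis using assms by simp
 next
  case False
  hence "?m = R/dist a y" using radial_factor[of dl a y R] assms by simp
  thus ?thesis using False assms by simp
 qed
 finally show ?thesis unfolding radial_dist[OF assms(1-4)] .
qed

lemma radial_out: assumes "0<dl" "dl<R" "dl <= dist a y" "dist a y <= R" shows "dist a (radial a R dl 1 y) = R"
proof -
 have "max 1 (R/max dl (dist a y)) = R/dist a y" by (rule radial_factor[OF assms(1,3,4)])
 moreover have "dist a y>0" using assms(1,3) by linarith
 ultimately show ?thesis using radial_dist[OF assms(1,2), of 1 a y] by simp
qed

text \<open>Points move outward on rays from \<open>a\<close>. As \<open>K\<close> is star-shaped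
  about \<open>a\<close>, a point outside \<open>K\<close> never enters it, and no other point
  reaches \<open>a\<close>; so both complements are preserved during the homotopy, and at the end
  everything off the small ball has left \<open>K\<close>.\<close>

lemma push_exists: assumes c: "c : A" and K: "K <= ball a R" "cball a R <= img c" and aK: "a : K" and star: "!!y. y : K ==> closed_segment a y <= K" and dl: "0<dl" "dl<R"
 obtains f where "homotopic_with (%h. h : (TM-(cpart c K)) \<rightarrow> TM-(cpart c K)) M M f id" "homotopic_with (%h. h : (TM-{cinv c a}) \<rightarrow> TM-{cinv c a}) M M f id"
  "!!q. q : TM ==> (q : fst c ==> snd c q ~: ball a dl) ==> f q : TM-(cpart c K)"
proof -
 let ?Kh = "(cpart c K)" and ?V = "img c"
 define F where "F z = (if snd z : fst c & snd c (snd z) : cball a R then cinv c (radial a R dl (fst z) (snd c (snd z))) else snd z)" for z :: "real \<times> 'a"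
 have RV: "radial a R dl t y : ?V" if "0 <= t" "t <= 1" "y : ?V" for t y
 proof (cases "dist a y <= R")
  case True
  thus ?thesis using radial_inside[OF dl that(1,2) True] K(2) by (auto simp: subset_iff)
 next
  case False
  thus ?thesis using radial_id[OF dl, of a y t] that(3) by simp
 qed
 have Fc: "F (t,q) = cinv c (radial a R dl t (snd c q))" if "q : fst c" for t q using that c radial_id[OF dl, of a "snd c q" t] by (auto simp: F_def)
 have F1: "snd c (F (t,q)) = radial a R dl t (snd c q) & F (t,q) : fst c" if "q : fst c" "0 <= t" "t <= 1" for t q
 proof -
  have rv: "radial a R dl t (snd c q) : ?V" by (rule RV[OF that(2,3)]) (use that(1) in simp)
  show ?thesis unfolding Fc[OF that(1)] using chart_chart_inv[OF rv] chart_inv_mem[OF rv] by blast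
 qed
 have F2: "F (t,q) = q" if "q ~: fst c" for t q using that by (simp add: F_def)
 have tM: "fst c <= TM" by (rule chart_sub[OF c])
 have Ft: "F (t,q) : TM" if "q : TM" "0 <= t" "t <= 1" for t q using F1[OF _ that(2,3), of q] F2[of q t] that(1) tM by (cases "q : fst c") auto
 let ?I = "top_of_set {0..1::real}"
 let ?P = "prod_topology ?I M"
 let ?T = "%b::bool. {0..1} \<times> (if b then fst c else TM-(cpart c (cball a R)))"
 let ?f = "%b::bool. if b then (%z. cinv c (radial a R dl (fst z) (snd c (snd z)))) else snd"
 have cont: "continuous_map ?P M F"
 proof (rule pasting_lemma[where I = UNIV and T = ?T and f = ?f])
  fix b :: bool
  have "openin M (if b then fst c else TM-(cpart c (cball a R)))" using chart_open(1)[OF c] closedin_chart_pre[OF c compact_cball K(2)] by auto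
  thus "openin ?P (?T b)" by (simp add: openin_prod_Times_iff)
  show "continuous_map (subtopology ?P (?T b)) M (?f b)"
  proof (cases b)
   case True
   have sub: "subtopology ?P (?T b) = prod_topology ?I (subtopology M (fst c))" using True by (simp add: prod_topology_subtopology)
   have ci: "continuous_map (top_of_set ?V) (subtopology M (fst c)) (cinv c)"
   proof -
    obtain g where g: "homeomorphic_maps (subtopology M (fst c)) (top_of_set ?V) (snd c) g" using chart_homeo[OF c] homeomorphic_map_maps by blast
    have "continuous_map (top_of_set ?V) (subtopology M (fst c)) g" using g by (simp add: homeomorphic_maps_def)
    thus ?thesis
    proof (rule continuous_map_eq)
     fix y assume "y : topspace (top_of_set ?V)"
     then obtain q where "q : fst c" "y = snd c q" by auto
     thus "g y = cinv c y" using g c tM by (auto simp: homeomorphic_maps_def Int_absorb1)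
    qed
   qed
   have cs: "continuous_map (subtopology M (fst c)) euclidean (snd c)" using homeomorphic_imp_continuous_map[OF chart_homeo[OF c]] by (simp add: continuous_map_in_subtopology)
   have "continuous_map (prod_topology ?I (subtopology M (fst c))) (prod_topology euclidean euclidean) (%z. (fst z,snd c (snd z)))"
   proof (rule continuous_map_pairedI)
    show "continuous_map (prod_topology ?I (subtopology M (fst c))) euclidean fst" using continuous_map_fst[of ?I "subtopology M (fst c)"] by (simp add: continuous_map_in_subtopology)
    show "continuous_map (prod_topology ?I (subtopology M (fst c))) euclidean (%z. snd c (snd z))" using continuous_map_compose[OF continuous_map_snd cs, of ?I] by (simp add: o_def)
   qed
   note c1 = this
   have c2: "continuous_map (prod_topology euclidean euclidean) euclidean (%z. radial a R dl (fst z) (snd z))" using radial_cont[OF dl(1)] by (simp add: euclidean_product_topology)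
   have "continuous_map (prod_topology ?I (subtopology M (fst c))) euclidean (%z. radial a R dl (fst z) (snd c (snd z)))" using continuous_map_compose[OF c1 c2] by (simp add: o_def)
   hence "continuous_map (prod_topology ?I (subtopology M (fst c))) (top_of_set ?V) (%z. radial a R dl (fst z) (snd c (snd z)))" using RV by (auto simp: continuous_map_in_subtopology)
   from continuous_map_compose[OF this ci] show ?thesis unfolding sub using True by (simp add: o_def continuous_map_in_subtopology)
  next
   case False
   thus ?thesis by (simp add: continuous_map_snd continuous_map_from_subtopology)
  qed
 next
  fix b b' z assume "z : topspace ?P Int ?T b Int ?T b'"
  thus "?f b z = ?f b' z" using radial_id[OF dl less_imp_le, of a "snd c (snd z)" "fst z"] c by (cases b; cases b'; cases "R<dist a (snd c (snd z))") auto
 next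
  fix z assume "z : topspace ?P"
  hence z: "fst z : {0..1}" "snd z : TM" by auto
  show "EX j. j : UNIV & z : ?T j & F z = ?f j z"
  proof (rule exI[of _ "snd z : fst c"])
   show "(snd z : fst c) : UNIV & z : ?T (snd z : fst c) & F z = ?f (snd z : fst c) z"
    using Fc[of "snd z" "fst z"] F2[of "snd z" "fst z"] z by (cases "snd z : fst c") (auto simp: mem_Times_iff)
  qed
 qed
 have F0: "F (0,q) = q" for q using c by (simp add: F_def radial_def)
 have hom: "homotopic_with P M M (%q. F (1,q)) id" if "!!t. 0 <= t ==> t <= 1 ==> P (%q. F (t,q))" for P
 proof -
  have "homotopic_with P M M (%q. F (0,q)) (%q. F (1,q))" unfolding homotopic_with_def using cont that by (intro exI[of _ F]) auto
  hence "homotopic_with P M M (%q. F (1,q)) (%q. F (0,q))" by (rule homotopic_with_symD)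
  moreover have "(%q. F (0,q)) = id" using F0 by auto
  ultimately show ?thesis by simp
 qed
 \<comment> \<open>The stretching factor is at least 1, so the starting point lies between
   \<open>a\<close> and its image; star-shapedness is used through this.\<close>
 have seg: "y : closed_segment a (radial a R dl t y)" if "0 <= t" for t y
 proof -
  define l where "l = 1+t*(max 1 (R/max dl (dist a y))-1)"
  have l: "l >= 1" using that by (simp add: l_def)
  have "y = (1-1/l)*Ra+(1/l)*R(a+l*R(y-a))" using l by (simp add: algebra_simps)
  thus ?thesis unfolding closed_segment_def radial_def l_def[symmetric] using l by (intro CollectI exI[of _ "1/l"]) auto
 qed
 show thesis
 proof (rule that[of "%q. F (1,q)"])
  show "homotopic_with (%h. h : (TM-?Kh) \<rightarrow> TM-?Kh) M M (%q. F (1,q)) id"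
  proof (rule hom)
   fix t :: real assume t: "0 <= t" "t <= 1"
   show "(%q. F (t,q)) : (TM-?Kh) \<rightarrow> TM-?Kh"
   proof
    fix q assume q: "q : TM-?Kh"
    have "F (t,q) ~: ?Kh"
    proof
     assume h: "F (t,q) : ?Kh"
     hence qc: "q : fst c" using F2[of q t] by (cases "q : fst c") auto
     have "radial a R dl t (snd c q) : K" using h F1[OF qc t] by auto
     hence "snd c q : K" using star seg[OF t(1), of "snd c q"] by blast
     thus False using q qc by simp
    qed
    thus "F (t,q) : TM-?Kh" using Ft[OF _ t] q by simp
   qed
  qed
  show "homotopic_with (%h. h : (TM-{cinv c a}) \<rightarrow> TM-{cinv c a}) M M (%q. F (1,q)) id"
  proof (rule hom)
   fix t :: real assume t: "0 <= t" "t <= 1"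
   have aV: "a : ?V" using K(2) dl by (auto simp: subset_iff)
   show "(%q. F (t,q)) : (TM-{cinv c a}) \<rightarrow> TM-{cinv c a}"
   proof
    fix q assume q: "q : TM-{cinv c a}"
    have "F (t,q) ~= cinv c a"
    proof
     assume h: "F (t,q) = cinv c a"
     hence qc: "q : fst c" using F2[of q t] chart_inv_mem[OF aV] by (cases "q : fst c") auto
     have "radial a R dl t (snd c q) = a" using h F1[OF qc t] chart_chart_inv[OF aV] by simp
     hence "snd c q = a" using seg[OF t(1), of "snd c q"] by simp
     thus False using q qc c chart_inv_chart by auto
    qed
    thus "F (t,q) : TM-{cinv c a}" using Ft[OF _ t] q by simp
   qed
  qed
  fix q assume q: "q : TM" and out: "q : fst c ==> snd c q ~: ball a dl"
  have "F (1,q) ~: ?Kh"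
  proof
   assume h: "F (1,q) : ?Kh"
   hence qc: "q : fst c" using F2[of q 1] by (cases "q : fst c") auto
   have rK: "radial a R dl 1 (snd c q) : K" using h F1[OF qc, of 1] by auto
   have ge: "dl <= dist a (snd c q)" using out[OF qc] by simp
   show False
   proof (cases "dist a (snd c q) <= R")
    case True
    thus False using radial_out[OF dl ge True] rK K(1) by auto
   next
    case False
    thus False using radial_id[OF dl, of a "snd c q" 1] rK K(1) by auto
   qed
  qed
  thus "F (1,q) : TM-?Kh" using Ft[OF q] by simp
 qed
qed

section \<open>Chains modulo chains off a set, compared with their classes at a point\<close>

abbreviation "off i K == sch i (subtopology M (TM-K))"
abbreviation "rcyc i K == singular_relcycle i M (TM-K)"
abbreviation "rbd i K == singular_relboundary i M (TM-K)"

lemma off_mono: "off i K c ==> K' <= K ==> off i K' c" by (erule singular_chain_mono) auto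

lemma off_chain: "off i K c ==> sch i M c" by (simp add: singular_chain_subtopology)

lemma off_Un: "off i K c ==> off i K' c ==> off i (K Un K') c" unfolding singular_chain_subtopology by blast

lemma rcyc_mono: "rcyc i K c ==> K' <= K ==> rcyc i K' c" unfolding singular_relcycle by (meson off_mono)

lemma rbd_mono: "rbd i K c ==> K' <= K ==> rbd i K' c" unfolding singular_relboundary using off_mono by blast

lemma off_push: assumes f: "continuous_map M M f" and img: "!!q. q : TM ==> q : S ==> f q : TM-K" and e: "sch i M e" and S: "!!s. s : kys e ==> s ` standard_simplex i <= S"
 shows "off i K (chain_map i f e)"
proof -
 have "sch i (subtopology M S) e" using e S by (simp add: singular_chain_subtopology)
 moreover have "continuous_map (subtopology M S) (subtopology M (TM-K)) f" using f img by (auto simp: continuous_map_in_subtopology continuous_map_from_subtopology)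
 ultimately show ?thesis by (rule singular_chain_chain_map)
qed

lemma chain_avoids: assumes e: "off i {x} e" and c: "c : A" "x : fst c" obtains dl where "dl>0" "!!s. s : kys e ==> s ` standard_simplex i <= {q. q : fst c --> snd c q ~: ball (snd c x) dl}"
proof -
 let ?S = "UN s:kys e. s ` standard_simplex i"
 have s: "singular_simplex i (subtopology M (TM-{x})) s" if "s : kys e" for s using e that by (auto simp: singular_chain_def)
 have "compactin M (s ` standard_simplex i)" if "s : kys e" for s
 proof -
  have "compactin (subtopology (powertop_real UNIV) (standard_simplex i)) (standard_simplex i)" by (simp add: compactin_subtopology compactin_standard_simplex)
  moreover have "continuous_map (subtopology (powertop_real UNIV) (standard_simplex i)) M s" using s[OF that] by (simp add: singular_simplex_def continuous_map_in_subtopology)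
  ultimately show ?thesis by (rule image_compactin)
 qed
 hence "compactin M ?S" by (intro compactin_Union[of "(%s. s ` standard_simplex i) ` kys e", simplified]) auto
 hence cl: "closedin M ?S" by (rule compactin_imp_closedin[OF haus])
 have xS: "x ~: ?S" using s by (auto simp: singular_simplex_subtopology)
 have xt: "x : TM" using c chart_sub by blast
 have "openin M (TM-?S)" "x : TM-?S" using cl xS xt by (auto intro: openin_diff)
 then obtain r where r: "r>0" "cball (snd c x) (2*r) <= snd c ` ((TM-?S) Int fst c)" using chart_ball[OF c] by blast
 show thesis
 proof (rule that[OF r(1)])
  fix s assume sk: "s : kys e"
  show "s ` standard_simplex i <= {q. q : fst c --> snd c q ~: ball (snd c x) r}"
  proof (intro subsetI CollectI impI notI)
   fix q assume q: "q : s ` standard_simplex i" "q : fst c" "snd c q : ball (snd c x) r"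
   have "snd c q : snd c ` ((TM-?S) Int fst c)" using q(3) r by (auto simp: subset_iff)
   hence "q : TM-?S" using chart_inj[OF c(1)] q(2) by (auto simp: inj_on_def)
   thus False using q(1) sk by blast
  qed
 qed
qed

definition starlike :: "'a set => 'a => bool" where "starlike K x \<longleftrightarrow> (EX c K' R. c : A & x : fst c & K = (cpart c K') & R>0 & K' <= ball (snd c x) R &
   cball (snd c x) R <= img c & snd c x : K' & (ALL y:K'. closed_segment (snd c x) y <= K'))"

lemma starlike_push: assumes K: "starlike K x" and e: "off i {x} e" obtains f where "homotopic_with (%h. h : (TM-K) \<rightarrow> TM-K) M M f id"
  "homotopic_with (%h. h : (TM-{x}) \<rightarrow> TM-{x}) M M f id" "off i K (chain_map i f e)" "continuous_map M M f"
proof -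
 obtain c K' R where c: "c : A" "x : fst c" and Keq: "K = (cpart c K')" and R: "R>0" "K' <= ball (snd c x) R"
   "cball (snd c x) R <= img c" "snd c x : K'" "!!y. y : K' ==> closed_segment (snd c x) y <= K'" using K unfolding starlike_def by blast
 obtain dl where dl: "dl>0" "!!s. s : kys e ==> s ` standard_simplex i <= {q. q : fst c --> snd c q ~: ball (snd c x) dl}" using chain_avoids[OF e c] by blast
 define d where "d = min dl (R/2)"
 have d: "0<d" "d<R" "d <= dl" using dl(1) R(1) by (auto simp: d_def)
 have cx: "cinv c (snd c x) = x" using c by simp
 obtain f where f: "homotopic_with (%h. h : (TM-(cpart c K')) \<rightarrow> TM-(cpart c K')) M M f id"
  "homotopic_with (%h. h : (TM-{cinv c (snd c x)}) \<rightarrow> TM-{cinv c (snd c x)}) M M f id" "!!q. q : TM ==> (q : fst c ==> snd c q ~: ball (snd c x) d) ==> f q : TM-(cpart c K')"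
  using push_exists[OF c(1) R(2-5) d(1,2)] by blast
 have fc: "continuous_map M M f" using homotopic_with_imp_continuous_maps[OF f(1)] by blast
 have "off i K (chain_map i f e)"
 proof (rule off_push[OF fc _ off_chain[OF e] dl(2)])
  show "f q : TM-K" if "q : TM" "q : {q. q : fst c --> snd c q ~: ball (snd c x) dl}" for q unfolding Keq by (rule f(3)) (use that d in auto)
 qed
 thus thesis using that[of f] f(1,2) fc unfolding cx Keq by blast
qed

lemma push_homologous: assumes "homotopic_with (%h. h : (TM-K) \<rightarrow> TM-K) M M f id" "rcyc i K a" shows "rbd i K (chain_map i f a-a)"
proof -
 have "sch i M a" using assms(2) by (simp add: singular_relcycle)
 hence "chain_map i id a = a" by (rule chain_map_ident)
 thus ?thesis using homotopic_imp_homologous_rel_chain_maps[OF assms] by (simp add: homologous_rel_def)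
qed

text \<open>If \<open>a\<close> bounds up to a remainder off \<open>x\<close>, push the remainder
  off \<open>K\<close>: the image of \<open>a\<close> then bounds up to a chain off
  \<open>K\<close>. The push is homotopic to the identity through maps preserving the complement of
  \<open>K\<close>, so \<open>a\<close> and its image are homologous off \<open>K\<close>.\<close>

lemma starlike_null: assumes K: "starlike K x" and a: "rcyc i K a" and n: "rbd i {x} a" shows "rbd i K a"
proof -
 obtain e r where e: "sch (Suc i) M e" "off i {x} r" "bdy (Suc i) e+r = a" using n unfolding singular_relboundary by blast
 obtain f where f: "homotopic_with (%h. h : (TM-K) \<rightarrow> TM-K) M M f id" "off i K (chain_map i f r)" "continuous_map M M f" using starlike_push[OF K e(2)] by metis
 have "chain_map i f a = bdy (Suc i) (chain_map (Suc i) f e) + chain_map i f r" using chain_boundary_chain_map[OF e(1), of f] by (simp add: e(3)[symmetric] chain_map_add)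
 moreover have "sch (Suc i) M (chain_map (Suc i) f e)" by (rule singular_chain_chain_map[OF e(1) f(3)])
 ultimately have "rbd i K (chain_map i f a)" unfolding singular_relboundary using f(2) by metis
 from singular_relboundary_diff[OF this push_homologous[OF f(1) a]] show ?thesis by simp
qed

text \<open>Push until the boundary has left \<open>K\<close>. Together with
  \<open>starlike_null\<close> this says that classes relative to the complement of \<open>K\<close>
  and of \<open>x\<close> are the same.\<close>

lemma starlike_extend: assumes K: "starlike K x" and a: "rcyc (Suc i) {x} a" obtains b where "rcyc (Suc i) K b" "rbd (Suc i) {x} (b-a)"
proof -
 have r: "off i {x} (bdy (Suc i) a)" and ac: "sch (Suc i) M a" using a by (simp_all add: singular_relcycle)
 obtain f where f: "homotopic_with (%h. h : (TM-{x}) \<rightarrow> TM-{x}) M M f id" "off i K (chain_map i f (bdy (Suc i) a))" "continuous_map M M f" using starlike_push[OF K r] by metis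
 show thesis
 proof (rule that[of "chain_map (Suc i) f a"])
  show "rcyc (Suc i) K (chain_map (Suc i) f a)" unfolding singular_relcycle using singular_chain_chain_map[OF ac f(3)] f(2) chain_boundary_chain_map[OF ac, of f] by simp
  show "rbd (Suc i) {x} (chain_map (Suc i) f a-a)" by (rule push_homologous[OF f(1) a])
 qed
qed

end

section \<open>Gluing chains\<close>

context closed_manifold
begin

definition prt :: "'a chart => (real^3) set => 'a set" where "prt c L = (cpart c L)"

text \<open>The factor 10 leaves room for pushes: seen from any point of
  \<open>cball a (2*r)\<close>, that ball lies within distance \<open>5*r\<close>, and the ball of
  radius \<open>5*r\<close> around the point stays in the chart.\<close>

definition nice :: "'a chart => real^3 => real => bool" where "nice c a r \<longleftrightarrow> c : A & r>0 & cball a (10*r) <= img c"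

lemma nice_cball: "nice c a r ==> cball a (2*r) <= cball a (10*r)" by (rule subset_cball) (simp add: nice_def)

lemma closedin_prt: assumes "nice c a r" "closed L" "L <= cball a (2*r)" shows "closedin M (prt c L)"
proof -
 have "compact L" using assms(2,3) by (metis bounded_cball bounded_subset compact_eq_bounded_closed)
 moreover have "L <= img c" using assms(1,3) nice_cball[OF assms(1)] unfolding nice_def by blast
 ultimately show ?thesis unfolding prt_def using assms(1) compactin_chart_pre compactin_imp_closedin[OF haus] unfolding nice_def by blast
qed

lemma convex_starlike: assumes n: "nice c a r" and L: "convex L" "L <= cball a (2*r)" and x: "x : prt c L" shows "starlike (prt c L) x" unfolding starlike_def
proof (intro exI conjI ballI)
 have r: "r>0" "cball a (10*r) <= img c" using n by (auto simp: nice_def)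
 have x2: "dist a (snd c x) <= 2*r" using x L by (auto simp: prt_def)
 show "c : A" "x : fst c" "prt c L = (cpart c L)" "5*r>0" "snd c x : L" using n x r by (auto simp: prt_def nice_def)
 show "L <= ball (snd c x) (5*r)"
 proof
  fix y assume "y : L"
  hence "dist a y <= 2*r" using L by auto
  thus "y : ball (snd c x) (5*r)" using dist_triangle[of "snd c x" y a] x2 r by (simp add: dist_commute)
 qed
 show "cball (snd c x) (5*r) <= img c"
 proof
  fix y assume "y : cball (snd c x) (5*r)"
  hence "y : cball a (10*r)" using dist_triangle[of a y "snd c x"] x2 r by simp
  thus "y : img c" using r by blast
 qed
 show "closed_segment (snd c x) y <= L" if "y : L" for y using closed_segment_subset[OF _ that L(1)] x by (simp add: prt_def)
qed

lemma rbd_alt: "rbd i K a \<longleftrightarrow> (EX e. sch (Suc i) M e & off i K (a-bdy (Suc i) e))"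
 unfolding singular_relboundary by (metis add_diff_cancel_left' diff_add_cancel add.commute)

lemma rbd_add: "rbd i K a ==> rbd i K b ==> rbd i K (a+b)" by (rule singular_relboundary_add)

text \<open>Mayer--Vietoris: two partial fillings which agree up to a boundary on the overlap can be
 merged, because subdivision splits a chain off the overlap into pieces off either set.\<close>

lemma glue: assumes K: "closedin M K1" "closedin M K2" and e: "sch (Suc (Suc i)) M e1" "sch (Suc (Suc i)) M e2"
  and f: "off (Suc i) K1 (al-bdy (Suc (Suc i)) e1)" "off (Suc i) K2 (al-bdy (Suc (Suc i)) e2)" and n: "rbd (Suc (Suc i)) (K1 Int K2) (e1-e2)"
 obtains y where "sch (Suc (Suc i)) M y" "off (Suc i) (K1 Un K2) (al-bdy (Suc (Suc i)) y)" "rbd (Suc (Suc i)) K1 (y-e1)" "rbd (Suc (Suc i)) K2 (y-e2)"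
proof -
 let ?d = "bdy (Suc (Suc i))" and ?d' = "bdy (Suc (Suc (Suc i)))"
 obtain g where g: "sch (Suc (Suc (Suc i))) M g" "off (Suc (Suc i)) (K1 Int K2) (e1-e2-?d' g)" using n unfolding rbd_alt by blast
 define w where "w = e1-e2-?d' g"
 have dd: "?d (?d' v) = 0" if "sch (Suc (Suc (Suc i))) M v" for v using chain_boundary_boundary[OF that] by simp
 have dw: "?d w = (al-?d e2)-(al-?d e1)" unfolding w_def by (simp add: chain_boundary_diff dd[OF g(1)])
 let ?X = "subtopology M (TM-K1 Int K2)"
 have sX: "K2-K1 <= TM" "K1 <= TM" using K closedin_subset by blast+
 have "closedin ?X (K2-K1)" unfolding closedin_subtopology using K(2) sX by (intro exI[of _ K2]) auto
 hence c1: "?X closure_of (K2-K1) = K2-K1" by (rule closure_of_closedin)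
 have "openin ?X (TM-K1)" unfolding openin_subtopology using K(1) by (intro exI[of _ "TM-K1"]) auto
 hence "?X interior_of (TM-K1) = TM-K1" by (rule interior_of_openin)
 hence cl: "?X closure_of (K2-K1) <= ?X interior_of (TM-K1)" using c1 sX by auto
 have s: "TM-K1 <= TM-K1 Int K2" by auto
 have wc: "sch (Suc (Suc i)) (subtopology ?X (TM-K1 Int K2)) w" using g(2) by (simp add: w_def subtopology_subtopology)
 obtain n a b where ab: "sch (Suc (Suc i)) (subtopology ?X (TM-K1 Int K2-(K2-K1))) a" "sch (Suc (Suc i)) (subtopology ?X (TM-K1)) b" "(singular_subdivision (Suc (Suc i)) ^^ n) w = a+b"
  by (rule excised_chain_exists[OF cl s wc])
 have a: "off (Suc (Suc i)) K2 a" using ab(1) unfolding subtopology_subtopology by (rule singular_chain_mono) auto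
 have b: "off (Suc (Suc i)) K1 b" using ab(2) unfolding subtopology_subtopology by (rule singular_chain_mono) auto
 \<comment> \<open>The homotopy between the identity and iterated subdivision is the same for all
   spaces, so it takes chains off a set to chains off that set; with it the splitting of the
   subdivided \<open>w\<close> is brought back to \<open>w\<close> itself.\<close>
 obtain h where h: "!!p c1 c2. h p (c1 - c2) = h p c1-h p (c2 :: 'a chain)" "!!p X c. sch p X c ==> sch (Suc p) X (h p c)"
  "!!p X c. sch p X c ==> bdy (Suc p) (h p c)+h (p-Suc 0) (bdy p c) = (singular_subdivision p ^^ n) c - c" by (rule chain_homotopic_iterated_singular_subdivision) blast
 define f1 f2 where "f1 = al-?d e1" and "f2 = al-?d e2"
 define P1 P2 where "P1 = b+h (Suc i) f1" and "P2 = a-h (Suc i) f2"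
 have P1: "off (Suc (Suc i)) K1 P1" unfolding P1_def f1_def by (rule singular_chain_add[OF b h(2)[OF f(1)]])
 have P2: "off (Suc (Suc i)) K2 P2" unfolding P2_def f2_def by (rule singular_chain_diff[OF a h(2)[OF f(2)]])
 have wM: "sch (Suc (Suc i)) M w" using g(2) off_chain unfolding w_def by blast
 note hw = h(2)[OF wM]
 have "?d' (h (Suc (Suc i)) w)+(h (Suc i) f2-h (Suc i) f1) = a+b-w" using h(3)[OF wM] ab(3) by (simp add: dw f1_def[symmetric] f2_def[symmetric] h(1))
 hence w: "w = P1+P2-?d' (h (Suc (Suc i)) w)" by (simp add: P1_def P2_def algebra_simps)
 \<comment> \<open>As \<open>w\<close> is \<open>P1 + P2\<close> up to a boundary,
   \<open>e1 - P1\<close> is \<open>e2 + P2\<close> up to a boundary: one chain that differs from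
   \<open>e1\<close> by a chain off \<open>K1\<close>, and from \<open>e2\<close> by a chain off
   \<open>K2\<close> and a boundary.\<close>
 define y where "y = e1-P1"
 define gg where "gg = g-h (Suc (Suc i)) w"
 have gg: "sch (Suc (Suc (Suc i))) M gg" unfolding gg_def by (rule singular_chain_diff[OF g(1) hw])
 have y2: "y-e2 = P2+?d' gg" using w by (simp add: y_def gg_def chain_boundary_diff w_def[symmetric]) (simp add: w_def algebra_simps)
 have y1: "y-e1 = - P1" by (simp add: y_def)
 show thesis
 proof (rule that)
  show "sch (Suc (Suc i)) M y" unfolding y_def by (rule singular_chain_diff[OF e(1) off_chain[OF P1]])
  have "al-?d y = f1+?d P1" by (simp add: y_def f1_def chain_boundary_diff)
  moreover have "off (Suc i) K1 (f1+?d P1)" using singular_chain_add[OF f(1) singular_chain_boundary_alt[OF P1]] by (simp add: f1_def)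
  moreover have "y = e2+P2+?d' gg" using y2 by (simp add: algebra_simps)
  hence "al-?d y = f2-?d P2" by (simp add: f2_def chain_boundary_add dd[OF gg])
  moreover have "off (Suc i) K2 (f2-?d P2)" using singular_chain_diff[OF f(2) singular_chain_boundary_alt[OF P2]] by (simp add: f2_def)
  ultimately show "off (Suc i) (K1 Un K2) (al-?d y)" using off_Un by metis
  show "rbd (Suc (Suc i)) K1 (y-e1)" unfolding y1 rbd_alt using singular_chain_minus[of _ _ P1] P1 by (intro exI[of _ 0]) simp
  show "rbd (Suc (Suc i)) K2 (y-e2)" unfolding y2 rbd_alt using P2 gg by (intro exI[of _ gg]) simp
 qed
qed

lemma high_null: assumes "rcyc i {x} a" "x : TM" "i>3" shows "rbd i {x} a" using local_homology_trivial assms by auto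

text \<open>Injectivity of the restriction of relative classes from \<open>K\<close> to its points.
  It is established in all degrees from 3 upward because a union in one degree needs the
  intersection in the next.\<close>

definition detects :: "nat => 'a set => bool" where "detects i K \<longleftrightarrow> (ALL a. rcyc i K a --> (ALL x:K. rbd i {x} a) --> rbd i K a)"

lemma detects_empty: "detects i {}" unfolding detects_def rbd_alt singular_relcycle by (auto intro!: exI[of _ 0] simp: singular_chain_0)

text \<open>Fillings over \<open>K1\<close> and over \<open>K2\<close> differ on the intersection by
  a relative cycle of degree at least 4. There the local homology vanishes, so the difference is
  null at every point, hence on the intersection, and the fillings can be glued.\<close>

lemma detects_Un: assumes K: "closedin M K1" "closedin M K2" and d: "detects (Suc i) K1" "detects (Suc i) K2" "detects (Suc (Suc i)) (K1 Int K2)" and i: "i >= 2"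
 shows "detects (Suc i) (K1 Un K2)" unfolding detects_def
proof (intro allI impI)
 fix a assume a: "rcyc (Suc i) (K1 Un K2) a" and n: "ALL x:K1 Un K2. rbd (Suc i) {x} a"
 have "rbd (Suc i) K1 a" "rbd (Suc i) K2 a" using d(1,2) rcyc_mono[OF a] n unfolding detects_def by auto
 then obtain e1 e2 where e: "sch (Suc (Suc i)) M e1" "off (Suc i) K1 (a-bdy (Suc (Suc i)) e1)" "sch (Suc (Suc i)) M e2" "off (Suc i) K2 (a-bdy (Suc (Suc i)) e2)" unfolding rbd_alt by blast
 have "off (Suc i) (K1 Int K2) ((a-bdy (Suc (Suc i)) e2)-(a-bdy (Suc (Suc i)) e1))" by (rule singular_chain_diff[OF off_mono[OF e(4)] off_mono[OF e(2)]]) auto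
 hence r: "rcyc (Suc (Suc i)) (K1 Int K2) (e1-e2)" using e by (simp add: singular_relcycle singular_chain_diff chain_boundary_diff)
 have "rbd (Suc (Suc i)) {x} (e1-e2)" if "x : K1 Int K2" for x by (rule high_null[OF rcyc_mono[OF r]]) (use that i closedin_subset[OF K(1)] in auto)
 hence "rbd (Suc (Suc i)) (K1 Int K2) (e1-e2)" using d(3) r unfolding detects_def by blast
 from glue[OF K e(1,3,2,4) this] show "rbd (Suc i) (K1 Un K2) a" unfolding rbd_alt by metis
qed

lemma detects_convex: assumes n: "nice c a r" and L: "convex L" "L <= cball a (2*r)" shows "detects i (prt c L)"
proof (cases "prt c L = {}")
 case True thus ?thesis using detects_empty by simp
next
 case False
 then obtain x where x: "x : prt c L" by blast
 show ?thesis unfolding detects_def using starlike_null[OF convex_starlike[OF n L x]] x by blast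
qed

text \<open>Induction on the number of sets with the degree left free: intersecting one set with the
  others gives fewer convex sets, to be treated one degree higher.\<close>

lemma detects_convex_Union: assumes n: "nice c a r" and "finite LL" "!!L. L : LL ==> convex L & closed L & L <= cball a (2*r)" and i: "i >= 2" shows "detects (Suc i) (prt c (\<Union>LL))"
 using assms(2-)
proof (induction LL arbitrary: i rule: measure_induct_rule[where f = card])
 case (less LL)
 show ?case
 proof (cases "LL = {}")
  case True
  thus ?thesis using detects_empty by (simp add: prt_def)
 next
  case False
  then obtain L where LL: "L : LL" by blast
  define LL' where "LL' = LL-{L}"
  have L: "LL = insert L LL'" "finite LL'" "card LL' < card LL" using LL less.prems(1) card_Diff1_less[OF less.prems(1) LL] unfolding LL'_def by blast+
  have b: "!!L. L : LL' ==> convex L & closed L & L <= cball a (2*r)" and b': "convex L" "closed L" "L <= cball a (2*r)" using less.prems L(1) by auto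
  have U: "prt c (\<Union>LL) = prt c L Un prt c (\<Union>LL')" by (auto simp: prt_def L(1))
  let ?I = "(%N. L Int N) ` LL'"
  have I: "prt c L Int prt c (\<Union>LL') = prt c (\<Union>?I)" by (auto simp: prt_def)
  show ?thesis unfolding U
  proof (rule detects_Un)
   show "closedin M (prt c L)" by (rule closedin_prt[OF n b'(2,3)])
   show "closedin M (prt c (\<Union>LL'))" by (rule closedin_prt[OF n]) (use b L(2) in "auto intro: closed_Union")
   show "detects (Suc i) (prt c L)" by (rule detects_convex[OF n b'(1,3)])
   show "detects (Suc i) (prt c (\<Union>LL'))" by (rule less.IH) (use L b less.prems in auto)
   show "detects (Suc (Suc i)) (prt c L Int prt c (\<Union>LL'))" unfolding I
   proof (rule less.IH)
    show "card ?I < card LL" using card_image_le[OF L(2), of "%N. L Int N"] L(3) by simp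
    show "convex N & closed N & N <= cball a (2*r)" if "N : ?I" for N using that b b' by (auto intro!: convex_Int closed_Int)
   qed (use L less.prems in auto)
   show "2 <= i" by fact
  qed
 qed
qed

text \<open>Cover \<open>K\<close> by finitely many closed balls with centres in \<open>K\<close>,
  so small that the boundary of \<open>al\<close> avoids them. Then \<open>al\<close> is a cycle
  relative to their union; it is null on each ball because it is null at the centre, so the result
  for convex sets applies to the union, which contains \<open>K\<close>.\<close>

lemma detects_chart: assumes n: "nice c a r" and K: "closedin M K" "K <= prt c (cball a r)" and i: "i >= 2" shows "detects (Suc i) K" unfolding detects_def
proof (intro allI impI)
 fix al assume al: "rcyc (Suc i) K al" and null: "ALL x:K. rbd (Suc i) {x} al"
 have cA: "c : A" and r: "r>0" using n by (auto simp: nice_def)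
 have alc: "sch (Suc i) M al" and alb: "off i K (bdy (Suc i) al)" using al by (auto simp: singular_relcycle)
 define ok where "ok p rho \<longleftrightarrow> rho>0 & rho <= r & off i (prt c (cball (snd c p) rho)) (bdy (Suc i) al)" for p rho
 have "EX rho. ok p rho" if p: "p : K" for p
 proof -
  have pc: "p : fst c" using p K(2) by (auto simp: prt_def)
  have "off i {p} (bdy (Suc i) al)" by (rule off_mono[OF alb]) (use p in auto)
  from chain_avoids[OF this cA pc] obtain dl where dl: "dl>0" "!!s. s : kys (bdy (Suc i) al) ==> s ` standard_simplex i <= {q. q : fst c --> snd c q ~: ball (snd c p) dl}" by blast
  let ?rho = "min (dl/2) r"
  have sub: "cball (snd c p) ?rho <= ball (snd c p) dl" using dl(1) by auto
  have *: "{q. q : fst c --> snd c q ~: ball (snd c p) dl} Int prt c (cball (snd c p) ?rho) = {}" using sub by (auto simp: prt_def)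
  have "s ` standard_simplex i <= TM-prt c (cball (snd c p) ?rho)" if "s : kys (bdy (Suc i) al)" for s using alb dl(2)[OF that] * that unfolding singular_chain_subtopology by blast
  hence "off i (prt c (cball (snd c p) ?rho)) (bdy (Suc i) al)" using off_chain[OF alb] by (simp add: singular_chain_subtopology)
  thus ?thesis using dl(1) r by (intro exI[of _ ?rho]) (simp add: ok_def)
 qed
 then obtain rho where rho: "!!p. p : K ==> ok p (rho p)" by metis
 let ?O = "%p. (cpart c (ball (snd c p) (rho p)))"
 have Kc: "compactin M K" by (rule closed_compactin[OF _ _ K(1), of "TM"]) (use compact closedin_subset[OF K(1)] in "auto simp: compact_space_def")
 obtain F where F: "finite F" "F <= K" "K <= \<Union>(?O ` F)"
 proof -
  have "EX FF. finite FF & FF <= ?O ` K & K <= \<Union>FF"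
  proof (rule compactinD[OF Kc])
   show "openin M U" if "U : ?O ` K" for U using that openin_chart_pre[OF cA open_ball] by auto
   show "K <= \<Union>(?O ` K)"
   proof
    fix p assume p: "p : K"
    hence "p : ?O p" using rho[OF p] K(2) by (auto simp: ok_def prt_def)
    thus "p : \<Union>(?O ` K)" using p by blast
   qed
  qed
  then obtain FF where FF: "finite FF" "FF <= ?O ` K" "K <= \<Union>FF" by blast
  from finite_subset_image[OF FF(1,2)] obtain F where "F <= K" "finite F" "FF = ?O ` F" by blast
  thus thesis using that[of F] FF(3) by blast
 qed
 define LL where "LL = (%p. cball (snd c p) (rho p)) ` F"
 have sub: "cball (snd c p) (rho p) <= cball a (2*r)" if "p : F" for p
 proof
  fix y assume y: "y : cball (snd c p) (rho p)"
  have p: "p : K" using that F by blast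
  have "dist a (snd c p) <= r" "rho p <= r" using p K(2) rho[OF p] by (auto simp: prt_def ok_def)
  thus "y : cball a (2*r)" using y dist_triangle[of a y "snd c p"] by simp
 qed
 have KL: "K <= prt c (\<Union>LL)" unfolding prt_def LL_def
 proof
  fix q assume "q : K"
  then obtain p where "p : F" "q : fst c" "dist (snd c p) (snd c q)<rho p" using F(3) by auto
  thus "q : {q : fst c. snd c q : \<Union>((%p. cball (snd c p) (rho p)) ` F)}" by (auto intro: less_imp_le)
 qed
 have offL: "off i (prt c (\<Union>LL)) (bdy (Suc i) al)"
 proof -
  have "off i (prt c (cball (snd c p) (rho p))) (bdy (Suc i) al)" if "p : F" for p using rho[of p] that F(2) by (auto simp: ok_def)
  thus ?thesis using alb unfolding singular_chain_subtopology LL_def prt_def by (intro conjI ballI subsetI) blast+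
 qed
 have rL: "rcyc (Suc i) (prt c (\<Union>LL)) al" using alc offL by (simp add: singular_relcycle)
 have "rbd (Suc i) {x} al" if x: "x : prt c (\<Union>LL)" for x
 proof -
  obtain p where p: "p : F" "x : prt c (cball (snd c p) (rho p))" using x by (auto simp: LL_def prt_def)
  have pK: "p : K" using p F by blast
  have pp: "p : prt c (cball (snd c p) (rho p))" using rho[OF pK] pK K(2) by (auto simp: prt_def ok_def)
  have "rcyc (Suc i) (prt c (cball (snd c p) (rho p))) al" by (rule rcyc_mono[OF rL]) (use p in "auto simp: prt_def LL_def")
  from starlike_null[OF convex_starlike[OF n convex_cball sub[OF p(1)] pp] this] null pK
  have "rbd (Suc i) (prt c (cball (snd c p) (rho p))) al" by blast
  from rbd_mono[OF this] show ?thesis using p(2) by blast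
 qed
 moreover have "detects (Suc i) (prt c (\<Union>LL))" by (rule detects_convex_Union[OF n _ _ i]) (use F(1) sub in "auto simp: LL_def")
 ultimately have "rbd (Suc i) (prt c (\<Union>LL)) al" using rL by (auto simp: detects_def)
 thus "rbd (Suc i) K al" using KL by (rule rbd_mono)
qed

end

section \<open>Integral 2-cycles\<close>

lemma cmul_diff: "frag_cmul k (a-b) = frag_cmul k a-frag_cmul k b" by (rule poly_mapping_eqI) (simp add: lookup_minus algebra_simps)

context closed_manifold
begin

lemma nice_ball: assumes "openin M W" "p : W" obtains c r where "nice c (snd c p) r" "p : fst c" "prt c (cball (snd c p) r) <= W"
proof -
 have "p : PA" using assms openin_subset pts by blast
 then obtain c where c: "c : A" "p : fst c" using chart_at by metis
 obtain r where r: "r>0" "cball (snd c p) (2*r) <= snd c ` (W Int fst c)" using chart_ball[OF c assms] .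
 show thesis
 proof (rule that[of c "r/5"])
  show "nice c (snd c p) (r/5)" using c r by (auto simp: nice_def)
  show "prt c (cball (snd c p) (r/5)) <= W"
  proof
   fix q assume q: "q : prt c (cball (snd c p) (r/5))"
   hence "snd c q : cball (snd c p) (2*r)" using r by (auto simp: prt_def)
   hence "snd c q : snd c ` (W Int fst c)" using r by blast
   thus "q : W" using chart_inj[OF c(1)] q by (auto simp: inj_on_def prt_def)
  qed
 qed (rule c)
qed

lemma prt_sub: "nice c a r ==> prt c L <= TM" using chart_sub[of c] by (auto simp: nice_def prt_def)

lemma openin_prt: "nice c a r ==> open L ==> openin M (prt c L)" unfolding prt_def nice_def using openin_chart_pre by blast

text \<open>The isomorphism is chosen for each point separately, without consistency of signs. Later
  arguments use products of two degrees at the same point, comparison with a common generator, and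
  vanishing, none of which sees the sign.\<close>

definition deg :: "'a => 'a chain => int" where "deg x = (SOME d. degree_map 3 M (TM-{x}) d)"

lemma deg: "x : TM ==> degree_map 3 M (TM-{x}) (deg x)" unfolding deg_def using local_degree by (metis someI_ex)

lemma deg_add: "x : TM ==> rcyc 3 {x} a ==> rcyc 3 {x} b ==> deg x (a+b) = deg x a+deg x b" using deg unfolding degree_map_def by metis

lemma deg_0: "x : TM ==> rcyc 3 {x} a ==> deg x a = 0 \<longleftrightarrow> rbd 3 {x} a" using deg unfolding degree_map_def by metis

lemma deg_diff: assumes "x : TM" "rcyc 3 {x} a" "rcyc 3 {x} b" shows "deg x (a-b) = deg x a-deg x b" using deg_add[OF assms(1) singular_relcycle_diff[OF assms(2,3)] assms(3)] by simp

lemma deg_cmul: assumes x: "x : TM" "rcyc 3 {x} a" shows "deg x (frag_cmul k a) = k*deg x a"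
proof (induction k rule: int_induct[where k = 0])
 case base
 show ?case using deg_add[OF x(1), of 0 0] by simp
next
 case (step1 i)
 thus ?case using deg_add[OF x(1) singular_relcycle_cmul[OF x(2), of i] x(2)] by (simp add: frag_cmul_distrib algebra_simps)
next
 case (step2 i)
 have "frag_cmul i a = frag_cmul (i-1) a+a" using frag_cmul_distrib[of "i-1" 1 a] by simp
 hence "deg x (frag_cmul i a) = deg x (frag_cmul (i-1) a)+deg x a" using deg_add[OF x(1) singular_relcycle_cmul[OF x(2), of "i-1"] x(2)] by simp
 thus ?case using step2 by (simp add: algebra_simps)
qed

text \<open>Subtract the multiple of \<open>nu\<close> that matches \<open>al\<close> at one point
  \<open>p\<close>. The difference is null at \<open>p\<close>, hence on the ball, which is
  star-shaped about \<open>p\<close>, and so has degree 0 everywhere in it.\<close>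

lemma deg_multiple: assumes n: "nice c a r" and B: "B = prt c (cball a r)" and v: "rcyc 3 B nu" "!!x. x : B ==> deg x nu = 1 \<or> deg x nu = -1" and al: "rcyc 3 B al"
 obtains m where "!!x. x : B ==> deg x al = m*deg x nu"
proof (cases "B = {}")
 case False
 then obtain p where p: "p : B" by blast
 have t: "x : TM" if "x : B" for x using that prt_sub[OF n] B by blast
 have r: "rcyc 3 {x} e" if "x : B" "rcyc 3 B e" for x e by (rule rcyc_mono[OF that(2)]) (use that in simp)
 define m where "m = deg p al*deg p nu"
 let ?e = "al-frag_cmul m nu"
 have e: "rcyc 3 B ?e" by (rule singular_relcycle_diff[OF al singular_relcycle_cmul[OF v(1)]])
 have d: "deg x ?e = deg x al-m*deg x nu" if "x : B" for x
  using deg_diff[OF t[OF that] r[OF that al] r[OF that singular_relcycle_cmul[OF v(1)]]] deg_cmul[OF t[OF that] r[OF that v(1)]] by simp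
 have "deg p ?e = 0" using d[OF p] v(2)[OF p] by (auto simp: m_def)
 hence "rbd 3 {p} ?e" using deg_0[OF t[OF p] r[OF p e]] by simp
 moreover have "starlike B p" unfolding B by (rule convex_starlike[OF n convex_cball]) (use p B n in "auto simp: nice_def")
 ultimately have "rbd 3 B ?e" using starlike_null e by blast
 hence "deg x ?e = 0" if "x : B" for x using deg_0[OF t[OF that] r[OF that e]] rbd_mono[of 3 B ?e "{x}"] that by simp
 thus thesis using that[of m] d by simp
qed (rule that, simp)

text \<open>Extend a generator at \<open>p\<close> over the ball to \<open>nu\<close>. A generator
  at another point \<open>x\<close>, extended likewise, is a multiple of \<open>nu\<close> up to a
  relative boundary and has degree 1 at \<open>x\<close>; so the degree of \<open>nu\<close> there
  divides 1.\<close>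

lemma local_generator: assumes n: "nice c a r" and B: "B = prt c (cball a r)" obtains nu where "rcyc 3 B nu" "!!x. x : B ==> deg x nu = 1 \<or> deg x nu = -1"
proof (cases "B = {}")
 case False
 then obtain p where p: "p : B" by blast
 have t: "x : TM" if "x : B" for x using that prt_sub[OF n] B by blast
 have st: "starlike B x" if "x : B" for x unfolding B by (rule convex_starlike[OF n convex_cball]) (use that B n in "auto simp: nice_def")
 have r: "rcyc 3 {x} e" if "x : B" "rcyc 3 B e" for x e by (rule rcyc_mono[OF that(2)]) (use that in simp)
 have ex: "EX b. rcyc 3 B b & deg x b = 1" if x: "x : B" for x
 proof -
  obtain e where e: "rcyc 3 {x} e" "deg x e = 1" using deg[OF t[OF x]] unfolding degree_map_def by blast
  obtain b where b: "rcyc 3 B b" "rbd 3 {x} (b-e)" using starlike_extend[OF st[OF x], of 2 e] e(1) by (auto simp: eval_nat_numeral)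
  have "deg x (b-e) = 0" using deg_0[OF t[OF x] singular_relcycle_diff[OF r[OF x b(1)] e(1)]] b(2) by simp
  thus ?thesis using deg_diff[OF t[OF x] r[OF x b(1)] e(1)] e(2) b(1) by auto
 qed
 obtain nu where v: "rcyc 3 B nu" "deg p nu = 1" using ex[OF p] by blast
 have "deg x nu = 1 \<or> deg x nu = -1" if x: "x : B" for x
 proof -
  obtain b where b: "rcyc 3 B b" "deg x b = 1" using ex[OF x] by blast
  let ?e = "b-frag_cmul (deg p b) nu"
  have e: "rcyc 3 B ?e" by (rule singular_relcycle_diff[OF b(1) singular_relcycle_cmul[OF v(1)]])
  have d: "deg y ?e = deg y b-deg p b*deg y nu" if "y : B" for y
   using deg_diff[OF t[OF that] r[OF that b(1)] r[OF that singular_relcycle_cmul[OF v(1)]]] deg_cmul[OF t[OF that] r[OF that v(1)]] by simp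
  have "deg p ?e = 0" using d[OF p] v(2) by simp
  hence "rbd 3 {p} ?e" using deg_0[OF t[OF p] r[OF p e]] by simp
  hence "rbd 3 B ?e" using starlike_null st[OF p] e by blast
  hence "deg x ?e = 0" using deg_0[OF t[OF x] r[OF x e]] rbd_mono[of 3 B ?e "{x}"] x by simp
  hence "deg p b*deg x nu = 1" using d[OF x] b(2) by simp
  thus ?thesis by (auto simp: zmult_eq_1_iff)
 qed
 thus thesis using that v(1) by blast
qed (rule that[of 0], simp_all)

end

context positive_ricci
begin

theorem twice_2_cycle_bounds: assumes z: "sch 2 M z" "bdy 2 z = 0" obtains y where "sch 3 M y" "bdy 3 y = frag_cmul 2 z"
proof -
 have "EX c r. nice c (snd c p) r & p : fst c" if "p : TM" for p using nice_ball[OF openin_topspace that] by metis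
 then obtain c r where cr: "!!p. p : TM ==> nice (c p) (snd (c p) p) (r p) & p : fst (c p)" by metis
 define a where "a p = snd (c p) p" for p
 have n: "nice (c p) (a p) (r p)" and pc: "p : fst (c p)" and r: "r p>0" if "p : TM" for p using cr[OF that] by (auto simp: a_def nice_def)
 define A' where "A' p = prt (c p) (cball (a p) (r p))" for p
 define G where "G p = prt (c p) (ball (a p) (r p))" for p
 define C where "C p = prt (c p) (cball (a p) (r p/2))" for p
 define O' where "O' p = prt (c p) (ball (a p) (r p/2))" for p
 have pA: "p : A' p" and pO: "p : O' p" if "p : TM" for p using pc[OF that] r[OF that] by (auto simp: A'_def O'_def prt_def a_def)
 have GA: "G p <= A' p" and OC: "O' p <= C p" for p by (auto simp: A'_def G_def C_def O'_def prt_def)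
 have CG: "C p <= G p" if "p : TM" for p using r[OF that] by (auto simp: G_def C_def prt_def)
 have Oo: "openin M (O' p)" and Go: "openin M (G p)" and Cc: "closedin M (C p)" and Asub: "A' p <= TM" if "p : TM" for p
  using openin_prt[OF n[OF that]] closedin_prt[OF n[OF that], of "cball (a p) (r p/2)"] prt_sub[OF n[OF that]] r[OF that] subset_cball[of "r p/2" "2*r p" "a p"]
  by (auto simp: O'_def G_def C_def A'_def)
 obtain P where P: "finite P" "P <= TM" "TM <= (UN p:P. O' p)" by (rule finite_cover[of O']) (use Oo pO in auto)
 have "EX w. sch 3 M w & off 2 (A' p) (z-bdy 3 w)" if p: "p : TM" for p
 proof -
  have z2: "rcyc 2 K z" for K using z by (simp add: singular_relcycle)
  have "starlike (A' p) p" unfolding A'_def by (rule convex_starlike[OF n[OF p] convex_cball]) (use pA[OF p] r[OF p] in "auto simp: A'_def")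
  from starlike_null[OF this z2 local_homology_trivial[OF p _ z2]] show ?thesis unfolding rbd_alt by (simp add: eval_nat_numeral)
 qed
 then obtain w where w: "!!p. p : TM ==> sch 3 M (w p) & off 2 (A' p) (z-bdy 3 (w p))" by metis
 have "EX nu. rcyc 3 (A' p) nu & (ALL x:A' p. deg x nu = 1 \<or> deg x nu = -1)" if "p : TM" for p using local_generator[OF n[OF that] A'_def] by metis
 then obtain mu where mu: "!!p. p : TM ==> rcyc 3 (A' p) (mu p)" "!!p x. p : TM ==> x : A' p ==> deg x (mu p) = 1 \<or> deg x (mu p) = -1" by metis
 have "EX k. k : P & x : O' k" if "x : TM" for x using that P by blast
 then obtain k where k: "!!x. x : TM ==> k x : P & x : O' (k x)" by metis
 have kt: "k x : TM" if "x : TM" for x using k[OF that] P by blast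
 \<comment> \<open>Near \<open>x\<close> the fillings of \<open>z\<close> are, up to boundaries,
   \<open>w (k x)\<close> plus an integral multiple of \<open>mu (k x)\<close>. The maps given by
   \<open>s\<close> and \<open>t\<close> convert the coefficient of \<open>mu (k y)\<close> into
   that of \<open>mu (k x)\<close>, all degrees being measured at \<open>x\<close>.\<close>
 define s :: "'a => 'a => real" where "s x y = of_int (deg x (mu (k x))*deg x (mu (k y)))" for x y
 define t :: "'a => 'a => real" where "t x y = of_int (deg x (w (k y)-w (k x))*deg x (mu (k x)))" for x y
 have wr: "rcyc 3 B (w i-w j)" if "i : TM" "j : TM" "B <= A' i" "B <= A' j" for i j B
 proof -
  have "off 2 B ((z-bdy 3 (w j))-(z-bdy 3 (w i)))" by (rule singular_chain_diff) (use w[OF that(1)] w[OF that(2)] off_mono that in blast)+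
  thus ?thesis using w[OF that(1)] w[OF that(2)] by (simp add: singular_relcycle chain_boundary_diff singular_chain_diff)
 qed
 \<comment> \<open>All degrees over \<open>V\<close> are expressed by one generator
   \<open>nu\<close>: \<open>m y\<close> is the sign of \<open>mu (k y)\<close> and
   \<open>n y q\<close> the degree of \<open>w (k y) - w (k q)\<close> in terms of it, both
   independent of the point where the degree is taken. This turns the cocycle law into
   arithmetic.\<close>
 define good where "good V B nu m n \<longleftrightarrow> openin M V & V <= B & (ALL x:V. B <= A' (k x)) & (ALL x:V. deg x nu = 1 \<or> deg x nu = (-1::int)) &
   (ALL y:V. m y = 1 \<or> m y = (-1::int)) & (ALL x:V. ALL y:V. deg x (mu (k y)) = m y*deg x nu) & (ALL x:V. ALL y:V. ALL q:V. deg x (w (k y)-w (k q)) = n y q*deg x nu)" for V B nu m n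
 have loc: "EX V B nu m n. p : V & good V B nu m n" if p: "p : TM" for p
 proof -
  \<comment> \<open>For \<open>x\<close> in \<open>V0\<close> the point \<open>x\<close> lies in
    \<open>C (k x)\<close>; then so does \<open>p\<close>, since \<open>V0\<close> avoids every
    \<open>C i\<close> that does not contain \<open>p\<close>. Hence \<open>V0\<close> lies in
    \<open>G (k x)\<close>, whatever index \<open>k\<close> selects.\<close>
  define V0 where "V0 = (INT i:P. if p : C i then G i else TM-C i) Int TM"
  have V0: "openin M V0" unfolding V0_def by (rule openin_INT[OF P(1)]) (use P(2) Go Cc in auto)
  have pV0: "p : V0" using p P(2) CG by (auto simp: V0_def)
  obtain c' r' where c': "nice c' (snd c' p) r'" "p : fst c'" "prt c' (cball (snd c' p) r') <= V0" using nice_ball[OF V0 pV0] .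
  define B where "B = prt c' (cball (snd c' p) r')"
  define V where "V = prt c' (ball (snd c' p) r')"
  have pV: "p : V" using c' by (auto simp: V_def prt_def nice_def)
  have VB: "V <= B" by (auto simp: V_def B_def prt_def)
  have BA: "B <= A' (k x)" if x: "x : V" for x
  proof -
   have xt: "x : V0" using x VB c' by (auto simp: B_def)
   hence k': "k x : P" "x : C (k x)" using k[of x] OC by (auto simp: V0_def)
   hence "p : C (k x)" using xt by (auto simp: V0_def split: if_splits)
   hence "V0 <= G (k x)" using k' by (auto simp: V0_def split: if_splits)
   thus ?thesis using GA c'(3) by (auto simp: B_def)
  qed
  have tV: "x : TM" if "x : V" for x using that VB c'(3) openin_subset[OF V0] unfolding B_def by blast
  obtain nu where v: "rcyc 3 B nu" "!!x. x : B ==> deg x nu = 1 \<or> deg x nu = -1" using local_generator[OF c'(1) B_def] by metis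
  have "EX m. ALL x:B. deg x (mu (k y)) = m*deg x nu" if y: "y : V" for y using deg_multiple[OF c'(1) B_def v rcyc_mono[OF mu(1)[OF kt[OF tV[OF y]]] BA[OF y]]] by metis
  then obtain m where m: "!!x y. y : V ==> x : B ==> deg x (mu (k y)) = m y*deg x nu" by metis
  have "EX m. ALL x:B. deg x (w (k y)-w (k q)) = m*deg x nu" if y: "y : V" "q : V" for y q
   using deg_multiple[OF c'(1) B_def v wr[OF kt[OF tV[OF y(1)]] kt[OF tV[OF y(2)]] BA[OF y(1)] BA[OF y(2)]]] by metis
  then obtain n' where n': "!!x y q. y : V ==> q : V ==> x : B ==> deg x (w (k y)-w (k q)) = n' y q*deg x nu" by metis
  have m1: "m y = 1 \<or> m y = -1" if y: "y : V" for y
  proof -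
   have "y : B" using y VB by blast
   thus ?thesis using m[OF y, of y] mu(2)[OF kt[OF tV[OF y]], of y] v(2)[of y] BA[OF y] by auto
  qed
  have "good V B nu m n'" unfolding good_def
  proof (intro conjI ballI)
   show "openin M V" unfolding V_def by (rule openin_prt[OF c'(1) open_ball])
  qed (use VB BA v(2) m1 m n' in blast)+
  thus ?thesis using pV by blast
 qed
 have st: "s x y = of_int (m x*m y)" "t x y = of_int (n y x*m x)" if g: "good V B nu m n" "x : V" "y : V" for V B nu m n x y
 proof -
  have "deg x (mu (k x)) = m x*deg x nu" "deg x (mu (k y)) = m y*deg x nu" "deg x (w (k y)-w (k x)) = n y x*deg x nu" "deg x nu = 1 \<or> deg x nu = -1" using g unfolding good_def by blast+
  thus "s x y = of_int (m x*m y)" "t x y = of_int (n y x*m x)" unfolding s_def t_def by auto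
 qed
 have good_top: "x : TM" if "good V B nu m n" "x : V" for V B nu m n x using that openin_subset unfolding good_def by blast
 obtain u where u: "!!p. p : TM ==> EX V. openin M V & p : V & (ALL x:V. ALL y:V. u x = s x y*u y+t x y)"
 proof (rule parallel_section)
  fix p assume p: "p : TM"
  obtain V B nu m n where V: "p : V" and g: "good V B nu m n" using loc[OF p] by blast
  have m: "m x = 1 \<or> m x = -1" if "x : V" for x using g that unfolding good_def by blast
  have nn: "n z x = n z y+n y x" if "x : V" "y : V" "z : V" for x y z
  proof -
   have BV: "{x} <= A' (k y)" if "y : V" for y using g that \<open>x \<in> V\<close> unfolding good_def by blast
   have d: "deg x (w (k y)-w (k q)) = n y q*deg x nu" if "y : V" "q : V" for y q using g that \<open>x \<in> V\<close> unfolding good_def by blast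
   have "rcyc 3 {x} (w (k z)-w (k y))" "rcyc 3 {x} (w (k y)-w (k x))" using wr[OF kt[OF good_top[OF g]] kt[OF good_top[OF g]] BV BV] that by blast+
   from deg_add[OF good_top[OF g that(1)] this] have "n z x*deg x nu = n z y*deg x nu+n y x*deg x nu" using d that by simp
   moreover have "deg x nu = 1 \<or> deg x nu = -1" using g that unfolding good_def by blast
   ultimately show ?thesis by auto
  qed
  show "EX V. openin M V & p : V & (ALL x:V. ALL y:V. s x y = 1 \<or> s x y = (-1::real)) & (ALL x:V. ALL y:V. ALL z:V. s x z = s x y * s y z & t x z = s x y*t y z+t x y)"
  proof (intro exI[of _ V] conjI ballI)
   show "openin M V" "p : V" using g V unfolding good_def by auto
   fix x y assume x: "x : V" and y: "y : V"
   show "s x y = 1 \<or> s x y = (-1::real)" using st(1)[OF g x y] m[OF x] m[OF y] by auto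
   fix z assume z: "z : V"
   show "s x z = s x y * s y z" "t x z = s x y*t y z+t x y" using st[OF g x y] st[OF g x z] st[OF g y z] nn[OF x y z] m[OF x] m[OF y] m[OF z] by auto
  qed
 qed blast
 define b where "b x = \<lfloor>u x\<rfloor> + \<lceil>u x\<rceil>" for x
 define omg where "omg x = frag_cmul 2 (w (k x))+frag_cmul (b x) (mu (k x))" for x
 let ?d = "bdy 3"
 \<comment> \<open>On a small ball around \<open>p\<close> the single chain \<open>omg p\<close>
   serves for all points: the parallel section makes \<open>omg p - omg x\<close> of degree 0 at
   each \<open>x\<close> in it.\<close>
 have fin: "EX V c' a' r'. openin M V & p : V & nice c' a' r' & V <= prt c' (cball a' r') & off 2 (prt c' (cball a' r')) (frag_cmul 2 z-?d (omg p)) &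
   (ALL x:prt c' (cball a' r'). rbd 3 {x} (omg p - omg x))" if p: "p : TM" for p
 proof -
  obtain V B nu m n where V: "p : V" and g: "good V B nu m n" using loc[OF p] by blast
  obtain V' where V': "openin M V'" "p : V'" "!!x y. x : V' ==> y : V' ==> u x = s x y*u y+t x y" using u[OF p] by blast
  have "openin M (V Int V')" "p : V Int V'" using V V' g unfolding good_def by auto
  from nice_ball[OF this] obtain c' r' where c': "nice c' (snd c' p) r'" "p : fst c'" "prt c' (cball (snd c' p) r') <= V Int V'" .
  let ?K = "prt c' (cball (snd c' p) r')"
  have A'x: "?K <= A' (k x)" if "x : V" for x using g that c'(3) unfolding good_def by blast
  have "rbd 3 {x} (omg p - omg x)" if x: "x : ?K" for x
  proof -
   have xV: "x : V" "x : V'" using x c'(3) by auto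
   have xt: "x : TM" by (rule good_top[OF g xV(1)])
   have v: "deg x nu = 1 \<or> deg x nu = -1" and mx: "m x = 1 \<or> m x = -1" "m p = 1 \<or> m p = -1" and
    d: "deg x (mu (k x)) = m x*deg x nu" "deg x (mu (k p)) = m p*deg x nu" "deg x (w (k p)-w (k x)) = n p x*deg x nu" using g xV V unfolding good_def by blast+
   define e j where "e = m x*m p" and "j = n p x*m x"
   have ux: "u x = of_int e*u p + of_int j" using V'(3)[OF xV(2) V'(2)] st[OF g xV(1) V] by (simp add: e_def j_def)
   have "e = 1 \<or> e = -1" using mx by (auto simp: e_def)
   hence "b x = e*b p+2*j" using ux by (auto simp: b_def floor_minus ceiling_minus)
   hence bx: "b x = m x*m p*b p+2*n p x*m x" by (simp add: e_def j_def)
   have r: "rcyc 3 {x} (mu (k x))" "rcyc 3 {x} (mu (k p))" "rcyc 3 {x} (w (k p)-w (k x))"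
    by (rule rcyc_mono[OF mu(1)[OF kt[OF xt]]], use A'x[OF xV(1)] x in blast, rule rcyc_mono[OF mu(1)[OF kt[OF p]]], use A'x[OF V] x in blast,
      rule wr[OF kt[OF p] kt[OF xt]]) (use A'x[OF V] A'x[OF xV(1)] x in blast)+
   note r' = singular_relcycle_cmul[OF r(1), of "b x"] singular_relcycle_cmul[OF r(2), of "b p"] singular_relcycle_cmul[OF r(3), of 2]
   have e: "omg p - omg x = frag_cmul 2 (w (k p)-w (k x))+frag_cmul (b p) (mu (k p))-frag_cmul (b x) (mu (k x))" by (simp add: omg_def cmul_diff algebra_simps frag_cmul_distrib2)
   note r2 = singular_relcycle_add[OF r'(3,2)]
   have "deg x (omg p - omg x) = (2*n p x+b p*m p-b x*m x)*deg x nu" unfolding e deg_diff[OF xt r2 r'(1)] deg_add[OF xt r'(3,2)] using deg_cmul[OF xt] r d by (simp add: algebra_simps)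
   also have "... = 0" using mx bx by auto
   finally show ?thesis using deg_0[OF xt singular_relcycle_diff[OF r2 r'(1)]] unfolding e by simp
  qed
  moreover have "off 2 ?K (frag_cmul 2 z-?d (omg p))"
  proof -
   have "off 2 ?K (z-?d (w (k p)))" "off 2 ?K (?d (mu (k p)))" using w[OF kt[OF p]] mu(1)[OF kt[OF p]] off_mono[OF _ A'x[OF V]] by (auto simp: singular_relcycle)
   hence "off 2 ?K (frag_cmul 2 (z-?d (w (k p)))-frag_cmul (b p) (?d (mu (k p))))" using singular_chain_diff singular_chain_cmul by blast
   thus ?thesis by (simp add: omg_def chain_boundary_add chain_boundary_cmul cmul_diff diff_diff_eq)
  qed
  moreover have "openin M (prt c' (ball (snd c' p) r'))" "p : prt c' (ball (snd c' p) r')" "prt c' (ball (snd c' p) r') <= ?K"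
   using openin_prt[OF c'(1)] c' by (blast, auto simp: prt_def nice_def)
  ultimately show ?thesis using c'(1) by blast
 qed
 obtain V c' a' r' where D: "!!p. p : TM ==> openin M (V p) & p : V p & nice (c' p) (a' p) (r' p) & V p <= prt (c' p) (cball (a' p) (r' p)) &
   off 2 (prt (c' p) (cball (a' p) (r' p))) (frag_cmul 2 z-?d (omg p)) & (ALL x:prt (c' p) (cball (a' p) (r' p)). rbd 3 {x} (omg p - omg x))" using fin by metis
 define K where "K p = prt (c' p) (cball (a' p) (r' p))" for p
 obtain F where F: "finite F" "F <= TM" "TM <= (UN p:F. V p)" using finite_cover[of V] D by blast
 have clK: "closedin M (K p)" if "p : TM" for p unfolding K_def by (rule closedin_prt) (use D[OF that] in "auto simp: nice_def")
 \<comment> \<open>The invariant that \<open>y - omg x\<close> is null at every covered point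
   \<open>x\<close> makes the next filling agree with \<open>y\<close> at each point of the overlap,
   hence on the overlap by \<open>detects_chart\<close>.\<close>
 have "finite F' ==> F' <= TM ==> EX y. sch 3 M y & off 2 (UN p:F'. K p) (frag_cmul 2 z-?d y) & (ALL x:(UN p:F'. K p). rbd 3 {x} (y - omg x))" for F'
 proof (induction F' rule: finite_induct)
  case empty
  thus ?case using z(1) by (intro exI[of _ 0]) (simp add: singular_chain_cmul)
 next
  case (insert p F')
  let ?U = "UN p:F'. K p"
  obtain y where y: "sch 3 M y" "off 2 ?U (frag_cmul 2 z-?d y)" "!!x. x : ?U ==> rbd 3 {x} (y - omg x)" using insert by auto
  have p: "p : TM" using insert by simp
  have clU: "closedin M ?U" using insert clK by (intro closedin_Union) auto
  have Dp: "off 2 (K p) (frag_cmul 2 z-?d (omg p))" "!!x. x : K p ==> rbd 3 {x} (omg p - omg x)" "nice (c' p) (a' p) (r' p)" using D[OF p] by (auto simp: K_def)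
  have omgc: "sch 3 M (omg p)" unfolding omg_def using w[OF kt[OF p]] mu(1)[OF kt[OF p]] by (intro singular_chain_add singular_chain_cmul) (auto simp: singular_relcycle)
  have "off 2 (?U Int K p) ((frag_cmul 2 z-?d (omg p))-(frag_cmul 2 z-?d y))" by (rule singular_chain_diff[OF off_mono[OF Dp(1)] off_mono[OF y(2)]]) auto
  hence rc: "rcyc 3 (?U Int K p) (y - omg p)" using y(1) omgc by (simp add: singular_relcycle chain_boundary_diff singular_chain_diff)
  have "rbd 3 {x} (y - omg p)" if "x : ?U Int K p" for x using singular_relboundary_diff[OF y(3) Dp(2)] that by simp
  moreover have "detects 3 (?U Int K p)" using detects_chart[OF Dp(3) closedin_Int[OF clU clK[OF p]], of 2] by (simp add: K_def eval_nat_numeral)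
  ultimately have "rbd 3 (?U Int K p) (y - omg p)" using rc unfolding detects_def by blast
  then obtain y' where y': "sch 3 M y'" "off 2 (?U Un K p) (frag_cmul 2 z-?d y')" "rbd 3 ?U (y'-y)" "rbd 3 (K p) (y' - omg p)"
   using glue[OF clU clK[OF p], of 1 y "omg p" "frag_cmul 2 z"] y omgc Dp(1) by (auto simp: eval_nat_numeral)
  have "rbd 3 {x} (y' - omg x)" if x: "x : ?U Un K p" for x
  proof (cases "x : ?U")
   case True
   from rbd_add[OF rbd_mono[OF y'(3), of "{x}"] y(3)[OF True]] True show ?thesis by simp
  next
   case False
   hence xp: "x : K p" using x by blast
   from rbd_add[OF rbd_mono[OF y'(4), of "{x}"] Dp(2)[OF xp]] xp show ?thesis by simp
  qed
  thus ?case using y'(1,2) by (intro exI[of _ y']) (auto simp: Un_commute)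
 qed
 from this[OF F(1,2)] obtain y where y: "sch 3 M y" "off 2 (UN p:F. K p) (frag_cmul 2 z-?d y)" by blast
 have "TM <= (UN p:F. K p)" proof
  fix q assume "q : TM"
  then obtain p where "p : F" "q : V p" using F(3) by blast
  thus "q : (UN p:F. K p)" using D[of p] F(2) by (auto simp: K_def)
 qed
 hence "off 2 TM (frag_cmul 2 z-?d y)" using y(2) off_mono by blast
 hence "frag_cmul 2 z-?d y = 0" by (simp add: singular_chain_empty)
 thus thesis using that[OF y(1)] by simp
qed

end

section \<open>Real chains\<close>

lemma vector_space_fun: "vector_space (%r (f :: 's => real) x. r*f x)" by unfold_locales (auto simp: fun_eq_iff algebra_simps)

interpretation fs: vector_space "%r (f :: 's => real) x. r*f x" by (rule vector_space_fun)

interpretation fr: vector_space_pair "%r (f :: 's => real) x. r*f x" "(*) :: real => real => real"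
 by (intro vector_space_pair.intro vector_space_fun) (unfold_locales, auto simp: algebra_simps)

lemma sum_fun: "sum f S x = (SUM s:S. f s x :: real)" by (induction S rule: infinite_finite_induct) auto

text \<open>A basis of \<open>W\<close> stays independent after \<open>z\<close> is added; prescribe
  0 on the basis and 1 at \<open>z\<close> and extend linearly to all functions.\<close>

lemma separating_functional: assumes "fs.subspace W" "z ~: W"
 obtains phi :: "('s => real) => real" where "Vector_Spaces.linear (%r f x. r*f x) (*) phi" "!!w. w : W ==> phi w = 0" "phi z = 1"
proof -
 obtain b where b: "b <= W" "fs.independent b" "W <= fs.span b" by (rule fs.maximal_independent_subset)
 have zb: "z ~: fs.span b" using fs.span_minimal[OF b(1) assms(1)] assms(2) by blast
 obtain phi where phi: "Vector_Spaces.linear (%r f x. r*f x) (*) phi" "!!x. x : insert z b ==> phi x = (if x = z then 1 else 0)"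
  using fr.linear_independent_extend[OF fs.independent_insertI[OF zb b(2)], of "%x. if x = z then 1 else 0"] by blast
 have "phi x = 0" if "x : b" for x using phi(2)[of x] that zb fs.span_base[of x b] by auto
 hence "phi w = 0" if "w : W" for w using fr.linear_eq_0_on_span[OF phi(1), of b w] that b(3) by blast
 thus thesis using that phi by simp
qed

lemma real_bdry_superset: assumes "finite S" "{si. c si ~= 0} <= S" shows "real_boundary p c ta = (SUM si:S. c si * of_int (lkp (bdy p (frag_of si)) ta))"
 unfolding real_boundary_def by (rule sum.mono_neutral_left) (use assms in auto)

lemma real_chain_add: assumes "c : real_chains p M" "d : real_chains p M" shows "c+d : real_chains p M"
proof -
 have "{si. (c+d) si ~= 0} <= {si. c si ~= 0} Un {si. d si ~= 0}" by auto
 thus ?thesis using assms unfolding real_chains_def by (auto intro: finite_subset)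
qed

lemma real_chain_sc: "c : real_chains p M ==> (%si. k * c si) : real_chains p M" unfolding real_chains_def by (auto elim: finite_subset[rotated])

lemma real_bdry_add: assumes "c : real_chains p M" "d : real_chains p M" shows "real_boundary p (c+d) = real_boundary p c+real_boundary p d"
proof
 fix ta
 let ?S = "{si. c si ~= 0} Un {si. d si ~= 0}"
 have S: "finite ?S" using assms by (simp add: real_chains_def)
 have "real_boundary p (c+d) ta = (SUM si:?S. (c+d) si * of_int (lkp (bdy p (frag_of si)) ta))" "real_boundary p c ta = (SUM si:?S. c si * of_int (lkp (bdy p (frag_of si)) ta))"
    "real_boundary p d ta = (SUM si:?S. d si * of_int (lkp (bdy p (frag_of si)) ta))" by (rule real_bdry_superset[OF S], force)+
 thus "real_boundary p (c+d) ta = (real_boundary p c+real_boundary p d) ta" by (simp add: sum.distrib[symmetric] distrib_right)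
qed

lemma real_bdry_sc: "real_boundary p (%si. k * c si) = (%ta. k*real_boundary p c ta)" by (cases "k = 0") (auto simp: real_boundary_def sum_distrib_left mult.assoc)

lemma subspace_boundaries: "fs.subspace (real_boundaries p M)"
proof (rule fs.subspaceI)
 show "0 : real_boundaries p M" unfolding real_boundaries_def by (rule image_eqI[of _ _ "0"]) (auto simp: real_boundary_def real_chains_def)
 show "x+y : real_boundaries p M" if xy: "x : real_boundaries p M" "y : real_boundaries p M" for x y
 proof -
  obtain c d where "c : real_chains (Suc p) M" "d : real_chains (Suc p) M" "x = real_boundary (Suc p) c" "y = real_boundary (Suc p) d" using xy unfolding real_boundaries_def by blast
  thus ?thesis using real_bdry_add[of c "Suc p" M d] real_chain_add[of c "Suc p" M d] unfolding real_boundaries_def by (metis image_eqI)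
 qed
 show "(%ta. k*x ta) : real_boundaries p M" if "x : real_boundaries p M" for k x
  using that real_bdry_sc[symmetric, of k] real_chain_sc[of _ "Suc p" M k] unfolding real_boundaries_def by auto
qed

section \<open>Reduction of real cycles to integral cycles\<close>

definition rc :: "'a chain => ((nat => real) => 'a) => real" where "rc c = (%si. of_int (lkp c si))"

lemma rc_chain: "sch p M c ==> rc c : real_chains p M" by (auto simp: rc_def real_chains_def singular_chain_def in_keys_iff subset_iff)

lemma rc_bdry: "real_boundary p (rc c) = rc (bdy p c)"
proof
 fix ta
 have k: "{si. rc c si ~= 0} = kys c" by (auto simp: rc_def in_keys_iff)
 have "bdy p c = (SUM si:kys c. frag_cmul (lkp c si) (bdy p (frag_of si)))" by (simp add: chain_boundary_def frag_extend_def[of _ c])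
 thus "real_boundary p (rc c) ta = rc (bdy p c) ta" unfolding real_boundary_def k by (simp add: rc_def lookup_sum)
qed

lemma rc_diff: "rc (a-b) = rc a-rc b" by (auto simp: rc_def lookup_minus)

lemma rc_cmul: "rc (frag_cmul k a) = (%si. of_int k*rc a si)" by (simp add: rc_def)

text \<open>Express the finitely many numbers in a basis of their rational span. Independence over
  the rationals will split one relation between real numbers into one rational relation for each
  basis element.\<close>

lemma rational_basis: assumes "finite (V :: real set)" obtains B q where "finite B" "!!v. v : V ==> v = (SUM b:B. of_rat (q v b)*b)"
  "!!k b. (SUM b:B. of_rat (k b)*b) = 0 ==> b : B ==> k b = 0"
proof -
 interpret Q: vector_space "%(q :: rat) (x :: real). of_rat q*x" by unfold_locales (auto simp: algebra_simps of_rat_add of_rat_mult)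
 obtain B where B: "B <= V" "Q.independent B" "V <= Q.span B" by (rule Q.maximal_independent_subset)
 have f: "finite B" using B(1) assms finite_subset by blast
 have "EX q. v = (SUM b:B. of_rat (q b)*b)" if "v : V" for v using B(3) that unfolding Q.span_finite[OF f] by auto
 then obtain q where q: "!!v. v : V ==> v = (SUM b:B. of_rat (q v b)*b)" by metis
 have "k b = 0" if "(SUM b:B. of_rat (k b)*b) = 0" "b : B" for k b using B(2) f that unfolding Q.independent_explicit_finite_subsets by blast
 thus thesis using f q by (intro that[of B q])
qed

lemma common_denominator: assumes "finite (S :: rat set)" obtains N :: int where "N>0" "!!q. q : S ==> EX m. of_int N*q = of_int m"
proof -
 have "EX N::int. N>0 & (ALL q:S. EX m. of_int N*q = of_int m)" using assms
 proof induction
  case empty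
  show ?case by (intro exI[of _ 1]) simp
 next
  case (insert q S)
  then obtain N :: int where N: "N>0" "ALL q:S. EX m. of_int N*q = of_int m" by blast
  obtain a b where q: "q = Fract a b" "b>0" by (cases q) auto
  have "EX m. of_int (N*b)*x = of_int m" if x: "x : insert q S" for x
  proof (cases "x = q")
   case True
   thus ?thesis using q by (intro exI[of _ "N*a"]) (simp add: Fract_of_int_quotient)
  next
   case False
   then obtain m where "of_int N*x = of_int m" using x N by blast
   hence "of_int (N*b)*x = of_int (m*b)" by (simp add: mult.assoc mult.left_commute[of _ "of_int b"] mult.commute[of "of_int b"])
   thus ?thesis by blast
  qed
  thus ?case using N q by (intro exI[of _ "N*b"]) auto
 qed
 thus thesis using that by blast
qed

text \<open>By a rational basis of the span of the coefficients, real cycles are real combinations of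
 integral cycles.\<close>

lemma cycles_sub_boundaries: assumes "!!z. sch p M z ==> bdy p z = 0 ==> rc z : real_boundaries p (M :: 'a topology)" shows "real_cycles p M <= real_boundaries p M"
proof
 fix c assume c: "c : real_cycles p M"
 define S where "S = {si. c si ~= 0}"
 have S: "finite S" "S <= singular_simplex_set p M" and cb: "real_boundary p c = (%ta. 0)" using c by (auto simp: real_cycles_def real_chains_def S_def)
 obtain B q where B: "finite B" "!!v. v : c ` S ==> v = (SUM b:B. of_rat (q v b)*b)" "!!k b. (SUM b:B. of_rat (k b)*b) = 0 ==> b : B ==> k b = 0"
  by (rule rational_basis[OF finite_imageI[OF S(1), of c]], rule that) blast+
 define Q where "Q si b = q (c si) b" for si b
 have cQ: "c si = (SUM b:B. of_rat (Q si b)*b)" if "si : S" for si using B(2)[of "c si"] that by (simp add: Q_def)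
 obtain N :: int where N: "N>0" "!!r. r : (%(si,b). Q si b) ` (S \<times> B) ==> EX m. of_int N*r = of_int m"
  by (rule common_denominator[of "(%(si,b). Q si b) ` (S \<times> B)"]) (use S(1) B(1) in auto)
 have "EX m. of_int N*Q si b = of_int m" if "si : S" "b : B" for si b using N(2)[of "Q si b"] that by force
 then obtain m where m: "!!si b. si : S ==> b : B ==> of_int N*Q si b = of_int (m si b)" by metis
 \<comment> \<open>The \<open>b\<close> component of \<open>c\<close>, cleared of denominators. The
   coefficients of the vanishing boundary of \<open>c\<close> have rational components, so by
   independence each component vanishes and each \<open>z b\<close> is a cycle.\<close>
 define z where "z b = (SUM si:S. frag_cmul (m si b) (frag_of si))" for b
 have zc: "sch p M (z b)" for b unfolding z_def using S(2) by (intro singular_chain_sum singular_chain_cmul) (auto simp: singular_chain_of)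
 have lz: "lkp (z b) si = (if si : S then m si b else 0)" for b si using S(1) by (simp add: z_def lookup_sum lookup_single when_def if_distrib cong: if_cong)
 have "bdy p (z b) = 0" if b: "b : B" for b
 proof (rule poly_mapping_eqI)
  fix ta
  let ?l = "%si. lkp (bdy p (frag_of (si :: (nat => real) => 'a))) ta"
  have "0 = (SUM si:S. c si * of_int (?l si))" using cb real_bdry_superset[OF S(1), of c p ta] by (simp add: S_def)
  also have "... = (SUM si:S. SUM b:B. of_rat (Q si b * of_int (?l si))*b)" by (rule sum.cong) (simp_all add: cQ sum_distrib_left of_rat_mult mult_ac)
  also have "... = (SUM b:B. of_rat (SUM si:S. Q si b * of_int (?l si))*b)" by (subst sum.swap) (simp add: of_rat_sum sum_distrib_right)
  finally have "(SUM si:S. Q si b * of_int (?l si)) = 0" using B(3)[OF _ b, of "%b. SUM si:S. Q si b * of_int (?l si)"] by simp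
  hence "0 = (SUM si:S. (of_int N*Q si b) * of_int (?l si))" by (simp add: sum_distrib_left[symmetric] mult.assoc)
  also have "... = (SUM si:S. of_int (m si b*?l si))" by (rule sum.cong) (simp_all add: m b)
  finally have "rat_of_int (SUM si:S. m si b*?l si) = 0" by simp
  hence "(SUM si:S. m si b*?l si) = 0" by (simp only: of_int_eq_0_iff)
  thus "lkp (bdy p (z b)) ta = lkp 0 ta" by (simp add: z_def chain_boundary_sum chain_boundary_cmul lookup_sum o_def)
 qed
 hence zb: "(%si. (b / of_int N)*rc (z b) si) : real_boundaries p M" if "b : B" for b using fs.subspace_scale[OF subspace_boundaries assms[OF zc]] that by blast
 have "c = (SUM b:B. (%si. (b / of_int N)*rc (z b) si))"
 proof
  fix si
  have "c si = (SUM b:B. (b / of_int N)*rc (z b) si)"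
  proof (cases "si : S")
   case True
   have "of_rat (Q si b)*b = (b / of_int N)*rc (z b) si" if "b : B" for b
   proof -
    have "of_int N * of_rat (Q si b) = (of_int (m si b) :: real)" using arg_cong[OF m[OF True that], of of_rat] by (simp add: of_rat_mult)
    thus ?thesis using N(1) True by (simp add: rc_def lz field_simps)
   qed
   thus ?thesis using cQ[OF True] by simp
  next
   case False
   thus ?thesis by (simp add: rc_def lz S_def)
  qed
  thus "c si = (SUM b:B. (%si. (b / of_int N)*rc (z b) si)) si" by (simp add: sum_fun)
 qed
 thus "c : real_boundaries p M" using fs.subspace_sum[OF subspace_boundaries zb] by simp
qed

lemma betti_0: assumes "real_cycles p M <= real_boundaries p M" shows "betti p M = 0"
proof -
 have "S = {}" if S: "finite S" "S <= real_cycles p M" "ALL a. (%x. SUM c:S. a c * c x) : real_boundaries p M --> (ALL c:S. a c = 0)" for S :: "(((nat => real) => 'a) => real) set"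
 proof (rule ccontr)
  assume "S ~= {}"
  then obtain c where c: "c : S" by blast
  have "(%x. SUM d:S. (if d = c then 1 else 0)*d x) = c" using S(1) c by (simp add: if_distrib[of "%t. t*_"] cong: if_cong)
  thus False using S(2) S(3)[rule_format, of "%d. if d = c then 1 else 0", OF _ c] c assms by auto
 qed
 note e = this
 have "betti p M <= 0" unfolding betti_def quotient_dim_def
 proof (rule SUP_least, elim CollectE conjE)
  fix S assume "finite S" "S <= real_cycles p M" "ALL a. (%x. SUM c:S. a c * c x) : real_boundaries p M --> (ALL c:S. a c = 0)"
  from e[OF this] show "enat (card S) <= 0" by (simp add: zero_enat_def)
 qed
 thus ?thesis by simp
qed

section \<open>Integral 1-cycles\<close>

definition pt :: "'a => 'a chain" where "pt x = frag_of (restrict (%_. x) (standard_simplex 0))"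

definition vx :: "nat => nat => real" where "vx k = (%i. if i = k then 1 else 0)"

lemma standard_simplex_0': "standard_simplex 0 = {vx 0}" by (auto simp: vx_def standard_simplex_0)

lemma bdry_1: "bdy (Suc 0) (frag_of si) = pt (si (vx (Suc 0)))-pt (si (vx 0))"
proof -
 have f: "simplical_face 0 (vx 0) = vx (Suc 0)" "simplical_face (Suc 0) (vx 0) = vx 0" by (auto simp: simplical_face_def vx_def fun_eq_iff)
 have "singular_face (Suc 0) 0 si = restrict (%_. si (vx (Suc 0))) (standard_simplex 0)" "singular_face (Suc 0) (Suc 0) si = restrict (%_. si (vx 0)) (standard_simplex 0)"
  using f by (auto simp: restrict_def singular_face_def standard_simplex_0')
 thus ?thesis by (simp add: chain_boundary_of pt_def)
qed

lemma path_chain: assumes "path_connected_space X" "x : topspace X" "y : topspace X" obtains c where "sch 1 X c" "bdy 1 c = pt x-pt y"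
proof -
 obtain g where g: "pathin X g" "g 0 = y" "g 1 = x" using assms unfolding path_connected_space_def by blast
 let ?s = "restrict (%f. g (f 1)) (standard_simplex 1)"
 have "continuous_map (subtopology (powertop_real UNIV) (standard_simplex 1)) (top_of_set {0..1}) (%f. f 1)"
  by (auto simp: continuous_map_in_subtopology standard_simplex_def intro!: continuous_map_from_subtopology continuous_map_product_projection)
 from continuous_map_compose[OF this] g(1) have "continuous_map (subtopology (powertop_real UNIV) (standard_simplex 1)) X (%f. g (f 1))" by (simp add: pathin_def o_def)
 hence "continuous_map (subtopology (powertop_real UNIV) (standard_simplex 1)) X ?s" by (rule continuous_map_eq) auto
 hence "sch 1 X (frag_of ?s)" by (simp add: singular_chain_of singular_simplex_def)
 moreover have "vx 0 : standard_simplex 1" "vx 1 : standard_simplex 1" by (auto simp: vx_def standard_simplex_def)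
 hence "bdy 1 (frag_of ?s) = pt x-pt y" using g by (simp add: bdry_1 vx_def)
 ultimately show thesis by (rule that)
qed

context closed_manifold
begin

lemma contractible_prt: assumes n: "nice c a r" shows "contractible_space (subtopology M (prt c (ball a r)))"
proof -
 have c: "c : A" and sub: "ball a r <= img c" using n by (auto simp: nice_def subset_iff)
 have "homeomorphic_map (subtopology (subtopology M (fst c)) (prt c (ball a r))) (subtopology (top_of_set (img c)) (ball a r)) (snd c)"
  by (rule homeomorphic_map_subtopologies[OF chart_homeo[OF c]]) (use sub chart_sub[OF c] in "auto simp: prt_def")
 moreover have "fst c Int prt c (ball a r) = prt c (ball a r)" "img c Int ball a r = ball a r" using sub by (auto simp: prt_def)
 ultimately have "homeomorphic_map (subtopology M (prt c (ball a r))) (top_of_set (ball a r)) (snd c)" by (simp only: subtopology_subtopology)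
 hence "subtopology M (prt c (ball a r)) homeomorphic_space top_of_set (ball a r)" by (rule homeomorphic_map_imp_homeomorphic_space)
 thus ?thesis using convex_imp_contractible[OF convex_ball, of a r] homeomorphic_space_contractibility unfolding contractible_space_top_of_set[symmetric] by blast
qed

lemma null_1_cycle: assumes n: "nice c a r" and z: "sch 1 (subtopology M (prt c (ball a r))) z" "bdy 1 z = 0" obtains y where "sch 2 M y" "bdy 2 y = z"
proof -
 let ?X = "subtopology M (prt c (ball a r))"
 have "trivial_group (homology_group (int 1) ?X)" using trivial_reduced_homology_group_contractible_space[OF contractible_prt[OF n], of 1] by (simp add: un_reduced_homology_group)
 moreover have "singular_relcycle 1 ?X {} z" using z by (simp add: singular_relcycle)
 ultimately have "singular_relboundary 1 ?X {} z" by (rule relhomology_trivialD)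
 then obtain e where "sch 2 ?X e" "bdy 2 e = z" by (auto simp: singular_relboundary singular_chain_empty eval_nat_numeral)
 thus thesis using that by (metis singular_chain_subtopology)
qed

end

context positive_ricci
begin

text \<open>The values of \<open>Phi\<close> on short paths form an additive cocycle
  \<open>t\<close>, and a parallel section \<open>u\<close> is a primitive of it: \<open>Phi\<close>
  of a short path is the difference of \<open>u\<close> at its ends. Over a cycle made of short
  simplices this telescopes to 0, contrary to \<open>phi (rc z) = 1\<close>.\<close>

theorem one_cycle_bounds: assumes z: "sch 1 M z" "bdy 1 z = 0" shows "rc z : real_boundaries 1 M"
proof (rule ccontr)
 assume "rc z ~: real_boundaries 1 M"
 then obtain phi where phi: "Vector_Spaces.linear (%r f x. r*f x) (*) phi" "!!w. w : real_boundaries 1 M ==> phi w = 0" "phi (rc z) = 1"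
  using separating_functional[OF subspace_boundaries] by metis
 define Phi where "Phi c = phi (rc c)" for c
 have Phid: "Phi (c-d) = Phi c-Phi d" for c d unfolding Phi_def rc_diff by (rule fr.linear_diff[OF phi(1)])
 have Phib: "Phi (bdy 2 y) = 0" if "sch 2 M y" for y unfolding Phi_def using rc_bdry[of 2 y] rc_chain[OF that]
  by (intro phi(2)) (auto simp: real_boundaries_def eval_nat_numeral image_iff intro!: bexI[of _ "rc y"])
 define VV where "VV = {V. EX c a r. nice c a r & V = prt c (ball a r)}"
 have "EX V:VV. openin M V & p : V" if p: "p : TM" for p
 proof -
  obtain c r where c: "nice c (snd c p) r" "p : fst c" by (rule nice_ball[OF openin_topspace p])
  have "p : prt c (ball (snd c p) r)" using c by (auto simp: prt_def nice_def)
  thus ?thesis using c(1) openin_prt[OF c(1) open_ball] unfolding VV_def by blast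
 qed
 from star_refinement[of VV, OF this] obtain Q where Q: "!!x. x : TM ==> openin M (Q x) & x : Q x"
  "!!x y. x : TM ==> y : TM ==> Q x Int Q y ~= {} ==> EX V:VV. openin M V & Q x Un Q y <= V" by metis
 have "EX D. openin M D & x : D & D <= Q x & path_connected_space (subtopology M D)" if x: "x : TM" for x
 proof -
  obtain c r where c: "nice c (snd c x) r" "x : fst c" "prt c (cball (snd c x) r) <= Q x" by (rule nice_ball[of "Q x" x]) (use Q(1)[OF x] in auto)
  show ?thesis by (rule exI[of _ "prt c (ball (snd c x) r)"])
   (use c openin_prt[OF c(1) open_ball] contractible_imp_path_connected_space[OF contractible_prt[OF c(1)]] in "auto simp: prt_def nice_def")
 qed
 then obtain D where D: "!!x. x : TM ==> openin M (D x) & x : D x & D x <= Q x & path_connected_space (subtopology M (D x))" by metis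
 define pth where "pth p y x c \<longleftrightarrow> p : TM & x : D p & sch 1 (subtopology M (D p)) c & bdy 1 c = pt x-pt y" for p y x c
 have Dt: "D p <= TM" if "p : TM" for p using D[OF that] openin_subset by blast
 have ex: "EX c. pth p y x c" if p: "p : TM" "x : D p" "y : D p" for p x y
 proof -
  have t: "x : topspace (subtopology M (D p))" "y : topspace (subtopology M (D p))" and "path_connected_space (subtopology M (D p))" using p D[OF p(1)] Dt[OF p(1)] by auto
  from path_chain[OF this(3) t] show ?thesis using p unfolding pth_def by metis
 qed
 \<comment> \<open>By the star refinement, two short paths with common ends lie in one contractible
   coordinate ball even if they belong to different sets \<open>D\<close>; so their difference
   bounds.\<close>
 have uniq: "Phi c = Phi d" if c: "pth p y x c" and d: "pth q y x d" for p q x y c d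
 proof -
  have pq: "p : TM" "q : TM" "x : D p" "x : D q" using c d by (auto simp: pth_def)
  hence "Q p Int Q q ~= {}" using D by blast
  then obtain c' a r where V: "nice c' a r" "Q p Un Q q <= prt c' (ball a r)" using Q(2)[OF pq(1,2)] unfolding VV_def by blast
  have "D p <= prt c' (ball a r)" "D q <= prt c' (ball a r)" using V(2) D pq by blast+
  hence "sch 1 (subtopology M (prt c' (ball a r))) (c-d)" using c d unfolding pth_def by (intro singular_chain_diff) (meson singular_chain_mono)+
  moreover have "bdy 1 (c-d) = 0" using c d by (simp add: pth_def chain_boundary_diff)
  ultimately obtain y where "sch 2 M y" "bdy 2 y = c-d" by (rule null_1_cycle[OF V(1)])
  thus ?thesis using Phib[of y] Phid by simp
 qed
 define t where "t x y = Phi (SOME c. EX p. pth p y x c)" for x y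
 have t: "t x y = Phi c" if c: "pth p y x c" for p x y c
 proof -
  have "EX p. pth p y x (SOME c. EX p. pth p y x c)" by (rule someI_ex) (use c in blast)
  thus ?thesis unfolding t_def using uniq c by blast
 qed
 obtain u where u: "!!p. p : TM ==> EX V. openin M V & p : V & (ALL x:V. ALL y:V. u x = 1*u y+t x y)"
 proof (rule parallel_section[of "%_ _. 1" t])
  fix p assume p: "p : TM"
  have "t x z = t y z+t x y" if "x : D p" "y : D p" "z : D p" for x y z
  proof -
   obtain c where c1: "pth p z y c" using ex[OF p \<open>y \<in> D p\<close> \<open>z \<in> D p\<close>] by blast
   obtain d where "pth p y x d" using ex[OF p \<open>x \<in> D p\<close> \<open>y \<in> D p\<close>] by blast
   note c = c1 this
   \<comment> \<open>Concatenation of paths, written with differences because additivity of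
     \<open>Phi\<close> is available in that form.\<close>
   have "pth p z x (c-(0-d))" using c unfolding pth_def by (auto intro: singular_chain_add simp: chain_boundary_add)
   from t[OF this] show ?thesis using t[OF c(1)] t[OF c(2)] Phid[of c "0-d"] Phid[of 0 d] Phid[of 0 0] by simp
  qed
  note tt = this
  show "EX V. openin M V & p : V & (ALL x:V. ALL y:V. 1 = 1 \<or> 1 = (-1::real)) & (ALL x:V. ALL y:V. ALL z:V. 1 = 1*(1::real) & t x z = 1*t y z+t x y)"
  proof (intro exI[of _ "D p"] conjI ballI disjI1)
   fix x y z assume "x : D p" "y : D p" "z : D p"
   from tt[OF this] show "t x z = 1*t y z+t x y" by simp
  qed (use D[OF p] in auto)
 qed blast
 then obtain V where V: "!!p. p : TM ==> openin M (V p) & p : V p & (ALL x:V p. ALL y:V p. u x = u y+t x y)" by (metis mult_1)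
 let ?C = "(%p. V p Int D p) ` TM"
 have "singular_relcycle 1 M {} z" using z by (simp add: singular_relcycle)
 note zc = this
 have C: "openin M W" if "W : ?C" for W using that V D by auto
 have C': "TM <= \<Union>?C" using V D by blast
 \<comment> \<open>Subdivision makes every simplex lie in a set where both the short paths and the
   equation for \<open>u\<close> are available.\<close>
 obtain z' where z': "singular_relcycle 1 M {} z'" "homologous_rel 1 M {} z z'" "!!f. f : kys z' ==> EX V:?C. f : standard_simplex 1 \<rightarrow> V"
 proof (rule small_homologous_rel_relcycle_exists[OF C C' zc], assumption, goal_cases)
  case (1 c')
  show ?case by (rule 1(1)[OF 1(2-)])
 qed
 obtain e where e: "sch 2 M e" "bdy 2 e = z-z'" using z'(2) by (auto simp: homologous_rel_def singular_relboundary singular_chain_empty eval_nat_numeral)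
 have zz: "Phi z = Phi z'" using Phib[OF e(1)] e(2) Phid by simp
 define U :: "'a chain => real" where "U c = (SUM s:kys c. of_int (lkp c s)*u (s (vx 0)))" for c
 have Us: "U c = (SUM s:S. of_int (lkp c s)*u (s (vx 0)))" if "finite S" "kys c <= S" for c S unfolding U_def by (rule sum.mono_neutral_left) (use that in "auto simp: in_keys_iff")
 have Ud: "U (c-d) = U c-U d" for c d
 proof -
  let ?S = "kys c Un kys d"
  have "kys (c-d) <= ?S" by (rule keys_diff)
  thus ?thesis using Us[of ?S c] Us[of ?S d] Us[of ?S "c-d"] by (simp add: lookup_minus algebra_simps sum_subtractf)
 qed
 have Up: "U (pt x) = u x" for x by (simp add: U_def pt_def standard_simplex_0')
 have "Phi z' = U (bdy 1 z')"
 proof (rule frag_induction[of z' "kys z'"])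
  show "Phi 0 = U (bdy 1 0)" using Phid[of 0 0] by (simp add: U_def)
  show "Phi (c-d) = U (bdy 1 (c-d))" if "Phi c = U (bdy 1 c)" "Phi d = U (bdy 1 d)" for c d using that by (simp add: Phid Ud chain_boundary_diff)
  fix si assume s: "si : kys z'"
  obtain p where p: "p : TM" "si : standard_simplex 1 \<rightarrow> V p Int D p" using z'(3)[OF s] by blast
  have "vx 0 : standard_simplex 1" "vx 1 : standard_simplex 1" by (auto simp: vx_def standard_simplex_def)
  hence m: "si (vx 0) : V p" "si (vx 1) : V p" "si (vx 1) : D p" using p by auto
  have "singular_simplex 1 M si" using z'(1) s by (auto simp: singular_relcycle singular_chain_def)
  hence "sch 1 (subtopology M (D p)) (frag_of si)" using p by (auto simp: singular_chain_of singular_simplex_subtopology)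
  hence "pth p (si (vx 0)) (si (vx 1)) (frag_of si)" using p m by (simp add: pth_def bdry_1)
  note t[OF this]
  moreover have "u (si (vx 1)) = u (si (vx 0))+t (si (vx 1)) (si (vx 0))" using V[OF p(1)] m(1,2) by blast
  ultimately have "Phi (frag_of si) = u (si (vx 1))-u (si (vx 0))" by linarith
  thus "Phi (frag_of si) = U (bdy 1 (frag_of si))" by (simp add: bdry_1 Ud Up)
 qed simp
 also have "bdy 1 z' = 0" using z'(1) by (simp add: singular_relcycle singular_chain_empty)
 finally have "Phi z' = 0" by (simp add: U_def)
 thus False using zz phi(3) by (simp add: Phi_def)
qed

theorem betti_vanish: "betti 1 M = 0" "betti 2 M = 0"
proof -
 show "betti 1 M = 0" by (intro betti_0 cycles_sub_boundaries one_cycle_bounds)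
 have "rc z : real_boundaries 2 M" if z: "sch 2 M z" "bdy 2 z = 0" for z
 proof -
  obtain y where y: "sch 3 M y" "bdy 3 y = frag_cmul 2 z" using twice_2_cycle_bounds[OF z] .
  have "(%ta. (1/2)*rc (bdy 3 y) ta) : real_boundaries 2 M"
   using rc_chain[OF y(1)] rc_bdry[of 3 y] by (intro fs.subspace_scale[OF subspace_boundaries]) (auto simp: real_boundaries_def eval_nat_numeral image_iff intro!: bexI[of _ "rc y"])
  thus ?thesis by (simp add: y(2) rc_cmul)
 qed
 thus "betti 2 M = 0" by (intro betti_0 cycles_sub_boundaries)
qed

end

section \<open>Application to the given metrics\<close>

lemma (in unit_killing) betti_vanish: assumes "!!q. q : PA ==> Ric A g T T q>0 &
   scal A g q>(2-eps) * Ric A g T T q+form_norm_sq A g (differential (%q. ln (Ric A g T T q))) q" shows "betti 1 M = 0 & betti 2 M = 0"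
proof -
 interpret H: unit_killing M A h T 1 by (rule h_unit_killing)
 have "positive_ricci M A h"
 proof (intro positive_ricci.intro H.framed_manifold_axioms positive_ricci_axioms.intro)
  fix p assume p: "p : PA"
  have "H.sgns = (%_. 1)" by auto
  thus "EX W E. H.frame W E (%_. 1) & p : W" using H.T_frame[OF p] by metis
  show "Ric A h V V p>0" if "vf V" "V p ~= tzero" for V by (rule h_Ric_positive[OF assms p that])
 qed
 thus ?thesis using positive_ricci.betti_vanish by blast
qed

theorem corollary1:
  fixes M :: "'a topology" and A :: "'a chart set"
  assumes "closed_3_manifold M A" and "connected_space M" and "oriented_atlas A"
  shows "(\<forall>g\<^sub>L T.
            lorentzian_metric A g\<^sub>L \<and>
            killing_field A g\<^sub>L T \<and>
            (\<forall>p\<in>topspace M. g\<^sub>L p (T p) (T p) = -1) \<and>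
            \<not> parallel_field A g\<^sub>L T \<and>
            (\<forall>p\<in>topspace M. Ric A g\<^sub>L T T p > 0 \<and>
               scal A g\<^sub>L p > 3 * Ric A g\<^sub>L T T p
                 + form_norm_sq A g\<^sub>L (differential (\<lambda>q. ln (Ric A g\<^sub>L T T q))) p)
            \<longrightarrow> betti 1 M = 0 \<and> betti 2 M = 0) \<and>
         (\<forall>g T.
            riemannian_metric A g \<and>
            killing_field A g T \<and>
            (\<forall>p\<in>topspace M. g p (T p) (T p) = 1) \<and>
            \<not> parallel_field A g T \<and>
            (\<forall>p\<in>topspace M. Ric A g T T p > 0 \<and>
               scal A g p > Ric A g T T p
                 + form_norm_sq A g (differential (\<lambda>q. ln (Ric A g T T q))) p)
            \<longrightarrow> betti 1 M = 0 \<and> betti 2 M = 0)"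
proof (intro conjI; intro allI impI; elim conjE)
 interpret closed_manifold M A by unfold_locales (rule assms(1))
 fix g T
 assume L: "lorentzian_metric A g" and K: "killing_field A g T" and u: "ALL p:TM. g p (T p) (T p) = -1"
  and R: "ALL p:TM. Ric A g T T p>0 & scal A g p>3 * Ric A g T T p+form_norm_sq A g (differential (%q. ln (Ric A g T T q))) p"
 have "vf T" using K by (simp add: killing_field_def)
 interpret unit_killing M A g T "-1"
 proof unfold_locales
  fix p v assume p: "p : PA" and v: "v : tsp p" "g p (T p) v = 0" "v ~= tzero"
  have gT: "g p (T p) (T p) = -1" using u p by (simp add: pts)
  have Tt: "T p : tsp p" by (rule vtan[OF \<open>vector_field A T\<close> p])
  show "g p v v>0" by (rule lorentzian_perp_positive[of g p "T p" v, OF L p Tt gT v])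
 qed (use L K u pts in "auto simp: lorentzian_metric_def killing_field_def")
 \<comment> \<open>For \<open>eps = -1\<close> the coefficient \<open>2 - eps\<close> is the 3 of
   the hypothesis.\<close>
 show "betti 1 M = 0 & betti 2 M = 0" by (rule betti_vanish) (use R pts in auto)
next
 interpret closed_manifold M A by unfold_locales (rule assms(1))
 fix g T
 assume L: "riemannian_metric A g" and K: "killing_field A g T" and u: "ALL p:TM. g p (T p) (T p) = 1"
  and R: "ALL p:TM. Ric A g T T p>0 & scal A g p>Ric A g T T p+form_norm_sq A g (differential (%q. ln (Ric A g T T q))) p"
 interpret unit_killing M A g T 1 by unfold_locales (use L K u pts in "auto simp: riemannian_metric_def killing_field_def")
 show "betti 1 M = 0 & betti 2 M = 0" by (rule betti_vanish) (use R pts in auto)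
qed

end
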